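(* Suppose that $\{u,z\}\in\mathcal X\times\mathcal Y$ is a stationary point of the Lagrangian functional $\mathcal L$, i.e. $\mathcal L_u(u,z)(\psi)+\mathcal L_z(u,z)(\varphi)=0$ for all $\{\psi,\varphi\}\in\mathcal X\times\mathcal Y$. Let $\{u_{kh},z_{kh}\}\in\mathcal X_{kh}^{r,p}\times\mathcal X_{kh}^{r,p}$ denote its stabilized Galerkin approximation, i.e. $u_{kh}$ solves the stabilized discrete primal problem and $z_{kh}$ solves the stabilized discrete dual problem. Then $$\mathcal J(u)-\mathcal J(u_{kh})=\frac12\rho(u_{kh})(z-\varphi_{kh})+\frac12\rho^\ast(z_{kh})(u-\psi_{kh})+\mathcal R_{\mathcal S}+\mathcal R_{\mathcal J}$$ for arbitrary functions $\{\varphi_{kh},\psi_{kh}\}\in\mathcal X_{kh}^{r,p}\times\mathcal X_{kh}^{r,p}$, where $$\mathcal R_{\mathcal S}:=\frac12 S(u_{kh})(\varphi_{kh}+z_{kh})+\frac12S^\ast(z_{kh})(\psi_{kh}-u_{kh})$$ and $$\mathcal R_{\mathcal J}:=\frac12\int_0^1\mathcal J'''(u_{kh}+s\cdot e)(e,e,e)\cdot s\cdot(s-1)\,\mathrm ds,\qquad e=u-u_{kh}.$$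
   Context: **Data.** $\Omega\subset\mathbb R^d$, $d\in\{2,3\}$, is a bounded polygonal/polyhedral domain, $I=(0,T]$. The coefficients satisfy $\alpha\ge 0$ constant, $\varepsilon>0$ constant, $\boldsymbol b\in H^1(\Omega)^d\cap L^\infty(\Omega)^d$ with $\nabla\cdot\boldsymbol b=0$ a.e.; $f\in L^2(0,T;H^{-1}(\Omega))$ (in the discrete stabilization terms, element-wise $L^2$ products with $f$ are assumed to make sense), $u_0\in L^2(\Omega)$. The underlying problem is $\partial_tu+\boldsymbol b\cdot\nabla u-\nabla\cdot(\varepsilon\nabla u)+\alpha u=f$ in $\Omega\times(0,T]$, $u=0$ on $\partial\Omega\times(0,T]$, $u(0)=u_0$. **Notation.** $\langle\cdot,\cdot\rangle$ is the $L^2(\Omega)$ inner product (or the $H^{-1}$–$H^1_0$ duality pairing where needed), $\langle\cdot,\cdot\rangle_K$ the $L^2(K)$ inner product, $\langle\langle v,w\rangle\rangle=\int_0^T\langle v,w\rangle\,\mathrm dt$. Time grid $0=t_0<t_1<\dots<t_M=T$, $I_m=(t_{m-1},t_m]$, $k_m=t_m-t_{m-1}$. One-sided limits $v_m^\pm=\lim_{s\to0,\,s>0}v(t_m\pm s)$, jumps $[v]_m=v_m^+-v_m^-$. For piecewise-in-time functions, the values at $0$ and $T$ occurring in the forms below are understood as $v(0)=v_0^+$, $v(T)=v_M^-=v_T^-$. **Spaces.** $\mathcal X=\{v\in L^2(0,T;H^1_0(\Omega)):\partial_tv\in L^2(0,T;H^{-1}(\Omega))\}$. $\mathcal Y=\{v\in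 L^2(0,T;H^1_0(\Omega)): v|_{I_m}\in C(\overline{I_m};H^1_0(\Omega))\text{ for all }m\}$ (i.e. $v|_{I_m}$ has a continuous extension to $\overline{I_m}$). $\mathcal T_h=\{K\}$ is a conforming decomposition of $\Omega$ into triangles/tetrahedra; $\mathcal V_h^p=\{v\in H^1_0(\Omega)\cap C(\overline\Omega):v|_K\in\mathcal P_p(K)\ \forall K\in\mathcal T_h\}$; $\mathcal V_h^{p,m}$ is such a space for the time interval $I_m$ (the mesh may differ between the $I_m$; $\mathcal T_h$ denotes the mesh of the respective interval). For integers $r\ge0$, $p\ge1$, $\mathcal X_{kh}^{r,p}$ is the space of functions $v_{kh}$ with $v_{kh}|_{I_m}\in\mathcal P_r(I_m;\mathcal V_h^{p,m})$ (polynomials in time of degree at most $r$ with values in $\mathcal V_h^{p,m}$), $m=1,\dots,M$, and $v_{kh}(0)\in\mathcal V_h^p$. One has $\mathcal X_{kh}^{r,p}\subset\mathcal Y$. **Target functional.** $\mathcal J:\mathcal Y\to\mathbb R$ is Fréchet differentiable, as often as derivatives of it are used, and is also evaluated on $\mathcal X+\mathcal X_{kh}^{r,p}$. Its derivative has an $L^2$ representation: for each $v$ there is $j(v)\in L^2(0,T;L^2(\Omega))$ with $\mathcal J'(v)(\varphi)=\langle\langle j(v),\varphi\rangle\rangle$. **Forms.** $F(\varphi)=\langle\langle f,\varphi\rangle\rangle$, $a(v)(\varphi)=\langle\langle\boldsymbol b\cdot\nabla v,\varphi\rangle\rangle+\langle\langle\varepsilon\nabla v,\nabla\varphi\rangle\rangle+\langle\langle\alpha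 v,\varphi\rangle\rangle$, $$A(v)(\varphi)=\sum_{m=1}^M\int_{I_m}\langle\partial_tv,\varphi\rangle\,\mathrm dt+a(v)(\varphi)+\sum_{m=2}^M\langle[v]_{m-1},\varphi_{m-1}^+\rangle,$$ $$A^\ast(z)(\psi)=-\sum_{m=1}^M\int_{I_m}\langle\partial_tz,\psi\rangle\,\mathrm dt-\langle\langle\boldsymbol b\cdot\nabla z,\psi\rangle\rangle+\langle\langle\varepsilon\nabla z,\nabla\psi\rangle\rangle+\langle\langle\alpha z,\psi\rangle\rangle-\sum_{m=2}^M\langle[z]_{m-1},\psi_{m-1}^-\rangle.$$ Stabilization (SUPG) forms, with positive parameters $\delta_K,\delta_K^\ast$ ($\delta_K\sim\min\{h_K/(p\|\boldsymbol b\|_{L^\infty(K)}),\,h_K^2/(p^4\varepsilon),\,1/(k_m+\alpha),\,(k_m+\alpha)/\alpha^2\}$, where $h_K$ is the diameter of $K$): $$S(u_{kh})(\varphi_{kh})=\sum_{m=1}^M\int_{I_m}\sum_K\delta_K\langle R(u_{kh}),\boldsymbol b\cdot\nabla\varphi_{kh}\rangle_K\,\mathrm dt+\sum_{m=2}^M\sum_K\delta_K\langle[u_{kh}]_{m-1},\boldsymbol b\cdot\nabla\varphi_{kh,m-1}^+\rangle_K+\sum_K\delta_K\langle u_{kh,0}^+-u_0,\boldsymbol b\cdot\nabla\varphi_{kh,0}^+\rangle_K,$$ $R(u_{kh})=\partial_tu_{kh}+\boldsymbol b\cdot\nabla u_{kh}-\nabla\cdot(\varepsilon\nabla u_{kh})+\alpha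 u_{kh}-f$; $$S^\ast(z_{kh})(\psi_{kh})=\sum_{m=1}^M\int_{I_m}\sum_K\delta_K^\ast\langle R^\ast(z_{kh}),-\boldsymbol b\cdot\nabla\psi_{kh}\rangle_K\,\mathrm dt-\sum_{m=2}^M\sum_K\delta_K^\ast\langle[z_{kh}]_{m-1},-\boldsymbol b\cdot\nabla\psi_{kh,m-1}^-\rangle_K+\sum_K\delta_K^\ast\langle z_{kh,M}^-,-\boldsymbol b\cdot\nabla\psi_{kh,M}^-\rangle_K,$$ $R^\ast(z_{kh})=-\partial_tz_{kh}-\boldsymbol b\cdot\nabla z_{kh}-\nabla\cdot(\varepsilon\nabla z_{kh})+\alpha z_{kh}-j(u_{kh})$ (residuals taken element-wise). **Lagrangian.** $\mathcal L:(\mathcal X+\mathcal X_{kh}^{r,p})\times\mathcal Y\to\mathbb R$, $$\mathcal L(u,z)=\mathcal J(u)+F(z)-\sum_{m=1}^M\int_{I_m}\langle\partial_tu,z\rangle\,\mathrm dt-a(u)(z)-\sum_{m=2}^M\langle[u]_{m-1},z_{m-1}^+\rangle-\langle u(0)-u_0,z(0)\rangle,$$ $\mathcal L_u,\mathcal L_z$ being its partial derivatives. For a stationary point $\{u,z\}$, $u$ is the weak solution of the primal problem and $z\in\mathcal X\cap\mathcal Y$ is the solution of the dual problem $-\langle\langle\partial_tz,\psi\rangle\rangle-\langle\langle\boldsymbol b\cdot\nabla z,\psi\rangle\rangle+\langle\langle\varepsilon\nabla z,\nabla\psi\rangle\rangle+\langle\langle\alpha z,\psi\rangle\rangle+\langle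 z(T),\psi(T)\rangle=\mathcal J'(u)(\psi)$ for all $\psi\in\mathcal Y$; $u,z\in C([0,T];L^2(\Omega))$. **Discrete problems.** Stabilized discrete primal problem: $u_{kh}\in\mathcal X_{kh}^{r,p}$ with $A(u_{kh})(\varphi_{kh})+S(u_{kh})(\varphi_{kh})+\langle u_{kh,0}^+,\varphi_{kh,0}^+\rangle=F(\varphi_{kh})+\langle u_0,\varphi_{kh,0}^+\rangle$ for all $\varphi_{kh}\in\mathcal X_{kh}^{r,p}$. Stabilized discrete dual problem: $z_{kh}\in\mathcal X_{kh}^{r,p}$ with $A^\ast(z_{kh})(\psi_{kh})+S^\ast(z_{kh})(\psi_{kh})+\langle z_{kh,M}^-,\psi_{kh,M}^-\rangle=\mathcal J'(u_{kh})(\psi_{kh})$ for all $\psi_{kh}\in\mathcal X_{kh}^{r,p}$. **Residuals.** For $\varphi\in\mathcal Y$ and $\psi\in\mathcal X+\mathcal X_{kh}^{r,p}$: $\rho(u_{kh})(\varphi)=F(\varphi)-A(u_{kh})(\varphi)-\langle u_{kh,0}^+-u_0,\varphi(0)\rangle$ and $\rho^\ast(z_{kh})(\psi)=\mathcal J'(u_{kh})(\psi)-A^\ast(z_{kh})(\psi)-\langle z_{kh,M}^-,\psi(T)\rangle$. *)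

theory Defs
  imports "HOL-Analysis.Analysis" "HOL-Library.Function_Algebras"
begin

text \<open>Space-time functions are curried functions of time and space, \<open>v t x\<close>.  The pointwise
  vector space structure lets \<open>v + s *\<^sub>R w\<close> and \<open>v - w\<close> be written for them and for functionals.\<close>

instantiation "fun" :: (type, real_vector) real_vector
begin

definition scaleR_fun :: "real \<Rightarrow> ('a \<Rightarrow> 'b) \<Rightarrow> 'a \<Rightarrow> 'b"
  where "scaleR_fun c f = (\<lambda>x. c *\<^sub>R f x)"

instance
  by standard (auto simp: scaleR_fun_def plus_fun_def fun_eq_iff algebra_simps)

end


section \<open>Bounded linear maps and Frechet derivatives on function spaces\<close>

text \<open>Elements of the function spaces are functions rather than equivalence classes, so the
  "norms" below are seminorms that vanish exactly on the functions representing zero, and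
  equality in a space with norm \<open>nV\<close> is read as \<open>nV (v - w) = 0\<close>.\<close>

definition bounded_linear_maps ::
    "'w::real_vector set \<Rightarrow> ('w \<Rightarrow> real) \<Rightarrow> 'v::real_vector set \<Rightarrow> ('v \<Rightarrow> real) \<Rightarrow> ('w \<Rightarrow> 'v) set"
  where "bounded_linear_maps W nW V nV = {l.
    (\<forall>h\<in>W. l h \<in> V) \<and>
    (\<forall>h\<in>W. \<forall>k\<in>W. nV (l (h + k) - l h - l k) = 0) \<and>
    (\<forall>h\<in>W. \<forall>c. nV (l (c *\<^sub>R h) - c *\<^sub>R l h) = 0) \<and>
    (\<exists>C. \<forall>h\<in>W. nV (l h) \<le> C * nW h)}"

definition operator_norm ::
    "'w::real_vector set \<Rightarrow> ('w \<Rightarrow> real) \<Rightarrow> ('v \<Rightarrow> real) \<Rightarrow> ('w \<Rightarrow> 'v) \<Rightarrow> real"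
  where "operator_norm W nW nV l = (SUP h\<in>{h\<in>W. nW h \<le> 1}. nV (l h))"

definition dual_space :: "'w::real_vector set \<Rightarrow> ('w \<Rightarrow> real) \<Rightarrow> ('w \<Rightarrow> real) set"
  where "dual_space W nW = bounded_linear_maps W nW UNIV abs"

definition dual_norm :: "'w::real_vector set \<Rightarrow> ('w \<Rightarrow> real) \<Rightarrow> ('w \<Rightarrow> real) \<Rightarrow> real"
  where "dual_norm W nW = operator_norm W nW abs"

definition has_frechet_derivative_on ::
    "('w::real_vector \<Rightarrow> 'v::real_vector) \<Rightarrow> ('w \<Rightarrow> 'w \<Rightarrow> 'v) \<Rightarrow>
     'w set \<Rightarrow> ('w \<Rightarrow> real) \<Rightarrow> 'v set \<Rightarrow> ('v \<Rightarrow> real) \<Rightarrow> bool"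
  where "has_frechet_derivative_on G G' W nW V nV \<longleftrightarrow>
    (\<forall>v\<in>W. G v \<in> V \<and> G' v \<in> bounded_linear_maps W nW V nV \<and>
      (\<forall>e>0. \<exists>d>0. \<forall>h\<in>W. nW h < d \<longrightarrow> nV (G (v + h) - G v - G' v h) \<le> e * nW h))"

definition continuous_into ::
    "real set \<Rightarrow> 'v::real_vector set \<Rightarrow> ('v \<Rightarrow> real) \<Rightarrow> (real \<Rightarrow> 'v) \<Rightarrow> bool"
  where "continuous_into I V nV v \<longleftrightarrow>
    (\<forall>t\<in>I. v t \<in> V \<and> ((\<lambda>s. nV (v s - v t)) \<longlongrightarrow> 0) (at t within I))"

text \<open>The Bochner space $L^2(I;V)$: strongly measurable and square integrable.\<close>

definition bochner_L2 ::
    "real set \<Rightarrow> 'v::real_vector set \<Rightarrow> ('v \<Rightarrow> real) \<Rightarrow> (real \<Rightarrow> 'v) set"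
  where "bochner_L2 I V nV = {v.
    (AE t in lebesgue_on I. v t \<in> V) \<and>
    (\<exists>s. (\<forall>n::nat. simple_function (lebesgue_on I) (s n) \<and> s n ` I \<subseteq> V) \<and>
         (AE t in lebesgue_on I. (\<lambda>n. nV (s n t - v t)) \<longlonglongrightarrow> 0)) \<and>
    integrable (lebesgue_on I) (\<lambda>t. (nV (v t))\<^sup>2)}"


section \<open>Lebesgue and Sobolev spaces\<close>

definition L2_space :: "'a::euclidean_space set \<Rightarrow> ('a \<Rightarrow> 'b::euclidean_space) set"
  where "L2_space D = {f \<in> borel_measurable (lebesgue_on D).
    integrable (lebesgue_on D) (\<lambda>x. (norm (f x))\<^sup>2)}"

definition L2_inner ::
    "'a::euclidean_space set \<Rightarrow> ('a \<Rightarrow> 'b::euclidean_space) \<Rightarrow> ('a \<Rightarrow> 'b) \<Rightarrow> real"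
  where "L2_inner D f g = (LINT x|lebesgue_on D. f x \<bullet> g x)"

definition L2_norm :: "'a::euclidean_space set \<Rightarrow> ('a \<Rightarrow> 'b::euclidean_space) \<Rightarrow> real"
  where "L2_norm D f = sqrt (L2_inner D f f)"

primrec C_k :: "nat \<Rightarrow> ('a::euclidean_space \<Rightarrow> real) \<Rightarrow> bool" where
  "C_k 0 f \<longleftrightarrow> continuous_on UNIV f"
| "C_k (Suc n) f \<longleftrightarrow> (\<forall>x. f differentiable (at x)) \<and>
     (\<forall>i\<in>Basis. C_k n (\<lambda>x. frechet_derivative f (at x) i))"

definition test_functions :: "'a::euclidean_space set \<Rightarrow> ('a \<Rightarrow> real) set"
  where "test_functions D = {\<phi>. (\<forall>n. C_k n \<phi>) \<and>
    compact (closure {x. \<phi> x \<noteq> 0}) \<and> closure {x. \<phi> x \<noteq> 0} \<subseteq> D}"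

definition classical_grad :: "('a::euclidean_space \<Rightarrow> real) \<Rightarrow> 'a \<Rightarrow> 'a"
  where "classical_grad \<phi> x = (\<Sum>i\<in>Basis. frechet_derivative \<phi> (at x) i *\<^sub>R i)"

definition has_weak_grad ::
    "'a::euclidean_space set \<Rightarrow> ('a \<Rightarrow> real) \<Rightarrow> ('a \<Rightarrow> 'a) \<Rightarrow> bool"
  where "has_weak_grad D f g \<longleftrightarrow> f \<in> L2_space D \<and> g \<in> L2_space D \<and>
    (\<forall>\<phi>\<in>test_functions D. (LINT x|lebesgue_on D. f x *\<^sub>R classical_grad \<phi> x)
                         = - (LINT x|lebesgue_on D. \<phi> x *\<^sub>R g x))"

text \<open>The weak gradient is unique up to null sets; \<open>wgrad\<close> is some representative of it.\<close>

definition wgrad :: "'a::euclidean_space set \<Rightarrow> ('a \<Rightarrow> real) \<Rightarrow> 'a \<Rightarrow> 'a"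
  where "wgrad D f = (SOME g. has_weak_grad D f g)"

definition wdiv :: "'a::euclidean_space set \<Rightarrow> ('a \<Rightarrow> 'a) \<Rightarrow> 'a \<Rightarrow> real"
  where "wdiv D G x = (\<Sum>i\<in>Basis. wgrad D (\<lambda>y. G y \<bullet> i) x \<bullet> i)"

definition H1_space :: "'a::euclidean_space set \<Rightarrow> ('a \<Rightarrow> real) set"
  where "H1_space D = {f. \<exists>g. has_weak_grad D f g}"

definition H1_norm :: "'a::euclidean_space set \<Rightarrow> ('a \<Rightarrow> real) \<Rightarrow> real"
  where "H1_norm D f = sqrt ((L2_norm D f)\<^sup>2 + (L2_norm D (wgrad D f))\<^sup>2)"

definition H10_space :: "'a::euclidean_space set \<Rightarrow> ('a \<Rightarrow> real) set"
  where "H10_space D = {f \<in> H1_space D.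
    \<exists>\<phi>. (\<forall>n::nat. \<phi> n \<in> test_functions D) \<and> (\<lambda>n. H1_norm D (\<phi> n - f)) \<longlonglongrightarrow> 0}"

definition Hminus1_space :: "'a::euclidean_space set \<Rightarrow> (('a \<Rightarrow> real) \<Rightarrow> real) set"
  where "Hminus1_space D = dual_space (H10_space D) (H1_norm D)"

definition Hminus1_norm :: "'a::euclidean_space set \<Rightarrow> (('a \<Rightarrow> real) \<Rightarrow> real) \<Rightarrow> real"
  where "Hminus1_norm D = dual_norm (H10_space D) (H1_norm D)"

text \<open>\<open>has_weak_dt D a b v g\<close>: on $(a,b)$ the distributional time derivative of $v$ is
  $g \in L^2(a,b;H^{-1})$, where $v(t)$ is regarded as an element of $H^{-1}$ via the
  $L^2$ inner product.\<close>

definition has_weak_dt :: "'a::euclidean_space set \<Rightarrow> real \<Rightarrow> real \<Rightarrow>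
    (real \<Rightarrow> 'a \<Rightarrow> real) \<Rightarrow> (real \<Rightarrow> ('a \<Rightarrow> real) \<Rightarrow> real) \<Rightarrow> bool"
  where "has_weak_dt D a b v g \<longleftrightarrow>
    g \<in> bochner_L2 {a<..b} (Hminus1_space D) (Hminus1_norm D) \<and>
    (\<forall>w\<in>H10_space D. \<forall>\<eta>\<in>test_functions {a<..<b}.
       (LINT t|lebesgue_on {a<..b}. deriv \<eta> t * L2_inner D (v t) w)
       = - (LINT t|lebesgue_on {a<..b}. \<eta> t * g t w))"

definition weak_dt :: "'a::euclidean_space set \<Rightarrow> real \<Rightarrow> real \<Rightarrow>
    (real \<Rightarrow> 'a \<Rightarrow> real) \<Rightarrow> real \<Rightarrow> ('a \<Rightarrow> real) \<Rightarrow> real"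
  where "weak_dt D a b v = (SOME g. has_weak_dt D a b v g)"

definition L2_Lim ::
    "'a::euclidean_space set \<Rightarrow> real filter \<Rightarrow> (real \<Rightarrow> 'a \<Rightarrow> real) \<Rightarrow> 'a \<Rightarrow> real"
  where "L2_Lim D Fl v = (SOME w. w \<in> L2_space D \<and> ((\<lambda>s. L2_norm D (v s - w)) \<longlongrightarrow> 0) Fl)"


section \<open>Domain and meshes\<close>

text \<open>The boundary consists of finitely many segments (2D) or plane polygons (3D).\<close>

definition polyhedral_domain :: "'a::euclidean_space set \<Rightarrow> bool"
  where "polyhedral_domain D \<longleftrightarrow> open D \<and> connected D \<and> bounded D \<and> D \<noteq> {} \<and>
    (\<exists>\<F>. finite \<F> \<and> (\<forall>F\<in>\<F>. polytope F \<and> aff_dim F = int DIM('a) - 1) \<and>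
          frontier D = \<Union>\<F>)"

text \<open>\<open>triangulation\<close> requires two simplices to meet in a common face, i.e. conformity.\<close>

definition conforming_mesh :: "'a::euclidean_space set \<Rightarrow> 'a set set \<Rightarrow> bool"
  where "conforming_mesh D \<T> \<longleftrightarrow> triangulation \<T> \<and>
    (\<forall>K\<in>\<T>. int DIM('a) simplex K \<and> interior K \<subseteq> D) \<and> \<Union>\<T> = closure D"

text \<open>Polynomial functions of total degree at most \<open>p\<close>.\<close>

definition polynomials :: "nat \<Rightarrow> ('a::euclidean_space \<Rightarrow> real) set"
  where "polynomials p = {q. \<exists>c. \<forall>x. q x =
    (\<Sum>\<mu> \<in> {\<mu> \<in> Basis \<rightarrow>\<^sub>E {..p}. (\<Sum>i\<in>Basis. \<mu> i) \<le> p}. c \<mu> * (\<Prod>i\<in>Basis. (x \<bullet> i) ^ \<mu> i))}"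

definition fe_space :: "'a::euclidean_space set \<Rightarrow> 'a set set \<Rightarrow> nat \<Rightarrow> ('a \<Rightarrow> real) set"
  where "fe_space D \<T> p = {v \<in> H10_space D. continuous_on (closure D) v \<and>
    (\<forall>K\<in>\<T>. \<exists>q\<in>polynomials p. \<forall>x\<in>K. v x = q x)}"


section \<open>Data of the continuous and the discrete problem\<close>

text \<open>\<open>source t\<close> is the functional $f(t)\in H^{-1}(\Omega)$; \<open>source_elem\<close> is the function that
  represents it on the elements, as needed for the $L^2(K)$ products with $f$ in the
  stabilization terms.  \<open>mesh m\<close> is the mesh of the interval $I_m$ and \<open>mesh 0\<close> that of the
  initial value; \<open>supg m K\<close> and \<open>supg_dual m K\<close> are $\delta_K$ and $\delta_K^*$ for the elements
  of \<open>mesh m\<close>.\<close>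

record 'a problem =
  dom :: "'a set"
  velocity :: "'a \<Rightarrow> 'a"
  diffusion :: real
  reaction :: real
  source :: "real \<Rightarrow> ('a \<Rightarrow> real) \<Rightarrow> real"
  source_elem :: "real \<Rightarrow> 'a \<Rightarrow> real"
  initial :: "'a \<Rightarrow> real"
  nsteps :: nat
  grid :: "nat \<Rightarrow> real"
  mesh :: "nat \<Rightarrow> 'a set set"
  time_deg :: nat
  space_deg :: nat
  supg :: "nat \<Rightarrow> 'a set \<Rightarrow> real"
  supg_dual :: "nat \<Rightarrow> 'a set \<Rightarrow> real"

definition final_time :: "('a, 'z) problem_scheme \<Rightarrow> real"
  where "final_time P = grid P (nsteps P)"

definition time_int :: "('a, 'z) problem_scheme \<Rightarrow> real set"
  where "time_int P = {0<..final_time P}"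

definition subint :: "('a, 'z) problem_scheme \<Rightarrow> nat \<Rightarrow> real set"
  where "subint P m = {grid P (m - 1)<..grid P m}"

definition problem_data :: "'a::euclidean_space problem \<Rightarrow> bool"
  where "problem_data P \<longleftrightarrow>
    DIM('a) \<in> {2, 3} \<and> polyhedral_domain (dom P) \<and>
    0 \<le> reaction P \<and> 0 < diffusion P \<and>
    (\<forall>i\<in>Basis. (\<lambda>x. velocity P x \<bullet> i) \<in> H1_space (dom P)) \<and>
    (\<exists>C. AE x in lebesgue_on (dom P). norm (velocity P x) \<le> C) \<and>
    (AE x in lebesgue_on (dom P). wdiv (dom P) (velocity P) x = 0) \<and>
    source P \<in> bochner_L2 (time_int P) (Hminus1_space (dom P)) (Hminus1_norm (dom P)) \<and>
    initial P \<in> L2_space (dom P) \<and>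
    1 \<le> nsteps P \<and> grid P 0 = 0 \<and> (\<forall>m\<in>{1..nsteps P}. grid P (m - 1) < grid P m) \<and>
    (\<forall>m\<le>nsteps P. conforming_mesh (dom P) (mesh P m)) \<and>
    1 \<le> space_deg P \<and>
    (\<forall>m\<in>{1..nsteps P}. \<forall>K\<in>mesh P m.
       source_elem P \<in> bochner_L2 (subint P m) (L2_space K) (L2_norm K) \<and>
       (AE t in lebesgue_on (subint P m). \<forall>\<phi>\<in>test_functions (interior K).
          source P t \<phi> = L2_inner K (source_elem P t) \<phi>)) \<and>
    (\<forall>m\<in>{1..nsteps P}. \<forall>K\<in>mesh P m. 0 < supg P m K \<and> 0 < supg_dual P m K)"


section \<open>Function spaces in space and time\<close>

type_synonym 'a st_fun = "real \<Rightarrow> 'a \<Rightarrow> real"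

text \<open>Elements of $\mathcal X$ are identified with their representatives in
  $C([0,T];L^2(\Omega))$, so that their point values in time are meaningful.\<close>

definition X_space :: "'a::euclidean_space problem \<Rightarrow> 'a st_fun set"
  where "X_space P = {v \<in> bochner_L2 (time_int P) (H10_space (dom P)) (H1_norm (dom P)).
    (\<exists>g. has_weak_dt (dom P) 0 (final_time P) v g) \<and>
    continuous_into {0..final_time P} (L2_space (dom P)) (L2_norm (dom P)) v}"

definition Y_space :: "'a::euclidean_space problem \<Rightarrow> 'a st_fun set"
  where "Y_space P = {v \<in> bochner_L2 (time_int P) (H10_space (dom P)) (H1_norm (dom P)).
    \<forall>m\<in>{1..nsteps P}. \<exists>w. (\<forall>t\<in>subint P m. w t = v t) \<and>
      continuous_into {grid P (m - 1)..grid P m} (H10_space (dom P)) (H1_norm (dom P)) w}"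

definition Xkh_space :: "'a::euclidean_space problem \<Rightarrow> 'a st_fun set"
  where "Xkh_space P = {v.
    (\<forall>m\<in>{1..nsteps P}. \<exists>c. (\<forall>j\<le>time_deg P. c j \<in> fe_space (dom P) (mesh P m) (space_deg P)) \<and>
       (\<forall>t\<in>subint P m. v t = (\<Sum>j\<le>time_deg P. t ^ j *\<^sub>R c j))) \<and>
    v 0 \<in> fe_space (dom P) (mesh P 0) (space_deg P)}"

definition XY_space :: "'a::euclidean_space problem \<Rightarrow> 'a st_fun set"
  where "XY_space P = {v + w | v w. v \<in> X_space P \<and> w \<in> Y_space P}"


section \<open>Forms and Lagrangian\<close>

text \<open>\<open>rlim P v m\<close> and \<open>llim P v m\<close> are $v_m^+$ and $v_m^-$.\<close>

definition rlim :: "'a::euclidean_space problem \<Rightarrow> 'a st_fun \<Rightarrow> nat \<Rightarrow> 'a \<Rightarrow> real"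
  where "rlim P v m = L2_Lim (dom P) (at_right (grid P m)) v"

definition llim :: "'a::euclidean_space problem \<Rightarrow> 'a st_fun \<Rightarrow> nat \<Rightarrow> 'a \<Rightarrow> real"
  where "llim P v m = L2_Lim (dom P) (at_left (grid P m)) v"

definition jump :: "'a::euclidean_space problem \<Rightarrow> 'a st_fun \<Rightarrow> nat \<Rightarrow> 'a \<Rightarrow> real"
  where "jump P v m = rlim P v m - llim P v m"

definition st_inner :: "'a::euclidean_space problem \<Rightarrow>
    (real \<Rightarrow> 'a \<Rightarrow> 'b::euclidean_space) \<Rightarrow> (real \<Rightarrow> 'a \<Rightarrow> 'b) \<Rightarrow> real"
  where "st_inner P v w = (LINT t|lebesgue_on (time_int P). L2_inner (dom P) (v t) (w t))"

definition grad :: "'a::euclidean_space problem \<Rightarrow> 'a st_fun \<Rightarrow> real \<Rightarrow> 'a \<Rightarrow> 'a"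
  where "grad P v t = wgrad (dom P) (v t)"

text \<open>The pairing $\sum_m\int_{I_m}\langle\partial_t v,w\rangle\,dt$.\<close>

definition dt_form :: "'a::euclidean_space problem \<Rightarrow> 'a st_fun \<Rightarrow> 'a st_fun \<Rightarrow> real"
  where "dt_form P v w = (\<Sum>m=1..nsteps P. LINT t|lebesgue_on (subint P m).
    weak_dt (dom P) (grid P (m - 1)) (grid P m) v t (w t))"

definition F_form :: "'a::euclidean_space problem \<Rightarrow> 'a st_fun \<Rightarrow> real"
  where "F_form P \<phi> = (LINT t|lebesgue_on (time_int P). source P t (\<phi> t))"

definition a_form :: "'a::euclidean_space problem \<Rightarrow> 'a st_fun \<Rightarrow> 'a st_fun \<Rightarrow> real"
  where "a_form P v \<phi> =
    st_inner P (\<lambda>t x. velocity P x \<bullet> grad P v t x) \<phi>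
    + st_inner P (\<lambda>t x. diffusion P *\<^sub>R grad P v t x) (grad P \<phi>)
    + st_inner P (\<lambda>t x. reaction P * v t x) \<phi>"

definition A_form :: "'a::euclidean_space problem \<Rightarrow> 'a st_fun \<Rightarrow> 'a st_fun \<Rightarrow> real"
  where "A_form P v \<phi> = dt_form P v \<phi> + a_form P v \<phi>
    + (\<Sum>m=2..nsteps P. L2_inner (dom P) (jump P v (m - 1)) (rlim P \<phi> (m - 1)))"

definition A_dual_form :: "'a::euclidean_space problem \<Rightarrow> 'a st_fun \<Rightarrow> 'a st_fun \<Rightarrow> real"
  where "A_dual_form P z \<psi> = - dt_form P z \<psi>
    - st_inner P (\<lambda>t x. velocity P x \<bullet> grad P z t x) \<psi>
    + st_inner P (\<lambda>t x. diffusion P *\<^sub>R grad P z t x) (grad P \<psi>)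
    + st_inner P (\<lambda>t x. reaction P * z t x) \<psi>
    - (\<Sum>m=2..nsteps P. L2_inner (dom P) (jump P z (m - 1)) (llim P \<psi> (m - 1)))"

text \<open>Element-wise residuals on \<open>K\<close>.  The time derivative is the pointwise one, as discrete
  functions are polynomials in time on each subinterval; \<open>jv\<close> stands for $j(u_{kh})$.\<close>

definition residual ::
    "'a::euclidean_space problem \<Rightarrow> 'a set \<Rightarrow> 'a st_fun \<Rightarrow> real \<Rightarrow> 'a \<Rightarrow> real"
  where "residual P K u t x =
    deriv (\<lambda>s. u s x) t + velocity P x \<bullet> wgrad (interior K) (u t) x
    - wdiv (interior K) (\<lambda>y. diffusion P *\<^sub>R wgrad (interior K) (u t) y) x
    + reaction P * u t x - source_elem P t x"

definition residual_dual ::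
    "'a::euclidean_space problem \<Rightarrow> 'a st_fun \<Rightarrow> 'a set \<Rightarrow> 'a st_fun \<Rightarrow> real \<Rightarrow> 'a \<Rightarrow> real"
  where "residual_dual P jv K z t x =
    - deriv (\<lambda>s. z s x) t - velocity P x \<bullet> wgrad (interior K) (z t) x
    - wdiv (interior K) (\<lambda>y. diffusion P *\<^sub>R wgrad (interior K) (z t) y) x
    + reaction P * z t x - jv t x"

definition streamline ::
    "'a::euclidean_space problem \<Rightarrow> 'a set \<Rightarrow> ('a \<Rightarrow> real) \<Rightarrow> 'a \<Rightarrow> real"
  where "streamline P K w x = velocity P x \<bullet> wgrad (interior K) w x"

definition S_form :: "'a::euclidean_space problem \<Rightarrow> 'a st_fun \<Rightarrow> 'a st_fun \<Rightarrow> real"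
  where "S_form P u \<phi> =
    (\<Sum>m=1..nsteps P. LINT t|lebesgue_on (subint P m).
       (\<Sum>K\<in>mesh P m. supg P m K * L2_inner K (residual P K u t) (streamline P K (\<phi> t))))
    + (\<Sum>m=2..nsteps P. \<Sum>K\<in>mesh P m.
         supg P m K * L2_inner K (jump P u (m - 1)) (streamline P K (rlim P \<phi> (m - 1))))
    + (\<Sum>K\<in>mesh P 1.
         supg P 1 K * L2_inner K (rlim P u 0 - initial P) (streamline P K (rlim P \<phi> 0)))"

text \<open>In the terms at $t_{m-1}$ and $t_M$ the test function is a limit from the left, so the
  elements are those of $I_{m-1}$ and $I_M$, respectively.\<close>

definition S_dual_form ::
    "'a::euclidean_space problem \<Rightarrow> 'a st_fun \<Rightarrow> 'a st_fun \<Rightarrow> 'a st_fun \<Rightarrow> real"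
  where "S_dual_form P jv z \<psi> =
    (\<Sum>m=1..nsteps P. LINT t|lebesgue_on (subint P m).
       (\<Sum>K\<in>mesh P m. supg_dual P m K *
          L2_inner K (residual_dual P jv K z t) (- streamline P K (\<psi> t))))
    - (\<Sum>m=2..nsteps P. \<Sum>K\<in>mesh P (m - 1). supg_dual P (m - 1) K *
         L2_inner K (jump P z (m - 1)) (- streamline P K (llim P \<psi> (m - 1))))
    + (\<Sum>K\<in>mesh P (nsteps P). supg_dual P (nsteps P) K *
         L2_inner K (llim P z (nsteps P)) (- streamline P K (llim P \<psi> (nsteps P))))"

definition Lagrangian ::
    "'a::euclidean_space problem \<Rightarrow> ('a st_fun \<Rightarrow> real) \<Rightarrow> 'a st_fun \<Rightarrow> 'a st_fun \<Rightarrow> real"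
  where "Lagrangian P J u z = J u + F_form P z - dt_form P u z - a_form P u z
    - (\<Sum>m=2..nsteps P. L2_inner (dom P) (jump P u (m - 1)) (rlim P z (m - 1)))
    - L2_inner (dom P) (rlim P u 0 - initial P) (rlim P z 0)"

definition Lagrangian_u :: "'a::euclidean_space problem \<Rightarrow> ('a st_fun \<Rightarrow> real) \<Rightarrow>
    'a st_fun \<Rightarrow> 'a st_fun \<Rightarrow> 'a st_fun \<Rightarrow> real"
  where "Lagrangian_u P J u z \<psi> = deriv (\<lambda>s. Lagrangian P J (u + s *\<^sub>R \<psi>) z) 0"

definition Lagrangian_z :: "'a::euclidean_space problem \<Rightarrow> ('a st_fun \<Rightarrow> real) \<Rightarrow>
    'a st_fun \<Rightarrow> 'a st_fun \<Rightarrow> 'a st_fun \<Rightarrow> real"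
  where "Lagrangian_z P J u z \<phi> = deriv (\<lambda>s. Lagrangian P J u (z + s *\<^sub>R \<phi>)) 0"

definition stationary_point :: "'a::euclidean_space problem \<Rightarrow> ('a st_fun \<Rightarrow> real) \<Rightarrow>
    'a st_fun \<Rightarrow> 'a st_fun \<Rightarrow> bool"
  where "stationary_point P J u z \<longleftrightarrow> u \<in> X_space P \<and> z \<in> Y_space P \<and>
    (\<forall>\<psi>\<in>X_space P. \<forall>\<phi>\<in>Y_space P. Lagrangian_u P J u z \<psi> + Lagrangian_z P J u z \<phi> = 0)"


section \<open>Target functional\<close>

text \<open>\<open>J\<close> is a three times Frechet differentiable functional on the sum of $\mathcal X$ and
  $\mathcal Y$, the linear hull of the places where it and its derivatives are evaluated.  The
  norm \<open>nrm\<close> with respect to which it is differentiable is arbitrary; it has to identify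
  exactly the functions that are equal almost everywhere.\<close>

definition norm_on_XY :: "'a::euclidean_space problem \<Rightarrow> ('a st_fun \<Rightarrow> real) \<Rightarrow> bool"
  where "norm_on_XY P nrm \<longleftrightarrow>
    (\<forall>v\<in>XY_space P. 0 \<le> nrm v) \<and>
    (\<forall>v\<in>XY_space P. \<forall>w\<in>XY_space P. nrm (v + w) \<le> nrm v + nrm w) \<and>
    (\<forall>v\<in>XY_space P. \<forall>c. nrm (c *\<^sub>R v) = \<bar>c\<bar> * nrm v) \<and>
    (\<forall>v\<in>XY_space P. nrm v = 0 \<longleftrightarrow>
       (AE t in lebesgue_on (time_int P). AE x in lebesgue_on (dom P). v t x = 0))"

definition target_functional :: "'a::euclidean_space problem \<Rightarrow> ('a st_fun \<Rightarrow> real) \<Rightarrow>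
    ('a st_fun \<Rightarrow> real) \<Rightarrow> ('a st_fun \<Rightarrow> 'a st_fun \<Rightarrow> real) \<Rightarrow>
    ('a st_fun \<Rightarrow> 'a st_fun \<Rightarrow> 'a st_fun \<Rightarrow> real) \<Rightarrow>
    ('a st_fun \<Rightarrow> 'a st_fun \<Rightarrow> 'a st_fun \<Rightarrow> 'a st_fun \<Rightarrow> real) \<Rightarrow>
    ('a st_fun \<Rightarrow> 'a st_fun) \<Rightarrow> bool"
  where "target_functional P nrm J J1 J2 J3 j \<longleftrightarrow>
    (let W = XY_space P;
         W1 = dual_space W nrm; n1 = dual_norm W nrm;
         W2 = bounded_linear_maps W nrm W1 n1; n2 = operator_norm W nrm n1
     in norm_on_XY P nrm \<and>
        has_frechet_derivative_on J J1 W nrm UNIV abs \<and>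
        has_frechet_derivative_on J1 J2 W nrm W1 n1 \<and>
        has_frechet_derivative_on J2 J3 W nrm W2 n2 \<and>
        (\<forall>v\<in>W. j v \<in> bochner_L2 (time_int P) (L2_space (dom P)) (L2_norm (dom P)) \<and>
               (\<forall>\<phi>\<in>W. J1 v \<phi> = st_inner P (j v) \<phi>)))"


section \<open>Discrete problems and residuals\<close>

definition discrete_primal_solution :: "'a::euclidean_space problem \<Rightarrow> 'a st_fun \<Rightarrow> bool"
  where "discrete_primal_solution P u \<longleftrightarrow> u \<in> Xkh_space P \<and>
    (\<forall>\<phi>\<in>Xkh_space P.
       A_form P u \<phi> + S_form P u \<phi> + L2_inner (dom P) (rlim P u 0) (rlim P \<phi> 0)
       = F_form P \<phi> + L2_inner (dom P) (initial P) (rlim P \<phi> 0))"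

definition discrete_dual_solution :: "'a::euclidean_space problem \<Rightarrow>
    ('a st_fun \<Rightarrow> 'a st_fun \<Rightarrow> real) \<Rightarrow> ('a st_fun \<Rightarrow> 'a st_fun) \<Rightarrow>
    'a st_fun \<Rightarrow> 'a st_fun \<Rightarrow> bool"
  where "discrete_dual_solution P J1 j u z \<longleftrightarrow> z \<in> Xkh_space P \<and>
    (\<forall>\<psi>\<in>Xkh_space P.
       A_dual_form P z \<psi> + S_dual_form P (j u) z \<psi>
         + L2_inner (dom P) (llim P z (nsteps P)) (llim P \<psi> (nsteps P))
       = J1 u \<psi>)"

definition rho :: "'a::euclidean_space problem \<Rightarrow> 'a st_fun \<Rightarrow> 'a st_fun \<Rightarrow> real"
  where "rho P u \<phi> = F_form P \<phi> - A_form P u \<phi>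
    - L2_inner (dom P) (rlim P u 0 - initial P) (rlim P \<phi> 0)"

definition rho_dual :: "'a::euclidean_space problem \<Rightarrow>
    ('a st_fun \<Rightarrow> 'a st_fun \<Rightarrow> real) \<Rightarrow> 'a st_fun \<Rightarrow> 'a st_fun \<Rightarrow> 'a st_fun \<Rightarrow> real"
  where "rho_dual P J1 u z \<psi> = J1 u \<psi> - A_dual_form P z \<psi>
    - L2_inner (dom P) (llim P z (nsteps P)) (llim P \<psi> (nsteps P))"

end

theory Submission
  imports Defs
begin

text \<open>Let \<open>e = u - ukh\<close>.  Along the segment from \<open>ukh\<close> to \<open>u\<close> the functional \<open>J\<close> is a three
  times differentiable function on $[0,1]$, and the trapezoidal rule with its Peano remainder
  gives \<open>J u - J ukh\<close> as half of \<open>J1 u e + J1 ukh e\<close> plus the remainder term of the theorem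
  (\<open>trapezoidal_rule_functional\<close>).  Everything else is about the two derivatives.

  Write \<open>full_form v w\<close> for $A(v)(w) + \langle v_0^+, w_0^+\rangle$.  In terms of this
  bilinear form the four ingredients of the error representation become similar.

  The primal equation turns $\rho(u_{kh})$ and, on discrete functions, the stabilization form
  $S(u_{kh})$ into \<open>full_form e\<close>.

  Integration by parts in time on each subinterval, together with the skew symmetry of the
  advection term, identifies $A^*(z_{kh})(v) + \langle z_{kh,M}^-, v_M^-\rangle$ with
  \<open>full_form v zkh\<close> (\<open>dual_form_eq\<close>).  Hence both $\rho^*(z_{kh})$ and, on discrete functions,
  $S^*(z_{kh})$ are \<open>\<lambda>v. J1 ukh v - full_form v zkh\<close>.

  In the sum of the residuals and stabilization terms the arbitrary functions \<open>\<phi>kh\<close> and \<open>\<psi>kh\<close>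
  cancel; \<open>full_form e z + J1 ukh e\<close> remains.

  It remains to see that \<open>J1 u e = full_form e z\<close>.  Stationarity yields this for arguments in
  $\mathcal X$, but \<open>ukh\<close> jumps in time.  Every discrete function is a combination of terms
  $t^j c$ on subintervals, with $c \in H^1_0(\Omega)$.  Multiplying $t^j c$ by a smooth cut-off that
  rises from 0 to 1 just to the right of a node gives an admissible function; as the
  cut-off steepens, its derivative becomes a delta functional which picks out the right limit of \<open>z\<close>
  at the node, exactly as the jump terms do (\<open>dual_step\<close>, \<open>dual_problem_Xkh\<close>).

  The function spaces consist of functions with Hilbert-chosen weak
  derivatives and limits.  Their uniqueness up to null sets rests on the du Bois-Reymond lemma,
  for which smooth test functions are constructed from $e^{-1/x}$.\<close>


section \<open>Seminorms, dual spaces and the trapezoidal rule\<close>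

lemma scaleR_fun_apply [simp]: "(c *\<^sub>R f) x = c *\<^sub>R f x"
  by (simp add: scaleR_fun_def)

definition seminorm_on :: "'v::real_vector set \<Rightarrow> ('v \<Rightarrow> real) \<Rightarrow> bool"
  where "seminorm_on V n \<longleftrightarrow> subspace V \<and>
    (\<forall>v\<in>V. 0 \<le> n v) \<and>
    (\<forall>v\<in>V. \<forall>w\<in>V. n (v + w) \<le> n v + n w) \<and>
    (\<forall>v\<in>V. \<forall>c. n (c *\<^sub>R v) = \<bar>c\<bar> * n v)"

lemma seminorm_onD:
  assumes "seminorm_on V n"
  shows "subspace V"
    and "v \<in> V \<Longrightarrow> 0 \<le> n v"
    and "v \<in> V \<Longrightarrow> w \<in> V \<Longrightarrow> n (v + w) \<le> n v + n w"
    and "v \<in> V \<Longrightarrow> n (c *\<^sub>R v) = \<bar>c\<bar> * n v"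
    and "v \<in> V \<Longrightarrow> w \<in> V \<Longrightarrow> v + w \<in> V"
    and "v \<in> V \<Longrightarrow> w \<in> V \<Longrightarrow> v - w \<in> V"
    and "v \<in> V \<Longrightarrow> c *\<^sub>R v \<in> V"
    and "0 \<in> V"
    and "n 0 = 0"
  subgoal using assms by (auto simp: seminorm_on_def)
  subgoal using assms by (auto simp: seminorm_on_def)
  subgoal using assms by (auto simp: seminorm_on_def)
  subgoal using assms by (auto simp: seminorm_on_def)
  subgoal using assms by (auto simp: seminorm_on_def subspace_add)
  subgoal using assms by (auto simp: seminorm_on_def subspace_diff)
  subgoal using assms by (auto simp: seminorm_on_def subspace_scale)
  subgoal using assms by (auto simp: seminorm_on_def subspace_0)
  subgoal
  proof -
    have "n (0 *\<^sub>R 0) = \<bar>0\<bar> * n 0"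
      using assms unfolding seminorm_on_def by (blast dest: subspace_0)
    then show ?thesis by simp
  qed
  done

lemma seminorm_on_minus:
  assumes "seminorm_on V n" "v \<in> V"
  shows "n (- v) = n v"
  using seminorm_onD(4)[OF assms, of "-1"] by simp

lemma seminorm_on_commute:
  assumes "seminorm_on V n" "v \<in> V" "w \<in> V"
  shows "n (v - w) = n (w - v)"
  using seminorm_on_minus[OF assms(1) seminorm_onD(6)[OF assms]] by simp

lemma seminorm_on_triangle3:
  assumes "seminorm_on V n" "u \<in> V" "v \<in> V" "w \<in> V"
  shows "n (u - w) \<le> n (u - v) + n (v - w)"
  using seminorm_onD(3)[OF assms(1) seminorm_onD(6)[OF assms(1,2,3)] seminorm_onD(6)[OF assms(1,3,4)]]
  by simp

lemma seminorm_on_abs_diff: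
  assumes "seminorm_on V n" "v \<in> V" "w \<in> V"
  shows "\<bar>n v - n w\<bar> \<le> n (v - w)"
proof -
  have "n v \<le> n (v - w) + n w" "n w \<le> n (w - v) + n v"
    using seminorm_onD(3)[OF assms(1), of "v - w" w] seminorm_onD(3)[OF assms(1), of "w - v" v]
      seminorm_onD(6)[OF assms(1)] assms by auto
  then show ?thesis using seminorm_on_commute[OF assms] by linarith
qed

lemma seminorm_on_eq:
  assumes "seminorm_on V n" "v \<in> V" "w \<in> V" "n (v - w) = 0"
  shows "n v = n w"
  using seminorm_on_abs_diff[OF assms(1-3)] assms(4) by simp

lemma seminorm_on_abs: "seminorm_on UNIV (abs :: real \<Rightarrow> real)"
  by (auto simp: seminorm_on_def subspace_def abs_mult)

lemma operator_norm_bdd: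
  assumes W: "seminorm_on W nW" and l: "l \<in> bounded_linear_maps W nW V nV"
  shows "bdd_above ((\<lambda>h. nV (l h)) ` {h \<in> W. nW h \<le> 1})"
proof -
  obtain C where C: "\<And>h. h \<in> W \<Longrightarrow> nV (l h) \<le> C * nW h"
    using l unfolding bounded_linear_maps_def by blast
  show ?thesis
  proof (rule bdd_aboveI2)
    fix h assume "h \<in> {h \<in> W. nW h \<le> 1}"
    then have "nV (l h) \<le> C * nW h" "0 \<le> nW h" "nW h \<le> 1"
      using C seminorm_onD(2)[OF W] by auto
    moreover have "C * nW h \<le> \<bar>C\<bar> * 1"
      using \<open>0 \<le> nW h\<close> \<open>nW h \<le> 1\<close> by (intro mult_mono) auto
    ultimately show "nV (l h) \<le> \<bar>C\<bar>" by linarith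
  qed
qed

text \<open>Homogeneity up to \<open>nV\<close>-null elements is enough to rescale the argument into the unit
  ball; if \<open>nW h = 0\<close>, the bound in the definition of \<open>bounded_linear_maps\<close> applies.\<close>

lemma operator_norm_bound:
  assumes W: "seminorm_on W nW" and V: "seminorm_on V nV"
    and l: "l \<in> bounded_linear_maps W nW V nV" and h: "h \<in> W"
  shows "nV (l h) \<le> operator_norm W nW nV l * nW h"
proof -
  obtain C where C: "\<And>h. h \<in> W \<Longrightarrow> nV (l h) \<le> C * nW h"
    using l unfolding bounded_linear_maps_def by blast
  have lV: "\<And>h. h \<in> W \<Longrightarrow> l h \<in> V" using l by (auto simp: bounded_linear_maps_def)
  note bdd = operator_norm_bdd[OF W l]
  show ?thesis
  proof (cases "nW h = 0")
    case True
    then show ?thesis using C[OF h] by simp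
  next
    case False
    then have pos: "0 < nW h" using seminorm_onD(2)[OF W h] by simp
    let ?c = "1 / nW h"
    have k: "?c *\<^sub>R h \<in> W" "nW (?c *\<^sub>R h) = 1"
      using pos by (simp_all add: seminorm_onD(7)[OF W h] seminorm_onD(4)[OF W h])
    have "nV (l (?c *\<^sub>R h)) \<le> operator_norm W nW nV l"
      unfolding operator_norm_def using k by (intro cSUP_upper bdd) auto
    moreover have "nV (l (?c *\<^sub>R h) - ?c *\<^sub>R l h) = 0"
      using l h by (auto simp: bounded_linear_maps_def)
    then have "nV (l (?c *\<^sub>R h)) = nV (?c *\<^sub>R l h)"
      using lV k(1) h by (intro seminorm_on_eq[OF V]) (auto intro: seminorm_onD(7)[OF V])
    then have "nV (l (?c *\<^sub>R h)) = ?c * nV (l h)"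
      using pos by (simp add: seminorm_onD(4)[OF V lV[OF h]])
    ultimately show ?thesis using pos by (simp add: field_simps)
  qed
qed

lemma operator_norm_least:
  assumes W: "seminorm_on W nW" and C: "\<And>h. h \<in> W \<Longrightarrow> nV (l h) \<le> C * nW h" and "0 \<le> C"
  shows "operator_norm W nW nV l \<le> C"
  unfolding operator_norm_def
proof (rule cSUP_least)
  show "{h \<in> W. nW h \<le> 1} \<noteq> {}"
    using seminorm_onD(8,9)[OF W] by (auto intro!: exI[of _ 0])
  fix h assume "h \<in> {h \<in> W. nW h \<le> 1}"
  then have "nV (l h) \<le> C * nW h" "nW h \<le> 1" using C by auto
  then show "nV (l h) \<le> C"
    using mult_left_mono[OF \<open>nW h \<le> 1\<close> \<open>0 \<le> C\<close>] by linarith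
qed

lemma operator_norm_nonneg:
  assumes W: "seminorm_on W nW" and V: "seminorm_on V nV"
    and l: "l \<in> bounded_linear_maps W nW V nV"
  shows "0 \<le> operator_norm W nW nV l"
proof -
  have "nV (l 0) \<le> operator_norm W nW nV l"
    unfolding operator_norm_def using seminorm_onD(8,9)[OF W]
    by (intro cSUP_upper operator_norm_bdd[OF W l]) auto
  moreover have "0 \<le> nV (l 0)"
    using l seminorm_onD(8)[OF W] seminorm_onD(2)[OF V] by (auto simp: bounded_linear_maps_def)
  ultimately show ?thesis by linarith
qed

text \<open>Derivatives of \<open>J\<close> of each order thus take values in a seminormed space, so that one lemma
  on derivatives along lines serves all orders.\<close>

lemma seminorm_on_bounded_linear_maps:
  assumes W: "seminorm_on W nW" and V: "seminorm_on V nV"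
  shows "seminorm_on (bounded_linear_maps W nW V nV) (operator_norm W nW nV)"
proof -
  let ?B = "bounded_linear_maps W nW V nV" and ?n = "operator_norm W nW nV"
  have add: "l + k \<in> ?B" "?n (l + k) \<le> ?n l + ?n k" if l: "l \<in> ?B" and k: "k \<in> ?B" for l k
  proof -
    have lV: "\<And>h. h \<in> W \<Longrightarrow> l h \<in> V" "\<And>h. h \<in> W \<Longrightarrow> k h \<in> V"
      using l k by (auto simp: bounded_linear_maps_def)
    have le: "nV ((l + k) h) \<le> (?n l + ?n k) * nW h" if "h \<in> W" for h
      using seminorm_onD(3)[OF V lV[OF that]] operator_norm_bound[OF W V l that]
        operator_norm_bound[OF W V k that] by (simp add: algebra_simps)
    have z: "nV (x + y) = 0" if "x \<in> V" "y \<in> V" "nV x = 0" "nV y = 0" for x y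
      using seminorm_onD(3)[OF V that(1,2)] seminorm_onD(2)[OF V seminorm_onD(5)[OF V that(1,2)]]
        that by simp
    have a: "nV ((l + k) (h + g) - (l + k) h - (l + k) g) = 0" if "h \<in> W" "g \<in> W" for h g
    proof -
      have "(l + k) (h + g) - (l + k) h - (l + k) g
          = (l (h + g) - l h - l g) + (k (h + g) - k h - k g)" by simp
      also have "nV \<dots> = 0"
        using l k that lV seminorm_onD(5)[OF W that]
        by (intro z) (auto simp: bounded_linear_maps_def intro!: seminorm_onD(6)[OF V])
      finally show ?thesis .
    qed
    have c: "nV ((l + k) (c *\<^sub>R h) - c *\<^sub>R (l + k) h) = 0" if "h \<in> W" for h c
    proof -
      have "(l + k) (c *\<^sub>R h) - c *\<^sub>R (l + k) h
          = (l (c *\<^sub>R h) - c *\<^sub>R l h) + (k (c *\<^sub>R h) - c *\<^sub>R k h)"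
        by (simp add: algebra_simps)
      also have "nV \<dots> = 0"
        using l k that lV seminorm_onD(7)[OF W that]
        by (intro z) (auto simp: bounded_linear_maps_def intro!: seminorm_onD(6,7)[OF V])
      finally show ?thesis .
    qed
    show "l + k \<in> ?B"
      unfolding bounded_linear_maps_def
      using lV le a c by (auto intro!: seminorm_onD(5)[OF V])
    show "?n (l + k) \<le> ?n l + ?n k"
      using operator_norm_nonneg[OF W V l] operator_norm_nonneg[OF W V k]
      by (intro operator_norm_least[OF W]) (use le in auto)
  qed
  have scale: "c *\<^sub>R l \<in> ?B" "?n (c *\<^sub>R l) \<le> \<bar>c\<bar> * ?n l" if l: "l \<in> ?B" for l c
  proof -
    have lV: "\<And>h. h \<in> W \<Longrightarrow> l h \<in> V"
      using l by (auto simp: bounded_linear_maps_def)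
    have le: "nV ((c *\<^sub>R l) h) \<le> (\<bar>c\<bar> * ?n l) * nW h" if "h \<in> W" for h
      using mult_left_mono[OF operator_norm_bound[OF W V l that], of "\<bar>c\<bar>"]
      by (simp add: seminorm_onD(4)[OF V lV[OF that]] algebra_simps)
    have a: "nV ((c *\<^sub>R l) (h + g) - (c *\<^sub>R l) h - (c *\<^sub>R l) g) = 0" if "h \<in> W" "g \<in> W" for h g
    proof -
      have "(c *\<^sub>R l) (h + g) - (c *\<^sub>R l) h - (c *\<^sub>R l) g = c *\<^sub>R (l (h + g) - l h - l g)"
        by (simp add: algebra_simps)
      also have "nV \<dots> = \<bar>c\<bar> * nV (l (h + g) - l h - l g)"
        using that lV seminorm_onD(5)[OF W that]
        by (intro seminorm_onD(4)[OF V] seminorm_onD(6)[OF V]) auto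
      also have "\<dots> = 0" using l that by (auto simp: bounded_linear_maps_def)
      finally show ?thesis .
    qed
    have d: "nV ((c *\<^sub>R l) (d *\<^sub>R h) - d *\<^sub>R (c *\<^sub>R l) h) = 0" if "h \<in> W" for h d
    proof -
      have "(c *\<^sub>R l) (d *\<^sub>R h) - d *\<^sub>R (c *\<^sub>R l) h = c *\<^sub>R (l (d *\<^sub>R h) - d *\<^sub>R l h)"
        by (simp add: algebra_simps)
      also have "nV \<dots> = \<bar>c\<bar> * nV (l (d *\<^sub>R h) - d *\<^sub>R l h)"
        using that lV seminorm_onD(7)[OF W that]
        by (intro seminorm_onD(4)[OF V] seminorm_onD(6)[OF V] seminorm_onD(7)[OF V]) auto
      also have "\<dots> = 0" using l that by (auto simp: bounded_linear_maps_def)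
      finally show ?thesis .
    qed
    show "c *\<^sub>R l \<in> ?B"
      unfolding bounded_linear_maps_def
      using lV le a d by (auto intro!: seminorm_onD(7)[OF V])
    show "?n (c *\<^sub>R l) \<le> \<bar>c\<bar> * ?n l"
      using operator_norm_nonneg[OF W V l] by (intro operator_norm_least[OF W]) (use le in auto)
  qed
  have zero: "(0 :: 'a \<Rightarrow> 'b) \<in> ?B"
    using seminorm_onD(8,9)[OF V] by (auto simp: bounded_linear_maps_def intro!: exI[of _ 0])
  have scale_eq: "?n (c *\<^sub>R l) = \<bar>c\<bar> * ?n l" if l: "l \<in> ?B" for l c
  proof (cases "c = 0")
    case True
    then show ?thesis
      using scale(2)[OF l, of 0] operator_norm_nonneg[OF W V scale(1)[OF l, of 0]] by simp
  next
    case False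
    have "?n ((1 / c) *\<^sub>R (c *\<^sub>R l)) \<le> \<bar>1 / c\<bar> * ?n (c *\<^sub>R l)"
      by (rule scale(2)[OF scale(1)[OF l]])
    then have "\<bar>c\<bar> * ?n l \<le> ?n (c *\<^sub>R l)" using False by (simp add: field_simps)
    then show ?thesis using scale(2)[OF l, of c] by simp
  qed
  show ?thesis
    unfolding seminorm_on_def subspace_def
    by (intro conjI ballI allI impI zero add scale(1) scale_eq operator_norm_nonneg[OF W V]) assumption+
qed

lemma seminorm_on_dual_space:
  assumes "seminorm_on W nW"
  shows "seminorm_on (dual_space W nW) (dual_norm W nW)"
  unfolding dual_space_def dual_norm_def
  by (rule seminorm_on_bounded_linear_maps[OF assms seminorm_on_abs])

lemma dual_norm_bound:
  assumes "seminorm_on W nW" "l \<in> dual_space W nW" "h \<in> W"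
  shows "\<bar>l h\<bar> \<le> dual_norm W nW l * nW h"
  using operator_norm_bound[OF assms(1) seminorm_on_abs] assms(2,3)
  by (simp add: dual_space_def dual_norm_def)

lemma dual_spaceD:
  assumes "l \<in> dual_space W nW"
  shows "h \<in> W \<Longrightarrow> k \<in> W \<Longrightarrow> l (h + k) = l h + l k"
    and "h \<in> W \<Longrightarrow> l (c *\<^sub>R h) = c * l h"
  using assms by (auto simp: dual_space_def bounded_linear_maps_def algebra_simps)


text \<open>A Frechet derivative is linear only up to null elements of its target space.  A scalar
  functional \<open>\<Lambda>\<close> bounded by the seminorm does not see these, so that composing with it gives a
  classical derivative.\<close>

lemma frechet_derivative_along_line:
  assumes W: "seminorm_on W nW" and V: "seminorm_on V nV"
    and D: "has_frechet_derivative_on G G' W nW V nV"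
    and v: "v \<in> W" and e: "e \<in> W"
    and add: "\<And>x y. x \<in> V \<Longrightarrow> y \<in> V \<Longrightarrow> \<Lambda> (x + y) = \<Lambda> x + \<Lambda> y"
    and scale: "\<And>x c. x \<in> V \<Longrightarrow> \<Lambda> (c *\<^sub>R x) = c * \<Lambda> x"
    and bound: "\<And>x. x \<in> V \<Longrightarrow> \<bar>\<Lambda> x\<bar> \<le> K * nV x"
  shows "((\<lambda>s. \<Lambda> (G (v + s *\<^sub>R e))) has_real_derivative \<Lambda> (G' (v + s *\<^sub>R e) e)) (at s)"
  unfolding has_field_derivative_def has_derivative_at_alt
proof (intro conjI allI impI)
  show "bounded_linear ((*) (\<Lambda> (G' (v + s *\<^sub>R e) e)))" by (rule bounded_linear_mult_right)
  fix \<epsilon> :: real assume \<epsilon>: "0 < \<epsilon>"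
  let ?w = "v + s *\<^sub>R e"
  have w: "?w \<in> W" using v e W by (auto intro: seminorm_onD)
  have diff: "\<Lambda> (x - y) = \<Lambda> x - \<Lambda> y" if "x \<in> V" "y \<in> V" for x y
    using add[OF seminorm_onD(6)[OF V that] that(2)] by simp
  (* The summands 1 cover the degenerate cases K = 0 and nW e = 0. *)
  define \<epsilon>' where "\<epsilon>' = \<epsilon> / ((\<bar>K\<bar> + 1) * (nW e + 1))"
  have ne: "0 \<le> nW e" using W e by (rule seminorm_onD)
  have \<epsilon>': "0 < \<epsilon>'" using \<epsilon> ne by (simp add: \<epsilon>'_def)
  obtain d where d: "0 < d" "\<And>h. h \<in> W \<Longrightarrow> nW h < d \<Longrightarrow>
      nV (G (?w + h) - G ?w - G' ?w h) \<le> \<epsilon>' * nW h"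
    using D w \<epsilon>' unfolding has_frechet_derivative_on_def by blast
  have GV: "G x \<in> V" if "x \<in> W" for x using D that unfolding has_frechet_derivative_on_def by blast
  have lin: "G' ?w \<in> bounded_linear_maps W nW V nV"
    using D w unfolding has_frechet_derivative_on_def by blast
  have G'V: "G' ?w h \<in> V" if "h \<in> W" for h
    using lin that by (auto simp: bounded_linear_maps_def)
  show "\<exists>d>0. \<forall>y. norm (y - s) < d \<longrightarrow>
      norm (\<Lambda> (G (v + y *\<^sub>R e)) - \<Lambda> (G ?w) - \<Lambda> (G' ?w e) * (y - s)) \<le> \<epsilon> * norm (y - s)"
  proof (intro exI[of _ "d / (nW e + 1)"] conjI allI impI)
    show "0 < d / (nW e + 1)" using d ne by simp
    fix y assume y: "norm (y - s) < d / (nW e + 1)"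
    let ?h = "(y - s) *\<^sub>R e"
    have h: "?h \<in> W" using e by (intro seminorm_onD(7)[OF W])
    have nh: "nW ?h = \<bar>y - s\<bar> * nW e" using e by (rule seminorm_onD(4)[OF W])
    have "\<bar>y - s\<bar> * nW e \<le> \<bar>y - s\<bar> * (nW e + 1)" by (intro mult_left_mono) auto
    also have "\<dots> < d" using y ne by (simp add: field_simps)
    finally have small: "nW ?h < d" using nh by simp
    let ?x = "G (?w + ?h) - G ?w - G' ?w ?h"
    have wh: "?w + ?h = v + y *\<^sub>R e" by (simp add: algebra_simps)
    have whW: "?w + ?h \<in> W" by (rule seminorm_onD(5)[OF W w h])
    have xV: "?x \<in> V" by (intro seminorm_onD(6)[OF V] GV G'V w h whW)
    have "\<Lambda> (G' ?w ?h - (y - s) *\<^sub>R G' ?w e) = 0"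
    proof -
      have "nV (G' ?w ?h - (y - s) *\<^sub>R G' ?w e) = 0"
        using lin e by (auto simp: bounded_linear_maps_def)
      moreover have "\<bar>\<Lambda> (G' ?w ?h - (y - s) *\<^sub>R G' ?w e)\<bar> \<le> K * nV (G' ?w ?h - (y - s) *\<^sub>R G' ?w e)"
        by (intro bound seminorm_onD(6)[OF V] seminorm_onD(7)[OF V] G'V h e)
      ultimately show ?thesis by simp
    qed
    then have hom: "\<Lambda> (G' ?w ?h) = (y - s) * \<Lambda> (G' ?w e)"
      using diff[OF G'V[OF h] seminorm_onD(7)[OF V G'V[OF e]]] scale[OF G'V[OF e]] by simp
    have "\<bar>\<Lambda> ?x\<bar> \<le> K * nV ?x" by (rule bound[OF xV])
    also have "\<dots> \<le> \<bar>K\<bar> * nV ?x" using seminorm_onD(2)[OF V xV] by (intro mult_right_mono) auto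
    also have "\<dots> \<le> \<bar>K\<bar> * (\<epsilon>' * nW ?h)" by (intro mult_left_mono d(2) h small) auto
    also have "\<dots> = (\<bar>K\<bar> * nW e) * (\<epsilon>' * \<bar>y - s\<bar>)" by (simp add: nh)
    also have "\<dots> \<le> ((\<bar>K\<bar> + 1) * (nW e + 1)) * (\<epsilon>' * \<bar>y - s\<bar>)"
      using ne \<epsilon>' by (intro mult_right_mono mult_mono) auto
    also have "\<dots> = \<epsilon> * \<bar>y - s\<bar>" using ne by (simp add: \<epsilon>'_def)
    finally have "\<bar>\<Lambda> ?x\<bar> \<le> \<epsilon> * \<bar>y - s\<bar>" .
    moreover have "\<Lambda> ?x = \<Lambda> (G (v + y *\<^sub>R e)) - \<Lambda> (G ?w) - \<Lambda> (G' ?w e) * (y - s)"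
    proof -
      have "\<Lambda> ?x = \<Lambda> (G (?w + ?h) - G ?w) - \<Lambda> (G' ?w ?h)"
        by (intro diff seminorm_onD(6)[OF V] GV G'V w h whW)
      also have "\<Lambda> (G (?w + ?h) - G ?w) = \<Lambda> (G (?w + ?h)) - \<Lambda> (G ?w)"
        by (intro diff GV w whW)
      finally show ?thesis by (simp only: wh hom mult.commute)
    qed
    ultimately show "norm (\<Lambda> (G (v + y *\<^sub>R e)) - \<Lambda> (G ?w) - \<Lambda> (G' ?w e) * (y - s)) \<le> \<epsilon> * norm (y - s)"
      by simp
  qed
qed

text \<open>The integrand of the Peano remainder has the antiderivative
  $f''(s)\,s(s-1) - f'(s)(2s-1) + 2f(s)$, and the fundamental theorem of calculus for the gauge
  integral applies to an arbitrary derivative.\<close>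

lemma trapezoidal_rule_remainder:
  fixes f f1 f2 f3 :: "real \<Rightarrow> real"
  assumes "\<And>s. (f has_real_derivative f1 s) (at s)"
    and "\<And>s. (f1 has_real_derivative f2 s) (at s)"
    and "\<And>s. (f2 has_real_derivative f3 s) (at s)"
  shows "f 1 - f 0 = 1/2 * (f1 0 + f1 1) + 1/2 * integral {0..1} (\<lambda>s. f3 s * s * (s - 1))"
proof -
  let ?g = "\<lambda>s. f2 s * (s * (s - 1)) - f1 s * (2 * s - 1) + 2 * f s"
  have "(?g has_real_derivative f3 s * s * (s - 1)) (at s within {0..1})" for s
    by (rule has_field_derivative_at_within)
      (auto intro!: derivative_eq_intros assms simp: algebra_simps)
  then have "((\<lambda>s. f3 s * s * (s - 1)) has_integral (?g 1 - ?g 0)) {0..1}"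
    by (intro fundamental_theorem_of_calculus) (auto simp: has_real_derivative_iff_has_vector_derivative)
  then have "integral {0..1} (\<lambda>s. f3 s * s * (s - 1)) = ?g 1 - ?g 0" by (rule integral_unique)
  then show ?thesis by (simp add: field_simps)
qed

lemma trapezoidal_rule_functional:
  assumes W: "seminorm_on W nW" and v: "v \<in> W" and e: "e \<in> W"
    and J1: "has_frechet_derivative_on J J1 W nW UNIV abs"
    and J2: "has_frechet_derivative_on J1 J2 W nW (dual_space W nW) (dual_norm W nW)"
    and J3: "has_frechet_derivative_on J2 J3 W nW
      (bounded_linear_maps W nW (dual_space W nW) (dual_norm W nW))
      (operator_norm W nW (dual_norm W nW))"
  shows "J (v + e) - J v = 1/2 * (J1 v e + J1 (v + e) e)
    + 1/2 * integral {0..1} (\<lambda>s. J3 (v + s *\<^sub>R e) e e e * s * (s - 1))"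
proof -
  let ?W1 = "dual_space W nW" and ?n1 = "dual_norm W nW"
  let ?W2 = "bounded_linear_maps W nW ?W1 ?n1" and ?n2 = "operator_norm W nW ?n1"
  have W1: "seminorm_on ?W1 ?n1" by (rule seminorm_on_dual_space[OF W])
  have W2: "seminorm_on ?W2 ?n2" by (rule seminorm_on_bounded_linear_maps[OF W W1])
  have ne: "0 \<le> nW e" using W e by (rule seminorm_onD)
  have "((\<lambda>s. J (v + s *\<^sub>R e)) has_real_derivative J1 (v + s *\<^sub>R e) e) (at s)" for s
    by (rule frechet_derivative_along_line[OF W seminorm_on_abs J1 v e, where \<Lambda> = "\<lambda>x. x" and K = 1]) auto
  moreover have "((\<lambda>s. J1 (v + s *\<^sub>R e) e) has_real_derivative J2 (v + s *\<^sub>R e) e e) (at s)" for s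
    by (rule frechet_derivative_along_line[OF W W1 J2 v e, where \<Lambda> = "\<lambda>l. l e" and K = "nW e"])
      (use dual_norm_bound[OF W _ e] in \<open>auto simp: mult.commute\<close>)
  moreover have "((\<lambda>s. J2 (v + s *\<^sub>R e) e e) has_real_derivative J3 (v + s *\<^sub>R e) e e e) (at s)" for s
  proof (rule frechet_derivative_along_line[OF W W2 J3 v e, where \<Lambda> = "\<lambda>l. l e e" and K = "nW e * nW e"])
    fix l assume l: "l \<in> ?W2"
    then have "l e \<in> ?W1" using e by (auto simp: bounded_linear_maps_def)
    then have "\<bar>l e e\<bar> \<le> ?n1 (l e) * nW e" by (rule dual_norm_bound[OF W _ e])
    also have "\<dots> \<le> ?n2 l * nW e * nW e"
      by (intro mult_right_mono operator_norm_bound[OF W W1 l e] ne)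
    finally show "\<bar>l e e\<bar> \<le> nW e * nW e * ?n2 l" by (simp add: mult_ac)
  qed auto
  ultimately show ?thesis
    using trapezoidal_rule_remainder[of "\<lambda>s. J (v + s *\<^sub>R e)" "\<lambda>s. J1 (v + s *\<^sub>R e) e"
      "\<lambda>s. J2 (v + s *\<^sub>R e) e e" "\<lambda>s. J3 (v + s *\<^sub>R e) e e e"] by simp
qed

section \<open>Smooth functions and cut-offs\<close>

definition smooth :: "('a::euclidean_space \<Rightarrow> real) \<Rightarrow> bool"
  where "smooth f \<longleftrightarrow> (\<forall>n. C_k n f)"

lemma C_k_continuous: "C_k n f \<Longrightarrow> continuous_on UNIV f"
proof (cases n)
  case (Suc m)
  assume "C_k n f"
  then have "\<And>x. f differentiable (at x)" using Suc by simp
  then show ?thesis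
    by (intro continuous_at_imp_continuous_on ballI differentiable_imp_continuous_within)
qed simp

lemma C_k_mono: "C_k (Suc n) f \<Longrightarrow> C_k n f"
proof (induction n arbitrary: f)
  case 0
  then show ?case using C_k_continuous[of 1 f] by simp
qed auto

lemma C_k_const: "C_k n (\<lambda>x. c)"
  by (induction n arbitrary: c) auto

lemma frechet_derivative_add_apply:
  assumes "f differentiable (at x)" "g differentiable (at x)"
  shows "frechet_derivative (\<lambda>x. f x + g x) (at x) i
    = frechet_derivative f (at x) i + frechet_derivative g (at x) i"
  using frechet_derivative_at[OF has_derivative_add[OF assms[unfolded frechet_derivative_works]]]
  by (metis)

lemma frechet_derivative_mult_apply:
  fixes f g :: "'a::euclidean_space \<Rightarrow> real"
  assumes "f differentiable (at x)" "g differentiable (at x)"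
  shows "frechet_derivative (\<lambda>x. f x * g x) (at x) i
    = f x * frechet_derivative g (at x) i + frechet_derivative f (at x) i * g x"
  using frechet_derivative_at[OF has_derivative_mult[OF assms[unfolded frechet_derivative_works]]]
  by (metis)

lemma C_k_add: "C_k n f \<Longrightarrow> C_k n g \<Longrightarrow> C_k n (\<lambda>x. f x + g x)"
  by (induction n arbitrary: f g)
    (auto simp: frechet_derivative_add_apply intro: continuous_on_add)

lemma C_k_mult: "C_k n f \<Longrightarrow> C_k n g \<Longrightarrow> C_k n (\<lambda>x. f x * g x)"
proof (induction n arbitrary: f g)
  case 0
  then show ?case by (auto intro: continuous_on_mult)
next
  case (Suc n)
  then have "C_k n f" "C_k n g" by (blast intro: C_k_mono)+
  with Suc show ?case
    by (auto simp: frechet_derivative_mult_apply intro!: C_k_add)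
qed

lemma C_k_inner: "C_k n (\<lambda>x. x \<bullet> i)"
proof (cases n)
  case (Suc m)
  have D: "((\<lambda>x. x \<bullet> i) has_derivative (\<lambda>h. h \<bullet> i)) (at x)" for x :: 'a
    by (auto intro!: derivative_eq_intros)
  have "(\<lambda>x. x \<bullet> i) differentiable (at x)" for x :: 'a
    using D unfolding differentiable_def by blast
  moreover have "frechet_derivative (\<lambda>x. x \<bullet> i) (at x) = (\<lambda>h. h \<bullet> i)" for x :: 'a
    using frechet_derivative_at[OF D] by simp
  ultimately show ?thesis using Suc by (auto simp: C_k_const)
qed (auto intro: continuous_intros)

lemma C_k_compose: "C_k n g \<Longrightarrow> C_k n f \<Longrightarrow> C_k n (\<lambda>x. g (f x :: real))"
proof (induction n arbitrary: f g)
  case 0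
  then show ?case
    by (auto intro: continuous_on_compose2)
next
  case (Suc n)
  have dg: "g differentiable (at y)" for y using Suc.prems by simp
  have df: "f differentiable (at x)" for x using Suc.prems by simp
  have D: "((\<lambda>x. g (f x)) has_derivative
      (\<lambda>h. frechet_derivative g (at (f x)) (frechet_derivative f (at x) h))) (at x)" for x
    by (rule has_derivative_compose[OF df[unfolded frechet_derivative_works] dg[unfolded frechet_derivative_works]])
  have lin: "frechet_derivative g (at y) c = frechet_derivative g (at y) 1 * c" for y c
    using linear_scale[OF linear_frechet_derivative[OF dg[of y]], of c 1] by simp
  have "frechet_derivative (\<lambda>x. g (f x)) (at x) i
      = frechet_derivative g (at (f x)) 1 * frechet_derivative f (at x) i" for x i
    by (rule trans[OF fun_cong[OF frechet_derivative_at[OF D, symmetric]] lin])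
  moreover have "C_k n (\<lambda>x. frechet_derivative g (at (f x)) 1)"
    using Suc.prems by (intro Suc.IH[of "\<lambda>y. frechet_derivative g (at y) 1"]) (auto intro: C_k_mono)
  ultimately show ?case
    using D Suc.prems by (auto simp: differentiable_def intro!: C_k_mult)
qed

lemma C_k_real_derivative:
  assumes "\<And>x. (f has_real_derivative f' x) (at x)" "C_k n f'"
  shows "C_k (Suc n) f"
proof -
  have "frechet_derivative f (at x) 1 = f' x" for x
    using frechet_derivative_at[OF assms(1)[unfolded has_field_derivative_def], symmetric] by simp
  then show ?thesis using assms by (auto simp: field_differentiable_imp_differentiable differentiable_def
      has_field_derivative_def)
qed

lemma smooth_const [intro, simp]: "smooth (\<lambda>x. c)"
  and smooth_inner [intro, simp]: "smooth (\<lambda>x. x \<bullet> i)"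
  and smooth_add [intro]: "smooth f \<Longrightarrow> smooth g \<Longrightarrow> smooth (\<lambda>x. f x + g x)"
  and smooth_mult [intro]: "smooth f \<Longrightarrow> smooth g \<Longrightarrow> smooth (\<lambda>x. f x * g x)"
  and smooth_compose: "smooth h \<Longrightarrow> smooth f \<Longrightarrow> smooth (\<lambda>x. h (f x))"
  by (auto simp: smooth_def C_k_const C_k_inner C_k_add C_k_mult C_k_compose)

lemma smooth_ident [intro, simp]: "smooth (\<lambda>x::real. x)"
  using smooth_inner[of "1::real"] by simp

lemma smooth_diff [intro]: "smooth f \<Longrightarrow> smooth g \<Longrightarrow> smooth (\<lambda>x. f x - g x)"
  using smooth_add[of f "\<lambda>x. - 1 * g x"] smooth_mult[of "\<lambda>x. - 1" g] by simp

lemma smooth_power [intro]: "smooth f \<Longrightarrow> smooth (\<lambda>x. f x ^ k)"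
  by (induction k) auto

lemma smooth_prod: "finite I \<Longrightarrow> (\<And>i. i \<in> I \<Longrightarrow> smooth (f i)) \<Longrightarrow> smooth (\<lambda>x. \<Prod>i\<in>I. f i x)"
  by (induction rule: finite_induct) auto

lemma smooth_differentiable: "smooth f \<Longrightarrow> f differentiable (at x)"
  using C_k.simps(2) unfolding smooth_def by blast

lemma smooth_continuous: "smooth f \<Longrightarrow> continuous_on S f"
  unfolding smooth_def using C_k_continuous continuous_on_subset by blast

lemma smooth_partial: "smooth f \<Longrightarrow> i \<in> Basis \<Longrightarrow> smooth (\<lambda>x. frechet_derivative f (at x) i)"
  unfolding smooth_def by (metis C_k.simps(2))

lemma smooth_real_derivative:
  fixes f :: "real \<Rightarrow> real"
  assumes "smooth f"
  shows "(f has_real_derivative deriv f x) (at x)"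
  using smooth_differentiable[OF assms, of x]
  by (simp add: DERIV_deriv_iff_real_differentiable)

lemma smooth_deriv:
  fixes f :: "real \<Rightarrow> real"
  assumes "smooth f"
  shows "smooth (deriv f)"
proof -
  have "frechet_derivative f (at x) 1 = deriv f x" for x
    using frechet_derivative_at[OF smooth_real_derivative[OF assms, unfolded has_field_derivative_def], symmetric]
    by simp
  then show ?thesis using smooth_partial[OF assms, of 1] by simp
qed

lemma smooth_realI:
  assumes "\<And>x. (f has_real_derivative f' x) (at x)" "smooth f'"
  shows "smooth f"
  unfolding smooth_def
proof
  fix n
  show "C_k n f"
    using C_k_real_derivative[OF assms(1)] assms(2) C_k_mono unfolding smooth_def by blast
qed

text \<open>The functions $x^{-k} e^{-1/x}$, extended by zero to $x \le 0$.  They are closed under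
  differentiation up to linear combinations, hence smooth.\<close>

definition flat_exp :: "nat \<Rightarrow> real \<Rightarrow> real"
  where "flat_exp k x = (if x \<le> 0 then 0 else exp (- (1 / x)) / x ^ k)"

lemma flat_exp_tendsto_0: "(flat_exp k \<longlongrightarrow> 0) (at 0)"
proof (subst filterlim_at_split, intro conjI)
  show "(flat_exp k \<longlongrightarrow> 0) (at_left 0)"
    by (rule tendsto_eventually) (auto simp: eventually_at_filter flat_exp_def)
  have "((\<lambda>x. inverse x ^ k / exp (inverse x)) \<longlongrightarrow> (0::real)) (at_right 0)"
    by (rule filterlim_compose[OF tendsto_power_div_exp_0 filterlim_inverse_at_top_right])
  then show "(flat_exp k \<longlongrightarrow> 0) (at_right 0)"
    by (rule Lim_transform_eventually)
      (auto simp: eventually_at_filter flat_exp_def exp_minus field_simps)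
qed

lemma flat_exp_derivative:
  "(flat_exp k has_real_derivative - real k * flat_exp (Suc k) x + flat_exp (Suc (Suc k)) x) (at x)"
proof -
  consider "x < 0" | "x = 0" | "0 < x" by linarith
  then show ?thesis
  proof cases
    case 1
    have "((\<lambda>x. 0) has_real_derivative 0) (at x)" by simp
    then have "(flat_exp k has_real_derivative 0) (at x)"
      by (rule has_field_derivative_transform_within_open[of _ _ _ "{..<0}"])
        (use 1 in \<open>auto simp: flat_exp_def\<close>)
    then show ?thesis using 1 by (simp add: flat_exp_def)
  next
    case 2
    have "((\<lambda>h. (flat_exp k (0 + h) - flat_exp k 0) / h) \<longlongrightarrow> 0) (at 0)"
      by (rule Lim_transform_eventually[OF flat_exp_tendsto_0[of "Suc k"]])
        (auto simp: eventually_at_filter flat_exp_def field_simps)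
    then show ?thesis using 2 by (simp add: DERIV_def flat_exp_def)
  next
    case 3
    have "((\<lambda>x. exp (- (1 / x))) has_real_derivative exp (- (1 / x)) / x\<^sup>2) (at x)"
      using 3 by (auto intro!: derivative_eq_intros simp: power2_eq_square)
    moreover have "((\<lambda>x. x ^ k) has_real_derivative real k * x ^ (k - 1)) (at x)"
      by (auto intro!: derivative_eq_intros)
    ultimately have "((\<lambda>x. exp (- (1 / x)) / x ^ k) has_real_derivative
        (exp (- (1 / x)) / x\<^sup>2 * x ^ k - exp (- (1 / x)) * (real k * x ^ (k - 1))) / (x ^ k * x ^ k)) (at x)"
      using 3 by (intro DERIV_divide) auto
    also have "(exp (- (1 / x)) / x\<^sup>2 * x ^ k - exp (- (1 / x)) * (real k * x ^ (k - 1))) / (x ^ k * x ^ k)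
        = - real k * flat_exp (Suc k) x + flat_exp (Suc (Suc k)) x"
      using 3 by (cases k) (auto simp: flat_exp_def field_simps power2_eq_square)
    finally have "((\<lambda>x. exp (- (1 / x)) / x ^ k) has_real_derivative
        - real k * flat_exp (Suc k) x + flat_exp (Suc (Suc k)) x) (at x)" .
    then show ?thesis
      by (rule has_field_derivative_transform_within_open[of _ _ _ "{0<..}"])
        (use 3 in \<open>auto simp: flat_exp_def\<close>)
  qed
qed

lemma smooth_flat_exp: "smooth (flat_exp k)"
  unfolding smooth_def
proof
  fix n show "C_k n (flat_exp k)"
  proof (induction n arbitrary: k)
    case 0
    have "isCont (flat_exp k) x" for x
      using flat_exp_derivative by (rule DERIV_isCont)
    then show ?case by (simp add: continuous_at_imp_continuous_on)
  next
    case (Suc n)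
    show ?case
      by (rule C_k_real_derivative[OF flat_exp_derivative]) (intro C_k_add C_k_mult C_k_const Suc)
  qed
qed

text \<open>The cut-off is flat up to 1 and constant from 2 on, so that \<open>step (n * x)\<close> vanishes in a
  neighbourhood of $\{x \le 0\}$ and converges to the indicator of $\{x > 0\}$.\<close>

definition is_smooth_step :: "(real \<Rightarrow> real) \<Rightarrow> bool"
  where "is_smooth_step \<Phi> \<longleftrightarrow> smooth \<Phi> \<and>
    (\<forall>x\<le>1. \<Phi> x = 0) \<and> (\<forall>x\<ge>2. \<Phi> x = 1) \<and> (\<forall>x. 0 \<le> \<Phi> x \<and> \<Phi> x \<le> 1) \<and>
    (\<forall>x. 0 \<le> deriv \<Phi> x)"

text \<open>The normalized antiderivative of the bump $e^{-1/(x-1)} e^{-1/(2-x)}$ on $(1,2)$.\<close>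

lemma smooth_step_exists: "\<exists>\<Phi>. is_smooth_step \<Phi>"
proof -
  define b :: "real \<Rightarrow> real" where "b x = flat_exp 0 (x - 1) * flat_exp 0 (2 - x)" for x
  have sb: "smooth b"
    unfolding b_def[abs_def] by (intro smooth_mult smooth_compose[OF smooth_flat_exp]) auto
  have b0: "b x = 0" if "x \<le> 1 \<or> 2 \<le> x" for x using that by (auto simp: b_def flat_exp_def)
  have bpos: "0 \<le> b x" for x by (auto simp: b_def flat_exp_def)
  have bcont: "continuous_on S b" for S by (rule smooth_continuous[OF sb])
  have bint: "b integrable_on {x..y}" for x y by (rule integrable_continuous_interval[OF bcont])
  define F where "F x = integral {1..x} b" for x
  have F_eq: "F x = integral {a..x} b" if "a \<le> 1" for a x
  proof (cases "1 \<le> x")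
    case True
    have "integral {a..1} b = integral {a..1} (\<lambda>x. 0)" by (rule integral_cong) (use b0 in auto)
    then show ?thesis
      using Henstock_Kurzweil_Integration.integral_combine[OF that True bint] by (simp add: F_def)
  next
    case False
    have "integral {a..x} b = integral {a..x} (\<lambda>x. 0)" by (rule integral_cong) (use b0 False in auto)
    then show ?thesis using False by (simp add: F_def)
  qed
  have Fd: "(F has_real_derivative b x) (at x)" for x
  proof -
    let ?a = "min x 1 - 1"
    have "((\<lambda>y. integral {?a..y} b) has_real_derivative b x) (at x within {?a..x + 1})"
      by (rule integral_has_real_derivative[OF bcont]) auto
    then have "((\<lambda>y. integral {?a..y} b) has_real_derivative b x) (at x)"
      by (simp add: at_within_Icc_at)
    moreover have "(\<lambda>y. integral {?a..y} b) = F" using F_eq[of ?a] by auto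
    ultimately show ?thesis by simp
  qed
  have F0: "F x = 0" if "x \<le> 1" for x
  proof -
    have "integral {x..x} b = F x" by (rule F_eq[symmetric, OF that])
    then show ?thesis by simp
  qed
  have mono: "F x \<le> F y" if "x \<le> y" for x y
    by (rule DERIV_nonneg_imp_nondecreasing[OF that]) (use Fd bpos in blast)
  have F2: "F x = F 2" if "2 \<le> x" for x
  proof -
    have "F x = F 2 + integral {2..x} b"
      using Henstock_Kurzweil_Integration.integral_combine[of 1 2 x b] that bint by (simp add: F_def)
    also have "integral {2..x} b = integral {2..x} (\<lambda>x. 0)" by (rule integral_cong) (use b0 in auto)
    finally show ?thesis by simp
  qed
  have Fpos: "0 < F 2"
  proof -
    have "F 1 < F 2"
    proof (rule DERIV_pos_imp_increasing_open[of 1 2 F])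
      show "\<exists>y. (F has_real_derivative y) (at x) \<and> y > 0" if "1 < x" "x < 2" for x :: real
      proof -
        have "0 < b x" using that by (simp add: b_def flat_exp_def)
        then show ?thesis using Fd by blast
      qed
      show "continuous_on {1..2} F"
        by (intro continuous_at_imp_continuous_on ballI DERIV_isCont[OF Fd])
    qed simp
    then show ?thesis using F0 by simp
  qed
  let ?\<Phi> = "\<lambda>x. (1 / F 2) * F x"
  have "smooth ?\<Phi>" using smooth_realI[OF Fd sb] by (intro smooth_mult) auto
  moreover have "\<forall>x. 0 \<le> ?\<Phi> x \<and> ?\<Phi> x \<le> 1"
  proof
    fix x
    have "0 \<le> F x" using mono[of "min x 1" x] F0 by simp
    moreover have "F x \<le> F 2" using mono[of x "max x 2"] F2[of "max x 2"] by simp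
    ultimately show "0 \<le> ?\<Phi> x \<and> ?\<Phi> x \<le> 1" using Fpos by simp
  qed
  moreover have "\<forall>x\<le>1. ?\<Phi> x = 0" using F0 by simp
  moreover have "\<forall>x\<ge>2. ?\<Phi> x = 1"
  proof (intro allI impI)
    fix x :: real assume "2 \<le> x"
    then have "F x = F 2" by (rule F2)
    then show "?\<Phi> x = 1" using Fpos by simp
  qed
  moreover have "\<forall>x. 0 \<le> deriv ?\<Phi> x"
  proof
    fix x
    have "(?\<Phi> has_real_derivative 1 / F 2 * b x) (at x)" by (rule DERIV_cmult[OF Fd])
    then have "deriv ?\<Phi> x = 1 / F 2 * b x" by (rule DERIV_imp_deriv)
    then show "0 \<le> deriv ?\<Phi> x" using Fpos bpos[of x] by simp
  qed
  ultimately have "is_smooth_step ?\<Phi>" unfolding is_smooth_step_def by (intro conjI)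
  then show ?thesis by (rule exI[of is_smooth_step ?\<Phi>])
qed

definition step :: "real \<Rightarrow> real"
  where "step = (SOME \<Phi>. is_smooth_step \<Phi>)"

lemma step_properties: "is_smooth_step step"
  unfolding step_def by (rule someI_ex[OF smooth_step_exists])

lemma smooth_step: "smooth step"
  using step_properties by (simp add: is_smooth_step_def)

lemma step_0: "x \<le> 1 \<Longrightarrow> step x = 0"
  using step_properties by (simp add: is_smooth_step_def)

lemma step_1: "2 \<le> x \<Longrightarrow> step x = 1"
  using step_properties by (simp add: is_smooth_step_def)

lemma step_ge_0: "0 \<le> step x"
  using step_properties by (simp add: is_smooth_step_def)

lemma step_le_1: "step x \<le> 1"
  using step_properties by (simp add: is_smooth_step_def)

lemma deriv_step_ge_0: "0 \<le> deriv step x"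
  using step_properties by (simp add: is_smooth_step_def)

lemma step_scaled_tendsto:
  "(\<lambda>n. step (real n * x)) \<longlonglongrightarrow> (if 0 < x then 1 else 0)"
proof (cases "0 < x")
  case True
  have "eventually (\<lambda>n. 2 / x \<le> real n) sequentially"
    by (rule eventually_sequentiallyI[of "nat \<lceil>2 / x\<rceil>"]) linarith
  then have "eventually (\<lambda>n. step (real n * x) = 1) sequentially"
    by eventually_elim (use True in \<open>auto intro!: step_1 simp: field_simps\<close>)
  then show ?thesis using True by (auto intro: tendsto_eventually)
next
  case False
  then have "step (real n * x) = 0" for n
    by (intro step_0) (simp add: mult_nonneg_nonpos order_trans[of _ 0])
  then show ?thesis using False by simp
qed

section \<open>Test functions and the du Bois-Reymond lemma\<close>

lemma test_functionsI:
  assumes "smooth \<phi>" "compact K" "K \<subseteq> D" "\<And>x. x \<notin> K \<Longrightarrow> \<phi> x = 0"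
  shows "\<phi> \<in> test_functions D"
proof -
  have "{x. \<phi> x \<noteq> 0} \<subseteq> K" using assms(4) by blast
  then have "closure {x. \<phi> x \<noteq> 0} \<subseteq> K"
    using assms(2) by (intro closure_minimal compact_imp_closed)
  moreover from this have "compact (closure {x. \<phi> x \<noteq> 0})"
    using assms(2) by (metis closed_closure compact_Int_closed inf.absorb_iff2)
  ultimately show ?thesis
    using assms(1,3) unfolding test_functions_def smooth_def by auto
qed

lemma test_functionsD:
  assumes "\<phi> \<in> test_functions D"
  shows "smooth \<phi>" and "compact (closure {x. \<phi> x \<noteq> 0})" and "closure {x. \<phi> x \<noteq> 0} \<subseteq> D"
    and "x \<notin> closure {x. \<phi> x \<noteq> 0} \<Longrightarrow> \<phi> x = 0" and "x \<notin> D \<Longrightarrow> \<phi> x = 0"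
proof -
  show s: "smooth \<phi>" "compact (closure {x. \<phi> x \<noteq> 0})" "closure {x. \<phi> x \<noteq> 0} \<subseteq> D"
    using assms unfolding test_functions_def smooth_def by auto
  have c: "{x. \<phi> x \<noteq> 0} \<subseteq> closure {x. \<phi> x \<noteq> 0}" by (rule closure_subset)
  show "x \<notin> closure {x. \<phi> x \<noteq> 0} \<Longrightarrow> \<phi> x = 0" using c by auto
  show "x \<notin> D \<Longrightarrow> \<phi> x = 0" using c s(3) by auto
qed

lemma test_functions_mono: "D \<subseteq> D' \<Longrightarrow> test_functions D \<subseteq> test_functions D'"
  unfolding test_functions_def by auto

lemma test_functions_smooth_mult:
  assumes "smooth f" "\<phi> \<in> test_functions D"
  shows "(\<lambda>x. f x * \<phi> x) \<in> test_functions D"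
proof (rule test_functionsI[OF _ test_functionsD(2,3)[OF assms(2)]])
  show "smooth (\<lambda>x. f x * \<phi> x)"
    by (rule smooth_mult[OF assms(1) test_functionsD(1)[OF assms(2)]])
  fix x assume "x \<notin> closure {x. \<phi> x \<noteq> 0}"
  then have "\<phi> x = 0" by (rule test_functionsD(4)[OF assms(2)])
  then show "f x * \<phi> x = 0" by simp
qed

lemma test_functions_add:
  assumes "\<phi> \<in> test_functions D" "\<psi> \<in> test_functions D"
  shows "\<phi> + \<psi> \<in> test_functions D"
proof (rule test_functionsI[OF _ compact_Un[OF test_functionsD(2)[OF assms(1)] test_functionsD(2)[OF assms(2)]]])
  show "smooth (\<phi> + \<psi>)"
    unfolding plus_fun_def by (intro smooth_add test_functionsD(1)[OF assms(1)] test_functionsD(1)[OF assms(2)])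
  show "closure {x. \<phi> x \<noteq> 0} \<union> closure {x. \<psi> x \<noteq> 0} \<subseteq> D"
    by (intro Un_least test_functionsD(3)[OF assms(1)] test_functionsD(3)[OF assms(2)])
  fix x assume "x \<notin> closure {x. \<phi> x \<noteq> 0} \<union> closure {x. \<psi> x \<noteq> 0}"
  then have "\<phi> x = 0" "\<psi> x = 0"
    by (intro test_functionsD(4)[OF assms(1)] test_functionsD(4)[OF assms(2)]; simp)+
  then show "(\<phi> + \<psi>) x = 0" by simp
qed

lemma test_functions_scale:
  assumes "\<phi> \<in> test_functions D"
  shows "c *\<^sub>R \<phi> \<in> test_functions D"
  using test_functions_smooth_mult[OF smooth_const assms, of c] by (simp add: scaleR_fun_def)

lemma test_functions_partial:
  assumes "\<phi> \<in> test_functions D" "i \<in> Basis"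
  shows "(\<lambda>x. frechet_derivative \<phi> (at x) i) \<in> test_functions D"
proof (rule test_functionsI[OF _ test_functionsD(2,3)[OF assms(1)]])
  show "smooth (\<lambda>x. frechet_derivative \<phi> (at x) i)"
    by (rule smooth_partial[OF test_functionsD(1)[OF assms(1)] assms(2)])
  fix x assume x: "x \<notin> closure {x. \<phi> x \<noteq> 0}"
  have "(\<phi> has_derivative (\<lambda>h. 0)) (at x)"
  proof (rule has_derivative_transform_within_open[OF _ open_Compl[OF closed_closure]])
    show "((\<lambda>x. 0 :: real) has_derivative (\<lambda>h. 0)) (at x)" by simp
    show "x \<in> - closure {x. \<phi> x \<noteq> 0}" using x by simp
    show "0 = \<phi> y" if "y \<in> - closure {x. \<phi> x \<noteq> 0}" for y
      using test_functionsD(4)[OF assms(1), of y] that by simp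
  qed
  then show "frechet_derivative \<phi> (at x) i = 0"
    by (metis frechet_derivative_at)
qed

lemma continuous_compact_support_bounded:
  fixes f :: "'a::euclidean_space \<Rightarrow> real"
  assumes "continuous_on UNIV f" "compact K" "\<And>x. x \<notin> K \<Longrightarrow> f x = 0"
  obtains B where "0 \<le> B" "\<And>x. \<bar>f x\<bar> \<le> B"
proof -
  have "bounded (f ` K)"
    using assms by (intro compact_imp_bounded compact_continuous_image) (auto intro: continuous_on_subset)
  then obtain B where B: "0 < B" "\<And>x. x \<in> K \<Longrightarrow> \<bar>f x\<bar> \<le> B"
    unfolding bounded_pos by auto
  then have "\<bar>f x\<bar> \<le> B" for x using assms(3) by (cases "x \<in> K") auto
  with B(1) show thesis by (intro that[of B]) auto
qed

lemma test_functions_bounded: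
  assumes "\<phi> \<in> test_functions D"
  obtains B where "0 \<le> B" "\<And>x. \<bar>\<phi> x\<bar> \<le> B"
  by (rule continuous_compact_support_bounded[OF smooth_continuous[OF test_functionsD(1)[OF assms]]
    test_functionsD(2)[OF assms] test_functionsD(4)[OF assms]]) (assumption | rule that)+

lemma smooth_measurable: "smooth f \<Longrightarrow> f \<in> borel_measurable borel"
  by (intro borel_measurable_continuous_onI smooth_continuous)

lemma smooth_measurable_lebesgue_on:
  assumes "smooth f"
  shows "f \<in> borel_measurable (lebesgue_on D)"
proof (rule measurable_restrict_space1)
  have "f \<in> borel_measurable lborel" using smooth_measurable[OF assms] by simp
  then show "f \<in> borel_measurable lebesgue" by (rule measurable_completion)
qed

lemma box_bump_test_function:
  fixes a b :: "'a::euclidean_space"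
  assumes "cbox a b \<subseteq> D"
  shows "(\<lambda>x. \<Prod>i\<in>Basis. step (real n * (x \<bullet> i - a \<bullet> i)) * step (real n * (b \<bullet> i - x \<bullet> i)))
    \<in> test_functions D"
proof (rule test_functionsI[OF _ compact_cbox assms])
  show "smooth (\<lambda>x. \<Prod>i\<in>Basis. step (real n * (x \<bullet> i - a \<bullet> i)) * step (real n * (b \<bullet> i - x \<bullet> i)))"
    by (intro smooth_prod smooth_mult smooth_compose[OF smooth_step] smooth_diff smooth_const smooth_inner) simp
  fix x assume "x \<notin> cbox a b"
  then obtain i where i: "i \<in> Basis" "x \<bullet> i - a \<bullet> i < 0 \<or> b \<bullet> i - x \<bullet> i < 0"
    by (auto simp: mem_box not_le)
  have neg: "step (real n * y) = 0" if "y < 0" for y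
  proof (rule step_0)
    have "real n * y \<le> 0" using that by (intro mult_nonneg_nonpos) auto
    then show "real n * y \<le> 1" by linarith
  qed
  show "(\<Prod>i\<in>Basis. step (real n * (x \<bullet> i - a \<bullet> i)) * step (real n * (b \<bullet> i - x \<bullet> i))) = 0"
    using i neg by (intro prod_zero bexI[of _ i]) auto
qed

text \<open>Products of steepening cut-offs in all coordinates are test functions that converge boundedly
  to the indicator of the box.\<close>

lemma integral_indicator_box_eq_0:
  fixes f :: "'a::euclidean_space \<Rightarrow> 'b::euclidean_space"
  assumes f: "integrable (lebesgue_on D) f"
    and test: "\<And>\<phi>. \<phi> \<in> test_functions D \<Longrightarrow> (LINT x|lebesgue_on D. \<phi> x *\<^sub>R f x) = 0"
    and ab: "cbox a b \<subseteq> D"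
  shows "(LINT x|lebesgue_on D. indicator (box a b) x *\<^sub>R f x) = 0"
proof -
  define \<phi> where "\<phi> n x = (\<Prod>i\<in>Basis. step (real n * (x \<bullet> i - a \<bullet> i)) * step (real n * (b \<bullet> i - x \<bullet> i)))"
    for n and x :: 'a
  have \<phi>: "\<phi> n \<in> test_functions D" for n
    unfolding \<phi>_def[abs_def] by (rule box_bump_test_function[OF ab])
  have bound: "0 \<le> \<phi> n x" "\<phi> n x \<le> 1" for n x
    unfolding \<phi>_def
    by (auto intro!: prod_nonneg prod_le_1 mult_le_one simp: step_ge_0 step_le_1)
  have lim: "(\<lambda>n. \<phi> n x) \<longlonglongrightarrow> indicator (box a b) x" for x
  proof -
    have "(\<lambda>n. \<phi> n x) \<longlonglongrightarrow> (\<Prod>i\<in>Basis. (if 0 < x \<bullet> i - a \<bullet> i then 1 else 0) * (if 0 < b \<bullet> i - x \<bullet> i then 1 else 0))"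
      unfolding \<phi>_def by (intro tendsto_prod tendsto_mult step_scaled_tendsto)
    also have "(\<Prod>i\<in>Basis. (if 0 < x \<bullet> i - a \<bullet> i then 1 else 0) * (if 0 < b \<bullet> i - x \<bullet> i then 1 else 0::real))
        = indicator (box a b) x"
    proof (cases "x \<in> box a b")
      case True
      then have "(\<Prod>i\<in>Basis. (if 0 < x \<bullet> i - a \<bullet> i then 1 else 0) * (if 0 < b \<bullet> i - x \<bullet> i then 1 else 0::real)) = 1"
        by (intro prod.neutral) (auto simp: mem_box)
      then show ?thesis using True by simp
    next
      case False
      then obtain i where "i \<in> Basis" "\<not> 0 < x \<bullet> i - a \<bullet> i \<or> \<not> 0 < b \<bullet> i - x \<bullet> i"
        by (auto simp: mem_box)
      then have "(\<Prod>i\<in>Basis. (if 0 < x \<bullet> i - a \<bullet> i then 1 else 0) * (if 0 < b \<bullet> i - x \<bullet> i then 1 else 0::real)) = 0"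
        by (intro prod_zero) auto
      then show ?thesis using False by simp
    qed
    finally show ?thesis .
  qed
  have "(\<lambda>n. LINT x|lebesgue_on D. \<phi> n x *\<^sub>R f x) \<longlonglongrightarrow> (LINT x|lebesgue_on D. indicator (box a b) x *\<^sub>R f x)"
  proof (rule integral_dominated_convergence[where w = "\<lambda>x. norm (f x)"])
    show "(\<lambda>x. indicator (box a b) x *\<^sub>R f x) \<in> borel_measurable (lebesgue_on D)"
      by (rule borel_measurable_scaleR[OF measurable_restrict_space1[OF borel_measurable_indicator]
        borel_measurable_integrable[OF f]]) auto
    show "(\<lambda>x. \<phi> n x *\<^sub>R f x) \<in> borel_measurable (lebesgue_on D)" for n
      using f by (intro borel_measurable_scaleR smooth_measurable_lebesgue_on test_functionsD(1)[OF \<phi>]) auto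
    show "integrable (lebesgue_on D) (\<lambda>x. norm (f x))" using f by simp
    show "AE x in lebesgue_on D. (\<lambda>n. \<phi> n x *\<^sub>R f x) \<longlonglongrightarrow> indicator (box a b) x *\<^sub>R f x"
      by (intro always_eventually allI tendsto_scaleR lim tendsto_const)
    show "AE x in lebesgue_on D. norm (\<phi> n x *\<^sub>R f x) \<le> norm (f x)" for n
      by (intro always_eventually allI) (simp add: bound mult_left_le_one_le)
  qed
  moreover have "(LINT x|lebesgue_on D. \<phi> n x *\<^sub>R f x) = 0" for n by (rule test[OF \<phi>])
  ultimately show ?thesis by (simp add: LIMSEQ_const_iff)
qed

text \<open>On a box inside \<open>D\<close> the boxes are an intersection-stable generator of the Borel sets, so \<open>f\<close>
  has integral zero over all measurable subsets.  Countably many such boxes exhaust \<open>D\<close>.\<close>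

lemma du_Bois_Reymond:
  fixes f :: "'a::euclidean_space \<Rightarrow> 'b::euclidean_space"
  assumes D: "open D" and f: "integrable (lebesgue_on D) f"
    and test: "\<And>\<phi>. \<phi> \<in> test_functions D \<Longrightarrow> (LINT x|lebesgue_on D. \<phi> x *\<^sub>R f x) = 0"
  shows "AE x in lebesgue_on D. f x = 0"
proof -
  have DL: "D \<in> sets lebesgue" using D by (simp add: lebesgue_openin)
  have gi: "integrable lebesgue (\<lambda>x. indicator D x *\<^sub>R f x)"
    using f DL by (simp add: integrable_restrict_space)
  have box0: "set_lebesgue_integral lebesgue (box a b) f = 0" if "cbox a b \<subseteq> D" for a b
  proof -
    have "box a b \<subseteq> D" using that box_subset_cbox by blast
    then have "(\<lambda>x. indicator D x *\<^sub>R indicat_real (box a b) x *\<^sub>R f x) = (\<lambda>x. indicator (box a b) x *\<^sub>R f x)"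
      by (intro ext) (auto simp: indicator_def)
    then show ?thesis
      using integral_indicator_box_eq_0[OF f test that] DL
      by (simp add: integral_restrict_space set_lebesgue_integral_def)
  qed
  have si: "set_integrable lebesgue A f" if "A \<in> sets lebesgue" "A \<subseteq> D" for A
  proof -
    have "set_integrable lebesgue D f" using gi by (simp add: set_integrable_def)
    then show ?thesis using that by (rule set_integrable_subset)
  qed
  have zero: "AE x in lebesgue. x \<in> cbox a b \<longrightarrow> f x = 0" if ab: "cbox a b \<subseteq> D" for a b
  proof -
    let ?B = "box a b"
    have BD: "?B \<subseteq> D" using ab box_subset_cbox by blast
    have borel: "set_lebesgue_integral lebesgue (A \<inter> ?B) f = 0" if "A \<in> sets borel" for A
    proof -
      let ?E = "range (\<lambda>(a, b). box a b :: 'a set)"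
      have sets: "sets borel = sigma_sets UNIV ?E" by (simp add: borel_eq_box)
      have leb: "X \<inter> ?B \<in> sets lebesgue" if "X \<in> sigma_sets UNIV ?E" for X
      proof -
        have "X \<in> sets borel" using that by (simp only: sets)
        then show ?thesis by auto
      qed
      have stable: "Int_stable ?E" by (auto simp: Int_stable_def box_Int_box)
      have "A \<in> sigma_sets UNIV ?E" using that sets by simp
      from stable subset_Pow_Union[of ?E, THEN subset_trans, OF Pow_mono[OF subset_UNIV]] this show ?thesis
      proof (induction rule: sigma_sets_induct_disjoint)
        case (basic A)
        then obtain c d where A: "A \<inter> ?B = box c d" by (auto simp: box_Int_box)
        show ?case
        proof (cases "box c d = {}")
          case False
          then have "cbox c d = closure (A \<inter> ?B)" using A by (simp add: closure_box)
          also have "\<dots> \<subseteq> cbox a b" by (intro closure_minimal closed_cbox) (use box_subset_cbox in auto)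
          finally show ?thesis using box0 ab A by simp
        qed (simp add: A set_lebesgue_integral_def)
      next
        case (compl A)
        have AB: "A \<inter> ?B \<in> sets lebesgue" by (rule leb[OF compl(1)])
        have AB': "(UNIV - A) \<inter> ?B \<in> sets lebesgue" using AB by (auto simp: Diff_Int_distrib2)
        have "set_lebesgue_integral lebesgue ((A \<inter> ?B) \<union> ((UNIV - A) \<inter> ?B)) f
            = set_lebesgue_integral lebesgue (A \<inter> ?B) f + set_lebesgue_integral lebesgue ((UNIV - A) \<inter> ?B) f"
          using BD AB AB' by (intro set_integral_Un si) auto
        moreover have "(A \<inter> ?B) \<union> ((UNIV - A) \<inter> ?B) = ?B" by auto
        ultimately show ?case using compl box0[OF ab] by simp
      next
        case (union A)
        have "set_lebesgue_integral lebesgue (\<Union>i. A i \<inter> ?B) f = (\<Sum>i. set_lebesgue_integral lebesgue (A i \<inter> ?B) f)"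
        proof (rule lebesgue_integral_countable_add)
          show AB: "A i \<inter> ?B \<in> sets lebesgue" for i using union(2) by (intro leb) auto
          show "A i \<inter> ?B \<inter> (A j \<inter> ?B) = {}" if "i \<noteq> j" for i j
            using union(1) that by (auto simp: disjoint_family_on_def)
          show "set_integrable lebesgue (\<Union>i. A i \<inter> ?B) f"
            using AB BD by (intro si sets.countable_UN) auto
        qed
        moreover have "(\<Union>i. A i \<inter> ?B) = (\<Union>i. A i) \<inter> ?B" by auto
        ultimately show ?case using union(3) by simp
      qed (auto simp: set_lebesgue_integral_def)
    qed
    interpret B: finite_measure "lebesgue_on ?B"
      by (rule finite_measure_lebesgue_on) simp
    have fB: "integrable (lebesgue_on ?B) f"
      using si[OF _ BD] by (simp add: integrable_restrict_space set_integrable_def)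
    have "AE x in lebesgue_on ?B. f x = 0"
    proof (rule B.density_zero[OF fB])
      fix A assume "A \<in> sets (lebesgue_on ?B)"
      then have A: "A \<in> sets lebesgue" "A \<subseteq> ?B"
        by (auto simp: sets_restrict_space_iff)
      obtain S N N' where S: "A = S \<union> N" "N \<subseteq> N'" "N' \<in> null_sets lborel" "S \<in> sets lborel"
        using A(1) by (auto elim: completionE simp: sets_completion)
      have "set_lebesgue_integral (lebesgue_on ?B) A f = set_lebesgue_integral lebesgue A f"
        unfolding set_lebesgue_integral_def
        by (subst integral_restrict_space) (use A in \<open>auto intro!: Bochner_Integration.integral_cong simp: indicator_def\<close>)
      also have "\<dots> = set_lebesgue_integral lebesgue S f"
      proof (rule set_integral_cong_set)
        have "AE x in lebesgue. x \<notin> N'"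
          using S(3) by (intro AE_not_in) (auto intro: null_sets_completionI)
        then show "AE x in lebesgue. (x \<in> S) = (x \<in> A)"
          by eventually_elim (use S in auto)
        have "A \<subseteq> D" "S \<subseteq> D" "S \<in> sets lebesgue" using S A BD by auto
        then show "set_borel_measurable lebesgue S f" "set_borel_measurable lebesgue A f"
          using borel_measurable_integrable[OF si[of S, unfolded set_integrable_def]]
            borel_measurable_integrable[OF si[of A, unfolded set_integrable_def]] A(1)
          unfolding set_borel_measurable_def by simp_all
      qed
      also have "S = S \<inter> ?B" using S A by auto
      also have "set_lebesgue_integral lebesgue (S \<inter> ?B) f = 0" using S(4) by (intro borel) simp
      finally show "set_lebesgue_integral (lebesgue_on ?B) A f = 0" .
    qed
    then have "AE x in lebesgue. x \<in> ?B \<longrightarrow> f x = 0"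
      by (simp add: AE_restrict_space_iff)
    moreover have "AE x in lebesgue. x \<notin> cbox a b - ?B"
      using negligible_frontier_interval by (intro AE_not_in) (simp add: negligible_iff_null_sets)
    ultimately show ?thesis by eventually_elim auto
  qed
  obtain \<D> where \<D>: "countable \<D>" "\<D> \<subseteq> Pow D" "\<And>X. X \<in> \<D> \<Longrightarrow> \<exists>a b. X = cbox a b" "\<Union>\<D> = D"
    using open_countable_Union_open_cbox[OF D] by metis
  have "AE x in lebesgue. \<forall>X\<in>\<D>. x \<in> X \<longrightarrow> f x = 0"
  proof (subst AE_ball_countable[OF \<D>(1)], intro ballI)
    fix X assume X: "X \<in> \<D>"
    then obtain a b where "X = cbox a b" using \<D>(3) by blast
    then show "AE x in lebesgue. x \<in> X \<longrightarrow> f x = 0" using zero \<D>(2) X by auto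
  qed
  then have "AE x in lebesgue. x \<in> D \<longrightarrow> f x = 0"
    by eventually_elim (use \<D>(4) in auto)
  then show ?thesis using DL by (simp add: AE_restrict_space_iff)
qed

section \<open>Semi-inner products\<close>

text \<open>The $L^2$ and the $H^1$ inner product are definite only up to null sets; both are instances of
  this notion, which provides Cauchy-Schwarz and the triangle inequality.\<close>

definition semi_inner_on :: "'v::real_vector set \<Rightarrow> ('v \<Rightarrow> 'v \<Rightarrow> real) \<Rightarrow> bool"
  where "semi_inner_on V B \<longleftrightarrow> subspace V \<and>
    (\<forall>x\<in>V. \<forall>y\<in>V. \<forall>z\<in>V. B (x + y) z = B x z + B y z) \<and>
    (\<forall>x\<in>V. \<forall>y\<in>V. \<forall>c. B (c *\<^sub>R x) y = c * B x y) \<and>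
    (\<forall>x\<in>V. \<forall>y\<in>V. B x y = B y x) \<and>
    (\<forall>x\<in>V. 0 \<le> B x x)"

lemma semi_inner_onD:
  assumes "semi_inner_on V B"
  shows "subspace V"
    and "x \<in> V \<Longrightarrow> y \<in> V \<Longrightarrow> z \<in> V \<Longrightarrow> B (x + y) z = B x z + B y z"
    and "x \<in> V \<Longrightarrow> y \<in> V \<Longrightarrow> B (c *\<^sub>R x) y = c * B x y"
    and "x \<in> V \<Longrightarrow> y \<in> V \<Longrightarrow> B x y = B y x"
    and "x \<in> V \<Longrightarrow> 0 \<le> B x x"
  using assms unfolding semi_inner_on_def by auto

lemma semi_inner_on_right:
  assumes B: "semi_inner_on V B" and "x \<in> V" "y \<in> V" "z \<in> V"
  shows "B z (x + y) = B z x + B z y" and "B z (c *\<^sub>R x) = c * B z x"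
  using assms semi_inner_onD[OF B] by (simp_all add: subspace_add subspace_scale)

lemma semi_inner_on_quadratic:
  assumes B: "semi_inner_on V B" and x: "x \<in> V" and y: "y \<in> V"
  shows "B (x + t *\<^sub>R y) (x + t *\<^sub>R y) = B x x + 2 * t * B x y + t\<^sup>2 * B y y"
proof -
  have ty: "t *\<^sub>R y \<in> V" and s: "x + t *\<^sub>R y \<in> V"
    using semi_inner_onD(1)[OF B] x y by (simp_all add: subspace_add subspace_scale)
  have "B (x + t *\<^sub>R y) (x + t *\<^sub>R y) = B x x + B x (t *\<^sub>R y) + (B (t *\<^sub>R y) x + B (t *\<^sub>R y) (t *\<^sub>R y))"
    by (simp only: semi_inner_onD(2)[OF B x ty s] semi_inner_on_right(1)[OF B x ty x]
      semi_inner_on_right(1)[OF B x ty ty])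
  also have "\<dots> = B x x + 2 * t * B x y + t\<^sup>2 * B y y"
    by (simp add: semi_inner_onD(3)[OF B y] semi_inner_on_right(2)[OF B y y] semi_inner_on_right(2)[OF B y _ x] x y ty
      semi_inner_onD(4)[OF B y x] power2_eq_square algebra_simps)
  finally show ?thesis .
qed

lemma semi_inner_on_Cauchy_Schwarz:
  assumes B: "semi_inner_on V B" and x: "x \<in> V" and y: "y \<in> V"
  shows "\<bar>B x y\<bar> \<le> sqrt (B x x) * sqrt (B y y)"
proof -
  have ge: "0 \<le> B x x + 2 * t * B x y + t\<^sup>2 * B y y" for t
  proof -
    have "x + t *\<^sub>R y \<in> V"
      using semi_inner_onD(1)[OF B] x y by (simp add: subspace_add subspace_scale)
    then show ?thesis using semi_inner_onD(5)[OF B] semi_inner_on_quadratic[OF B x y, of t] by metis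
  qed
  have "(B x y)\<^sup>2 \<le> B x x * B y y"
  proof (cases "B y y = 0")
    case True
    have "B x y = 0"
    proof (rule ccontr)
      assume "B x y \<noteq> 0"
      then show False using ge[of "- (B x x + 1) / (2 * B x y)"] True by (simp add: field_simps)
    qed
    then show ?thesis using True by simp
  next
    case False
    then have "0 < B y y" using semi_inner_onD(5)[OF B y] by simp
    then show ?thesis using ge[of "- B x y / B y y"] by (simp add: field_simps power2_eq_square)
  qed
  then have "sqrt ((B x y)\<^sup>2) \<le> sqrt (B x x * B y y)" by (rule real_sqrt_le_mono)
  then show ?thesis by (simp add: real_sqrt_mult)
qed

lemma seminorm_on_semi_inner:
  assumes B: "semi_inner_on V B"
  shows "seminorm_on V (\<lambda>x. sqrt (B x x))"
  unfolding seminorm_on_def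
proof (intro conjI ballI allI)
  show "subspace V" by (rule semi_inner_onD(1)[OF B])
  show "0 \<le> sqrt (B x x)" if "x \<in> V" for x using semi_inner_onD(5)[OF B that] by simp
  show "sqrt (B (x + y) (x + y)) \<le> sqrt (B x x) + sqrt (B y y)" if "x \<in> V" "y \<in> V" for x y
  proof (rule real_le_lsqrt)
    have "B (x + y) (x + y) = B x x + 2 * B x y + B y y"
      using semi_inner_on_quadratic[OF B that, of 1] by simp
    also have "\<dots> \<le> B x x + 2 * (sqrt (B x x) * sqrt (B y y)) + B y y"
      using semi_inner_on_Cauchy_Schwarz[OF B that] by simp
    also have "\<dots> = (sqrt (B x x) + sqrt (B y y))\<^sup>2"
      using semi_inner_onD(5)[OF B] that by (simp add: power2_sum)
    finally show "B (x + y) (x + y) \<le> (sqrt (B x x) + sqrt (B y y))\<^sup>2" .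
  qed (use semi_inner_onD(5)[OF B] that in auto)
  show "sqrt (B (c *\<^sub>R x) (c *\<^sub>R x)) = \<bar>c\<bar> * sqrt (B x x)" if "x \<in> V" for x c
  proof -
    have "c *\<^sub>R x \<in> V" using semi_inner_onD(1)[OF B] that by (simp add: subspace_scale)
    then have "B (c *\<^sub>R x) (c *\<^sub>R x) = c\<^sup>2 * B x x"
      using that by (simp add: semi_inner_onD(3)[OF B] semi_inner_on_right(2)[OF B] power2_eq_square)
    then show ?thesis by (simp add: real_sqrt_mult)
  qed
qed


section \<open>Square integrable functions\<close>

lemma L2_spaceD:
  assumes "f \<in> L2_space D"
  shows "f \<in> borel_measurable (lebesgue_on D)" "integrable (lebesgue_on D) (\<lambda>x. (norm (f x))\<^sup>2)"
  using assms by (auto simp: L2_space_def)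

lemma L2_spaceI:
  assumes "f \<in> borel_measurable (lebesgue_on D)" "integrable (lebesgue_on D) g"
    and "AE x in lebesgue_on D. (norm (f x))\<^sup>2 \<le> g x"
  shows "f \<in> L2_space D"
  unfolding L2_space_def
proof (intro CollectI conjI assms(1) Bochner_Integration.integrable_bound[OF assms(2)])
  show "(\<lambda>x. (norm (f x))\<^sup>2) \<in> borel_measurable (lebesgue_on D)" using assms(1) by measurable
  show "AE x in lebesgue_on D. norm ((norm (f x))\<^sup>2) \<le> norm (g x)"
    using assms(3) by eventually_elim auto
qed

lemma L2_inner_integrable:
  assumes "f \<in> L2_space D" "g \<in> L2_space D"
  shows "integrable (lebesgue_on D) (\<lambda>x. f x \<bullet> g x)"
proof (rule Bochner_Integration.integrable_bound)
  show "integrable (lebesgue_on D) (\<lambda>x. (norm (f x))\<^sup>2 + (norm (g x))\<^sup>2)"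
    using assms by (intro Bochner_Integration.integrable_add L2_spaceD)
  show "(\<lambda>x. f x \<bullet> g x) \<in> borel_measurable (lebesgue_on D)"
    using assms by (intro borel_measurable_inner L2_spaceD)
  have "\<bar>f x \<bullet> g x\<bar> \<le> (norm (f x))\<^sup>2 + (norm (g x))\<^sup>2" for x
  proof -
    have "\<bar>f x \<bullet> g x\<bar> \<le> norm (f x) * norm (g x)" by (rule Cauchy_Schwarz_ineq2)
    also have "\<dots> \<le> (norm (f x))\<^sup>2 + (norm (g x))\<^sup>2"
      using sum_squares_bound[of "norm (f x)" "norm (g x)"]
        mult_nonneg_nonneg[OF norm_ge_zero[of "f x"] norm_ge_zero[of "g x"]] by linarith
    finally show ?thesis .
  qed
  then show "AE x in lebesgue_on D. norm (f x \<bullet> g x) \<le> norm ((norm (f x))\<^sup>2 + (norm (g x))\<^sup>2)"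
    by (intro always_eventually allI) simp
qed

lemma subspace_L2_space: "subspace (L2_space D)"
  unfolding subspace_def
proof (intro conjI ballI allI)
  show "0 \<in> L2_space D" by (simp add: L2_space_def zero_fun_def)
  show "f + g \<in> L2_space D" if "f \<in> L2_space D" "g \<in> L2_space D"
    for f g :: "'a \<Rightarrow> 'b"
  proof (rule L2_spaceI)
    show "f + g \<in> borel_measurable (lebesgue_on D)"
      unfolding plus_fun_def using that by (intro borel_measurable_add L2_spaceD)
    show "integrable (lebesgue_on D) (\<lambda>x. 2 * (norm (f x))\<^sup>2 + 2 * (norm (g x))\<^sup>2)"
      using that by (intro Bochner_Integration.integrable_add integrable_mult_right L2_spaceD)
    have "(norm (f x + g x))\<^sup>2 \<le> 2 * (norm (f x))\<^sup>2 + 2 * (norm (g x))\<^sup>2" for x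
    proof -
      have "(norm (f x + g x))\<^sup>2 \<le> (norm (f x) + norm (g x))\<^sup>2"
        by (intro power_mono norm_triangle_ineq) simp
      then show ?thesis using sum_squares_bound[of "norm (f x)" "norm (g x)"]
        by (simp add: power2_sum)
    qed
    then show "AE x in lebesgue_on D. (norm ((f + g) x))\<^sup>2 \<le> 2 * (norm (f x))\<^sup>2 + 2 * (norm (g x))\<^sup>2"
      by simp
  qed
  show "c *\<^sub>R f \<in> L2_space D" if "f \<in> L2_space D" for f :: "'a \<Rightarrow> 'b" and c
  proof (rule L2_spaceI)
    show "c *\<^sub>R f \<in> borel_measurable (lebesgue_on D)"
      unfolding scaleR_fun_def by (rule borel_measurable_scaleR[OF borel_measurable_const L2_spaceD(1)[OF that]])
    show "integrable (lebesgue_on D) (\<lambda>x. c\<^sup>2 * (norm (f x))\<^sup>2)"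
      using that by (intro integrable_mult_right L2_spaceD)
  qed (simp add: power_mult_distrib)
qed

lemma semi_inner_on_L2: "semi_inner_on (L2_space D) (L2_inner D)"
  unfolding semi_inner_on_def
proof (intro conjI ballI allI)
  show "subspace (L2_space D)" by (rule subspace_L2_space)
  show "L2_inner D (f + g) h = L2_inner D f h + L2_inner D g h"
    if "f \<in> L2_space D" "g \<in> L2_space D" "h \<in> L2_space D" for f g h :: "'a \<Rightarrow> 'b"
    unfolding L2_inner_def using that
    by (simp add: inner_add_left L2_inner_integrable)
  show "L2_inner D (c *\<^sub>R f) g = c * L2_inner D f g" for f g :: "'a \<Rightarrow> 'b" and c
    unfolding L2_inner_def by simp
  show "L2_inner D f g = L2_inner D g f" for f g :: "'a \<Rightarrow> 'b"
    unfolding L2_inner_def by (simp add: inner_commute)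
  show "0 \<le> L2_inner D f f" for f :: "'a \<Rightarrow> 'b"
    unfolding L2_inner_def by (intro integral_nonneg_AE) simp
qed

lemma seminorm_on_L2: "seminorm_on (L2_space D) (L2_norm D)"
  using seminorm_on_semi_inner[OF semi_inner_on_L2] by (simp add: L2_norm_def[abs_def])

lemma L2_Cauchy_Schwarz:
  assumes "f \<in> L2_space D" "g \<in> L2_space D"
  shows "\<bar>L2_inner D f g\<bar> \<le> L2_norm D f * L2_norm D g"
  using semi_inner_on_Cauchy_Schwarz[OF semi_inner_on_L2 assms] by (simp add: L2_norm_def)

lemma L2_norm_power2: "(L2_norm D f)\<^sup>2 = L2_inner D f f"
  unfolding L2_norm_def L2_inner_def
  by (intro real_sqrt_pow2 integral_nonneg_AE) simp

lemma L2_inner_commute: "L2_inner D f g = L2_inner D g f"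
  unfolding L2_inner_def by (simp add: inner_commute)

lemma L2_inner_scale_left: "L2_inner D (c *\<^sub>R f) g = c * L2_inner D f g"
  unfolding L2_inner_def by simp

lemma L2_inner_scale_right: "L2_inner D f (c *\<^sub>R g) = c * L2_inner D f g"
  unfolding L2_inner_def by simp

lemma L2_inner_add_left:
  "f \<in> L2_space D \<Longrightarrow> g \<in> L2_space D \<Longrightarrow> h \<in> L2_space D \<Longrightarrow>
    L2_inner D (f + g) h = L2_inner D f h + L2_inner D g h"
  by (rule semi_inner_onD(2)[OF semi_inner_on_L2])

lemma L2_inner_add_right:
  "f \<in> L2_space D \<Longrightarrow> g \<in> L2_space D \<Longrightarrow> h \<in> L2_space D \<Longrightarrow>
    L2_inner D h (f + g) = L2_inner D h f + L2_inner D h g"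
  by (rule semi_inner_on_right(1)[OF semi_inner_on_L2])

lemma L2_inner_diff_left:
  assumes "f \<in> L2_space D" "g \<in> L2_space D" "h \<in> L2_space D"
  shows "L2_inner D (f - g) h = L2_inner D f h - L2_inner D g h"
  using L2_inner_add_left[OF seminorm_onD(6)[OF seminorm_on_L2 assms(1,2)] assms(2,3)] by simp

lemma L2_inner_cong_AE:
  assumes "f \<in> L2_space D" "f' \<in> L2_space D" "g \<in> L2_space D" "AE x in lebesgue_on D. f x = f' x"
  shows "L2_inner D f g = L2_inner D f' g"
  unfolding L2_inner_def
proof (rule integral_cong_AE)
  show "(\<lambda>x. f x \<bullet> g x) \<in> borel_measurable (lebesgue_on D)"
    by (rule borel_measurable_inner[OF L2_spaceD(1)[OF assms(1)] L2_spaceD(1)[OF assms(3)]])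
  show "(\<lambda>x. f' x \<bullet> g x) \<in> borel_measurable (lebesgue_on D)"
    by (rule borel_measurable_inner[OF L2_spaceD(1)[OF assms(2)] L2_spaceD(1)[OF assms(3)]])
  show "AE x in lebesgue_on D. f x \<bullet> g x = f' x \<bullet> g x"
    using assms(4) by eventually_elim simp
qed

text \<open>Functionals defined through \<open>L2_inner\<close> depend only on the class modulo null sets.\<close>

lemma L2_inner_eq_if_norm_0:
  assumes "f \<in> L2_space D" "g \<in> L2_space D" "h \<in> L2_space D" "L2_norm D (f - g) = 0"
  shows "L2_inner D f h = L2_inner D g h"
  using L2_Cauchy_Schwarz[OF seminorm_onD(6)[OF seminorm_on_L2 assms(1,2)] assms(3)] assms
  by (simp add: L2_inner_diff_left)

lemma L2_space_integrable:
  assumes "D \<in> lmeasurable" "f \<in> L2_space D"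
  shows "integrable (lebesgue_on D) f"
proof (rule Bochner_Integration.integrable_bound)
  interpret finite_measure "lebesgue_on D" by (rule finite_measure_lebesgue_on[OF assms(1)])
  show "integrable (lebesgue_on D) (\<lambda>x. 1 + (norm (f x))\<^sup>2)"
    using L2_spaceD[OF assms(2)] by (intro Bochner_Integration.integrable_add integrable_const)
  show "f \<in> borel_measurable (lebesgue_on D)" by (rule L2_spaceD[OF assms(2)])
  have "norm (f x) \<le> 1 + (norm (f x))\<^sup>2" for x
    using sum_squares_bound[of 1 "norm (f x)"] norm_ge_zero[of "f x"] unfolding power2_eq_square by linarith
  then show "AE x in lebesgue_on D. norm (f x) \<le> norm (1 + (norm (f x))\<^sup>2)"
    by (intro always_eventually allI) (simp add: abs_of_nonneg)
qed

lemma bounded_in_L2_space: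
  assumes "D \<in> lmeasurable" "f \<in> borel_measurable (lebesgue_on D)" "\<And>x. norm (f x) \<le> B"
  shows "f \<in> L2_space D"
proof (rule L2_spaceI[OF assms(2)])
  interpret finite_measure "lebesgue_on D" by (rule finite_measure_lebesgue_on[OF assms(1)])
  show "integrable (lebesgue_on D) (\<lambda>x. B\<^sup>2)" by (rule integrable_const)
  show "AE x in lebesgue_on D. (norm (f x))\<^sup>2 \<le> B\<^sup>2"
    by (intro always_eventually allI power_mono assms(3)) simp
qed

lemma L2_inner_bounded_field:
  fixes b :: "'a::euclidean_space \<Rightarrow> 'b::euclidean_space"
  assumes b: "b \<in> borel_measurable (lebesgue_on D)" and C: "AE x in lebesgue_on D. norm (b x) \<le> C"
    and "0 \<le> C" and g: "g \<in> L2_space D"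
  shows "(\<lambda>x. b x \<bullet> g x) \<in> L2_space D" and "L2_norm D (\<lambda>x. b x \<bullet> g x) \<le> C * L2_norm D g"
proof -
  have le: "AE x in lebesgue_on D. (norm (b x \<bullet> g x))\<^sup>2 \<le> C\<^sup>2 * (norm (g x))\<^sup>2"
    using C
  proof eventually_elim
    case (elim x)
    have "\<bar>b x \<bullet> g x\<bar> \<le> norm (b x) * norm (g x)" by (rule Cauchy_Schwarz_ineq2)
    also have "\<dots> \<le> C * norm (g x)" using elim by (intro mult_right_mono) auto
    finally have "\<bar>b x \<bullet> g x\<bar>\<^sup>2 \<le> (C * norm (g x))\<^sup>2" by (intro power_mono) auto
    then show ?case by (simp add: power_mult_distrib)
  qed
  have int: "integrable (lebesgue_on D) (\<lambda>x. C\<^sup>2 * (norm (g x))\<^sup>2)"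
    using L2_spaceD[OF g] by (intro integrable_mult_right)
  show bg: "(\<lambda>x. b x \<bullet> g x) \<in> L2_space D"
    by (rule L2_spaceI[OF borel_measurable_inner[OF b L2_spaceD(1)[OF g]] int le])
  have "L2_inner D (\<lambda>x. b x \<bullet> g x) (\<lambda>x. b x \<bullet> g x) \<le> (LINT x|lebesgue_on D. C\<^sup>2 * (norm (g x))\<^sup>2)"
    unfolding L2_inner_def using le L2_inner_integrable[OF bg bg]
    by (intro integral_mono_AE int) (auto simp: power2_eq_square elim: eventually_mono)
  also have "\<dots> = C\<^sup>2 * L2_inner D g g"
    unfolding L2_inner_def by (simp add: power2_norm_eq_inner)
  finally have "(L2_norm D (\<lambda>x. b x \<bullet> g x))\<^sup>2 \<le> (C * L2_norm D g)\<^sup>2"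
    by (simp add: L2_norm_power2 power_mult_distrib)
  moreover have "0 \<le> C * L2_norm D g"
    using \<open>0 \<le> C\<close> seminorm_onD(2)[OF seminorm_on_L2 g] by simp
  ultimately show "L2_norm D (\<lambda>x. b x \<bullet> g x) \<le> C * L2_norm D g" by (rule power2_le_imp_le)
qed

section \<open>Weak gradients\<close>

lemma classical_grad_inner:
  assumes "i \<in> Basis"
  shows "classical_grad \<phi> x \<bullet> i = frechet_derivative \<phi> (at x) i"
  using assms unfolding classical_grad_def by (simp add: inner_sum_left inner_Basis if_distrib cong: if_cong)

lemma classical_grad_mult:
  assumes "smooth \<phi>" "smooth \<psi>"
  shows "classical_grad (\<lambda>x. \<phi> x * \<psi> x) x = \<phi> x *\<^sub>R classical_grad \<psi> x + \<psi> x *\<^sub>R classical_grad \<phi> x"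
  using assms unfolding classical_grad_def
  by (simp add: frechet_derivative_mult_apply smooth_differentiable scaleR_sum_right sum.distrib[symmetric] algebra_simps)

lemma borel_measurable_classical_grad:
  assumes "\<phi> \<in> test_functions D"
  shows "classical_grad \<phi> \<in> borel_measurable (lebesgue_on E)"
  unfolding classical_grad_def[abs_def]
  by (intro borel_measurable_sum borel_measurable_scaleR borel_measurable_const smooth_measurable_lebesgue_on
    test_functionsD(1)[OF test_functions_partial[OF assms]])

lemma classical_grad_bounded:
  assumes "\<phi> \<in> test_functions D"
  obtains B where "0 \<le> B" "\<And>x. norm (classical_grad \<phi> x) \<le> B"
proof -
  have "\<exists>B. 0 \<le> B \<and> (\<forall>x. \<bar>frechet_derivative \<phi> (at x) i\<bar> \<le> B)" if i: "i \<in> Basis" for i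
    using test_functions_bounded[OF test_functions_partial[OF assms i]] by metis
  then obtain B where B: "\<And>i x. i \<in> Basis \<Longrightarrow> 0 \<le> B i \<and> \<bar>frechet_derivative \<phi> (at x) i\<bar> \<le> B i"
    by metis
  show thesis
  proof (rule that)
    show "0 \<le> (\<Sum>i\<in>Basis. B i)" using B by (intro sum_nonneg) blast
    show "norm (classical_grad \<phi> x) \<le> (\<Sum>i\<in>Basis. B i)" for x
      unfolding classical_grad_def using B by (intro sum_norm_le) simp
  qed
qed

lemma classical_grad_L2:
  assumes "D \<in> lmeasurable" "\<phi> \<in> test_functions D"
  shows "classical_grad \<phi> \<in> L2_space D"
proof -
  obtain B where "\<And>x. norm (classical_grad \<phi> x) \<le> B" using classical_grad_bounded[OF assms(2)] by metis
  then show ?thesis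
    by (rule bounded_in_L2_space[OF assms(1) borel_measurable_classical_grad[OF assms(2)]])
qed

lemma test_functions_L2:
  assumes "D \<in> lmeasurable" "\<phi> \<in> test_functions D"
  shows "\<phi> \<in> L2_space D"
proof -
  obtain B where "\<And>x. \<bar>\<phi> x\<bar> \<le> B" using test_functions_bounded[OF assms(2)] by metis
  then have "\<And>x. norm (\<phi> x) \<le> B" by simp
  then show ?thesis
    by (rule bounded_in_L2_space[OF assms(1) smooth_measurable_lebesgue_on[OF test_functionsD(1)[OF assms(2)]]])
qed

lemma integrable_scaleR_bounded:
  fixes f :: "'a \<Rightarrow> real" and g :: "'a \<Rightarrow> 'b::{banach, second_countable_topology}"
  assumes "integrable M g" "f \<in> borel_measurable M" "\<And>x. \<bar>f x\<bar> \<le> B"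
  shows "integrable M (\<lambda>x. f x *\<^sub>R g x)"
proof (rule Bochner_Integration.integrable_bound)
  show "integrable M (\<lambda>x. B *\<^sub>R g x)" using assms(1) by simp
  show "(\<lambda>x. f x *\<^sub>R g x) \<in> borel_measurable M" using assms by measurable
  have "\<bar>f x\<bar> \<le> \<bar>B\<bar>" for x using assms(3)[of x] by linarith
  then show "AE x in M. norm (f x *\<^sub>R g x) \<le> norm (B *\<^sub>R g x)"
    by (intro always_eventually allI) (simp add: mult_right_mono)
qed

lemma integrable_scaleR_bounded_right:
  fixes f :: "'a \<Rightarrow> real" and g :: "'a \<Rightarrow> 'b::{banach, second_countable_topology}"
  assumes "integrable M f" "g \<in> borel_measurable M" "\<And>x. norm (g x) \<le> B"
  shows "integrable M (\<lambda>x. f x *\<^sub>R g x)"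
proof (rule Bochner_Integration.integrable_bound)
  show "integrable M (\<lambda>x. B * f x)" using assms(1) by simp
  show "(\<lambda>x. f x *\<^sub>R g x) \<in> borel_measurable M" using assms by measurable
  have "norm (g x) \<le> \<bar>B\<bar>" for x using assms(3)[of x] by linarith
  then show "AE x in M. norm (f x *\<^sub>R g x) \<le> norm (B * f x)"
    by (intro always_eventually allI) (simp add: abs_mult mult.commute[of "\<bar>B\<bar>"] mult_left_mono)
qed

lemma integrable_test_scaleR:
  fixes g :: "'a::euclidean_space \<Rightarrow> 'b::euclidean_space"
  assumes "D \<in> lmeasurable" "g \<in> L2_space D" "\<phi> \<in> test_functions D"
  shows "integrable (lebesgue_on D) (\<lambda>x. \<phi> x *\<^sub>R g x)"
proof -
  obtain B where "\<And>x. \<bar>\<phi> x\<bar> \<le> B" using test_functions_bounded[OF assms(3)] by metis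
  then show ?thesis
    by (rule integrable_scaleR_bounded[OF L2_space_integrable[OF assms(1,2)]
      smooth_measurable_lebesgue_on[OF test_functionsD(1)[OF assms(3)]]])
qed

lemma integrable_scaleR_grad:
  assumes "D \<in> lmeasurable" "f \<in> L2_space D" "\<phi> \<in> test_functions D"
  shows "integrable (lebesgue_on D) (\<lambda>x. f x *\<^sub>R classical_grad \<phi> x)"
proof -
  obtain B where "\<And>x. norm (classical_grad \<phi> x) \<le> B" using classical_grad_bounded[OF assms(3)] by metis
  then show ?thesis
    by (rule integrable_scaleR_bounded_right[OF L2_space_integrable[OF assms(1,2)]
      borel_measurable_classical_grad[OF assms(3)]])
qed

lemma has_weak_gradD:
  assumes "has_weak_grad D f g"
  shows "f \<in> L2_space D" "g \<in> L2_space D"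
    and "\<phi> \<in> test_functions D \<Longrightarrow> (LINT x|lebesgue_on D. f x *\<^sub>R classical_grad \<phi> x)
      = - (LINT x|lebesgue_on D. \<phi> x *\<^sub>R g x)"
  using assms unfolding has_weak_grad_def by auto

lemma has_weak_grad_unique:
  assumes D: "open D" "D \<in> lmeasurable" and g: "has_weak_grad D f g" and h: "has_weak_grad D f h"
  shows "AE x in lebesgue_on D. g x = h x"
proof -
  have "AE x in lebesgue_on D. g x - h x = 0"
  proof (rule du_Bois_Reymond[OF D(1)])
    show "integrable (lebesgue_on D) (\<lambda>x. g x - h x)"
      by (intro Bochner_Integration.integrable_diff L2_space_integrable[OF D(2)] has_weak_gradD(2)[OF g] has_weak_gradD(2)[OF h])
    fix \<phi> assume \<phi>: "\<phi> \<in> test_functions D"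
    show "(LINT x|lebesgue_on D. \<phi> x *\<^sub>R (g x - h x)) = 0"
      using has_weak_gradD(3)[OF g \<phi>] has_weak_gradD(3)[OF h \<phi>]
      by (simp add: scaleR_diff_right integrable_test_scaleR[OF D(2) has_weak_gradD(2)[OF g] \<phi>]
        integrable_test_scaleR[OF D(2) has_weak_gradD(2)[OF h] \<phi>])
  qed
  then show ?thesis by eventually_elim simp
qed

lemma has_weak_grad_add:
  assumes D: "D \<in> lmeasurable" and f: "has_weak_grad D f g" and f': "has_weak_grad D f' g'"
  shows "has_weak_grad D (f + f') (g + g')"
  unfolding has_weak_grad_def
proof (intro conjI ballI)
  show "f + f' \<in> L2_space D" "g + g' \<in> L2_space D"
    by (intro seminorm_onD(5)[OF seminorm_on_L2] has_weak_gradD[OF f] has_weak_gradD[OF f'])+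
  fix \<phi> assume \<phi>: "\<phi> \<in> test_functions D"
  show "(LINT x|lebesgue_on D. (f + f') x *\<^sub>R classical_grad \<phi> x) = - (LINT x|lebesgue_on D. \<phi> x *\<^sub>R (g + g') x)"
    using has_weak_gradD(3)[OF f \<phi>] has_weak_gradD(3)[OF f' \<phi>]
    by (simp add: scaleR_add_right scaleR_add_left integrable_test_scaleR[OF D has_weak_gradD(2)[OF f] \<phi>]
        integrable_test_scaleR[OF D has_weak_gradD(2)[OF f'] \<phi>]
        integrable_scaleR_grad[OF D has_weak_gradD(1)[OF f] \<phi>]
        integrable_scaleR_grad[OF D has_weak_gradD(1)[OF f'] \<phi>])
qed

lemma has_weak_grad_scale:
  assumes f: "has_weak_grad D f g"
  shows "has_weak_grad D (c *\<^sub>R f) (c *\<^sub>R g)"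
  unfolding has_weak_grad_def
proof (intro conjI ballI)
  show "c *\<^sub>R f \<in> L2_space D" "c *\<^sub>R g \<in> L2_space D"
    by (intro seminorm_onD(7)[OF seminorm_on_L2] has_weak_gradD[OF f])+
  fix \<phi> assume \<phi>: "\<phi> \<in> test_functions D"
  have "(LINT x|lebesgue_on D. (c *\<^sub>R f) x *\<^sub>R classical_grad \<phi> x)
      = c *\<^sub>R (LINT x|lebesgue_on D. f x *\<^sub>R classical_grad \<phi> x)"
    by (simp flip: integral_scaleR_right)
  also have "\<dots> = - (c *\<^sub>R (LINT x|lebesgue_on D. \<phi> x *\<^sub>R g x))"
    using has_weak_gradD(3)[OF f \<phi>] by simp
  also have "\<dots> = - (LINT x|lebesgue_on D. \<phi> x *\<^sub>R (c *\<^sub>R g) x)"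
    by (simp flip: integral_scaleR_right add: mult.commute)
  finally show "(LINT x|lebesgue_on D. (c *\<^sub>R f) x *\<^sub>R classical_grad \<phi> x)
      = - (LINT x|lebesgue_on D. \<phi> x *\<^sub>R (c *\<^sub>R g) x)" .
qed

lemma has_weak_grad_wgrad: "f \<in> H1_space D \<Longrightarrow> has_weak_grad D f (wgrad D f)"
  unfolding H1_space_def wgrad_def by (auto intro: someI[of "has_weak_grad D f"])

lemma H1_spaceD:
  assumes "f \<in> H1_space D"
  shows "f \<in> L2_space D" "wgrad D f \<in> L2_space D"
  using has_weak_gradD(1,2)[OF has_weak_grad_wgrad[OF assms]] .

lemma subspace_H1_space:
  assumes D: "D \<in> lmeasurable"
  shows "subspace (H1_space D)"
  unfolding subspace_def
proof (intro conjI ballI allI)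
  have "has_weak_grad D 0 0"
    unfolding has_weak_grad_def by (intro conjI ballI subspace_0[OF subspace_L2_space]) simp
  then show "0 \<in> H1_space D" unfolding H1_space_def by auto
  show "f + g \<in> H1_space D" if "f \<in> H1_space D" "g \<in> H1_space D" for f g
    using has_weak_grad_add[OF D has_weak_grad_wgrad[OF that(1)] has_weak_grad_wgrad[OF that(2)]]
    unfolding H1_space_def by auto
  show "c *\<^sub>R f \<in> H1_space D" if "f \<in> H1_space D" for f c
    using has_weak_grad_scale[OF has_weak_grad_wgrad[OF that]]
    unfolding H1_space_def by auto
qed

lemma wgrad_add:
  assumes D: "open D" "D \<in> lmeasurable" and f: "f \<in> H1_space D" and g: "g \<in> H1_space D"
  shows "AE x in lebesgue_on D. wgrad D (f + g) x = (wgrad D f + wgrad D g) x"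
  by (rule has_weak_grad_unique[OF D has_weak_grad_wgrad[OF subspace_add[OF subspace_H1_space[OF D(2)] f g]]
    has_weak_grad_add[OF D(2) has_weak_grad_wgrad[OF f] has_weak_grad_wgrad[OF g]]])

lemma wgrad_scale:
  assumes D: "open D" "D \<in> lmeasurable" and f: "f \<in> H1_space D"
  shows "AE x in lebesgue_on D. wgrad D (c *\<^sub>R f) x = (c *\<^sub>R wgrad D f) x"
  by (rule has_weak_grad_unique[OF D has_weak_grad_wgrad[OF subspace_scale[OF subspace_H1_space[OF D(2)] f]]
    has_weak_grad_scale[OF has_weak_grad_wgrad[OF f]]])

lemma L2_inner_wgrad_linear:
  assumes D: "open D" "D \<in> lmeasurable" and f: "f \<in> H1_space D" and g: "g \<in> H1_space D" and h: "h \<in> L2_space D"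
  shows "L2_inner D (wgrad D (f + g)) h = L2_inner D (wgrad D f) h + L2_inner D (wgrad D g) h"
    and "L2_inner D (wgrad D (c *\<^sub>R f)) h = c * L2_inner D (wgrad D f) h"
proof -
  note H1 = subspace_H1_space[OF D(2)]
  have "L2_inner D (wgrad D (f + g)) h = L2_inner D (wgrad D f + wgrad D g) h"
    by (intro L2_inner_cong_AE wgrad_add[OF D f g] h H1_spaceD(2) subspace_add[OF H1 f g]
      seminorm_onD(5)[OF seminorm_on_L2] H1_spaceD(2)[OF f] H1_spaceD(2)[OF g])
  then show "L2_inner D (wgrad D (f + g)) h = L2_inner D (wgrad D f) h + L2_inner D (wgrad D g) h"
    by (simp add: L2_inner_add_left[OF H1_spaceD(2)[OF f] H1_spaceD(2)[OF g] h])
  have "L2_inner D (wgrad D (c *\<^sub>R f)) h = L2_inner D (c *\<^sub>R wgrad D f) h"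
    by (intro L2_inner_cong_AE wgrad_scale[OF D f] h H1_spaceD(2) subspace_scale[OF H1 f]
      seminorm_onD(7)[OF seminorm_on_L2] H1_spaceD(2)[OF f])
  then show "L2_inner D (wgrad D (c *\<^sub>R f)) h = c * L2_inner D (wgrad D f) h"
    by (simp add: L2_inner_scale_left)
qed

text \<open>Choosing a representative of the weak gradient is not a linear operation.  Inside the
  $L^2$ inner product it becomes one, by uniqueness up to null sets.\<close>

lemma semi_inner_on_H1:
  assumes D: "open D" "D \<in> lmeasurable"
  shows "semi_inner_on (H1_space D) (\<lambda>f g. L2_inner D f g + L2_inner D (wgrad D f) (wgrad D g))"
  unfolding semi_inner_on_def
proof (intro conjI ballI allI)
  show "subspace (H1_space D)" by (rule subspace_H1_space[OF D(2)])
  fix f g assume f: "f \<in> H1_space D" and g: "g \<in> H1_space D"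
  show "L2_inner D (f + g) h + L2_inner D (wgrad D (f + g)) (wgrad D h)
      = L2_inner D f h + L2_inner D (wgrad D f) (wgrad D h) + (L2_inner D g h + L2_inner D (wgrad D g) (wgrad D h))"
    if h: "h \<in> H1_space D" for h
    by (simp add: L2_inner_add_left[OF H1_spaceD(1)[OF f] H1_spaceD(1)[OF g] H1_spaceD(1)[OF h]]
      L2_inner_wgrad_linear(1)[OF D f g H1_spaceD(2)[OF h]])
  show "L2_inner D (c *\<^sub>R f) g + L2_inner D (wgrad D (c *\<^sub>R f)) (wgrad D g)
      = c * (L2_inner D f g + L2_inner D (wgrad D f) (wgrad D g))" for c
    by (simp add: L2_inner_scale_left L2_inner_wgrad_linear(2)[OF D f f H1_spaceD(2)[OF g]] algebra_simps)
next
  fix f g assume f: "f \<in> H1_space D"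
  show "L2_inner D f g + L2_inner D (wgrad D f) (wgrad D g) = L2_inner D g f + L2_inner D (wgrad D g) (wgrad D f)" for g
    by (simp add: L2_inner_commute)
  show "0 \<le> L2_inner D f f + L2_inner D (wgrad D f) (wgrad D f)"
    by (intro add_nonneg_nonneg semi_inner_onD(5)[OF semi_inner_on_L2] H1_spaceD[OF f])
qed

lemma seminorm_on_H1:
  assumes "open D" "D \<in> lmeasurable"
  shows "seminorm_on (H1_space D) (H1_norm D)"
  using seminorm_on_semi_inner[OF semi_inner_on_H1[OF assms]]
  by (simp add: H1_norm_def[abs_def] L2_norm_power2)

lemma L2_norm_le_H1_norm:
  shows "L2_norm D f \<le> H1_norm D f" "L2_norm D (wgrad D f) \<le> H1_norm D f"
  unfolding H1_norm_def by (intro real_le_rsqrt; simp)+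

text \<open>By translation invariance of Lebesgue measure, the integral of each difference quotient
  vanishes; the quotients converge boundedly with common compact support.\<close>

lemma integral_test_partial:
  fixes \<psi> :: "'a::euclidean_space \<Rightarrow> real"
  assumes \<psi>: "\<psi> \<in> test_functions UNIV" and i: "i \<in> Basis"
  shows "(LINT x|lborel. frechet_derivative \<psi> (at x) i) = 0"
proof -
  note sm = test_functionsD(1)[OF \<psi>]
  define K where "K = closure {x. \<psi> x \<noteq> 0}"
  have K: "compact K" "\<And>x. x \<notin> K \<Longrightarrow> \<psi> x = 0"
    unfolding K_def by (rule test_functionsD(2)[OF \<psi>], rule test_functionsD(4)[OF \<psi>])
  obtain R where R: "\<And>x. x \<in> K \<Longrightarrow> norm x \<le> R"
    using compact_imp_bounded[OF K(1)] unfolding bounded_iff by metis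
  obtain B where B: "0 \<le> B" "\<And>x. \<bar>frechet_derivative \<psi> (at x) i\<bar> \<le> B"
    using test_functions_bounded[OF test_functions_partial[OF \<psi> i]] by metis
  have line: "((\<lambda>t. \<psi> (x + t *\<^sub>R i)) has_real_derivative frechet_derivative \<psi> (at (x + t *\<^sub>R i)) i) (at t)" for x t
  proof -
    have D: "(\<psi> has_derivative frechet_derivative \<psi> (at (x + t *\<^sub>R i))) (at (x + t *\<^sub>R i))"
      using smooth_differentiable[OF sm] by (simp add: frechet_derivative_works)
    have "((\<lambda>t. x + t *\<^sub>R i) has_derivative (\<lambda>h. h *\<^sub>R i)) (at t)"
      by (auto intro!: derivative_eq_intros)
    from has_derivative_compose[OF this D]
    have "((\<lambda>t. \<psi> (x + t *\<^sub>R i)) has_derivative (\<lambda>h. frechet_derivative \<psi> (at (x + t *\<^sub>R i)) (h *\<^sub>R i))) (at t)" .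
    moreover have "frechet_derivative \<psi> (at (x + t *\<^sub>R i)) (h *\<^sub>R i) = frechet_derivative \<psi> (at (x + t *\<^sub>R i)) i * h" for h
      using linear_scale[OF linear_frechet_derivative[OF smooth_differentiable[OF sm]]] by simp
    ultimately show ?thesis unfolding has_field_derivative_def by simp
  qed
  define q where "q n x = real (Suc n) * (\<psi> (x + (1 / real (Suc n)) *\<^sub>R i) - \<psi> x)" for n x
  have q_bound: "\<bar>q n x\<bar> \<le> B * indicator (cball 0 (R + 1)) x" for n x
  proof (cases "x \<in> cball 0 (R + 1)")
    case True
    let ?h = "1 / real (Suc n)"
    have "\<exists>z. 0 < z \<and> z < ?h \<and> \<psi> (x + ?h *\<^sub>R i) - \<psi> (x + 0 *\<^sub>R i)
        = (?h - 0) * frechet_derivative \<psi> (at (x + z *\<^sub>R i)) i"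
      by (rule MVT2[of 0 ?h "\<lambda>t. \<psi> (x + t *\<^sub>R i)" "\<lambda>t. frechet_derivative \<psi> (at (x + t *\<^sub>R i)) i"])
        (simp, rule line)
    then obtain z where "\<psi> (x + ?h *\<^sub>R i) - \<psi> x = ?h * frechet_derivative \<psi> (at (x + z *\<^sub>R i)) i"
      by auto
    then have "q n x = frechet_derivative \<psi> (at (x + z *\<^sub>R i)) i"
      unfolding q_def by simp
    then show ?thesis using B(2)[of "x + z *\<^sub>R i"] True by simp
  next
    case False
    have "norm ((1 / real (Suc n)) *\<^sub>R i) \<le> 1" using i by simp
    moreover have "norm x > R + 1" using False by simp
    moreover have "norm x \<le> norm (x + (1 / real (Suc n)) *\<^sub>R i) + norm ((1 / real (Suc n)) *\<^sub>R i)"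
      using norm_triangle_ineq4[of "x + (1 / real (Suc n)) *\<^sub>R i" "(1 / real (Suc n)) *\<^sub>R i"] by simp
    ultimately have "\<not> norm x \<le> R" "\<not> norm (x + (1 / real (Suc n)) *\<^sub>R i) \<le> R"
      by linarith+
    then have "x \<notin> K" "x + (1 / real (Suc n)) *\<^sub>R i \<notin> K" using R by blast+
    then have "q n x = 0" using K(2) by (simp add: q_def)
    then show ?thesis using B(1) by simp
  qed
  have q_lim: "(\<lambda>n. q n x) \<longlonglongrightarrow> frechet_derivative \<psi> (at x) i" for x
  proof -
    have "((\<lambda>h. (\<psi> (x + h *\<^sub>R i) - \<psi> x) / h) \<longlongrightarrow> frechet_derivative \<psi> (at x) i) (at 0)"
      using line[of x 0] by (simp add: DERIV_def)
    moreover have "filterlim (\<lambda>n. 1 / real (Suc n)) (at 0) sequentially"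
      using LIMSEQ_inverse_real_of_nat by (simp add: filterlim_at inverse_eq_divide)
    ultimately have "(\<lambda>n. (\<psi> (x + (1 / real (Suc n)) *\<^sub>R i) - \<psi> x) / (1 / real (Suc n))) \<longlonglongrightarrow> frechet_derivative \<psi> (at x) i"
      by (rule filterlim_compose)
    then show ?thesis by (simp add: q_def mult.commute)
  qed
  have meas: "\<psi> \<in> borel_measurable borel" by (rule smooth_measurable[OF sm])
  have q_meas: "q n \<in> borel_measurable lborel" for n
    unfolding q_def[abs_def] using meas by measurable
  have "(\<lambda>n. LINT x|lborel. q n x) \<longlonglongrightarrow> (LINT x|lborel. frechet_derivative \<psi> (at x) i)"
  proof (rule integral_dominated_convergence[where w = "\<lambda>x. B * indicator (cball 0 (R + 1)) x"])
    show "(\<lambda>x. frechet_derivative \<psi> (at x) i) \<in> borel_measurable lborel"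
      using smooth_measurable[OF smooth_partial[OF sm i]] by simp
    show "integrable lborel (\<lambda>x::'a. B * indicator (cball 0 (R + 1)) x)"
      by (intro integrable_mult_right integrable_real_indicator) (auto simp: emeasure_bounded_finite[OF bounded_cball, simplified])
  qed (use q_meas q_lim q_bound in auto)
  moreover have "(LINT x|lborel. q n x) = 0" for n
  proof -
    obtain C where C: "0 \<le> C" "\<And>x. \<bar>\<psi> x\<bar> \<le> C" using test_functions_bounded[OF \<psi>] by metis
    have int: "integrable lborel \<psi>"
    proof (rule Bochner_Integration.integrable_bound)
      show "integrable lborel (\<lambda>x::'a. C * indicator (cball 0 R) x)"
        by (intro integrable_mult_right integrable_real_indicator) (auto simp: emeasure_bounded_finite[OF bounded_cball, simplified])
      show "AE x in lborel. norm (\<psi> x) \<le> norm (C * indicat_real (cball 0 R) x)"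
      proof (intro always_eventually allI)
        fix x show "norm (\<psi> x) \<le> norm (C * indicat_real (cball 0 R) x)"
          using C K(2)[of x] R[of x] by (cases "x \<in> K") auto
      qed
    qed (use meas in simp)
    let ?c = "(1 / real (Suc n)) *\<^sub>R i"
    have "(LINT x|lborel. \<psi> x) = (LINT x|distr lborel borel ((+) ?c). \<psi> x)"
      by (simp add: lborel_distr_plus)
    also have "\<dots> = (LINT x|lborel. \<psi> (?c + x))"
      by (rule integral_distr) (use meas in auto)
    finally have eq: "(LINT x|lborel. \<psi> (x + ?c)) = (LINT x|lborel. \<psi> x)" by (simp add: add.commute)
    have "integrable (distr lborel borel ((+) ?c)) \<psi>" using int by (simp add: lborel_distr_plus)
    then have "integrable lborel (\<lambda>x. \<psi> (?c + x))"
      by (subst (asm) integrable_distr_eq) (use meas in auto)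
    then have "integrable lborel (\<lambda>x. \<psi> (x + ?c))" by (simp add: add.commute)
    then show ?thesis unfolding q_def using int eq by simp
  qed
  ultimately show ?thesis by (simp add: LIMSEQ_const_iff)
qed

lemma has_weak_grad_test:
  assumes D: "D \<in> lmeasurable" and \<phi>: "\<phi> \<in> test_functions D"
  shows "has_weak_grad D \<phi> (classical_grad \<phi>)"
  unfolding has_weak_grad_def
proof (intro conjI ballI)
  show L: "\<phi> \<in> L2_space D" "classical_grad \<phi> \<in> L2_space D"
    by (rule test_functions_L2[OF D \<phi>], rule classical_grad_L2[OF D \<phi>])
  fix \<theta> assume \<theta>: "\<theta> \<in> test_functions D"
  have "\<phi> \<in> test_functions UNIV" "\<theta> \<in> test_functions UNIV"
    using \<phi> \<theta> test_functions_mono[of D UNIV] by auto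
  then have prod: "(\<lambda>x. \<phi> x * \<theta> x) \<in> test_functions UNIV" "(\<lambda>x. \<phi> x * \<theta> x) \<in> test_functions D"
    using test_functions_smooth_mult test_functionsD(1) \<theta> by blast+
  have i1: "integrable (lebesgue_on D) (\<lambda>x. \<phi> x *\<^sub>R classical_grad \<theta> x)"
    by (rule integrable_scaleR_grad[OF D L(1) \<theta>])
  have i2: "integrable (lebesgue_on D) (\<lambda>x. \<theta> x *\<^sub>R classical_grad \<phi> x)"
    by (rule integrable_scaleR_grad[OF D test_functions_L2[OF D \<theta>] \<phi>])
  have "(LINT x|lebesgue_on D. classical_grad (\<lambda>x. \<phi> x * \<theta> x) x) = 0"
  proof (rule euclidean_eqI)
    fix i :: 'a assume i: "i \<in> Basis"
    note par = test_functions_partial[OF prod(2) i]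
    have "integrable (lebesgue_on D) (classical_grad (\<lambda>x. \<phi> x * \<theta> x))"
      by (rule L2_space_integrable[OF D classical_grad_L2[OF D prod(2)]])
    then have "(LINT x|lebesgue_on D. classical_grad (\<lambda>x. \<phi> x * \<theta> x) x) \<bullet> i
        = (LINT x|lebesgue_on D. classical_grad (\<lambda>x. \<phi> x * \<theta> x) x \<bullet> i)"
      by (subst integral_inner_left) auto
    also have "\<dots> = (LINT x|lebesgue_on D. frechet_derivative (\<lambda>x. \<phi> x * \<theta> x) (at x) i)"
      by (simp add: classical_grad_inner[OF i])
    also have "\<dots> = (LINT x|lebesgue. indicator D x *\<^sub>R frechet_derivative (\<lambda>x. \<phi> x * \<theta> x) (at x) i)"
      using D by (intro integral_restrict_space) auto
    also have "(\<lambda>x. indicator D x *\<^sub>R frechet_derivative (\<lambda>x. \<phi> x * \<theta> x) (at x) i)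
        = (\<lambda>x. frechet_derivative (\<lambda>x. \<phi> x * \<theta> x) (at x) i)"
      using test_functionsD(5)[OF par] by (intro ext) (auto simp: indicator_def)
    also have "(LINT x|lebesgue. frechet_derivative (\<lambda>x. \<phi> x * \<theta> x) (at x) i)
        = (LINT x|lborel. frechet_derivative (\<lambda>x. \<phi> x * \<theta> x) (at x) i)"
      using smooth_measurable[OF test_functionsD(1)[OF par]] by (intro integral_completion) simp
    also have "\<dots> = 0" by (rule integral_test_partial[OF prod(1) i])
    finally show "(LINT x|lebesgue_on D. classical_grad (\<lambda>x. \<phi> x * \<theta> x) x) \<bullet> i = 0 \<bullet> i" by simp
  qed
  then have "(LINT x|lebesgue_on D. \<phi> x *\<^sub>R classical_grad \<theta> x) + (LINT x|lebesgue_on D. \<theta> x *\<^sub>R classical_grad \<phi> x) = 0"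
    using i1 i2 by (simp add: classical_grad_mult[OF test_functionsD(1)[OF \<phi>] test_functionsD(1)[OF \<theta>]])
  then show "(LINT x|lebesgue_on D. \<phi> x *\<^sub>R classical_grad \<theta> x) = - (LINT x|lebesgue_on D. \<theta> x *\<^sub>R classical_grad \<phi> x)"
    by (simp add: eq_neg_iff_add_eq_0)
qed

lemma test_functions_H1: "D \<in> lmeasurable \<Longrightarrow> \<phi> \<in> test_functions D \<Longrightarrow> \<phi> \<in> H1_space D"
  unfolding H1_space_def using has_weak_grad_test by auto

lemma wgrad_test:
  assumes D: "open D" "D \<in> lmeasurable" and \<phi>: "\<phi> \<in> test_functions D"
  shows "AE x in lebesgue_on D. wgrad D \<phi> x = classical_grad \<phi> x"
  by (rule has_weak_grad_unique[OF D has_weak_grad_wgrad[OF test_functions_H1[OF D(2) \<phi>]] has_weak_grad_test[OF D(2) \<phi>]])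

lemma H10_spaceD:
  assumes "f \<in> H10_space D"
  shows "f \<in> H1_space D" "f \<in> L2_space D" "wgrad D f \<in> L2_space D"
    and "\<exists>\<phi>. (\<forall>n::nat. \<phi> n \<in> test_functions D) \<and> (\<lambda>n. H1_norm D (\<phi> n - f)) \<longlonglongrightarrow> 0"
  using assms H1_spaceD[of f D] unfolding H10_space_def by auto

lemma seminorm_on_H10:
  assumes D: "open D" "D \<in> lmeasurable"
  shows "seminorm_on (H10_space D) (H1_norm D)"
proof -
  note H1 = seminorm_on_H1[OF D]
  have "subspace (H10_space D)"
    unfolding subspace_def
  proof (intro conjI ballI allI)
    have "(0 :: 'a \<Rightarrow> real) \<in> test_functions D"
      by (rule test_functionsI[of _ "{}"]) (auto simp: zero_fun_def)
    then show "0 \<in> H10_space D"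
      unfolding H10_space_def using seminorm_onD(8,9)[OF H1]
      by (auto intro!: exI[of _ "\<lambda>n. 0"])
    fix f assume f: "f \<in> H10_space D"
    obtain \<phi> where \<phi>: "\<And>n::nat. \<phi> n \<in> test_functions D" "(\<lambda>n. H1_norm D (\<phi> n - f)) \<longlonglongrightarrow> 0"
      using H10_spaceD(4)[OF f] by blast
    have df: "\<phi> n - f \<in> H1_space D" for n
      by (rule seminorm_onD(6)[OF H1 test_functions_H1[OF D(2) \<phi>(1)] H10_spaceD(1)[OF f]])
    show "f + g \<in> H10_space D" if g: "g \<in> H10_space D" for g
    proof -
      obtain \<psi> where \<psi>: "\<And>n::nat. \<psi> n \<in> test_functions D" "(\<lambda>n. H1_norm D (\<psi> n - g)) \<longlonglongrightarrow> 0"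
        using H10_spaceD(4)[OF g] by blast
      have dg: "\<psi> n - g \<in> H1_space D" for n
        by (rule seminorm_onD(6)[OF H1 test_functions_H1[OF D(2) \<psi>(1)] H10_spaceD(1)[OF g]])
      have eq: "(\<phi> n + \<psi> n) - (f + g) = (\<phi> n - f) + (\<psi> n - g)" for n by simp
      have "(\<lambda>n. H1_norm D ((\<phi> n + \<psi> n) - (f + g))) \<longlonglongrightarrow> 0"
      proof (rule tendsto_sandwich[OF _ _ tendsto_const tendsto_add_zero[OF \<phi>(2) \<psi>(2)]])
        show "\<forall>\<^sub>F n in sequentially. 0 \<le> H1_norm D ((\<phi> n + \<psi> n) - (f + g))"
          unfolding eq by (intro always_eventually allI seminorm_onD(2)[OF H1] seminorm_onD(5)[OF H1] df dg)
        show "\<forall>\<^sub>F n in sequentially. H1_norm D ((\<phi> n + \<psi> n) - (f + g)) \<le> H1_norm D (\<phi> n - f) + H1_norm D (\<psi> n - g)"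
          unfolding eq by (intro always_eventually allI seminorm_onD(3)[OF H1] df dg)
      qed
      moreover have "f + g \<in> H1_space D"
        by (intro seminorm_onD(5)[OF H1] H10_spaceD(1) f g)
      ultimately show ?thesis
        unfolding H10_space_def using test_functions_add[OF \<phi>(1) \<psi>(1)]
        by (intro CollectI conjI exI[of _ "\<lambda>n. \<phi> n + \<psi> n"]) auto
    qed
    show "c *\<^sub>R f \<in> H10_space D" for c
    proof -
      have eq: "c *\<^sub>R \<phi> n - c *\<^sub>R f = c *\<^sub>R (\<phi> n - f)" for n by (simp add: scaleR_diff_right)
      have "(\<lambda>n. \<bar>c\<bar> * H1_norm D (\<phi> n - f)) \<longlonglongrightarrow> 0"
        using tendsto_mult_right_zero[OF \<phi>(2)] .
      then have "(\<lambda>n. H1_norm D (c *\<^sub>R \<phi> n - c *\<^sub>R f)) \<longlonglongrightarrow> 0"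
        unfolding eq seminorm_onD(4)[OF H1 df] .
      moreover have "c *\<^sub>R f \<in> H1_space D"
        by (intro seminorm_onD(7)[OF H1] H10_spaceD(1) f)
      ultimately show ?thesis
        unfolding H10_space_def using test_functions_scale[OF \<phi>(1)]
        by (intro CollectI conjI exI[of _ "\<lambda>n. c *\<^sub>R \<phi> n"]) auto
    qed
  qed
  moreover have "H10_space D \<subseteq> H1_space D" unfolding H10_space_def by auto
  ultimately show ?thesis using H1 unfolding seminorm_on_def by (meson subsetD)
qed

section \<open>Bounded bilinear forms and Bochner spaces\<close>

definition bounded_bilinear_on ::
    "'v::real_vector set \<Rightarrow> ('v \<Rightarrow> real) \<Rightarrow> 'w::real_vector set \<Rightarrow> ('w \<Rightarrow> real) \<Rightarrow> ('v \<Rightarrow> 'w \<Rightarrow> real) \<Rightarrow> bool"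
  where "bounded_bilinear_on V nV W nW B \<longleftrightarrow>
    (\<forall>x\<in>V. \<forall>y\<in>V. \<forall>z\<in>W. B (x + y) z = B x z + B y z) \<and>
    (\<forall>x\<in>V. \<forall>z\<in>W. \<forall>c. B (c *\<^sub>R x) z = c * B x z) \<and>
    (\<forall>x\<in>V. \<forall>y\<in>W. \<forall>z\<in>W. B x (y + z) = B x y + B x z) \<and>
    (\<forall>x\<in>V. \<forall>z\<in>W. \<forall>c. B x (c *\<^sub>R z) = c * B x z) \<and>
    (\<exists>C\<ge>0. \<forall>x\<in>V. \<forall>z\<in>W. \<bar>B x z\<bar> \<le> C * (nV x * nW z))"

lemma bounded_bilinear_onD:
  assumes "bounded_bilinear_on V nV W nW B"
  shows "x \<in> V \<Longrightarrow> y \<in> V \<Longrightarrow> z \<in> W \<Longrightarrow> B (x + y) z = B x z + B y z"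
    and "x \<in> V \<Longrightarrow> z \<in> W \<Longrightarrow> B (c *\<^sub>R x) z = c * B x z"
    and "x \<in> V \<Longrightarrow> y' \<in> W \<Longrightarrow> z \<in> W \<Longrightarrow> B x (y' + z) = B x y' + B x z"
    and "x \<in> V \<Longrightarrow> z \<in> W \<Longrightarrow> B x (c *\<^sub>R z) = c * B x z"
  using assms unfolding bounded_bilinear_on_def by auto

lemma bounded_bilinear_on_bound:
  assumes "bounded_bilinear_on V nV W nW B"
  shows "\<exists>C\<ge>0. \<forall>x\<in>V. \<forall>z\<in>W. \<bar>B x z\<bar> \<le> C * (nV x * nW z)"
  using assms unfolding bounded_bilinear_on_def by auto

lemma bounded_bilinear_on_add:
  assumes "bounded_bilinear_on V nV W nW B" "bounded_bilinear_on V nV W nW B'"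
  shows "bounded_bilinear_on V nV W nW (\<lambda>x y. B x y + B' x y)"
proof -
  obtain C where C: "0 \<le> C" "\<And>x z. x \<in> V \<Longrightarrow> z \<in> W \<Longrightarrow> \<bar>B x z\<bar> \<le> C * (nV x * nW z)"
    using bounded_bilinear_on_bound[OF assms(1)] by auto
  obtain C' where C': "0 \<le> C'" "\<And>x z. x \<in> V \<Longrightarrow> z \<in> W \<Longrightarrow> \<bar>B' x z\<bar> \<le> C' * (nV x * nW z)"
    using bounded_bilinear_on_bound[OF assms(2)] by auto
  have "\<bar>B x z + B' x z\<bar> \<le> (C + C') * (nV x * nW z)" if "x \<in> V" "z \<in> W" for x z
    using C(2)[OF that] C'(2)[OF that] by (simp add: distrib_right)
  then have "\<exists>C\<ge>0. \<forall>x\<in>V. \<forall>z\<in>W. \<bar>B x z + B' x z\<bar> \<le> C * (nV x * nW z)"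
    using C(1) C'(1) by (intro exI[of _ "C + C'"]) auto
  then show ?thesis
    using assms unfolding bounded_bilinear_on_def by (auto simp: algebra_simps)
qed


lemma bounded_bilinear_on_cmult:
  assumes "bounded_bilinear_on V nV W nW B"
  shows "bounded_bilinear_on V nV W nW (\<lambda>x y. k * B x y)"
proof -
  obtain C where C: "0 \<le> C" "\<And>x z. x \<in> V \<Longrightarrow> z \<in> W \<Longrightarrow> \<bar>B x z\<bar> \<le> C * (nV x * nW z)"
    using bounded_bilinear_on_bound[OF assms] by auto
  have "\<bar>k * B x z\<bar> \<le> (\<bar>k\<bar> * C) * (nV x * nW z)" if "x \<in> V" "z \<in> W" for x z
    using mult_left_mono[OF C(2)[OF that], of "\<bar>k\<bar>"] by (simp add: abs_mult mult.assoc)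
  then have "\<exists>C\<ge>0. \<forall>x\<in>V. \<forall>z\<in>W. \<bar>k * B x z\<bar> \<le> C * (nV x * nW z)"
    using C(1) by (intro exI[of _ "\<bar>k\<bar> * C"]) simp
  then show ?thesis
    using assms unfolding bounded_bilinear_on_def by (auto simp: algebra_simps)
qed

lemma bounded_bilinear_on_swap:
  assumes "bounded_bilinear_on V nV W nW B"
  shows "bounded_bilinear_on W nW V nV (\<lambda>x y. B y x)"
proof -
  obtain C where C: "0 \<le> C" "\<And>x z. x \<in> V \<Longrightarrow> z \<in> W \<Longrightarrow> \<bar>B x z\<bar> \<le> C * (nV x * nW z)"
    using bounded_bilinear_on_bound[OF assms] by auto
  then have "\<exists>C\<ge>0. \<forall>x\<in>W. \<forall>z\<in>V. \<bar>B z x\<bar> \<le> C * (nW x * nV z)"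
    by (intro exI[of _ C]) (simp add: mult.commute[of "nW _"])
  then show ?thesis
    using assms unfolding bounded_bilinear_on_def by simp
qed

lemma bounded_bilinear_on_sum_left:
  assumes B: "bounded_bilinear_on V nV W nW B" and V: "subspace V"
    and "finite J" "\<And>j. j \<in> J \<Longrightarrow> c j \<in> V" and y: "y \<in> W"
  shows "B (\<Sum>j\<in>J. s j *\<^sub>R c j) y = (\<Sum>j\<in>J. s j * B (c j) y)"
  using assms(3,4)
proof (induction rule: finite_induct)
  case empty
  have "B (0 *\<^sub>R 0) y = 0 * B 0 y" by (rule bounded_bilinear_onD(2)[OF B subspace_0[OF V] y])
  then show ?case by simp
next
  case (insert i J)
  have "(\<Sum>j\<in>J. s j *\<^sub>R c j) \<in> V" "s i *\<^sub>R c i \<in> V"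
    using insert by (auto intro!: subspace_sum[OF V] subspace_scale[OF V])
  then show ?case
    using insert y by (simp add: bounded_bilinear_onD(1,2)[OF B])
qed

lemma bounded_bilinear_on_tendsto:
  assumes V: "seminorm_on V nV" and W: "seminorm_on W nW" and B: "bounded_bilinear_on V nV W nW B"
    and x: "x \<in> V" "\<And>n::nat. xs n \<in> V" "(\<lambda>n. nV (xs n - x)) \<longlonglongrightarrow> 0"
    and y: "y \<in> W" "\<And>n. ys n \<in> W" "(\<lambda>n. nW (ys n - y)) \<longlonglongrightarrow> 0"
  shows "(\<lambda>n. B (xs n) (ys n)) \<longlonglongrightarrow> B x y"
proof -
  obtain C where C: "0 \<le> C" "\<And>x z. x \<in> V \<Longrightarrow> z \<in> W \<Longrightarrow> \<bar>B x z\<bar> \<le> C * (nV x * nW z)"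
    using bounded_bilinear_on_bound[OF B] by auto
  let ?r = "\<lambda>n. C * (nV (xs n - x) * (nW (ys n - y) + nW y)) + C * (nV x * nW (ys n - y))"
  have "\<bar>B (xs n) (ys n) - B x y\<bar> \<le> ?r n" for n
  proof -
    have dx: "xs n - x \<in> V" and dy: "ys n - y \<in> W"
      by (rule seminorm_onD(6)[OF V x(2,1)], rule seminorm_onD(6)[OF W y(2,1)])
    have 1: "B (xs n) (ys n) = B (xs n - x) (ys n) + B x (ys n)"
      using bounded_bilinear_onD(1)[OF B dx x(1) y(2), of n] by simp
    have 2: "B x (ys n) = B x (ys n - y) + B x y"
      using bounded_bilinear_onD(3)[OF B x(1) dy y(1)] by simp
    have "nW (ys n) \<le> nW (ys n - y) + nW y"
      using seminorm_onD(3)[OF W dy y(1)] by simp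
    then have "nV (xs n - x) * nW (ys n) \<le> nV (xs n - x) * (nW (ys n - y) + nW y)"
      using seminorm_onD(2)[OF V dx] by (intro mult_left_mono)
    then have "\<bar>B (xs n - x) (ys n)\<bar> \<le> C * (nV (xs n - x) * (nW (ys n - y) + nW y))"
      by (rule order_trans[OF C(2)[OF dx y(2)] mult_left_mono[OF _ C(1)]])
    moreover have "\<bar>B x (ys n - y)\<bar> \<le> C * (nV x * nW (ys n - y))" by (rule C(2)[OF x(1) dy])
    ultimately show ?thesis using 1 2 by linarith
  qed
  then have le: "\<forall>n. norm (B (xs n) (ys n) - B x y) \<le> ?r n" by simp
  have "?r \<longlonglongrightarrow> C * (0 * (0 + nW y)) + C * (nV x * 0)"
    by (intro tendsto_intros x(3) y(3))
  then have lim: "?r \<longlonglongrightarrow> 0" by simp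
  have "(\<lambda>n. B (xs n) (ys n) - B x y) \<longlonglongrightarrow> 0"
    by (rule Lim_null_comparison[OF always_eventually[OF le] lim])
  then show ?thesis by (simp add: LIM_zero_iff)
qed

lemma seminorm_on_tendsto:
  assumes V: "seminorm_on V nV" and x: "x \<in> V" "\<And>n::nat. xs n \<in> V" "(\<lambda>n. nV (xs n - x)) \<longlonglongrightarrow> 0"
  shows "(\<lambda>n. nV (xs n)) \<longlonglongrightarrow> nV x"
proof -
  have le: "\<forall>n. norm (nV (xs n) - nV x) \<le> nV (xs n - x)"
    using seminorm_on_abs_diff[OF V x(2,1)] by (intro allI) (simp only: real_norm_def)
  have "(\<lambda>n. nV (xs n) - nV x) \<longlonglongrightarrow> 0"
    by (rule Lim_null_comparison[OF always_eventually[OF le] x(3)])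
  then show ?thesis by (simp only: LIM_zero_iff)
qed

text \<open>Limits almost everywhere suffice because Lebesgue measure is complete.\<close>

lemma borel_measurable_lebesgue_on_AE_limit:
  fixes f :: "'a::euclidean_space \<Rightarrow> real"
  assumes I: "I \<in> sets lebesgue"
    and s: "\<And>n::nat. s n \<in> borel_measurable (lebesgue_on I)"
    and lim: "AE t in lebesgue_on I. (\<lambda>n. s n t) \<longlonglongrightarrow> f t"
  shows "f \<in> borel_measurable (lebesgue_on I)"
proof -
  let ?s = "\<lambda>n t. indicator I t *\<^sub>R s n t"
  have "(\<lambda>t. lim (\<lambda>n. ?s n t)) \<in> borel_measurable lebesgue"
    using s I by (intro borel_measurable_lim_metric) (simp add: borel_measurable_restrict_space_iff)
  moreover have "AE t in lebesgue. lim (\<lambda>n. ?s n t) = indicator I t *\<^sub>R f t"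
  proof -
    have "AE t in lebesgue. t \<in> I \<longrightarrow> (\<lambda>n. s n t) \<longlonglongrightarrow> f t"
      using lim I by (simp add: AE_restrict_space_iff)
    then show ?thesis
    proof eventually_elim
      case (elim t)
      have "(\<lambda>n. ?s n t) \<longlonglongrightarrow> indicator I t *\<^sub>R f t"
        using elim by (cases "t \<in> I") auto
      then show ?case by (rule limI)
    qed
  qed
  ultimately have "(\<lambda>t. indicator I t *\<^sub>R f t) \<in> borel_measurable lebesgue"
    by (rule borel_measurable_AE)
  then show ?thesis using I by (simp add: borel_measurable_restrict_space_iff)
qed

lemma bochner_L2D:
  assumes "v \<in> bochner_L2 I V nV"
  shows "\<exists>s. (\<forall>n::nat. simple_function (lebesgue_on I) (s n)) \<and> (\<forall>n. \<forall>t\<in>I. s n t \<in> V) \<and>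
    (AE t in lebesgue_on I. v t \<in> V \<and> (\<lambda>n. nV (s n t - v t)) \<longlonglongrightarrow> 0) \<and>
    integrable (lebesgue_on I) (\<lambda>t. (nV (v t))\<^sup>2)"
proof -
  obtain s where s: "\<forall>n::nat. simple_function (lebesgue_on I) (s n) \<and> s n ` I \<subseteq> V"
    "AE t in lebesgue_on I. (\<lambda>n. nV (s n t - v t)) \<longlonglongrightarrow> 0"
    using assms unfolding bochner_L2_def by auto
  have "AE t in lebesgue_on I. v t \<in> V" "integrable (lebesgue_on I) (\<lambda>t. (nV (v t))\<^sup>2)"
    using assms unfolding bochner_L2_def by auto
  with s show ?thesis
    by (intro exI[of _ s]) auto
qed

lemma bochner_L2_AE: "v \<in> bochner_L2 I V nV \<Longrightarrow> AE t in lebesgue_on I. v t \<in> V"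
  unfolding bochner_L2_def by auto

lemma bochner_L2I:
  assumes "AE t in lebesgue_on I. v t \<in> V"
    and "\<And>n::nat. simple_function (lebesgue_on I) (s n)" "\<And>n t. t \<in> I \<Longrightarrow> s n t \<in> V"
    and "AE t in lebesgue_on I. (\<lambda>n. nV (s n t - v t)) \<longlonglongrightarrow> 0"
    and "integrable (lebesgue_on I) (\<lambda>t. (nV (v t))\<^sup>2)"
  shows "v \<in> bochner_L2 I V nV"
  unfolding bochner_L2_def using assms by (intro CollectI conjI exI[of _ s]) auto

lemma bochner_L2_cong:
  assumes "v \<in> bochner_L2 I V nV" "\<And>t. t \<in> I \<Longrightarrow> v t = w t"
  shows "w \<in> bochner_L2 I V nV"
proof -
  obtain s where s: "\<And>n::nat. simple_function (lebesgue_on I) (s n)" "\<And>n t. t \<in> I \<Longrightarrow> s n t \<in> V"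
    "AE t in lebesgue_on I. v t \<in> V \<and> (\<lambda>n. nV (s n t - v t)) \<longlonglongrightarrow> 0"
    "integrable (lebesgue_on I) (\<lambda>t. (nV (v t))\<^sup>2)"
    using bochner_L2D[OF assms(1)] by blast
  have sp: "AE t in lebesgue_on I. t \<in> I" using AE_space[of "lebesgue_on I"] by simp
  show ?thesis
  proof (rule bochner_L2I[OF _ s(1,2)])
    show "AE t in lebesgue_on I. w t \<in> V" using s(3) sp by eventually_elim (use assms(2) in auto)
    show "AE t in lebesgue_on I. (\<lambda>n. nV (s n t - w t)) \<longlonglongrightarrow> 0"
      using s(3) sp by eventually_elim (use assms(2) in auto)
    show "integrable (lebesgue_on I) (\<lambda>t. (nV (w t))\<^sup>2)"
    proof -
      have "integrable (lebesgue_on I) (\<lambda>t. (nV (v t))\<^sup>2) = integrable (lebesgue_on I) (\<lambda>t. (nV (w t))\<^sup>2)"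
        by (rule Bochner_Integration.integrable_cong) (simp_all add: assms(2))
      then show ?thesis using s(4) by simp
    qed
  qed
qed

lemma subspace_bochner_L2:
  assumes I: "I \<in> sets lebesgue" and V: "seminorm_on V nV"
  shows "subspace (bochner_L2 I V nV)"
  unfolding subspace_def
proof (intro conjI ballI allI)
  have sp: "AE t in lebesgue_on I. t \<in> I" using AE_space[of "lebesgue_on I"] by simp
  show "0 \<in> bochner_L2 I V nV"
    by (rule bochner_L2I[where s = "\<lambda>n t. 0"]) (use seminorm_onD(8,9)[OF V] in \<open>auto simp: zero_fun_def\<close>)
  fix v assume v: "v \<in> bochner_L2 I V nV"
  obtain s where s: "\<And>n::nat. simple_function (lebesgue_on I) (s n)" "\<And>n t. t \<in> I \<Longrightarrow> s n t \<in> V"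
    "AE t in lebesgue_on I. v t \<in> V \<and> (\<lambda>n. nV (s n t - v t)) \<longlonglongrightarrow> 0"
    "integrable (lebesgue_on I) (\<lambda>t. (nV (v t))\<^sup>2)"
    using bochner_L2D[OF v] by blast
  show "v + w \<in> bochner_L2 I V nV" if w: "w \<in> bochner_L2 I V nV" for w
  proof -
    obtain r where r: "\<And>n::nat. simple_function (lebesgue_on I) (r n)" "\<And>n t. t \<in> I \<Longrightarrow> r n t \<in> V"
      "AE t in lebesgue_on I. w t \<in> V \<and> (\<lambda>n. nV (r n t - w t)) \<longlonglongrightarrow> 0"
      "integrable (lebesgue_on I) (\<lambda>t. (nV (w t))\<^sup>2)"
      using bochner_L2D[OF w] by blast
    have simple: "simple_function (lebesgue_on I) (\<lambda>t. s n t + r n t)" for n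
      by (rule simple_function_compose2[OF s(1) r(1)])
    have lim: "AE t in lebesgue_on I. (\<lambda>n. nV (s n t + r n t - (v + w) t)) \<longlonglongrightarrow> 0"
      using s(3) r(3) sp
    proof eventually_elim
      case (elim t)
      have sv: "s n t - v t \<in> V" "r n t - w t \<in> V" for n
        using elim s(2) r(2) by (auto intro: seminorm_onD(6)[OF V])
      have eq: "s n t + r n t - (v + w) t = (s n t - v t) + (r n t - w t)" for n by simp
      show ?case
      proof (rule tendsto_sandwich[OF _ _ tendsto_const tendsto_add_zero])
        show "\<forall>\<^sub>F n in sequentially. 0 \<le> nV (s n t + r n t - (v + w) t)"
          unfolding eq by (intro always_eventually allI seminorm_onD(2)[OF V] seminorm_onD(5)[OF V] sv)
        show "\<forall>\<^sub>F n in sequentially. nV (s n t + r n t - (v + w) t) \<le> nV (s n t - v t) + nV (r n t - w t)"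
          unfolding eq by (intro always_eventually allI seminorm_onD(3)[OF V] sv)
      qed (use elim in auto)
    qed
    have VW: "AE t in lebesgue_on I. (v + w) t \<in> V"
      using s(3) r(3) by eventually_elim (auto intro: seminorm_onD(5)[OF V])
    show ?thesis
    proof (rule bochner_L2I[OF VW simple _ lim])
      show "s n t + r n t \<in> V" if "t \<in> I" for n t by (rule seminorm_onD(5)[OF V s(2)[OF that] r(2)[OF that]])
      have meas: "(\<lambda>t. nV ((v + w) t)) \<in> borel_measurable (lebesgue_on I)"
      proof (rule borel_measurable_lebesgue_on_AE_limit[OF I])
        show "(\<lambda>t. nV (s n t + r n t)) \<in> borel_measurable (lebesgue_on I)" for n
          by (rule borel_measurable_simple_function[OF simple_function_compose1[OF simple]])
        show "AE t in lebesgue_on I. (\<lambda>n. nV (s n t + r n t)) \<longlonglongrightarrow> nV ((v + w) t)"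
          using lim VW sp
        proof eventually_elim
          case (elim t)
          have "s n t + r n t \<in> V" for n by (rule seminorm_onD(5)[OF V s(2)[OF elim(3)] r(2)[OF elim(3)]])
          then show ?case by (rule seminorm_on_tendsto[OF V elim(2) _ elim(1)])
        qed
      qed
      show "integrable (lebesgue_on I) (\<lambda>t. (nV ((v + w) t))\<^sup>2)"
      proof (rule Bochner_Integration.integrable_bound)
        show "integrable (lebesgue_on I) (\<lambda>t. 2 * (nV (v t))\<^sup>2 + 2 * (nV (w t))\<^sup>2)"
          using s(4) r(4) by simp
        show "(\<lambda>t. (nV ((v + w) t))\<^sup>2) \<in> borel_measurable (lebesgue_on I)"
          by (rule borel_measurable_power[OF meas])
        show "AE t in lebesgue_on I. norm ((nV ((v + w) t))\<^sup>2) \<le> norm (2 * (nV (v t))\<^sup>2 + 2 * (nV (w t))\<^sup>2)"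
          using s(3) r(3)
        proof eventually_elim
          case (elim t)
          have "(nV (v t + w t))\<^sup>2 \<le> (nV (v t) + nV (w t))\<^sup>2"
            using elim by (intro power_mono seminorm_onD(2,3)[OF V] seminorm_onD(5)[OF V]) auto
          then show ?case using sum_squares_bound[of "nV (v t)" "nV (w t)"]
            by (simp add: power2_sum)
        qed
      qed
    qed
  qed
  show "c *\<^sub>R v \<in> bochner_L2 I V nV" for c
  proof (rule bochner_L2I[where s = "\<lambda>n t. c *\<^sub>R s n t"])
    show "AE t in lebesgue_on I. (c *\<^sub>R v) t \<in> V"
      using s(3) by eventually_elim (auto intro: seminorm_onD(7)[OF V])
    show "simple_function (lebesgue_on I) (\<lambda>t. c *\<^sub>R s n t)" for n
      by (rule simple_function_compose1[OF s(1)])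
    show "c *\<^sub>R s n t \<in> V" if "t \<in> I" for n t by (rule seminorm_onD(7)[OF V s(2)[OF that]])
    show "AE t in lebesgue_on I. (\<lambda>n. nV (c *\<^sub>R s n t - (c *\<^sub>R v) t)) \<longlonglongrightarrow> 0"
      using s(3) sp
    proof eventually_elim
      case (elim t)
      have "nV (c *\<^sub>R s n t - (c *\<^sub>R v) t) = \<bar>c\<bar> * nV (s n t - v t)" for n
        using seminorm_onD(4)[OF V seminorm_onD(6)[OF V s(2)[OF elim(2)]]] elim(1)
        by (simp flip: scaleR_diff_right)
      moreover have "(\<lambda>n. \<bar>c\<bar> * nV (s n t - v t)) \<longlonglongrightarrow> 0"
        using elim(1) by (intro tendsto_mult_right_zero) simp
      ultimately show ?case by simp
    qed
    have int: "integrable (lebesgue_on I) (\<lambda>t. c\<^sup>2 * (nV (v t))\<^sup>2)" using s(4) by simp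
    have eq: "AE t in lebesgue_on I. c\<^sup>2 * (nV (v t))\<^sup>2 = (nV ((c *\<^sub>R v) t))\<^sup>2"
      using s(3) by eventually_elim (simp add: seminorm_onD(4)[OF V] power_mult_distrib)
    have meas: "(\<lambda>t. (nV ((c *\<^sub>R v) t))\<^sup>2) \<in> borel_measurable (lebesgue_on I)"
    proof (rule borel_measurable_lebesgue_on_AE_limit[OF I borel_measurable_integrable[OF int]])
      show "AE t in lebesgue_on I. (\<lambda>n. c\<^sup>2 * (nV (v t))\<^sup>2) \<longlonglongrightarrow> (nV ((c *\<^sub>R v) t))\<^sup>2"
        using eq by eventually_elim simp
    qed
    show "integrable (lebesgue_on I) (\<lambda>t. (nV ((c *\<^sub>R v) t))\<^sup>2)"
      by (rule integrable_cong_AE[THEN iffD1, OF borel_measurable_integrable[OF int] meas eq int])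
  qed
qed

lemma bochner_L2_restrict:
  assumes v: "v \<in> bochner_L2 I V nV" and I: "I \<in> sets lebesgue" and J: "J \<in> sets lebesgue" "J \<subseteq> I"
  shows "v \<in> bochner_L2 J V nV"
proof -
  obtain s where s: "\<And>n::nat. simple_function (lebesgue_on I) (s n)" "\<And>n t. t \<in> I \<Longrightarrow> s n t \<in> V"
    "AE t in lebesgue_on I. v t \<in> V \<and> (\<lambda>n. nV (s n t - v t)) \<longlonglongrightarrow> 0"
    "integrable (lebesgue_on I) (\<lambda>t. (nV (v t))\<^sup>2)"
    using bochner_L2D[OF v] by blast
  have ae: "AE t in lebesgue_on J. P t" if "AE t in lebesgue_on I. P t" for P
  proof -
    have "AE t in lebesgue. t \<in> I \<longrightarrow> P t" using that I by (simp add: AE_restrict_space_iff)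
    then have "AE t in lebesgue. t \<in> J \<longrightarrow> P t" by eventually_elim (use J(2) in auto)
    then show ?thesis using J by (simp add: AE_restrict_space_iff)
  qed
  show ?thesis
  proof (rule bochner_L2I[where s = s])
    show "AE t in lebesgue_on J. v t \<in> V" "AE t in lebesgue_on J. (\<lambda>n. nV (s n t - v t)) \<longlonglongrightarrow> 0"
      using ae[OF s(3)] by auto
    show "simple_function (lebesgue_on J) (s n)" for n
      unfolding simple_function_def
    proof (intro conjI ballI)
      have "s n ` J \<subseteq> s n ` I" using J(2) by auto
      then show "finite (s n ` space (lebesgue_on J))"
        using s(1)[of n] unfolding simple_function_def by (auto dest: finite_subset)
      fix x assume "x \<in> s n ` space (lebesgue_on J)"
      then have "s n -` {x} \<inter> I \<in> sets (lebesgue_on I)"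
        using s(1)[of n] J(2) unfolding simple_function_def by auto
      then have "(s n -` {x} \<inter> I) \<inter> J \<in> sets lebesgue"
        using I J by (auto simp: sets_restrict_space_iff)
      moreover have "(s n -` {x} \<inter> I) \<inter> J = s n -` {x} \<inter> space (lebesgue_on J)" using J(2) by auto
      ultimately show "s n -` {x} \<inter> space (lebesgue_on J) \<in> sets (lebesgue_on J)"
        using J by (simp add: sets_restrict_space_iff)
    qed
    show "s n t \<in> V" if "t \<in> J" for n t using s(2) J(2) that by auto
    have "set_integrable lebesgue I (\<lambda>t. (nV (v t))\<^sup>2)"
      using s(4) I by (simp add: set_integrable_def integrable_restrict_space)
    then have "set_integrable lebesgue J (\<lambda>t. (nV (v t))\<^sup>2)" by (rule set_integrable_subset) (use J in auto)
    then show "integrable (lebesgue_on J) (\<lambda>t. (nV (v t))\<^sup>2)"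
      using J by (simp add: set_integrable_def integrable_restrict_space)
  qed
qed

lemma bochner_L2_scalar:
  assumes I: "I \<in> lmeasurable" and V: "seminorm_on V nV" and w: "w \<in> V"
    and \<theta>: "\<theta> \<in> borel_measurable (lebesgue_on I)" "\<And>t. t \<in> I \<Longrightarrow> \<bar>\<theta> t\<bar> \<le> B"
  shows "(\<lambda>t. \<theta> t *\<^sub>R w) \<in> bochner_L2 I V nV"
proof -
  interpret finite_measure "lebesgue_on I" by (rule finite_measure_lebesgue_on[OF I])
  obtain F :: "nat \<Rightarrow> real \<Rightarrow> real" where F: "\<And>n. simple_function (lebesgue_on I) (F n)"
    "\<And>t. t \<in> I \<Longrightarrow> (\<lambda>n. F n t) \<longlonglongrightarrow> \<theta> t"
    using borel_measurable_implies_sequence_metric[OF \<theta>(1), of 0] by auto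
  have sp: "AE t in lebesgue_on I. t \<in> I" using AE_space[of "lebesgue_on I"] by simp
  have norm: "nV (c *\<^sub>R w) = \<bar>c\<bar> * nV w" for c by (rule seminorm_onD(4)[OF V w])
  show ?thesis
  proof (rule bochner_L2I[where s = "\<lambda>n t. F n t *\<^sub>R w"])
    show "AE t in lebesgue_on I. \<theta> t *\<^sub>R w \<in> V" by (simp add: seminorm_onD(7)[OF V w])
    show "simple_function (lebesgue_on I) (\<lambda>t. F n t *\<^sub>R w)" for n by (rule simple_function_compose1[OF F(1)])
    show "F n t *\<^sub>R w \<in> V" for n t by (simp add: seminorm_onD(7)[OF V w])
    show "AE t in lebesgue_on I. (\<lambda>n. nV (F n t *\<^sub>R w - \<theta> t *\<^sub>R w)) \<longlonglongrightarrow> 0"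
      using sp
    proof eventually_elim
      case (elim t)
      have "(\<lambda>n. \<bar>F n t - \<theta> t\<bar> * nV w) \<longlonglongrightarrow> \<bar>\<theta> t - \<theta> t\<bar> * nV w"
        by (intro tendsto_intros F(2)[OF elim])
      then show ?case by (simp add: norm flip: scaleR_diff_left)
    qed
    show "integrable (lebesgue_on I) (\<lambda>t. (nV (\<theta> t *\<^sub>R w))\<^sup>2)"
    proof (rule Bochner_Integration.integrable_bound)
      show "integrable (lebesgue_on I) (\<lambda>t. (B * nV w)\<^sup>2)" by (rule integrable_const)
      show "(\<lambda>t. (nV (\<theta> t *\<^sub>R w))\<^sup>2) \<in> borel_measurable (lebesgue_on I)"
        unfolding norm using \<theta>(1) by measurable
      show "AE t in lebesgue_on I. norm ((nV (\<theta> t *\<^sub>R w))\<^sup>2) \<le> norm ((B * nV w)\<^sup>2)"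
        using sp
      proof eventually_elim
        case (elim t)
        have "\<bar>\<theta> t\<bar> * nV w \<le> B * nV w"
          using \<theta>(2)[OF elim] seminorm_onD(2)[OF V w] by (intro mult_right_mono)
        then show ?case
          unfolding norm using seminorm_onD(2)[OF V w] by (simp add: power_mono)
      qed
    qed
  qed
qed

text \<open>A bilinear form applied to approximating simple functions is again simple, which gives
  measurability; the bound and Young's inequality give a majorant.  This is the source of
  integrability for the integrands in time below.\<close>

lemma integrable_bounded_bilinear_bochner:
  assumes I: "I \<in> sets lebesgue" and V: "seminorm_on V nV" and W: "seminorm_on W nW"
    and B: "bounded_bilinear_on V nV W nW B"
    and v: "v \<in> bochner_L2 I V nV" and w: "w \<in> bochner_L2 I W nW"
  shows "integrable (lebesgue_on I) (\<lambda>t. B (v t) (w t))"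
proof -
  obtain s where s: "\<And>n::nat. simple_function (lebesgue_on I) (s n)" "\<And>n t. t \<in> I \<Longrightarrow> s n t \<in> V"
    "AE t in lebesgue_on I. v t \<in> V \<and> (\<lambda>n. nV (s n t - v t)) \<longlonglongrightarrow> 0"
    "integrable (lebesgue_on I) (\<lambda>t. (nV (v t))\<^sup>2)"
    using bochner_L2D[OF v] by blast
  obtain r where r: "\<And>n::nat. simple_function (lebesgue_on I) (r n)" "\<And>n t. t \<in> I \<Longrightarrow> r n t \<in> W"
    "AE t in lebesgue_on I. w t \<in> W \<and> (\<lambda>n. nW (r n t - w t)) \<longlonglongrightarrow> 0"
    "integrable (lebesgue_on I) (\<lambda>t. (nW (w t))\<^sup>2)"
    using bochner_L2D[OF w] by blast
  have sp: "AE t in lebesgue_on I. t \<in> I" using AE_space[of "lebesgue_on I"] by simp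
  obtain C where C: "0 \<le> C" "\<And>x z. x \<in> V \<Longrightarrow> z \<in> W \<Longrightarrow> \<bar>B x z\<bar> \<le> C * (nV x * nW z)"
    using bounded_bilinear_on_bound[OF B] by auto
  show ?thesis
  proof (rule Bochner_Integration.integrable_bound)
    show "integrable (lebesgue_on I) (\<lambda>t. C * ((nV (v t))\<^sup>2 + (nW (w t))\<^sup>2))" using s(4) r(4) by simp
    show "(\<lambda>t. B (v t) (w t)) \<in> borel_measurable (lebesgue_on I)"
    proof (rule borel_measurable_lebesgue_on_AE_limit[OF I])
      show "(\<lambda>t. B (s n t) (r n t)) \<in> borel_measurable (lebesgue_on I)" for n
        by (rule borel_measurable_simple_function[OF simple_function_compose2[OF s(1) r(1)]])
      show "AE t in lebesgue_on I. (\<lambda>n. B (s n t) (r n t)) \<longlonglongrightarrow> B (v t) (w t)"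
        using s(3) r(3) sp
      proof eventually_elim
        case (elim t)
        show ?case
          by (rule bounded_bilinear_on_tendsto[OF V W B]) (use elim s(2) r(2) in auto)
      qed
    qed
    show "AE t in lebesgue_on I. norm (B (v t) (w t)) \<le> norm (C * ((nV (v t))\<^sup>2 + (nW (w t))\<^sup>2))"
      using s(3) r(3)
    proof eventually_elim
      case (elim t)
      have n: "0 \<le> nV (v t)" "0 \<le> nW (w t)"
        using elim seminorm_onD(2)[OF V] seminorm_onD(2)[OF W] by auto
      have "nV (v t) * nW (w t) \<le> (nV (v t))\<^sup>2 + (nW (w t))\<^sup>2"
        using sum_squares_bound[of "nV (v t)" "nW (w t)"] mult_nonneg_nonneg[OF n] by linarith
      then have "C * (nV (v t) * nW (w t)) \<le> C * ((nV (v t))\<^sup>2 + (nW (w t))\<^sup>2)"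
        by (rule mult_left_mono[OF _ C(1)])
      moreover have "\<bar>B (v t) (w t)\<bar> \<le> C * (nV (v t) * nW (w t))" using C(2) elim by simp
      moreover have "0 \<le> C * ((nV (v t))\<^sup>2 + (nW (w t))\<^sup>2)" using C(1) by simp
      ultimately show ?case by simp
    qed
  qed
qed

lemma bounded_bilinear_on_dual_pairing:
  assumes W: "seminorm_on W nW"
  shows "bounded_bilinear_on (dual_space W nW) (dual_norm W nW) W nW (\<lambda>l h. l h)"
  unfolding bounded_bilinear_on_def
proof (intro conjI ballI allI)
  show "\<exists>C\<ge>0. \<forall>l\<in>dual_space W nW. \<forall>z\<in>W. \<bar>l z\<bar> \<le> C * (dual_norm W nW l * nW z)"
    using dual_norm_bound[OF W] by (intro exI[of _ 1]) auto
qed (auto simp: dual_spaceD)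

lemma bounded_bilinear_on_L2_inner:
  assumes "V \<subseteq> L2_space D" "W \<subseteq> L2_space D"
    and "\<And>v. v \<in> V \<Longrightarrow> L2_norm D v \<le> nV v" "\<And>w. w \<in> W \<Longrightarrow> L2_norm D w \<le> nW w"
  shows "bounded_bilinear_on V nV W nW (L2_inner D)"
  unfolding bounded_bilinear_on_def
proof (intro conjI ballI allI)
  have "\<bar>L2_inner D x z\<bar> \<le> 1 * (nV x * nW z)" if "x \<in> V" "z \<in> W" for x z
  proof -
    have xz: "x \<in> L2_space D" "z \<in> L2_space D" using assms(1,2) that by auto
    have n: "0 \<le> L2_norm D x" "0 \<le> L2_norm D z" using xz seminorm_onD(2)[OF seminorm_on_L2] by auto
    have "\<bar>L2_inner D x z\<bar> \<le> L2_norm D x * L2_norm D z" by (rule L2_Cauchy_Schwarz[OF xz])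
    also have "\<dots> \<le> nV x * nW z"
      using n assms(3)[OF that(1)] assms(4)[OF that(2)] by (intro mult_mono) auto
    finally show ?thesis by simp
  qed
  then show "\<exists>C\<ge>0. \<forall>x\<in>V. \<forall>z\<in>W. \<bar>L2_inner D x z\<bar> \<le> C * (nV x * nW z)"
    by (intro exI[of _ 1]) auto
qed (use assms(1,2) in \<open>auto simp: L2_inner_scale_left L2_inner_scale_right intro!: L2_inner_add_left L2_inner_add_right\<close>)

section \<open>Advection by a solenoidal field\<close>

locale bounded_open_domain =
  fixes D :: "'a::euclidean_space set"
  assumes D: "open D" "D \<in> lmeasurable"
begin

lemma H10: "seminorm_on (H10_space D) (H1_norm D)"
  by (rule seminorm_on_H10[OF D])

end

locale solenoidal_flow = bounded_open_domain D
  for D :: "'a::euclidean_space set" +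
  fixes b :: "'a \<Rightarrow> 'a" and C :: real
  assumes b_H1: "i \<in> Basis \<Longrightarrow> (\<lambda>x. b x \<bullet> i) \<in> H1_space D"
    and b_bound: "AE x in lebesgue_on D. norm (b x) \<le> C" and C_nonneg: "0 \<le> C"
    and div_b: "AE x in lebesgue_on D. wdiv D b x = 0"
begin

definition adv :: "('a \<Rightarrow> real) \<Rightarrow> ('a \<Rightarrow> real) \<Rightarrow> real"
  where "adv f g = L2_inner D (\<lambda>x. b x \<bullet> wgrad D f x) g"

lemma b_measurable: "b \<in> borel_measurable (lebesgue_on D)"
proof (subst borel_measurable_euclidean_space, intro ballI)
  show "(\<lambda>x. b x \<bullet> i) \<in> borel_measurable (lebesgue_on D)" if "i \<in> Basis" for i
    by (rule L2_spaceD(1)[OF H1_spaceD(1)[OF b_H1[OF that]]])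
qed

lemma adv_L2:
  assumes "f \<in> H1_space D"
  shows "(\<lambda>x. b x \<bullet> wgrad D f x) \<in> L2_space D"
    and "L2_norm D (\<lambda>x. b x \<bullet> wgrad D f x) \<le> C * L2_norm D (wgrad D f)"
  using L2_inner_bounded_field[OF b_measurable b_bound C_nonneg H1_spaceD(2)[OF assms]] by auto

lemma mult_b_L2:
  assumes h: "h \<in> L2_space D"
  shows "(\<lambda>x. h x *\<^sub>R b x) \<in> L2_space D"
proof (rule L2_spaceI)
  show "(\<lambda>x. h x *\<^sub>R b x) \<in> borel_measurable (lebesgue_on D)"
    by (rule borel_measurable_scaleR[OF L2_spaceD(1)[OF h] b_measurable])
  show "integrable (lebesgue_on D) (\<lambda>x. C\<^sup>2 * (norm (h x))\<^sup>2)"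
    by (rule integrable_mult_right[OF L2_spaceD(2)[OF h]])
  show "AE x in lebesgue_on D. (norm (h x *\<^sub>R b x))\<^sup>2 \<le> C\<^sup>2 * (norm (h x))\<^sup>2"
    using b_bound
  proof eventually_elim
    case (elim x)
    have "(norm (b x))\<^sup>2 \<le> C\<^sup>2" using elim by (intro power_mono) auto
    then have "(norm (h x))\<^sup>2 * (norm (b x))\<^sup>2 \<le> (norm (h x))\<^sup>2 * C\<^sup>2" by (intro mult_left_mono) auto
    then show ?case by (simp add: power_mult_distrib mult.commute)
  qed
qed

text \<open>Moving \<open>b\<close> to the second argument reduces linearity in the first one to that of the weak
  gradient.\<close>

lemma adv_eq: "adv f g = L2_inner D (wgrad D f) (\<lambda>x. g x *\<^sub>R b x)"
  unfolding adv_def L2_inner_def by (simp add: inner_commute mult.commute)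

lemma bounded_bilinear_adv:
  "bounded_bilinear_on (H10_space D) (H1_norm D) (H10_space D) (H1_norm D) adv"
  unfolding bounded_bilinear_on_def
proof (intro conjI ballI allI)
  have "\<bar>adv f g\<bar> \<le> C * (H1_norm D f * H1_norm D g)" if f: "f \<in> H10_space D" and g: "g \<in> H10_space D" for f g
  proof -
    have "\<bar>adv f g\<bar> \<le> L2_norm D (\<lambda>x. b x \<bullet> wgrad D f x) * L2_norm D g"
      unfolding adv_def by (rule L2_Cauchy_Schwarz[OF adv_L2(1)[OF H10_spaceD(1)[OF f]] H10_spaceD(2)[OF g]])
    also have "\<dots> \<le> (C * H1_norm D f) * H1_norm D g"
    proof (rule mult_mono)
      show "L2_norm D (\<lambda>x. b x \<bullet> wgrad D f x) \<le> C * H1_norm D f"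
        using adv_L2(2)[OF H10_spaceD(1)[OF f]] mult_left_mono[OF L2_norm_le_H1_norm(2)[of D f] C_nonneg]
        by (rule order_trans)
      show "0 \<le> C * H1_norm D f" using seminorm_onD(2)[OF H10 f] C_nonneg by simp
      show "0 \<le> L2_norm D g" by (rule seminorm_onD(2)[OF seminorm_on_L2 H10_spaceD(2)[OF g]])
    qed (rule L2_norm_le_H1_norm)
    finally show ?thesis by (simp add: mult.assoc)
  qed
  then show "\<exists>C\<ge>0. \<forall>f\<in>H10_space D. \<forall>g\<in>H10_space D. \<bar>adv f g\<bar> \<le> C * (H1_norm D f * H1_norm D g)"
    using C_nonneg by (intro exI[of _ C]) simp
  show "adv (f + g) h = adv f h + adv g h"
    if "f \<in> H10_space D" "g \<in> H10_space D" "h \<in> H10_space D" for f g h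
    unfolding adv_eq by (rule L2_inner_wgrad_linear(1)[OF D H10_spaceD(1)[OF that(1)] H10_spaceD(1)[OF that(2)]
      mult_b_L2[OF H10_spaceD(2)[OF that(3)]]])
  show "adv (c *\<^sub>R f) h = c * adv f h" if "f \<in> H10_space D" "h \<in> H10_space D" for f h c
    unfolding adv_eq by (rule L2_inner_wgrad_linear(2)[OF D H10_spaceD(1)[OF that(1)] H10_spaceD(1)[OF that(1)]
      mult_b_L2[OF H10_spaceD(2)[OF that(2)]]])
  show "adv f (g + h) = adv f g + adv f h"
    if "f \<in> H10_space D" "g \<in> H10_space D" "h \<in> H10_space D" for f g h
    unfolding adv_def by (rule L2_inner_add_right[OF H10_spaceD(2)[OF that(2)] H10_spaceD(2)[OF that(3)]
      adv_L2(1)[OF H10_spaceD(1)[OF that(1)]]])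
  show "adv f (c *\<^sub>R g) = c * adv f g" for f g c
    unfolding adv_def by (rule L2_inner_scale_right)
qed

text \<open>This is the weak form of $\nabla\cdot b = 0$: testing the weak gradient of each component
  of \<open>b\<close> and summing the diagonal.\<close>

lemma integral_b_grad_test:
  assumes \<phi>: "\<phi> \<in> test_functions D"
  shows "(LINT x|lebesgue_on D. b x \<bullet> classical_grad \<phi> x) = 0"
proof -
  have b_eq: "b x \<bullet> classical_grad \<phi> x = (\<Sum>i\<in>Basis. ((b x \<bullet> i) *\<^sub>R classical_grad \<phi> x) \<bullet> i)" for x
    by (subst euclidean_inner) simp
  have int: "integrable (lebesgue_on D) (\<lambda>x. (b x \<bullet> i) *\<^sub>R classical_grad \<phi> x)" if "i \<in> Basis" for i
    by (rule integrable_scaleR_grad[OF D(2) H1_spaceD(1)[OF b_H1[OF that]] \<phi>])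
  have int': "integrable (lebesgue_on D) (\<lambda>x. \<phi> x *\<^sub>R wgrad D (\<lambda>y. b y \<bullet> i) x)" if "i \<in> Basis" for i
    by (rule integrable_test_scaleR[OF D(2) H1_spaceD(2)[OF b_H1[OF that]] \<phi>])
  have "(LINT x|lebesgue_on D. b x \<bullet> classical_grad \<phi> x)
      = (\<Sum>i\<in>Basis. LINT x|lebesgue_on D. ((b x \<bullet> i) *\<^sub>R classical_grad \<phi> x) \<bullet> i)"
    unfolding b_eq by (intro Bochner_Integration.integral_sum integrable_inner_left int)
  also have "\<dots> = (\<Sum>i\<in>Basis. (LINT x|lebesgue_on D. (b x \<bullet> i) *\<^sub>R classical_grad \<phi> x) \<bullet> i)"
    by (intro sum.cong refl integral_inner_left int)
  also have "\<dots> = (\<Sum>i\<in>Basis. - ((LINT x|lebesgue_on D. \<phi> x *\<^sub>R wgrad D (\<lambda>y. b y \<bullet> i) x) \<bullet> i))"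
    by (intro sum.cong refl) (simp add: has_weak_gradD(3)[OF has_weak_grad_wgrad[OF b_H1] \<phi>])
  also have "\<dots> = - (\<Sum>i\<in>Basis. LINT x|lebesgue_on D. (\<phi> x *\<^sub>R wgrad D (\<lambda>y. b y \<bullet> i) x) \<bullet> i)"
    unfolding sum_negf[symmetric] by (intro sum.cong refl arg_cong[of _ _ uminus] integral_inner_left[symmetric] int')
  also have "(\<Sum>i\<in>Basis. LINT x|lebesgue_on D. (\<phi> x *\<^sub>R wgrad D (\<lambda>y. b y \<bullet> i) x) \<bullet> i)
      = (LINT x|lebesgue_on D. (\<Sum>i\<in>Basis. (\<phi> x *\<^sub>R wgrad D (\<lambda>y. b y \<bullet> i) x) \<bullet> i))"
    by (intro Bochner_Integration.integral_sum[symmetric] integrable_inner_left int')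
  also have "\<dots> = (LINT x|lebesgue_on D. \<phi> x * wdiv D b x)"
    by (simp add: wdiv_def sum_distrib_left)
  also have "\<dots> = 0"
    by (rule integral_eq_zero_AE) (use div_b in eventually_elim, simp)
  finally show ?thesis by simp
qed

lemma adv_skew_test:
  assumes \<phi>: "\<phi> \<in> test_functions D" and \<psi>: "\<psi> \<in> test_functions D"
  shows "adv \<phi> \<psi> + adv \<psi> \<phi> = 0"
proof -
  have eq: "adv f g = (LINT x|lebesgue_on D. (b x \<bullet> classical_grad f x) * g x)"
    and int: "integrable (lebesgue_on D) (\<lambda>x. (b x \<bullet> classical_grad f x) * g x)"
    if f: "f \<in> test_functions D" and g: "g \<in> test_functions D" for f g
  proof -
    note gL = mult_b_L2[OF test_functions_L2[OF D(2) g]]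
    have "adv f g = L2_inner D (classical_grad f) (\<lambda>x. g x *\<^sub>R b x)"
      unfolding adv_eq
      by (rule L2_inner_cong_AE[OF H1_spaceD(2)[OF test_functions_H1[OF D(2) f]] classical_grad_L2[OF D(2) f]
        gL wgrad_test[OF D f]])
    then show "adv f g = (LINT x|lebesgue_on D. (b x \<bullet> classical_grad f x) * g x)"
      by (simp add: L2_inner_def inner_commute mult.commute)
    have "integrable (lebesgue_on D) (\<lambda>x. classical_grad f x \<bullet> (g x *\<^sub>R b x))"
      by (rule L2_inner_integrable[OF classical_grad_L2[OF D(2) f] gL])
    then show "integrable (lebesgue_on D) (\<lambda>x. (b x \<bullet> classical_grad f x) * g x)"
      by (simp add: inner_commute mult.commute)
  qed
  have "adv \<phi> \<psi> + adv \<psi> \<phi> = (LINT x|lebesgue_on D. (b x \<bullet> classical_grad \<phi> x) * \<psi> x + (b x \<bullet> classical_grad \<psi> x) * \<phi> x)"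
    by (simp add: eq[OF \<phi> \<psi>] eq[OF \<psi> \<phi>] int[OF \<phi> \<psi>] int[OF \<psi> \<phi>])
  also have "\<dots> = (LINT x|lebesgue_on D. b x \<bullet> classical_grad (\<lambda>x. \<phi> x * \<psi> x) x)"
    by (simp add: classical_grad_mult[OF test_functionsD(1)[OF \<phi>] test_functionsD(1)[OF \<psi>]] inner_add_right algebra_simps)
  also have "\<dots> = 0"
    by (rule integral_b_grad_test[OF test_functions_smooth_mult[OF test_functionsD(1)[OF \<phi>] \<psi>]])
  finally show ?thesis .
qed

lemma test_functions_H10: "\<phi> \<in> test_functions D \<Longrightarrow> \<phi> \<in> H10_space D"
  unfolding H10_space_def using test_functions_H1[OF D(2)] seminorm_onD(9)[OF seminorm_on_H1[OF D]]
  by (intro CollectI conjI exI[of _ "\<lambda>n. \<phi>"]) simp_all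

text \<open>For test functions both terms add up to $\int b\cdot\nabla(\varphi\psi) = 0$; both sides are
  continuous in the $H^1$ norm, and test functions are dense.\<close>

lemma adv_skew:
  assumes f: "f \<in> H10_space D" and g: "g \<in> H10_space D"
  shows "adv g f = - adv f g"
proof -
  obtain \<phi> where \<phi>: "\<And>n::nat. \<phi> n \<in> test_functions D" "(\<lambda>n. H1_norm D (\<phi> n - f)) \<longlonglongrightarrow> 0"
    using H10_spaceD(4)[OF f] by blast
  obtain \<psi> where \<psi>: "\<And>n::nat. \<psi> n \<in> test_functions D" "(\<lambda>n. H1_norm D (\<psi> n - g)) \<longlonglongrightarrow> 0"
    using H10_spaceD(4)[OF g] by blast
  have "(\<lambda>n. adv (\<phi> n) (\<psi> n) + adv (\<psi> n) (\<phi> n)) \<longlonglongrightarrow> adv f g + adv g f"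
    by (intro tendsto_add bounded_bilinear_on_tendsto[OF H10 H10 bounded_bilinear_adv] f g
      test_functions_H10 \<phi> \<psi>)
  then have "adv f g + adv g f = 0"
    by (simp add: adv_skew_test[OF \<phi>(1) \<psi>(1)] LIMSEQ_const_iff)
  then show ?thesis by simp
qed

end

section \<open>Integration by parts for weakly differentiable scalar functions\<close>

lemma integrable_lebesgue_on_subset:
  fixes f :: "'a::euclidean_space \<Rightarrow> 'b::euclidean_space"
  assumes "integrable (lebesgue_on I) f" "I \<in> sets lebesgue" "J \<in> sets lebesgue" "J \<subseteq> I"
  shows "integrable (lebesgue_on J) f"
proof -
  have "set_integrable lebesgue I f"
    using assms by (simp add: set_integrable_def integrable_restrict_space)
  then have "set_integrable lebesgue J f" by (rule set_integrable_subset) (use assms in auto)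
  then show ?thesis using assms by (simp add: set_integrable_def integrable_restrict_space)
qed

lemma integral_lebesgue_on_subset:
  fixes f :: "'a::euclidean_space \<Rightarrow> 'b::euclidean_space"
  assumes "I \<in> sets lebesgue" "J \<in> sets lebesgue" "J \<subseteq> I" "\<And>t. t \<in> I - J \<Longrightarrow> f t = 0"
  shows "(LINT t|lebesgue_on I. f t) = (LINT t|lebesgue_on J. f t)"
proof -
  have "indicator I t *\<^sub>R f t = indicator J t *\<^sub>R f t" for t
    using assms(3,4) by (cases "t \<in> J"; cases "t \<in> I") auto
  then have eq: "(\<lambda>t. indicator I t *\<^sub>R f t) = (\<lambda>t. indicator J t *\<^sub>R f t)" by (rule ext)
  have "(LINT t|lebesgue_on I. f t) = (LINT t|lebesgue. indicator I t *\<^sub>R f t)"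
    using assms(1) by (intro integral_restrict_space) auto
  also have "\<dots> = (LINT t|lebesgue. indicator J t *\<^sub>R f t)" by (simp only: eq)
  also have "\<dots> = (LINT t|lebesgue_on J. f t)"
    using assms(2) by (intro integral_restrict_space[symmetric]) auto
  finally show ?thesis .
qed

lemma Ioc_lmeasurable: "{a<..b::real} \<in> lmeasurable"
  by (rule bounded_set_imp_lmeasurable) auto

lemma bounded_on_Ioc:
  fixes f :: "real \<Rightarrow> real"
  assumes "continuous_on UNIV f"
  obtains B where "\<And>t. t \<in> {a<..b} \<Longrightarrow> \<bar>f t\<bar> \<le> B"
proof -
  have "bounded (f ` {a..b})"
    by (intro compact_imp_bounded compact_continuous_image continuous_on_subset[OF assms]) auto
  then have "\<exists>B. \<forall>t\<in>{a..b}. \<bar>f t\<bar> \<le> B" by (simp add: bounded_iff)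
  then obtain B where "\<And>t. t \<in> {a..b} \<Longrightarrow> \<bar>f t\<bar> \<le> B" by blast
  then show thesis by (intro that[of B]) auto
qed

lemma continuous_measurable_lebesgue_on:
  fixes f :: "real \<Rightarrow> real"
  assumes "continuous_on UNIV f"
  shows "f \<in> borel_measurable (lebesgue_on S)"
proof (rule measurable_restrict_space1)
  have "f \<in> borel_measurable lborel" using borel_measurable_continuous_onI[OF assms] by simp
  then show "f \<in> borel_measurable lebesgue" by (rule measurable_completion)
qed

lemma integrable_continuous_mult_Ioc:
  fixes f V :: "real \<Rightarrow> real"
  assumes "continuous_on UNIV f" "integrable (lebesgue_on {a<..b}) V"
  shows "integrable (lebesgue_on {a<..b}) (\<lambda>t. f t * V t)"
proof -
  obtain B where B: "\<And>t. t \<in> {a<..b} \<Longrightarrow> \<bar>f t\<bar> \<le> B" using bounded_on_Ioc[OF assms(1)] by blast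
  show ?thesis
  proof (rule Bochner_Integration.integrable_bound)
    show "integrable (lebesgue_on {a<..b}) (\<lambda>t. B * V t)" using assms(2) by simp
    show "(\<lambda>t. f t * V t) \<in> borel_measurable (lebesgue_on {a<..b})"
      by (rule borel_measurable_times[OF continuous_measurable_lebesgue_on[OF assms(1)] borel_measurable_integrable[OF assms(2)]])
    have "norm (f t * V t) \<le> norm (B * V t)" if "t \<in> {a<..b}" for t
    proof -
      have "\<bar>f t\<bar> \<le> \<bar>B\<bar>" using B[OF that] by linarith
      then show ?thesis by (simp add: abs_mult mult_right_mono)
    qed
    then show "AE t in lebesgue_on {a<..b}. norm (f t * V t) \<le> norm (B * V t)"
      by (intro AE_I2) (simp only: space_lebesgue_on)
  qed
qed

lemma integrable_continuous_Ioc: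
  fixes f :: "real \<Rightarrow> real"
  assumes "continuous_on UNIV f"
  shows "integrable (lebesgue_on {a<..b}) f"
proof -
  interpret finite_measure "lebesgue_on {a<..b}"
    by (rule finite_measure_lebesgue_on[OF Ioc_lmeasurable])
  show ?thesis
    using integrable_continuous_mult_Ioc[OF assms, of a b "\<lambda>t. 1"] by simp
qed

lemma integral_Ioc_FTC:
  fixes f F :: "real \<Rightarrow> real"
  assumes "a \<le> b" "\<And>t. (F has_real_derivative f t) (at t)" "continuous_on UNIV f"
  shows "(LINT t|lebesgue_on {a<..b}. f t) = F b - F a"
proof -
  have "(f has_integral F b - F a) {a..b}"
    using assms by (intro fundamental_theorem_of_calculus)
      (auto intro: has_vector_derivative_at_within simp: has_real_derivative_iff_has_vector_derivative)
  then have "(f has_integral F b - F a) {a<..b}"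
    by (rule has_integral_spike_set_eq[THEN iffD1, rotated 2])
      (auto intro: negligible_subset[of "{a}"])
  moreover have "(f has_integral (LINT t|lebesgue_on {a<..b}. f t)) {a<..b}"
    by (rule has_integral_integral_lebesgue_on[OF integrable_continuous_Ioc[OF assms(3)]]) simp
  ultimately show ?thesis by (metis has_integral_unique)
qed

text \<open>Stated for kernels that concentrate where \<open>V\<close> is close to \<open>L\<close>, so as to cover
  left and right limits alike.\<close>

lemma approximate_identity_tendsto:
  fixes \<kappa> :: "nat \<Rightarrow> 'a \<Rightarrow> real"
  assumes \<kappa>: "\<And>n. integrable M (\<kappa> n)" "\<And>n t. 0 \<le> \<kappa> n t"
    and \<kappa>V: "\<And>n. integrable M (\<lambda>t. \<kappa> n t * V t)"
    and one: "eventually (\<lambda>n. (LINT t|M. \<kappa> n t) = 1) sequentially"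
    and conc: "\<And>e. 0 < e \<Longrightarrow> eventually (\<lambda>n. \<forall>t\<in>space M. \<kappa> n t \<noteq> 0 \<longrightarrow> \<bar>V t - L\<bar> \<le> e) sequentially"
  shows "(\<lambda>n. LINT t|M. \<kappa> n t * V t) \<longlonglongrightarrow> L"
proof (rule LIMSEQ_I)
  fix e :: real assume e: "0 < e"
  have "eventually (\<lambda>n. norm ((LINT t|M. \<kappa> n t * V t) - L) < e) sequentially"
    using one conc[OF half_gt_zero[OF e]]
  proof eventually_elim
    case (elim n)
    have "(LINT t|M. \<kappa> n t * V t) - L = (LINT t|M. \<kappa> n t * V t) - L * (LINT t|M. \<kappa> n t)"
      using elim by simp
    also have "\<dots> = (LINT t|M. \<kappa> n t * V t - L * \<kappa> n t)"
      using \<kappa>(1) \<kappa>V by simp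
    also have "\<bar>\<dots>\<bar> \<le> (LINT t|M. \<bar>\<kappa> n t * V t - L * \<kappa> n t\<bar>)"
      by (rule integral_abs_bound)
    also have "\<dots> \<le> (LINT t|M. (e/2) * \<kappa> n t)"
    proof (rule integral_mono)
      show "integrable M (\<lambda>t. \<bar>\<kappa> n t * V t - L * \<kappa> n t\<bar>)" "integrable M (\<lambda>t. (e/2) * \<kappa> n t)"
        using \<kappa>(1) \<kappa>V by simp_all
      fix t assume t: "t \<in> space M"
      have "\<bar>\<kappa> n t * V t - L * \<kappa> n t\<bar> = \<bar>\<kappa> n t * (V t - L)\<bar>" by (simp add: algebra_simps)
      also have "\<dots> = \<kappa> n t * \<bar>V t - L\<bar>" using \<kappa>(2)[of n t] by (simp add: abs_mult)
      also have "\<dots> \<le> \<kappa> n t * (e/2)"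
      proof (cases "\<kappa> n t = 0")
        case False
        then have "\<bar>V t - L\<bar> \<le> e/2" using elim(2) e t by simp
        then show ?thesis by (rule mult_left_mono[OF _ \<kappa>(2)])
      qed simp
      finally show "\<bar>\<kappa> n t * V t - L * \<kappa> n t\<bar> \<le> (e/2) * \<kappa> n t" by (simp add: mult.commute)
    qed
    also have "\<dots> = e/2" using elim by simp
    finally show ?case using e by simp
  qed
  then show "\<exists>N. \<forall>n\<ge>N. norm ((LINT t|M. \<kappa> n t * V t) - L) < e"
    by (simp add: eventually_sequentially)
qed

lemma deriv_step_eq_0: "x < 1 \<or> 2 < x \<Longrightarrow> deriv step x = 0"
proof -
  assume x: "x < 1 \<or> 2 < x"
  have "(step has_real_derivative 0) (at x)"
    using x
  proof
    assume "x < 1"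
    show ?thesis
      by (rule has_field_derivative_transform_within_open[of "\<lambda>x. 0" _ _ "{..<1}"])
        (use \<open>x < 1\<close> in \<open>auto simp: step_0\<close>)
  next
    assume "2 < x"
    show ?thesis
      by (rule has_field_derivative_transform_within_open[of "\<lambda>x. 1" _ _ "{2<..}"])
        (use \<open>2 < x\<close> in \<open>auto simp: step_1\<close>)
  qed
  then show ?thesis by (rule DERIV_imp_deriv)
qed

lemma eventually_inverse_nat_less:
  assumes "0 < (d::real)"
  shows "eventually (\<lambda>n. 2 < real n * d) sequentially"
proof (rule eventually_sequentiallyI[of "nat \<lceil>2 / d\<rceil> + 1"])
  fix n assume "nat \<lceil>2 / d\<rceil> + 1 \<le> n"
  then have "2 / d < real n" by linarith
  then show "2 < real n * d" using assms by (simp add: field_simps)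
qed

text \<open>With \<open>s = 1\<close> a rise from 0 to 1 just to the right of \<open>c\<close>, with \<open>s = - 1\<close> a descent from 1
  to 0 just to the left of \<open>c\<close>.\<close>

definition ramp :: "real \<Rightarrow> real \<Rightarrow> nat \<Rightarrow> real \<Rightarrow> real"
  where "ramp s c n t = step (real n * (s * (t - c)))"

lemma smooth_ramp: "smooth (ramp s c n)"
  unfolding ramp_def[abs_def]
  by (intro smooth_compose[OF smooth_step] smooth_mult smooth_const smooth_diff smooth_ident)

lemma ramp_derivative:
  "(ramp s c n has_real_derivative real n * s * deriv step (real n * (s * (t - c)))) (at t)"
proof -
  have "((\<lambda>t. real n * (s * (t - c))) has_real_derivative real n * s) (at t)"
    by (auto intro!: derivative_eq_intros)
  from DERIV_chain2[OF smooth_real_derivative[OF smooth_step] this]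
  show ?thesis unfolding ramp_def[abs_def] by (simp add: mult.commute)
qed

lemma ramp_bounds: "0 \<le> ramp s c n t" "ramp s c n t \<le> 1"
  by (simp_all add: ramp_def step_ge_0 step_le_1)

lemma ramp_tendsto: "(\<lambda>n. ramp s c n t) \<longlonglongrightarrow> (if 0 < s * (t - c) then 1 else 0)"
  unfolding ramp_def by (rule step_scaled_tendsto)

lemma ramp_eq_0: "s * (t - c) \<le> 0 \<Longrightarrow> ramp s c n t = 0"
  unfolding ramp_def by (intro step_0) (simp add: mult_nonneg_nonpos order_trans[of _ 0])

lemma ramp_delta:
  fixes V :: "real \<Rightarrow> real"
  assumes "a < b" and V: "integrable (lebesgue_on {a<..b}) V"
    and sc: "s = 1 \<and> c = a \<and> F = at_right a \<or> s = - 1 \<and> c = b \<and> F = at_left b"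
    and lim: "(V \<longlongrightarrow> L) F"
  shows "(\<lambda>n. LINT t|lebesgue_on {a<..b}. (s * deriv (ramp s c n) t) * V t) \<longlonglongrightarrow> L"
proof (rule approximate_identity_tendsto)
  have ss: "s * s = 1" using sc by auto
  have dr: "deriv (ramp s c n) t = real n * s * deriv step (real n * (s * (t - c)))" for n t
    by (rule DERIV_imp_deriv[OF ramp_derivative])
  have eq: "s * deriv (ramp s c n) t = real n * deriv step (real n * (s * (t - c)))" for n t
    unfolding dr using ss by (simp add: algebra_simps)
  have cont: "continuous_on UNIV (\<lambda>t. s * deriv (ramp s c n) t)" for n
    by (intro smooth_continuous smooth_mult smooth_const smooth_deriv smooth_ramp)
  show "integrable (lebesgue_on {a<..b}) (\<lambda>t. s * deriv (ramp s c n) t)" for n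
    by (rule integrable_continuous_Ioc[OF cont])
  show "0 \<le> s * deriv (ramp s c n) t" for n t
    unfolding eq by (simp add: deriv_step_ge_0)
  show "integrable (lebesgue_on {a<..b}) (\<lambda>t. s * deriv (ramp s c n) t * V t)" for n
    by (rule integrable_continuous_mult_Ioc[OF cont V])
  show "eventually (\<lambda>n. (LINT t|lebesgue_on {a<..b}. s * deriv (ramp s c n) t) = 1) sequentially"
    using eventually_inverse_nat_less[OF diff_gt_0_iff_gt[THEN iffD2, OF \<open>a < b\<close>]]
  proof eventually_elim
    case (elim n)
    have "((\<lambda>t. s * ramp s c n t) has_real_derivative s * deriv (ramp s c n) t) (at t)" for t
      by (intro DERIV_cmult smooth_real_derivative smooth_ramp)
    then have "(LINT t|lebesgue_on {a<..b}. s * deriv (ramp s c n) t) = s * ramp s c n b - s * ramp s c n a"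
      by (intro integral_Ioc_FTC cont) (use \<open>a < b\<close> in auto)
    also have "\<dots> = 1"
      using sc elim by (auto simp: ramp_def step_0 step_1 right_diff_distrib)
    finally show ?case .
  qed
  fix e :: real assume e: "0 < e"
  have "eventually (\<lambda>t. \<bar>V t - L\<bar> < e) F"
    using tendstoD[OF lim e] by (simp add: dist_real_def)
  then obtain d where d: "0 < d" "\<And>t. 0 < s * (t - c) \<Longrightarrow> s * (t - c) < d \<Longrightarrow> \<bar>V t - L\<bar> < e"
  proof -
    assume ev: "eventually (\<lambda>t. \<bar>V t - L\<bar> < e) F"
    show thesis
      using sc
    proof (elim disjE conjE)
      assume *: "s = 1" "c = a" "F = at_right a"
      have "\<exists>d>a. \<forall>y>a. y < d \<longrightarrow> \<bar>V y - L\<bar> < e"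
        using ev unfolding *(3) eventually_at_right_field .
      then obtain d where "d > a" "\<And>y. y > a \<Longrightarrow> y < d \<Longrightarrow> \<bar>V y - L\<bar> < e" by blast
      then show thesis using * by (intro that[of "d - a"]) auto
    next
      assume *: "s = - 1" "c = b" "F = at_left b"
      have "\<exists>d<b. \<forall>y>d. y < b \<longrightarrow> \<bar>V y - L\<bar> < e"
        using ev unfolding *(3) eventually_at_left_field .
      then obtain d where "d < b" "\<And>y. y > d \<Longrightarrow> y < b \<Longrightarrow> \<bar>V y - L\<bar> < e" by blast
      then show thesis using * by (intro that[of "b - d"]) auto
    qed
  qed
  show "eventually (\<lambda>n. \<forall>t\<in>space (lebesgue_on {a<..b}). s * deriv (ramp s c n) t \<noteq> 0 \<longrightarrow> \<bar>V t - L\<bar> \<le> e) sequentially"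
    using eventually_inverse_nat_less[OF d(1)]
  proof eventually_elim
    case (elim n)
    have "\<bar>V t - L\<bar> \<le> e" if "s * deriv (ramp s c n) t \<noteq> 0" for t
    proof -
      have ne: "deriv step (real n * (s * (t - c))) \<noteq> 0" using that unfolding eq by auto
      then have *: "1 \<le> real n * (s * (t - c))" "real n * (s * (t - c)) \<le> 2"
        using deriv_step_eq_0[of "real n * (s * (t - c))"] by linarith+
      then have "0 < s * (t - c)"
        by (smt (verit) of_nat_0_le_iff mult_nonneg_nonpos)
      moreover have "real n * (s * (t - c)) < real n * d" using * elim by linarith
      then have "s * (t - c) < d" by (rule mult_left_less_imp_less) simp
      ultimately show ?thesis using d(2) by (simp add: less_imp_le)
    qed
    then show ?case by blast
  qed
qed

lemma ramp_integral_tendsto: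
  fixes V :: "real \<Rightarrow> real"
  assumes "a < b" and V: "integrable (lebesgue_on {a<..b}) V" and p: "continuous_on UNIV p"
    and sc: "s = 1 \<and> c = a \<or> s = - 1 \<and> c = b"
  shows "(\<lambda>n. LINT t|lebesgue_on {a<..b}. p t * ramp s c n t * V t) \<longlonglongrightarrow> (LINT t|lebesgue_on {a<..b}. p t * V t)"
proof (rule integral_dominated_convergence[where w = "\<lambda>t. \<bar>p t * V t\<bar>"])
  note pV = integrable_continuous_mult_Ioc[OF p V]
  show "(\<lambda>t. p t * V t) \<in> borel_measurable (lebesgue_on {a<..b})" using pV by simp
  show "integrable (lebesgue_on {a<..b}) (\<lambda>t. \<bar>p t * V t\<bar>)" using pV by simp
  show "(\<lambda>t. p t * ramp s c n t * V t) \<in> borel_measurable (lebesgue_on {a<..b})" for n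
    by (intro borel_measurable_integrable integrable_continuous_mult_Ioc[OF _ V] continuous_on_mult p
      smooth_continuous smooth_ramp)
  have "AE t in lebesgue. t \<notin> {b}" by (rule AE_not_in) auto
  then have "AE t in lebesgue_on {a<..b}. t \<in> {a<..b} \<and> t \<noteq> b"
    by (simp add: AE_restrict_space_iff) (auto elim: eventually_mono)
  then show "AE t in lebesgue_on {a<..b}. (\<lambda>n. p t * ramp s c n t * V t) \<longlonglongrightarrow> p t * V t"
  proof eventually_elim
    case (elim t)
    have "(\<lambda>n. ramp s c n t) \<longlonglongrightarrow> 1" using ramp_tendsto[of s c t] sc elim by auto
    then have "(\<lambda>n. p t * ramp s c n t * V t) \<longlonglongrightarrow> p t * 1 * V t" by (intro tendsto_intros)
    then show ?case by simp
  qed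
  show "AE t in lebesgue_on {a<..b}. norm (p t * ramp s c n t * V t) \<le> \<bar>p t * V t\<bar>" for n
  proof (intro always_eventually allI)
    fix t
    have "\<bar>p t * V t\<bar> * ramp s c n t \<le> \<bar>p t * V t\<bar> * 1"
      by (intro mult_left_mono ramp_bounds) simp
    then show "norm (p t * ramp s c n t * V t) \<le> \<bar>p t * V t\<bar>"
      using ramp_bounds(1)[of s c n t] by (simp add: abs_mult mult_ac)
  qed
qed

text \<open>The product rule produces a regular term and the derivative of the cut-off, which acts like a
  point evaluation of the one-sided limit.\<close>

lemma ramp_deriv_tendsto:
  fixes V :: "real \<Rightarrow> real"
  assumes ab: "a < b" and V: "integrable (lebesgue_on {a<..b}) V" and p: "smooth p"
    and sc: "s = 1 \<and> c = a \<and> F = at_right a \<or> s = - 1 \<and> c = b \<and> F = at_left b"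
    and lim: "(V \<longlongrightarrow> L) F"
  shows "(\<lambda>n. LINT t|lebesgue_on {a<..b}. deriv (\<lambda>t. p t * ramp s c n t) t * V t)
    \<longlonglongrightarrow> (LINT t|lebesgue_on {a<..b}. deriv p t * V t) + s * (p c * L)"
proof -
  have ss: "s * s = 1" using sc by auto
  have pcont: "continuous_on UNIV p" by (rule smooth_continuous[OF p])
  have p'cont: "continuous_on UNIV (deriv p)" by (rule smooth_continuous[OF smooth_deriv[OF p]])
  note pV = integrable_continuous_mult_Ioc[OF pcont V]
  have "((\<lambda>t. p t * V t) \<longlongrightarrow> p c * L) F"
  proof (rule tendsto_mult[OF _ lim])
    have "isCont p c" using pcont by (simp add: continuous_on_eq_continuous_at)
    then show "(p \<longlongrightarrow> p c) F"
      using sc by (auto simp: isCont_def intro: filterlim_mono[OF _ order_refl at_le])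
  qed
  from ramp_delta[OF ab pV sc this]
  have "(\<lambda>n. s * (LINT t|lebesgue_on {a<..b}. (s * deriv (ramp s c n) t) * (p t * V t))) \<longlonglongrightarrow> s * (p c * L)"
    by (intro tendsto_mult tendsto_const)
  moreover have "(\<lambda>n. LINT t|lebesgue_on {a<..b}. deriv p t * ramp s c n t * V t) \<longlonglongrightarrow> (LINT t|lebesgue_on {a<..b}. deriv p t * V t)"
    by (rule ramp_integral_tendsto[OF ab V p'cont]) (use sc in auto)
  ultimately have lim': "(\<lambda>n. (LINT t|lebesgue_on {a<..b}. deriv p t * ramp s c n t * V t)
      + s * (LINT t|lebesgue_on {a<..b}. (s * deriv (ramp s c n) t) * (p t * V t)))
      \<longlonglongrightarrow> (LINT t|lebesgue_on {a<..b}. deriv p t * V t) + s * (p c * L)"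
    by (intro tendsto_add)
  moreover have "(LINT t|lebesgue_on {a<..b}. deriv p t * ramp s c n t * V t)
      + s * (LINT t|lebesgue_on {a<..b}. (s * deriv (ramp s c n) t) * (p t * V t))
      = (LINT t|lebesgue_on {a<..b}. deriv (\<lambda>t. p t * ramp s c n t) t * V t)" for n
  proof -
    have d: "deriv (\<lambda>t. p t * ramp s c n t) t = deriv p t * ramp s c n t + deriv (ramp s c n) t * p t" for t
      by (rule DERIV_imp_deriv[OF DERIV_mult[OF smooth_real_derivative[OF p] smooth_real_derivative[OF smooth_ramp]]])
    have i1: "integrable (lebesgue_on {a<..b}) (\<lambda>t. deriv p t * ramp s c n t * V t)"
      by (intro integrable_continuous_mult_Ioc[OF _ V] smooth_continuous smooth_mult smooth_deriv p smooth_ramp)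
    have i2: "integrable (lebesgue_on {a<..b}) (\<lambda>t. deriv (ramp s c n) t * (p t * V t))"
      by (intro integrable_continuous_mult_Ioc[OF _ pV] smooth_continuous smooth_deriv smooth_ramp)
    have "s * (LINT t|lebesgue_on {a<..b}. (s * deriv (ramp s c n) t) * (p t * V t))
        = (s * s) * (LINT t|lebesgue_on {a<..b}. deriv (ramp s c n) t * (p t * V t))"
      by (simp add: mult.assoc)
    also have "\<dots> = (LINT t|lebesgue_on {a<..b}. deriv (ramp s c n) t * (p t * V t))" using ss by simp
    finally show ?thesis
      unfolding d using i1 i2 by (simp add: distrib_right mult.assoc)
  qed
  ultimately show ?thesis by simp
qed

text \<open>Multiplying \<open>p\<close> by smooth cut-offs at both ends gives a test function; as the
  cut-offs steepen, their derivatives pick out the one-sided limits of \<open>V\<close>.\<close>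

lemma weak_derivative_integration_by_parts:
  fixes V G :: "real \<Rightarrow> real"
  assumes ab: "a < b" and V: "integrable (lebesgue_on {a<..b}) V" and G: "integrable (lebesgue_on {a<..b}) G"
    and weak: "\<And>\<eta>. \<eta> \<in> test_functions {a<..<b} \<Longrightarrow>
      (LINT t|lebesgue_on {a<..b}. deriv \<eta> t * V t) = - (LINT t|lebesgue_on {a<..b}. \<eta> t * G t)"
    and Va: "(V \<longlongrightarrow> Va) (at_right a)" and Vb: "(V \<longlongrightarrow> Vb) (at_left b)" and p: "smooth p"
  shows "(LINT t|lebesgue_on {a<..b}. p t * G t) + (LINT t|lebesgue_on {a<..b}. deriv p t * V t) = p b * Vb - p a * Va"
proof -
  let ?I = "\<lambda>f. LINT t|lebesgue_on {a<..b}. f t"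
  define q where "q k t = p t * ramp (- 1) b k t" for k t
  have q: "smooth (q k)" for k unfolding q_def[abs_def] by (intro smooth_mult p smooth_ramp)
  have "?I (\<lambda>t. deriv (q k) t * V t) + q k a * Va = - ?I (\<lambda>t. q k t * G t)" for k
  proof -
    have test: "(\<lambda>t. q k t * ramp 1 a n t) \<in> test_functions {a<..<b}" for n
      (* The denominators are n + 1 and k + 1 because n = 0 and k = 0 occur. *)
    proof (rule test_functionsI[of _ "{a + 1 / (real n + 1)..b - 1 / (real k + 1)}"])
      show "smooth (\<lambda>t. q k t * ramp 1 a n t)" by (intro smooth_mult q smooth_ramp)
      show "{a + 1 / (real n + 1)..b - 1 / (real k + 1)} \<subseteq> {a<..<b}"
      proof
        fix t assume t: "t \<in> {a + 1 / (real n + 1)..b - 1 / (real k + 1)}"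
        have "a < a + 1 / (real n + 1)" "b - 1 / (real k + 1) < b" by auto
        moreover have "a + 1 / (real n + 1) \<le> t" "t \<le> b - 1 / (real k + 1)" using t by simp_all
        ultimately have "a < t" "t < b" by linarith+
        then show "t \<in> {a<..<b}" by simp
      qed
      have small: "step (real m * x) = 0" if "x < 1 / (real m + 1)" for m :: nat and x
      proof (rule step_0)
        have "real m * x \<le> real m * (1 / (real m + 1))" using that by (intro mult_left_mono) auto
        also have "\<dots> \<le> 1" by (simp add: field_simps)
        finally show "real m * x \<le> 1" .
      qed
      fix t assume "t \<notin> {a + 1 / (real n + 1)..b - 1 / (real k + 1)}"
      then have "t - a < 1 / (real n + 1) \<or> b - t < 1 / (real k + 1)" by auto
      then show "q k t * ramp 1 a n t = 0"
        using small[of "t - a" n] small[of "b - t" k] by (auto simp: q_def ramp_def)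
    qed simp
    have "(\<lambda>n. ?I (\<lambda>t. deriv (\<lambda>t. q k t * ramp 1 a n t) t * V t)) \<longlonglongrightarrow> ?I (\<lambda>t. deriv (q k) t * V t) + 1 * (q k a * Va)"
      by (rule ramp_deriv_tendsto[OF ab V q _ Va]) simp
    moreover have "(\<lambda>n. - ?I (\<lambda>t. q k t * ramp 1 a n t * G t)) \<longlonglongrightarrow> - ?I (\<lambda>t. q k t * G t)"
      by (intro tendsto_minus ramp_integral_tendsto[OF ab G smooth_continuous[OF q]]) simp
    ultimately show ?thesis
      unfolding weak[OF test] using LIMSEQ_unique by fastforce
  qed
  moreover have "(\<lambda>k. ?I (\<lambda>t. deriv (q k) t * V t) + q k a * Va) \<longlonglongrightarrow> (?I (\<lambda>t. deriv p t * V t) + - 1 * (p b * Vb)) + p a * Va"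
  proof (intro tendsto_add tendsto_mult tendsto_const)
    show "(\<lambda>k. ?I (\<lambda>t. deriv (q k) t * V t)) \<longlonglongrightarrow> ?I (\<lambda>t. deriv p t * V t) + - 1 * (p b * Vb)"
      unfolding q_def[abs_def] by (rule ramp_deriv_tendsto[OF ab V p _ Vb]) simp
    have "(\<lambda>k. p a * ramp (- 1) b k a) \<longlonglongrightarrow> p a * (if 0 < - 1 * (a - b) then 1 else 0)"
      by (intro tendsto_mult tendsto_const ramp_tendsto)
    then show "(\<lambda>k. q k a) \<longlonglongrightarrow> p a" using ab by (simp add: q_def)
  qed
  moreover have "(\<lambda>k. - ?I (\<lambda>t. q k t * G t)) \<longlonglongrightarrow> - ?I (\<lambda>t. p t * G t)"
    unfolding q_def by (intro tendsto_minus ramp_integral_tendsto[OF ab G smooth_continuous[OF p]]) simp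
  ultimately have "(?I (\<lambda>t. deriv p t * V t) + - 1 * (p b * Vb)) + p a * Va = - ?I (\<lambda>t. p t * G t)"
    using LIMSEQ_unique by fastforce
  then show ?thesis by simp
qed

section \<open>One-sided limits and weak time derivatives\<close>

text \<open>\<open>L2_Lim\<close> picks some limit.  Keeping the limit as an argument allows computing with explicit
  ones; inner products with the chosen limit agree with those (\<open>L2_inner_L2_Lim\<close>).\<close>

definition has_L2_lim ::
    "'a::euclidean_space set \<Rightarrow> real filter \<Rightarrow> (real \<Rightarrow> 'a \<Rightarrow> real) \<Rightarrow> ('a \<Rightarrow> real) \<Rightarrow> bool"
  where "has_L2_lim D Fl v w \<longleftrightarrow> w \<in> L2_space D \<and> eventually (\<lambda>s. v s \<in> L2_space D) Fl \<and>
    ((\<lambda>s. L2_norm D (v s - w)) \<longlongrightarrow> 0) Fl"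

lemma has_L2_lim_L2_Lim: "has_L2_lim D Fl v w \<Longrightarrow> has_L2_lim D Fl v (L2_Lim D Fl v)"
  using someI[of "\<lambda>w. w \<in> L2_space D \<and> ((\<lambda>s. L2_norm D (v s - w)) \<longlongrightarrow> 0) Fl" w]
  unfolding has_L2_lim_def L2_Lim_def by simp

lemma has_L2_lim_unique:
  assumes "Fl \<noteq> bot" and v: "has_L2_lim D Fl v w" and v': "has_L2_lim D Fl v w'"
  shows "L2_norm D (w - w') = 0"
proof -
  note N = seminorm_on_L2[of D]
  have w: "w \<in> L2_space D" "w' \<in> L2_space D" using v v' unfolding has_L2_lim_def by auto
  have ev: "eventually (\<lambda>s. v s \<in> L2_space D) Fl" using v unfolding has_L2_lim_def by simp
  have "((\<lambda>s. L2_norm D (v s - w) + L2_norm D (v s - w')) \<longlongrightarrow> 0 + 0) Fl"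
    using v v' unfolding has_L2_lim_def by (intro tendsto_add) auto
  then have lim: "((\<lambda>s. L2_norm D (v s - w) + L2_norm D (v s - w')) \<longlongrightarrow> 0) Fl" by simp
  have "eventually (\<lambda>s. L2_norm D (w - w') \<le> L2_norm D (v s - w) + L2_norm D (v s - w')) Fl"
    using ev
  proof eventually_elim
    case (elim s)
    show ?case using seminorm_on_triangle3[OF N w(1) elim w(2)] seminorm_on_commute[OF N w(1) elim] by simp
  qed
  then have "L2_norm D (w - w') \<le> 0"
    by (rule tendsto_lowerbound[OF lim _ assms(1)])
  then show ?thesis using seminorm_onD(2)[OF N seminorm_onD(6)[OF N w]] by simp
qed

lemma L2_inner_L2_Lim:
  assumes "Fl \<noteq> bot" and v: "has_L2_lim D Fl v w" and h: "h \<in> L2_space D"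
  shows "L2_inner D (L2_Lim D Fl v) h = L2_inner D w h"
proof (rule L2_inner_eq_if_norm_0[OF _ _ h])
  note v' = has_L2_lim_L2_Lim[OF v]
  show "L2_Lim D Fl v \<in> L2_space D" "w \<in> L2_space D" using v v' unfolding has_L2_lim_def by auto
  show "L2_norm D (L2_Lim D Fl v - w) = 0" by (rule has_L2_lim_unique[OF assms(1) v' v])
qed

lemma has_L2_lim_add:
  assumes v: "has_L2_lim D Fl v v0" and w: "has_L2_lim D Fl w w0"
  shows "has_L2_lim D Fl (v + w) (v0 + w0)"
  unfolding has_L2_lim_def
proof (intro conjI)
  note N = seminorm_on_L2[of D]
  have L: "v0 \<in> L2_space D" "w0 \<in> L2_space D" and ev: "eventually (\<lambda>s. v s \<in> L2_space D) Fl"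
    "eventually (\<lambda>s. w s \<in> L2_space D) Fl"
    using v w unfolding has_L2_lim_def by auto
  show "v0 + w0 \<in> L2_space D" by (rule seminorm_onD(5)[OF N L])
  show "eventually (\<lambda>s. (v + w) s \<in> L2_space D) Fl"
    using ev by eventually_elim (auto intro: seminorm_onD(5)[OF N])
  have "((\<lambda>s. L2_norm D (v s - v0) + L2_norm D (w s - w0)) \<longlongrightarrow> 0 + 0) Fl"
    using v w unfolding has_L2_lim_def by (intro tendsto_add) auto
  then have lim: "((\<lambda>s. L2_norm D (v s - v0) + L2_norm D (w s - w0)) \<longlongrightarrow> 0) Fl" by simp
  have d: "(v + w) s - (v0 + w0) = (v s - v0) + (w s - w0)" for s by simp
  show "((\<lambda>s. L2_norm D ((v + w) s - (v0 + w0))) \<longlongrightarrow> 0) Fl"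
  proof (rule tendsto_sandwich[OF _ _ tendsto_const lim])
    show "eventually (\<lambda>s. 0 \<le> L2_norm D ((v + w) s - (v0 + w0))) Fl"
      unfolding d using ev
      by eventually_elim (intro seminorm_onD(2)[OF N] seminorm_onD(5)[OF N] seminorm_onD(6)[OF N] L)
    show "eventually (\<lambda>s. L2_norm D ((v + w) s - (v0 + w0)) \<le> L2_norm D (v s - v0) + L2_norm D (w s - w0)) Fl"
      unfolding d using ev
      by eventually_elim (intro seminorm_onD(3)[OF N] seminorm_onD(6)[OF N] L)
  qed
qed

lemma has_L2_lim_scale:
  assumes v: "has_L2_lim D Fl v v0"
  shows "has_L2_lim D Fl (c *\<^sub>R v) (c *\<^sub>R v0)"
  unfolding has_L2_lim_def
proof (intro conjI)
  note N = seminorm_on_L2[of D]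
  have L: "v0 \<in> L2_space D" and ev: "eventually (\<lambda>s. v s \<in> L2_space D) Fl"
    using v unfolding has_L2_lim_def by auto
  show "c *\<^sub>R v0 \<in> L2_space D" by (rule seminorm_onD(7)[OF N L])
  show "eventually (\<lambda>s. (c *\<^sub>R v) s \<in> L2_space D) Fl"
    using ev by eventually_elim (auto intro: seminorm_onD(7)[OF N])
  have lim: "((\<lambda>s. \<bar>c\<bar> * L2_norm D (v s - v0)) \<longlongrightarrow> 0) Fl"
    using v unfolding has_L2_lim_def by (intro tendsto_mult_right_zero) simp
  have "eventually (\<lambda>s. \<bar>c\<bar> * L2_norm D (v s - v0) = L2_norm D ((c *\<^sub>R v) s - c *\<^sub>R v0)) Fl"
    using ev
  proof eventually_elim
    case (elim s)
    show ?case using seminorm_onD(4)[OF N seminorm_onD(6)[OF N elim L], of c] by (simp add: scaleR_diff_right)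
  qed
  then show "((\<lambda>s. L2_norm D ((c *\<^sub>R v) s - c *\<^sub>R v0)) \<longlongrightarrow> 0) Fl"
    by (rule Lim_transform_eventually[OF lim])
qed

lemma has_L2_lim_inner_tendsto:
  assumes v: "has_L2_lim D Fl v w" and h: "h \<in> L2_space D"
  shows "((\<lambda>s. L2_inner D (v s) h) \<longlongrightarrow> L2_inner D w h) Fl"
proof -
  note N = seminorm_on_L2[of D]
  have w: "w \<in> L2_space D" and ev: "eventually (\<lambda>s. v s \<in> L2_space D) Fl"
    and lim: "((\<lambda>s. L2_norm D (v s - w)) \<longlongrightarrow> 0) Fl"
    using v unfolding has_L2_lim_def by auto
  have le: "eventually (\<lambda>s. norm (L2_inner D (v s) h - L2_inner D w h) \<le> L2_norm D (v s - w) * L2_norm D h) Fl"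
    using ev
  proof eventually_elim
    case (elim s)
    have "L2_inner D (v s) h - L2_inner D w h = L2_inner D (v s - w) h"
      by (rule L2_inner_diff_left[OF elim w h, symmetric])
    then show ?case using L2_Cauchy_Schwarz[OF seminorm_onD(6)[OF N elim w] h] by simp
  qed
  have "((\<lambda>s. L2_norm D (v s - w) * L2_norm D h) \<longlongrightarrow> 0) Fl"
    by (rule tendsto_mult_left_zero[OF lim])
  from Lim_null_comparison[OF le this] show ?thesis by (simp only: LIM_zero_iff)
qed

lemma has_L2_lim_cong:
  assumes "has_L2_lim D Fl v w" "eventually (\<lambda>s. v s = v' s) Fl"
  shows "has_L2_lim D Fl v' w"
  unfolding has_L2_lim_def
proof (intro conjI)
  show "w \<in> L2_space D" using assms(1) unfolding has_L2_lim_def by simp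
  have "eventually (\<lambda>s. v s \<in> L2_space D) Fl" using assms(1) unfolding has_L2_lim_def by simp
  then show "eventually (\<lambda>s. v' s \<in> L2_space D) Fl" using assms(2) by eventually_elim simp
  have "((\<lambda>s. L2_norm D (v s - w)) \<longlongrightarrow> 0) Fl" using assms(1) unfolding has_L2_lim_def by simp
  moreover have "eventually (\<lambda>s. L2_norm D (v s - w) = L2_norm D (v' s - w)) Fl"
    using assms(2) by eventually_elim simp
  ultimately show "((\<lambda>s. L2_norm D (v' s - w)) \<longlongrightarrow> 0) Fl" by (rule Lim_transform_eventually)
qed

lemma has_L2_lim_scalar:
  assumes c: "c \<in> L2_space D" and \<theta>: "(\<theta> \<longlongrightarrow> \<theta>0) Fl"
  shows "has_L2_lim D Fl (\<lambda>t. \<theta> t *\<^sub>R c) (\<theta>0 *\<^sub>R c)"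
  unfolding has_L2_lim_def
proof (intro conjI)
  note N = seminorm_on_L2[of D]
  show "\<theta>0 *\<^sub>R c \<in> L2_space D" "eventually (\<lambda>s. \<theta> s *\<^sub>R c \<in> L2_space D) Fl"
    by (simp_all add: seminorm_onD(7)[OF N c])
  have "((\<lambda>s. \<bar>\<theta> s - \<theta>0\<bar> * L2_norm D c) \<longlongrightarrow> \<bar>\<theta>0 - \<theta>0\<bar> * L2_norm D c) Fl"
    by (intro tendsto_intros \<theta>)
  then show "((\<lambda>s. L2_norm D (\<theta> s *\<^sub>R c - \<theta>0 *\<^sub>R c)) \<longlongrightarrow> 0) Fl"
    by (simp add: seminorm_onD(4)[OF N c] flip: scaleR_diff_left)
qed

lemma has_L2_lim_sum:
  assumes "finite I" "\<And>i. i \<in> I \<Longrightarrow> has_L2_lim D Fl (v i) (w i)"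
  shows "has_L2_lim D Fl (\<Sum>i\<in>I. v i) (\<Sum>i\<in>I. w i)"
  using assms
proof (induction rule: finite_induct)
  case empty
  have "(\<lambda>x. 0 :: real) \<in> L2_space D" "L2_norm D (\<lambda>x. 0 :: real) = 0"
    using seminorm_onD(8,9)[OF seminorm_on_L2[of D]] by (simp_all add: zero_fun_def)
  then show ?case by (simp add: has_L2_lim_def zero_fun_def)
qed (simp add: has_L2_lim_add)

lemma continuous_into_imp_has_L2_lim:
  assumes v: "continuous_into {a..b} V n v" and "a < b"
    and V: "V \<subseteq> L2_space D"
    and n: "\<And>x. x \<in> V \<Longrightarrow> L2_norm D x \<le> n x" "\<And>x y. x \<in> V \<Longrightarrow> y \<in> V \<Longrightarrow> x - y \<in> V"
  shows "c \<in> {a..<b} \<Longrightarrow> has_L2_lim D (at_right c) v (v c)"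
    and "c \<in> {a<..b} \<Longrightarrow> has_L2_lim D (at_left c) v (v c)"
proof -
  have *: "has_L2_lim D Fl v (v c)" if c: "c \<in> {a..b}" and le: "Fl \<le> at c within {a..b}" for c Fl
    unfolding has_L2_lim_def
  proof (intro conjI)
    have vV: "v s \<in> V" if "s \<in> {a..b}" for s using v that unfolding continuous_into_def by blast
    show "v c \<in> L2_space D" using vV[OF c] V by blast
    have "eventually (\<lambda>s. s \<in> {a..b}) (at c within {a..b})" by (simp add: eventually_at_filter)
    then have ev: "eventually (\<lambda>s. s \<in> {a..b}) Fl" using le by (rule filter_leD[rotated])
    then show "eventually (\<lambda>s. v s \<in> L2_space D) Fl" by eventually_elim (use vV V in blast)
    have "((\<lambda>s. n (v s - v c)) \<longlongrightarrow> 0) (at c within {a..b})" using v c unfolding continuous_into_def by blast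
    then have lim: "((\<lambda>s. n (v s - v c)) \<longlongrightarrow> 0) Fl" using le by (rule tendsto_mono[rotated])
    show "((\<lambda>s. L2_norm D (v s - v c)) \<longlongrightarrow> 0) Fl"
    proof (rule tendsto_sandwich[OF _ _ tendsto_const lim])
      show "eventually (\<lambda>s. 0 \<le> L2_norm D (v s - v c)) Fl"
        using ev
      proof eventually_elim
        case (elim s)
        then have "v s - v c \<in> L2_space D" using n(2)[OF vV vV[OF c]] V by blast
        then show ?case by (rule seminorm_onD(2)[OF seminorm_on_L2])
      qed
      show "eventually (\<lambda>s. L2_norm D (v s - v c) \<le> n (v s - v c)) Fl"
        using ev by eventually_elim (intro n vV c)
    qed
  qed
  show "has_L2_lim D (at_right c) v (v c)" if c: "c \<in> {a..<b}"
  proof (rule *)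
    have "at_right c = at c within {c..b}" using c by (simp add: at_within_Icc_at_right)
    also have "\<dots> \<le> at c within {a..b}" using c by (intro at_le) auto
    finally show "at_right c \<le> at c within {a..b}" .
  qed (use c in auto)
  show "has_L2_lim D (at_left c) v (v c)" if c: "c \<in> {a<..b}"
  proof (rule *)
    have "at_left c = at c within {a..c}" using c by (simp add: at_within_Icc_at_left)
    also have "\<dots> \<le> at c within {a..b}" using c by (intro at_le) auto
    finally show "at_left c \<le> at c within {a..b}" .
  qed (use c in auto)
qed

lemma continuous_into_add:
  assumes V: "seminorm_on V n" and v: "continuous_into I V n v" and w: "continuous_into I V n w"
  shows "continuous_into I V n (v + w)"
  unfolding continuous_into_def
proof (intro ballI conjI)
  fix t assume t: "t \<in> I"
  have vV: "v s \<in> V" "w s \<in> V" if "s \<in> I" for s using v w that unfolding continuous_into_def by auto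
  show "(v + w) t \<in> V" using seminorm_onD(5)[OF V vV[OF t]] by simp
  have "((\<lambda>s. n (v s - v t) + n (w s - w t)) \<longlongrightarrow> 0 + 0) (at t within I)"
    using v w t unfolding continuous_into_def by (intro tendsto_add) auto
  then have lim: "((\<lambda>s. n (v s - v t) + n (w s - w t)) \<longlongrightarrow> 0) (at t within I)" by simp
  have d: "(v + w) s - (v + w) t = (v s - v t) + (w s - w t)" for s by simp
  have ev: "eventually (\<lambda>s. s \<in> I) (at t within I)" by (simp add: eventually_at_filter)
  show "((\<lambda>s. n ((v + w) s - (v + w) t)) \<longlongrightarrow> 0) (at t within I)"
  proof (rule tendsto_sandwich[OF _ _ tendsto_const lim])
    show "eventually (\<lambda>s. 0 \<le> n ((v + w) s - (v + w) t)) (at t within I)"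
      unfolding d using ev
      by eventually_elim (intro seminorm_onD(2)[OF V] seminorm_onD(5)[OF V] seminorm_onD(6)[OF V] vV t)
    show "eventually (\<lambda>s. n ((v + w) s - (v + w) t) \<le> n (v s - v t) + n (w s - w t)) (at t within I)"
      unfolding d using ev
      by eventually_elim (intro seminorm_onD(3)[OF V] seminorm_onD(6)[OF V] vV t)
  qed
qed

lemma continuous_into_scale:
  assumes V: "seminorm_on V n" and v: "continuous_into I V n v"
  shows "continuous_into I V n (c *\<^sub>R v)"
  unfolding continuous_into_def
proof (intro ballI conjI)
  fix t assume t: "t \<in> I"
  have vV: "v s \<in> V" if "s \<in> I" for s using v that unfolding continuous_into_def by auto
  show "(c *\<^sub>R v) t \<in> V" using seminorm_onD(7)[OF V vV[OF t]] by simp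
  have lim: "((\<lambda>s. \<bar>c\<bar> * n (v s - v t)) \<longlongrightarrow> 0) (at t within I)"
    using v t unfolding continuous_into_def by (intro tendsto_mult_right_zero) auto
  have "eventually (\<lambda>s. s \<in> I) (at t within I)" by (simp add: eventually_at_filter)
  then have "eventually (\<lambda>s. \<bar>c\<bar> * n (v s - v t) = n ((c *\<^sub>R v) s - (c *\<^sub>R v) t)) (at t within I)"
  proof eventually_elim
    case (elim s)
    show ?case using seminorm_onD(4)[OF V seminorm_onD(6)[OF V vV[OF elim] vV[OF t]], of c]
      by (simp add: scaleR_diff_right)
  qed
  then show "((\<lambda>s. n ((c *\<^sub>R v) s - (c *\<^sub>R v) t)) \<longlongrightarrow> 0) (at t within I)"
    by (rule Lim_transform_eventually[OF lim])
qed

lemma continuous_into_scalar: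
  assumes V: "seminorm_on V n" and c: "c \<in> V" and \<theta>: "continuous_on I \<theta>"
  shows "continuous_into I V n (\<lambda>t. \<theta> t *\<^sub>R c)"
  unfolding continuous_into_def
proof (intro ballI conjI)
  fix t assume t: "t \<in> I"
  show "\<theta> t *\<^sub>R c \<in> V" by (rule seminorm_onD(7)[OF V c])
  have "(\<theta> \<longlongrightarrow> \<theta> t) (at t within I)" using \<theta> t by (simp add: continuous_on_def)
  then have "((\<lambda>s. \<bar>\<theta> s - \<theta> t\<bar> * n c) \<longlongrightarrow> \<bar>\<theta> t - \<theta> t\<bar> * n c) (at t within I)"
    by (intro tendsto_intros)
  then show "((\<lambda>s. n (\<theta> s *\<^sub>R c - \<theta> t *\<^sub>R c)) \<longlongrightarrow> 0) (at t within I)"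
    by (simp add: seminorm_onD(4)[OF V c] flip: scaleR_diff_left)
qed

lemma integral_Ioc_combine:
  fixes f :: "real \<Rightarrow> real"
  assumes "a \<le> b" "b \<le> c" "integrable (lebesgue_on {a<..c}) f"
  shows "(LINT t|lebesgue_on {a<..c}. f t) = (LINT t|lebesgue_on {a<..b}. f t) + (LINT t|lebesgue_on {b<..c}. f t)"
proof -
  have si: "set_integrable lebesgue {a<..c} f"
    using assms(3) by (simp add: set_integrable_def integrable_restrict_space)
  have "set_lebesgue_integral lebesgue ({a<..b} \<union> {b<..c}) f
      = set_lebesgue_integral lebesgue {a<..b} f + set_lebesgue_integral lebesgue {b<..c} f"
    by (rule set_integral_Un) (use assms(1,2) in \<open>auto intro: set_integrable_subset[OF si]\<close>)
  moreover have "{a<..b} \<union> {b<..c} = {a<..c}" using assms(1,2) by auto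
  ultimately show ?thesis
    by (simp add: set_lebesgue_integral_def integral_restrict_space)
qed

context bounded_open_domain
begin

lemma Hminus1: "seminorm_on (Hminus1_space D) (Hminus1_norm D)"
  unfolding Hminus1_space_def Hminus1_norm_def by (rule seminorm_on_dual_space[OF H10])

lemma Hminus1_pairing:
  "bounded_bilinear_on (Hminus1_space D) (Hminus1_norm D) (H10_space D) (H1_norm D) (\<lambda>l h. l h)"
  unfolding Hminus1_space_def Hminus1_norm_def by (rule bounded_bilinear_on_dual_pairing[OF H10])

lemma L2_pairing:
  "bounded_bilinear_on (H10_space D) (H1_norm D) (H10_space D) (H1_norm D) (L2_inner D)"
  by (rule bounded_bilinear_on_L2_inner) (auto intro: H10_spaceD L2_norm_le_H1_norm)

lemma L2_inner_in_Hminus1: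
  assumes "c \<in> H10_space D"
  shows "L2_inner D c \<in> Hminus1_space D"
proof -
  obtain K where K: "\<And>x z. x \<in> H10_space D \<Longrightarrow> z \<in> H10_space D \<Longrightarrow> \<bar>L2_inner D x z\<bar> \<le> K * (H1_norm D x * H1_norm D z)"
    using bounded_bilinear_on_bound[OF L2_pairing] by auto
  have "\<bar>L2_inner D c h\<bar> \<le> (K * H1_norm D c) * H1_norm D h" if "h \<in> H10_space D" for h
    using K[OF assms that] by (simp add: mult.assoc)
  then show ?thesis
    unfolding Hminus1_space_def dual_space_def bounded_linear_maps_def
    using bounded_bilinear_onD(3,4)[OF L2_pairing assms]
    by (intro CollectI conjI ballI allI exI[of _ "K * H1_norm D c"]) auto
qed

lemma bochner_const: "w \<in> H10_space D \<Longrightarrow> (\<lambda>t. w) \<in> bochner_L2 {a<..b} (H10_space D) (H1_norm D)"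
  using bochner_L2_scalar[OF Ioc_lmeasurable H10, of w "\<lambda>t. 1" a b 1] by simp

lemma has_weak_dtD:
  assumes "has_weak_dt D a b v g"
  shows "g \<in> bochner_L2 {a<..b} (Hminus1_space D) (Hminus1_norm D)"
    and "w \<in> H10_space D \<Longrightarrow> \<eta> \<in> test_functions {a<..<b} \<Longrightarrow>
      (LINT t|lebesgue_on {a<..b}. deriv \<eta> t * L2_inner D (v t) w) = - (LINT t|lebesgue_on {a<..b}. \<eta> t * g t w)"
  using assms unfolding has_weak_dt_def by auto

lemma has_weak_dt_weak_dt: "has_weak_dt D a b v g \<Longrightarrow> has_weak_dt D a b v (weak_dt D a b v)"
  unfolding weak_dt_def by (rule someI[of "has_weak_dt D a b v"])

lemma integrable_dt_pairing:
  assumes "g \<in> bochner_L2 {a<..b} (Hminus1_space D) (Hminus1_norm D)"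
    and "\<phi> \<in> bochner_L2 {a<..b} (H10_space D) (H1_norm D)"
  shows "integrable (lebesgue_on {a<..b}) (\<lambda>t. g t (\<phi> t))"
  by (rule integrable_bounded_bilinear_bochner[OF _ Hminus1 H10 Hminus1_pairing assms]) simp

lemma integrable_L2_pairing:
  assumes "v \<in> bochner_L2 {a<..b} (H10_space D) (H1_norm D)"
    and "\<phi> \<in> bochner_L2 {a<..b} (H10_space D) (H1_norm D)"
  shows "integrable (lebesgue_on {a<..b}) (\<lambda>t. L2_inner D (v t) (\<phi> t))"
  by (rule integrable_bounded_bilinear_bochner[OF _ H10 H10 L2_pairing assms]) simp

text \<open>For a fixed \<open>w\<close> the du Bois-Reymond lemma gives equality outside a null set depending on
  \<open>w\<close>.  The simple functions that approximate \<open>\<phi>\<close> take only countably many values altogether, so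
  one null set serves all of them, and boundedness of the functionals allows passing to
  the limit.\<close>

lemma has_weak_dt_unique:
  assumes g: "has_weak_dt D a b v g" and h: "has_weak_dt D a b v h"
    and \<phi>: "\<phi> \<in> bochner_L2 {a<..b} (H10_space D) (H1_norm D)"
  shows "AE t in lebesgue_on {a<..b}. g t (\<phi> t) = h t (\<phi> t)"
proof -
  let ?I = "{a<..b}" and ?J = "{a<..<b}"
  have fixed: "AE t in lebesgue_on ?I. g t w = h t w" if w: "w \<in> H10_space D" for w
  proof -
    have ig: "integrable (lebesgue_on ?I) (\<lambda>t. g t w)" and ih: "integrable (lebesgue_on ?I) (\<lambda>t. h t w)"
      by (rule integrable_dt_pairing[OF has_weak_dtD(1)[OF g] bochner_const[OF w]],
        rule integrable_dt_pairing[OF has_weak_dtD(1)[OF h] bochner_const[OF w]])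
    have "AE t in lebesgue_on ?J. g t w - h t w = 0"
    proof (rule du_Bois_Reymond)
      show "open ?J" by simp
      show "integrable (lebesgue_on ?J) (\<lambda>t. g t w - h t w)"
        by (rule integrable_lebesgue_on_subset[OF Bochner_Integration.integrable_diff[OF ig ih]]) auto
      fix \<eta> :: "real \<Rightarrow> real" assume \<eta>: "\<eta> \<in> test_functions ?J"
      have cont: "continuous_on UNIV \<eta>" by (rule smooth_continuous[OF test_functionsD(1)[OF \<eta>]])
      have "(LINT t|lebesgue_on ?I. \<eta> t *\<^sub>R (g t w - h t w)) = (LINT t|lebesgue_on ?J. \<eta> t *\<^sub>R (g t w - h t w))"
        by (rule integral_lebesgue_on_subset) (use test_functionsD(5)[OF \<eta>] in auto)
      moreover have "(LINT t|lebesgue_on ?I. \<eta> t *\<^sub>R (g t w - h t w))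
          = (LINT t|lebesgue_on ?I. \<eta> t * g t w) - (LINT t|lebesgue_on ?I. \<eta> t * h t w)"
        using integrable_continuous_mult_Ioc[OF cont ig] integrable_continuous_mult_Ioc[OF cont ih]
        by (simp add: right_diff_distrib)
      ultimately show "(LINT t|lebesgue_on ?J. \<eta> t *\<^sub>R (g t w - h t w)) = 0"
        using has_weak_dtD(2)[OF g w \<eta>] has_weak_dtD(2)[OF h w \<eta>] by simp
    qed
    then have "AE t in lebesgue. t \<in> ?J \<longrightarrow> g t w - h t w = 0" by (simp add: AE_restrict_space_iff)
    moreover have "AE t in lebesgue. t \<notin> {b}" by (rule AE_not_in) auto
    ultimately have "AE t in lebesgue. t \<in> ?I \<longrightarrow> g t w = h t w" by eventually_elim auto
    then show ?thesis by (simp add: AE_restrict_space_iff)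
  qed
  obtain s where s: "\<And>n::nat. simple_function (lebesgue_on ?I) (s n)" "\<And>n t. t \<in> ?I \<Longrightarrow> s n t \<in> H10_space D"
    "AE t in lebesgue_on ?I. \<phi> t \<in> H10_space D \<and> (\<lambda>n. H1_norm D (s n t - \<phi> t)) \<longlonglongrightarrow> 0"
    using bochner_L2D[OF \<phi>] by blast
  have "AE t in lebesgue_on ?I. \<forall>n. \<forall>w\<in>s n ` ?I. g t w = h t w"
  proof (subst AE_all_countable, intro allI)
    fix n
    have "finite (s n ` ?I)" using s(1)[of n] unfolding simple_function_def by simp
    then show "AE t in lebesgue_on ?I. \<forall>w\<in>s n ` ?I. g t w = h t w"
      by (subst AE_ball_countable[OF countable_finite]) (use fixed s(2) in auto)
  qed
  moreover have "AE t in lebesgue_on ?I. t \<in> ?I" using AE_space[of "lebesgue_on ?I"] by simp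
  ultimately show ?thesis
    using s(3) bochner_L2_AE[OF has_weak_dtD(1)[OF g]] bochner_L2_AE[OF has_weak_dtD(1)[OF h]]
  proof eventually_elim
    case (elim t)
    have lim: "(\<lambda>n. l (s n t)) \<longlonglongrightarrow> l (\<phi> t)" if l: "l \<in> Hminus1_space D" for l
    proof (rule bounded_bilinear_on_tendsto[OF Hminus1 H10 Hminus1_pairing l l])
      show "(\<lambda>n. Hminus1_norm D (l - l)) \<longlonglongrightarrow> 0" using seminorm_onD(9)[OF Hminus1] by simp
    qed (use elim s(2) in auto)
    have "(\<lambda>n. g t (s n t)) = (\<lambda>n. h t (s n t))" using elim by (intro ext) auto
    then show ?case using lim[OF elim(4)] lim[OF elim(5)] LIMSEQ_unique by metis
  qed
qed

lemma has_weak_dt_integral_eq: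
  assumes g: "has_weak_dt D a b v g" and h: "has_weak_dt D a b v h"
    and \<phi>: "\<phi> \<in> bochner_L2 {a<..b} (H10_space D) (H1_norm D)"
  shows "(LINT t|lebesgue_on {a<..b}. g t (\<phi> t)) = (LINT t|lebesgue_on {a<..b}. h t (\<phi> t))"
  by (rule integral_cong_AE[OF borel_measurable_integrable[OF integrable_dt_pairing[OF has_weak_dtD(1)[OF g] \<phi>]]
    borel_measurable_integrable[OF integrable_dt_pairing[OF has_weak_dtD(1)[OF h] \<phi>]] has_weak_dt_unique[OF g h \<phi>]])

lemma has_weak_dt_add:
  assumes g: "has_weak_dt D a b v g" and h: "has_weak_dt D a b w h"
    and v: "v \<in> bochner_L2 {a<..b} (H10_space D) (H1_norm D)"
    and w: "w \<in> bochner_L2 {a<..b} (H10_space D) (H1_norm D)"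
  shows "has_weak_dt D a b (v + w) (g + h)"
  unfolding has_weak_dt_def
proof (intro conjI ballI)
  let ?I = "{a<..b}"
  show "g + h \<in> bochner_L2 ?I (Hminus1_space D) (Hminus1_norm D)"
    using has_weak_dtD(1)[OF g] has_weak_dtD(1)[OF h] by (intro subspace_add subspace_bochner_L2 Hminus1) auto
  fix x \<eta> assume x: "x \<in> H10_space D" and \<eta>: "\<eta> \<in> test_functions {a<..<b}"
  note sm = test_functionsD(1)[OF \<eta>]
  have c: "continuous_on UNIV \<eta>" "continuous_on UNIV (deriv \<eta>)"
    by (intro smooth_continuous sm smooth_deriv)+
  note i1 = integrable_continuous_mult_Ioc[OF c(2) integrable_L2_pairing[OF v bochner_const[OF x]]]
    integrable_continuous_mult_Ioc[OF c(2) integrable_L2_pairing[OF w bochner_const[OF x]]]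
  note i2 = integrable_continuous_mult_Ioc[OF c(1) integrable_dt_pairing[OF has_weak_dtD(1)[OF g] bochner_const[OF x]]]
    integrable_continuous_mult_Ioc[OF c(1) integrable_dt_pairing[OF has_weak_dtD(1)[OF h] bochner_const[OF x]]]
  have sum: "(v + w) \<in> bochner_L2 ?I (H10_space D) (H1_norm D)"
    using v w by (intro subspace_add subspace_bochner_L2 H10) auto
  have "(LINT t|lebesgue_on ?I. deriv \<eta> t * L2_inner D ((v + w) t) x)
      = (LINT t|lebesgue_on ?I. deriv \<eta> t * L2_inner D (v t) x + deriv \<eta> t * L2_inner D (w t) x)"
  proof (rule integral_cong_AE)
    show "AE t in lebesgue_on ?I. deriv \<eta> t * L2_inner D ((v + w) t) x
        = deriv \<eta> t * L2_inner D (v t) x + deriv \<eta> t * L2_inner D (w t) x"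
      using bochner_L2_AE[OF v] bochner_L2_AE[OF w]
    proof eventually_elim
      case (elim t)
      show ?case
        using L2_inner_add_left[OF H10_spaceD(2)[OF elim(1)] H10_spaceD(2)[OF elim(2)] H10_spaceD(2)[OF x]]
        by (simp add: distrib_left)
    qed
    show "(\<lambda>t. deriv \<eta> t * L2_inner D ((v + w) t) x) \<in> borel_measurable (lebesgue_on ?I)"
      by (rule borel_measurable_integrable[OF integrable_continuous_mult_Ioc[OF c(2) integrable_L2_pairing[OF sum bochner_const[OF x]]]])
    show "(\<lambda>t. deriv \<eta> t * L2_inner D (v t) x + deriv \<eta> t * L2_inner D (w t) x) \<in> borel_measurable (lebesgue_on ?I)"
      by (rule borel_measurable_integrable[OF Bochner_Integration.integrable_add[OF i1]])
  qed
  also have "\<dots> = - (LINT t|lebesgue_on ?I. \<eta> t * g t x) + - (LINT t|lebesgue_on ?I. \<eta> t * h t x)"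
    by (simp only: Bochner_Integration.integral_add[OF i1] has_weak_dtD(2)[OF g x \<eta>] has_weak_dtD(2)[OF h x \<eta>])
  also have "\<dots> = - (LINT t|lebesgue_on ?I. \<eta> t * (g + h) t x)"
    using Bochner_Integration.integral_add[OF i2] by (simp add: distrib_left)
  finally show "(LINT t|lebesgue_on ?I. deriv \<eta> t * L2_inner D ((v + w) t) x)
      = - (LINT t|lebesgue_on ?I. \<eta> t * (g + h) t x)" .
qed

lemma has_weak_dt_scale:
  assumes g: "has_weak_dt D a b v g"
  shows "has_weak_dt D a b (c *\<^sub>R v) (c *\<^sub>R g)"
  unfolding has_weak_dt_def
proof (intro conjI ballI)
  show "c *\<^sub>R g \<in> bochner_L2 {a<..b} (Hminus1_space D) (Hminus1_norm D)"
    using has_weak_dtD(1)[OF g] by (intro subspace_scale subspace_bochner_L2 Hminus1) auto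
  fix x \<eta> assume x: "x \<in> H10_space D" and \<eta>: "\<eta> \<in> test_functions {a<..<b}"
  have "(LINT t|lebesgue_on {a<..b}. deriv \<eta> t * L2_inner D ((c *\<^sub>R v) t) x)
      = c * (LINT t|lebesgue_on {a<..b}. deriv \<eta> t * L2_inner D (v t) x)"
    by (simp add: L2_inner_scale_left mult.left_commute)
  also have "\<dots> = c * - (LINT t|lebesgue_on {a<..b}. \<eta> t * g t x)"
    by (simp only: has_weak_dtD(2)[OF g x \<eta>])
  also have "\<dots> = - (LINT t|lebesgue_on {a<..b}. \<eta> t * (c *\<^sub>R g) t x)"
    by (simp add: mult.left_commute)
  finally show "(LINT t|lebesgue_on {a<..b}. deriv \<eta> t * L2_inner D ((c *\<^sub>R v) t) x)
      = - (LINT t|lebesgue_on {a<..b}. \<eta> t * (c *\<^sub>R g) t x)" .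
qed

lemma has_weak_dt_cong:
  assumes g: "has_weak_dt D a b v g" and eq: "\<And>t. t \<in> {a<..b} \<Longrightarrow> v t = w t"
  shows "has_weak_dt D a b w g"
proof -
  have "(LINT t|lebesgue_on {a<..b}. deriv \<eta> t * L2_inner D (w t) x)
      = (LINT t|lebesgue_on {a<..b}. deriv \<eta> t * L2_inner D (v t) x)" for \<eta> x
    by (rule Bochner_Integration.integral_cong) (simp_all add: eq)
  then show ?thesis using g unfolding has_weak_dt_def by simp
qed

lemma has_weak_dt_restrict:
  assumes g: "has_weak_dt D a b v g" and "a \<le> c" "d \<le> b"
  shows "has_weak_dt D c d v g"
  unfolding has_weak_dt_def
proof (intro conjI ballI)
  show "g \<in> bochner_L2 {c<..d} (Hminus1_space D) (Hminus1_norm D)"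
    by (rule bochner_L2_restrict[OF has_weak_dtD(1)[OF g]]) (use assms in auto)
  fix x \<eta> assume x: "x \<in> H10_space D" and \<eta>: "\<eta> \<in> test_functions {c<..<d}"
  have "{c<..<d} \<subseteq> {a<..<b}" using assms(2,3) by auto
  then have \<eta>': "\<eta> \<in> test_functions {a<..<b}"
    by (rule subsetD[OF test_functions_mono \<eta>])
  have z: "\<eta> t = 0" "deriv \<eta> t = 0" if "t \<notin> {c<..<d}" for t
  proof -
    show "\<eta> t = 0" by (rule test_functionsD(5)[OF \<eta> that])
    have "deriv \<eta> t = frechet_derivative \<eta> (at t) 1"
      using fun_cong[OF frechet_derivative_at[OF smooth_real_derivative[OF test_functionsD(1)[OF \<eta>], of t, unfolded has_field_derivative_def]], of 1]
      by simp
    also have "\<dots> = 0" using test_functionsD(5)[OF test_functions_partial[OF \<eta>, of 1] that] by simp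
    finally show "deriv \<eta> t = 0" .
  qed
  have "(LINT t|lebesgue_on {a<..b}. deriv \<eta> t * L2_inner D (v t) x) = (LINT t|lebesgue_on {c<..d}. deriv \<eta> t * L2_inner D (v t) x)"
    by (rule integral_lebesgue_on_subset) (use assms z in auto)
  moreover have "(LINT t|lebesgue_on {a<..b}. \<eta> t * g t x) = (LINT t|lebesgue_on {c<..d}. \<eta> t * g t x)"
    by (rule integral_lebesgue_on_subset) (use assms z in auto)
  ultimately show "(LINT t|lebesgue_on {c<..d}. deriv \<eta> t * L2_inner D (v t) x) = - (LINT t|lebesgue_on {c<..d}. \<eta> t * g t x)"
    using has_weak_dtD(2)[OF g x \<eta>'] by simp
qed

lemma has_weak_dt_scalar:
  assumes "a \<le> b" and \<theta>: "smooth \<theta>" and c: "c \<in> H10_space D"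
  shows "has_weak_dt D a b (\<lambda>t. \<theta> t *\<^sub>R c) (\<lambda>t. deriv \<theta> t *\<^sub>R L2_inner D c)"
  unfolding has_weak_dt_def
proof (intro conjI ballI)
  have c': "continuous_on UNIV (deriv \<theta>)" by (intro smooth_continuous smooth_deriv \<theta>)
  obtain B where B: "\<And>t. t \<in> {a<..b} \<Longrightarrow> \<bar>deriv \<theta> t\<bar> \<le> B" using bounded_on_Ioc[OF c'] by blast
  show "(\<lambda>t. deriv \<theta> t *\<^sub>R L2_inner D c) \<in> bochner_L2 {a<..b} (Hminus1_space D) (Hminus1_norm D)"
    by (rule bochner_L2_scalar[OF Ioc_lmeasurable Hminus1 L2_inner_in_Hminus1[OF c]
      continuous_measurable_lebesgue_on[OF c'] B])
  fix x \<eta> assume x: "x \<in> H10_space D" and \<eta>: "\<eta> \<in> test_functions {a<..<b}"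
  note sm = test_functionsD(1)[OF \<eta>]
  have "(LINT t|lebesgue_on {a<..b}. deriv \<eta> t * \<theta> t + deriv \<theta> t * \<eta> t) = \<eta> b * \<theta> b - \<eta> a * \<theta> a"
    by (rule integral_Ioc_FTC[OF assms(1) DERIV_mult[OF smooth_real_derivative[OF sm] smooth_real_derivative[OF \<theta>]]])
      (intro smooth_continuous smooth_add smooth_mult smooth_deriv sm \<theta>)
  also have "\<dots> = 0" using test_functionsD(5)[OF \<eta>, of a] test_functionsD(5)[OF \<eta>, of b] by simp
  finally have 0: "(LINT t|lebesgue_on {a<..b}. deriv \<eta> t * \<theta> t) + (LINT t|lebesgue_on {a<..b}. deriv \<theta> t * \<eta> t) = 0"
    by (subst (asm) Bochner_Integration.integral_add)
      (intro integrable_continuous_Ioc smooth_continuous smooth_mult smooth_deriv sm \<theta>)+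
  have "(LINT t|lebesgue_on {a<..b}. deriv \<eta> t * L2_inner D (\<theta> t *\<^sub>R c) x)
      = (LINT t|lebesgue_on {a<..b}. deriv \<eta> t * \<theta> t) * L2_inner D c x"
    by (simp add: L2_inner_scale_left flip: mult.assoc)
  also have "\<dots> = - ((LINT t|lebesgue_on {a<..b}. deriv \<theta> t * \<eta> t) * L2_inner D c x)"
    using 0 by (simp add: add_eq_0_iff)
  also have "(LINT t|lebesgue_on {a<..b}. deriv \<theta> t * \<eta> t) * L2_inner D c x
      = (LINT t|lebesgue_on {a<..b}. (deriv \<theta> t * \<eta> t) * L2_inner D c x)"
    by simp
  also have "\<dots> = (LINT t|lebesgue_on {a<..b}. \<eta> t * (deriv \<theta> t *\<^sub>R L2_inner D c) x)"
    by (intro Bochner_Integration.integral_cong refl) (simp add: mult_ac)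
  finally show "(LINT t|lebesgue_on {a<..b}. deriv \<eta> t * L2_inner D (\<theta> t *\<^sub>R c) x)
      = - (LINT t|lebesgue_on {a<..b}. \<eta> t * (deriv \<theta> t *\<^sub>R L2_inner D c) x)" .
qed

lemma bochner_L2_smooth_scalar:
  assumes "smooth \<theta>" "c \<in> H10_space D"
  shows "(\<lambda>t. \<theta> t *\<^sub>R c) \<in> bochner_L2 {a<..b} (H10_space D) (H1_norm D)"
proof -
  have c': "continuous_on UNIV \<theta>" by (intro smooth_continuous assms)
  obtain B where B: "\<And>t. t \<in> {a<..b} \<Longrightarrow> \<bar>\<theta> t\<bar> \<le> B" using bounded_on_Ioc[OF c'] by blast
  show ?thesis
    by (rule bochner_L2_scalar[OF Ioc_lmeasurable H10 assms(2) continuous_measurable_lebesgue_on[OF c'] B])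
qed

lemma has_weak_dt_sum_scalar:
  assumes "a \<le> b" "finite J" "\<And>j. j \<in> J \<Longrightarrow> smooth (\<theta> j)" "\<And>j. j \<in> J \<Longrightarrow> c j \<in> H10_space D"
  shows "has_weak_dt D a b (\<lambda>t. \<Sum>j\<in>J. \<theta> j t *\<^sub>R c j) (\<lambda>t. \<Sum>j\<in>J. deriv (\<theta> j) t *\<^sub>R L2_inner D (c j))
    \<and> (\<lambda>t. \<Sum>j\<in>J. \<theta> j t *\<^sub>R c j) \<in> bochner_L2 {a<..b} (H10_space D) (H1_norm D)"
  using assms(2-)
proof (induction rule: finite_induct)
  case empty
  have "0 \<in> bochner_L2 {a<..b} (Hminus1_space D) (Hminus1_norm D)"
    by (intro subspace_0 subspace_bochner_L2 Hminus1) simp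
  moreover have "0 \<in> bochner_L2 {a<..b} (H10_space D) (H1_norm D)"
    by (intro subspace_0 subspace_bochner_L2 H10) simp
  ultimately show ?case
    by (simp add: has_weak_dt_def L2_inner_def zero_fun_def)
next
  case (insert i J)
  have 1: "has_weak_dt D a b (\<lambda>t. \<theta> i t *\<^sub>R c i) (\<lambda>t. deriv (\<theta> i) t *\<^sub>R L2_inner D (c i))"
    using insert by (intro has_weak_dt_scalar assms(1)) auto
  have 2: "(\<lambda>t. \<theta> i t *\<^sub>R c i) \<in> bochner_L2 {a<..b} (H10_space D) (H1_norm D)"
    using insert by (intro bochner_L2_smooth_scalar) auto
  have 3: "has_weak_dt D a b (\<lambda>t. \<Sum>j\<in>J. \<theta> j t *\<^sub>R c j) (\<lambda>t. \<Sum>j\<in>J. deriv (\<theta> j) t *\<^sub>R L2_inner D (c j))"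
    and 4: "(\<lambda>t. \<Sum>j\<in>J. \<theta> j t *\<^sub>R c j) \<in> bochner_L2 {a<..b} (H10_space D) (H1_norm D)"
    by (rule conjunct1[OF insert.IH], use insert.prems in auto)
      (rule conjunct2[OF insert.IH], use insert.prems in auto)
  have "has_weak_dt D a b ((\<lambda>t. \<theta> i t *\<^sub>R c i) + (\<lambda>t. \<Sum>j\<in>J. \<theta> j t *\<^sub>R c j))
      ((\<lambda>t. deriv (\<theta> i) t *\<^sub>R L2_inner D (c i)) + (\<lambda>t. \<Sum>j\<in>J. deriv (\<theta> j) t *\<^sub>R L2_inner D (c j)))"
    by (rule has_weak_dt_add[OF 1 3 2 4])
  moreover have "(\<lambda>t. \<theta> i t *\<^sub>R c i) + (\<lambda>t. \<Sum>j\<in>J. \<theta> j t *\<^sub>R c j) \<in> bochner_L2 {a<..b} (H10_space D) (H1_norm D)"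
    using 2 4 by (intro subspace_add subspace_bochner_L2 H10) auto
  moreover have "(\<lambda>t. \<theta> i t *\<^sub>R c i) + (\<lambda>t. \<Sum>j\<in>J. \<theta> j t *\<^sub>R c j) = (\<lambda>t. \<Sum>j\<in>insert i J. \<theta> j t *\<^sub>R c j)"
    by (rule ext) (simp only: sum.insert[OF insert(1,2)] plus_fun_apply)
  moreover have "(\<lambda>t. deriv (\<theta> i) t *\<^sub>R L2_inner D (c i)) + (\<lambda>t. \<Sum>j\<in>J. deriv (\<theta> j) t *\<^sub>R L2_inner D (c j))
      = (\<lambda>t. \<Sum>j\<in>insert i J. deriv (\<theta> j) t *\<^sub>R L2_inner D (c j))"
    by (rule ext) (simp only: sum.insert[OF insert(1,2)] plus_fun_apply)
  ultimately show ?case by (simp only: simp_thms)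
qed

end

section \<open>Function spaces of the problem\<close>

lemma sum_fun_apply: "(\<Sum>i\<in>I. f i) x = (\<Sum>i\<in>I. f i x)"
  by (induction I rule: infinite_finite_induct) simp_all

lemma sum_shift_pred:
  fixes B :: "nat \<Rightarrow> real"
  assumes "1 \<le> M"
  shows "(\<Sum>m=1..M. B m) = (\<Sum>m=2..M. B (m - 1)) + B M"
  using assms
proof (induction M rule: dec_induct)
  case (step n)
  have "{2..Suc n} = insert (Suc n) {2..n}" using step by auto
  then show ?case using step by simp
qed simp

lemma sum_split_first:
  fixes B :: "nat \<Rightarrow> real"
  assumes "1 \<le> M"
  shows "(\<Sum>m=1..M. B m) = B 1 + (\<Sum>m=2..M. B m)"
  using sum.atLeast_Suc_atMost[OF assms, of B] by (simp add: numeral_2_eq_2)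

lemma weakly_monotone_grid:
  fixes f :: "nat \<Rightarrow> real"
  assumes "\<And>m. m \<in> {1..M} \<Longrightarrow> f (m - 1) < f m" "k \<le> n" "n \<le> M"
  shows "f k \<le> f n"
  using assms(2,3)
proof (induction n rule: dec_induct)
  case (step n)
  then show ?case using assms(1)[of "Suc n"] by simp
qed simp

locale convection_diffusion_problem =
  fixes P :: "'a::euclidean_space problem"
  assumes problem_data: "problem_data P"
begin

abbreviation "D \<equiv> dom P"
abbreviation "V \<equiv> H10_space (dom P)"
abbreviation "nV \<equiv> H1_norm (dom P)"
abbreviation "M \<equiv> nsteps P"
abbreviation "Tend \<equiv> final_time P"

lemma domain: "open D" "D \<in> lmeasurable"
proof -
  show "open D" using problem_data unfolding problem_data_def polyhedral_domain_def by blast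
  moreover have "bounded D" using problem_data unfolding problem_data_def polyhedral_domain_def by blast
  ultimately show "D \<in> lmeasurable" by (rule lmeasurable_open[rotated])
qed

sublocale bounded_open_domain "dom P"
  by unfold_locales (rule domain)+

definition velocity_bound :: real
  where "velocity_bound = (SOME C. 0 \<le> C \<and> (AE x in lebesgue_on D. norm (velocity P x) \<le> C))"

lemma velocity_bound: "0 \<le> velocity_bound" "AE x in lebesgue_on D. norm (velocity P x) \<le> velocity_bound"
proof -
  obtain C where C: "AE x in lebesgue_on D. norm (velocity P x) \<le> C"
    using problem_data unfolding problem_data_def by blast
  have "AE x in lebesgue_on D. norm (velocity P x) \<le> \<bar>C\<bar>" using C by eventually_elim simp
  then have "0 \<le> \<bar>C\<bar> \<and> (AE x in lebesgue_on D. norm (velocity P x) \<le> \<bar>C\<bar>)" by simp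
  then have "0 \<le> velocity_bound \<and> (AE x in lebesgue_on D. norm (velocity P x) \<le> velocity_bound)"
    unfolding velocity_bound_def by (rule someI)
  then show "0 \<le> velocity_bound" "AE x in lebesgue_on D. norm (velocity P x) \<le> velocity_bound" by simp_all
qed

sublocale flow: solenoidal_flow "dom P" "velocity P" velocity_bound
proof unfold_locales
  show "(\<lambda>x. velocity P x \<bullet> i) \<in> H1_space D" if "i \<in> Basis" for i
    using problem_data that unfolding problem_data_def by blast
  show "AE x in lebesgue_on D. wdiv D (velocity P) x = 0"
    using problem_data unfolding problem_data_def by blast
qed (rule velocity_bound)+

lemma grid_0: "grid P 0 = 0"
  and M_pos: "1 \<le> M"
  and grid_less: "m \<in> {1..M} \<Longrightarrow> grid P (m - 1) < grid P m"
  using problem_data unfolding problem_data_def by blast+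

lemma grid_mono: "k \<le> n \<Longrightarrow> n \<le> M \<Longrightarrow> grid P k \<le> grid P n"
  using weakly_monotone_grid[of M "grid P"] grid_less by blast

lemma grid_bounds: "m \<le> M \<Longrightarrow> 0 \<le> grid P m" "m \<le> M \<Longrightarrow> grid P m \<le> Tend"
  using grid_mono[of 0 m] grid_mono[of m M] by (simp_all add: grid_0 final_time_def)

lemma grid_less_Tend: "k < M \<Longrightarrow> grid P k < Tend"
  using grid_less[of "Suc k"] grid_bounds(2)[of "Suc k"] by simp

lemma Tend_pos: "0 < Tend"
  using grid_less_Tend[of 0] M_pos by (simp add: grid_0)

lemma subint_subset: "m \<in> {1..M} \<Longrightarrow> subint P m \<subseteq> time_int P"
proof -
  assume "m \<in> {1..M}"
  then have "m - 1 \<le> M" "m \<le> M" by auto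
  then show ?thesis
    using grid_bounds(1)[of "m - 1"] grid_bounds(2)[of m] by (auto simp: subint_def time_int_def)
qed

lemma time_int_sets: "time_int P \<in> sets lebesgue" and subint_sets: "subint P m \<in> sets lebesgue"
  by (simp_all add: time_int_def subint_def)

definition L2_H10 :: "'a st_fun set"
  where "L2_H10 = bochner_L2 (time_int P) V nV"

lemma L2_H10_subspace: "subspace L2_H10"
  unfolding L2_H10_def by (rule subspace_bochner_L2[OF time_int_sets H10])

lemma L2_H10_subint: "v \<in> L2_H10 \<Longrightarrow> m \<in> {1..M} \<Longrightarrow> v \<in> bochner_L2 {grid P (m - 1)<..grid P m} V nV"
  unfolding L2_H10_def using bochner_L2_restrict[OF _ time_int_sets subint_sets subint_subset] by (simp add: subint_def)

lemma L2_H10_AE: "v \<in> L2_H10 \<Longrightarrow> AE t in lebesgue_on (time_int P). v t \<in> V"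
  unfolding L2_H10_def by (rule bochner_L2_AE)

lemma integrable_L2_H10:
  assumes "bounded_bilinear_on V nV V nV B" "v \<in> L2_H10" "w \<in> L2_H10"
  shows "integrable (lebesgue_on (time_int P)) (\<lambda>t. B (v t) (w t))"
  using integrable_bounded_bilinear_bochner[OF time_int_sets H10 H10 assms(1)] assms(2,3) unfolding L2_H10_def by blast

lemma integral_L2_H10_linear:
  assumes B: "bounded_bilinear_on V nV V nV B" and v: "v \<in> L2_H10" "v' \<in> L2_H10" and w: "w \<in> L2_H10" "w' \<in> L2_H10"
  shows "(LINT t|lebesgue_on (time_int P). B ((v + v') t) (w t))
      = (LINT t|lebesgue_on (time_int P). B (v t) (w t)) + (LINT t|lebesgue_on (time_int P). B (v' t) (w t))"
    and "(LINT t|lebesgue_on (time_int P). B ((c *\<^sub>R v) t) (w t)) = c * (LINT t|lebesgue_on (time_int P). B (v t) (w t))"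
    and "(LINT t|lebesgue_on (time_int P). B (v t) ((w + w') t))
      = (LINT t|lebesgue_on (time_int P). B (v t) (w t)) + (LINT t|lebesgue_on (time_int P). B (v t) (w' t))"
    and "(LINT t|lebesgue_on (time_int P). B (v t) ((c *\<^sub>R w) t)) = c * (LINT t|lebesgue_on (time_int P). B (v t) (w t))"
proof -
  let ?M = "lebesgue_on (time_int P)"
  note i = integrable_L2_H10[OF B] and m = borel_measurable_integrable[OF integrable_L2_H10[OF B]]
  have "(LINT t|?M. B ((v + v') t) (w t)) = (LINT t|?M. B (v t) (w t) + B (v' t) (w t))"
  proof (rule integral_cong_AE[OF m[OF subspace_add[OF L2_H10_subspace v] w(1)]
        borel_measurable_add[OF m[OF v(1) w(1)] m[OF v(2) w(1)]]])
    show "AE t in ?M. B ((v + v') t) (w t) = B (v t) (w t) + B (v' t) (w t)"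
      using L2_H10_AE[OF v(1)] L2_H10_AE[OF v(2)] L2_H10_AE[OF w(1)]
      by eventually_elim (simp add: bounded_bilinear_onD(1)[OF B])
  qed
  then show "(LINT t|?M. B ((v + v') t) (w t)) = (LINT t|?M. B (v t) (w t)) + (LINT t|?M. B (v' t) (w t))"
    by (simp add: i v w)
  have "(LINT t|?M. B ((c *\<^sub>R v) t) (w t)) = (LINT t|?M. c * B (v t) (w t))"
  proof (rule integral_cong_AE[OF m[OF subspace_scale[OF L2_H10_subspace v(1)] w(1)]
        borel_measurable_times[OF borel_measurable_const m[OF v(1) w(1)]]])
    show "AE t in ?M. B ((c *\<^sub>R v) t) (w t) = c * B (v t) (w t)"
      using L2_H10_AE[OF v(1)] L2_H10_AE[OF w(1)]
      by eventually_elim (simp add: bounded_bilinear_onD(2)[OF B])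
  qed
  then show "(LINT t|?M. B ((c *\<^sub>R v) t) (w t)) = c * (LINT t|?M. B (v t) (w t))" by simp
  have "(LINT t|?M. B (v t) ((w + w') t)) = (LINT t|?M. B (v t) (w t) + B (v t) (w' t))"
  proof (rule integral_cong_AE[OF m[OF v(1) subspace_add[OF L2_H10_subspace w]]
        borel_measurable_add[OF m[OF v(1) w(1)] m[OF v(1) w(2)]]])
    show "AE t in ?M. B (v t) ((w + w') t) = B (v t) (w t) + B (v t) (w' t)"
      using L2_H10_AE[OF v(1)] L2_H10_AE[OF w(1)] L2_H10_AE[OF w(2)]
      by eventually_elim (simp add: bounded_bilinear_onD(3)[OF B])
  qed
  then show "(LINT t|?M. B (v t) ((w + w') t)) = (LINT t|?M. B (v t) (w t)) + (LINT t|?M. B (v t) (w' t))"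
    by (simp add: i v w)
  have "(LINT t|?M. B (v t) ((c *\<^sub>R w) t)) = (LINT t|?M. c * B (v t) (w t))"
  proof (rule integral_cong_AE[OF m[OF v(1) subspace_scale[OF L2_H10_subspace w(1)]]
        borel_measurable_times[OF borel_measurable_const m[OF v(1) w(1)]]])
    show "AE t in ?M. B (v t) ((c *\<^sub>R w) t) = c * B (v t) (w t)"
      using L2_H10_AE[OF v(1)] L2_H10_AE[OF w(1)]
      by eventually_elim (simp add: bounded_bilinear_onD(4)[OF B])
  qed
  then show "(LINT t|?M. B (v t) ((c *\<^sub>R w) t)) = c * (LINT t|?M. B (v t) (w t))" by simp
qed

definition traceable :: "'a st_fun \<Rightarrow> bool"
  where "traceable v \<longleftrightarrow> (\<forall>m\<in>{1..M}.
    (\<exists>w. has_L2_lim D (at_right (grid P (m - 1))) v w) \<and> (\<exists>w. has_L2_lim D (at_left (grid P m)) v w))"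

text \<open>\<open>trace_space\<close> is where one-sided limits at the nodes exist; on \<open>broken_space\<close> there are in
  addition time derivatives on each subinterval.  The latter contains $\mathcal X$ and the discrete
  functions, and is the natural domain for the first argument of the forms; the former
  contains $\mathcal Y$ and suits the second argument.\<close>

definition trace_space :: "'a st_fun set"
  where "trace_space = {v \<in> L2_H10. traceable v}"

definition broken_space :: "'a st_fun set"
  where "broken_space = {v \<in> trace_space. \<forall>m\<in>{1..M}. \<exists>g. has_weak_dt D (grid P (m - 1)) (grid P m) v g}"

lemma trace_space_L2_H10: "v \<in> trace_space \<Longrightarrow> v \<in> L2_H10"
  by (simp add: trace_space_def)

lemma broken_space_T: "v \<in> broken_space \<Longrightarrow> v \<in> trace_space"
  by (simp add: broken_space_def)

lemma rlim_lim:
  assumes "v \<in> trace_space" "m < M"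
  shows "has_L2_lim D (at_right (grid P m)) v (rlim P v m)"
proof -
  have "Suc m \<in> {1..M}" using assms(2) by simp
  then obtain w where "has_L2_lim D (at_right (grid P (Suc m - 1))) v w"
    using assms(1) unfolding trace_space_def traceable_def by blast
  then show ?thesis unfolding rlim_def using has_L2_lim_L2_Lim by simp
qed

lemma llim_lim:
  assumes "v \<in> trace_space" "m \<in> {1..M}"
  shows "has_L2_lim D (at_left (grid P m)) v (llim P v m)"
  using assms has_L2_lim_L2_Lim unfolding llim_def trace_space_def traceable_def by blast

lemma rlim_L2: "v \<in> trace_space \<Longrightarrow> m < M \<Longrightarrow> rlim P v m \<in> L2_space D"
  using rlim_lim unfolding has_L2_lim_def by blast

lemma llim_L2: "v \<in> trace_space \<Longrightarrow> m \<in> {1..M} \<Longrightarrow> llim P v m \<in> L2_space D"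
  using llim_lim unfolding has_L2_lim_def by blast

lemma rlim_inner:
  assumes "has_L2_lim D (at_right (grid P m)) v w" "h \<in> L2_space D"
  shows "L2_inner D (rlim P v m) h = L2_inner D w h"
  unfolding rlim_def by (rule L2_inner_L2_Lim[OF _ assms]) simp

lemma llim_inner:
  assumes "has_L2_lim D (at_left (grid P m)) v w" "h \<in> L2_space D"
  shows "L2_inner D (llim P v m) h = L2_inner D w h"
  unfolding llim_def by (rule L2_inner_L2_Lim[OF _ assms]) simp

lemma subspace_trace_space: "subspace trace_space"
  unfolding subspace_def
proof (intro conjI ballI allI)
  have "has_L2_lim D Fl 0 0" for Fl
    using has_L2_lim_sum[of "{}" D Fl "\<lambda>i. 0" "\<lambda>i. 0"] by simp
  then show "0 \<in> trace_space"
    unfolding trace_space_def traceable_def using subspace_0[OF L2_H10_subspace] by blast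
  show "v + w \<in> trace_space" if "v \<in> trace_space" "w \<in> trace_space" for v w
    unfolding trace_space_def traceable_def
  proof (intro CollectI conjI ballI)
    show "v + w \<in> L2_H10" by (rule subspace_add[OF L2_H10_subspace trace_space_L2_H10 trace_space_L2_H10]) (rule that)+
    fix m assume m: "m \<in> {1..M}"
    then have m': "m - 1 < M" by auto
    show "\<exists>x. has_L2_lim D (at_right (grid P (m - 1))) (v + w) x"
      using has_L2_lim_add[OF rlim_lim[OF that(1) m'] rlim_lim[OF that(2) m']] by (intro exI)
    show "\<exists>x. has_L2_lim D (at_left (grid P m)) (v + w) x"
      using has_L2_lim_add[OF llim_lim[OF that(1) m] llim_lim[OF that(2) m]] by (intro exI)
  qed
  show "c *\<^sub>R v \<in> trace_space" if "v \<in> trace_space" for v c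
    unfolding trace_space_def traceable_def
  proof (intro CollectI conjI ballI)
    show "c *\<^sub>R v \<in> L2_H10" by (rule subspace_scale[OF L2_H10_subspace trace_space_L2_H10]) (rule that)
    fix m assume m: "m \<in> {1..M}"
    then have m': "m - 1 < M" by auto
    show "\<exists>x. has_L2_lim D (at_right (grid P (m - 1))) (c *\<^sub>R v) x"
      using has_L2_lim_scale[OF rlim_lim[OF that m']] by (intro exI)
    show "\<exists>x. has_L2_lim D (at_left (grid P m)) (c *\<^sub>R v) x"
      using has_L2_lim_scale[OF llim_lim[OF that m]] by (intro exI)
  qed
qed

lemma rlim_linear:
  assumes "v \<in> trace_space" "w \<in> trace_space" "m < M" "h \<in> L2_space D"
  shows "L2_inner D (rlim P (v + w) m) h = L2_inner D (rlim P v m) h + L2_inner D (rlim P w m) h"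
    and "L2_inner D (rlim P (c *\<^sub>R v) m) h = c * L2_inner D (rlim P v m) h"
  using rlim_inner[OF has_L2_lim_add[OF rlim_lim[OF assms(1,3)] rlim_lim[OF assms(2,3)]] assms(4)]
    rlim_inner[OF has_L2_lim_scale[OF rlim_lim[OF assms(1,3)]] assms(4)]
    L2_inner_add_left[OF rlim_L2[OF assms(1,3)] rlim_L2[OF assms(2,3)] assms(4)]
  by (simp_all add: L2_inner_scale_left)

lemma llim_linear:
  assumes "v \<in> trace_space" "w \<in> trace_space" "m \<in> {1..M}" "h \<in> L2_space D"
  shows "L2_inner D (llim P (v + w) m) h = L2_inner D (llim P v m) h + L2_inner D (llim P w m) h"
    and "L2_inner D (llim P (c *\<^sub>R v) m) h = c * L2_inner D (llim P v m) h"
  using llim_inner[OF has_L2_lim_add[OF llim_lim[OF assms(1,3)] llim_lim[OF assms(2,3)]] assms(4)]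
    llim_inner[OF has_L2_lim_scale[OF llim_lim[OF assms(1,3)]] assms(4)]
    L2_inner_add_left[OF llim_L2[OF assms(1,3)] llim_L2[OF assms(2,3)] assms(4)]
  by (simp_all add: L2_inner_scale_left)

lemma jump_inner:
  assumes "v \<in> trace_space" "m \<in> {1..<M}" "h \<in> L2_space D"
  shows "L2_inner D (jump P v m) h = L2_inner D (rlim P v m) h - L2_inner D (llim P v m) h"
  unfolding jump_def using assms by (intro L2_inner_diff_left rlim_L2 llim_L2) auto

lemma broken_space_dt:
  assumes "v \<in> broken_space" "m \<in> {1..M}"
  shows "has_weak_dt D (grid P (m - 1)) (grid P m) v (weak_dt D (grid P (m - 1)) (grid P m) v)"
  using assms has_weak_dt_weak_dt unfolding broken_space_def by blast

lemma subspace_broken_space: "subspace broken_space"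
  unfolding subspace_def
proof (intro conjI ballI allI)
  have "has_weak_dt D a b 0 0" if "a \<le> b" for a b
    using has_weak_dt_sum_scalar[OF that, of "{}"] by (simp add: zero_fun_def)
  then show "0 \<in> broken_space"
    unfolding broken_space_def using subspace_0[OF subspace_trace_space] grid_less by (blast intro: less_imp_le)
  show "v + w \<in> broken_space" if v: "v \<in> broken_space" and w: "w \<in> broken_space" for v w
    unfolding broken_space_def
  proof (intro CollectI conjI ballI)
    show "v + w \<in> trace_space" by (intro subspace_add[OF subspace_trace_space] broken_space_T v w)
    fix m assume m: "m \<in> {1..M}"
    show "\<exists>g. has_weak_dt D (grid P (m - 1)) (grid P m) (v + w) g"
      using has_weak_dt_add[OF broken_space_dt[OF v m] broken_space_dt[OF w m] L2_H10_subint[OF trace_space_L2_H10[OF broken_space_T[OF v]] m]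
        L2_H10_subint[OF trace_space_L2_H10[OF broken_space_T[OF w]] m]] by (intro exI)
  qed
  show "c *\<^sub>R v \<in> broken_space" if v: "v \<in> broken_space" for v c
    unfolding broken_space_def
  proof (intro CollectI conjI ballI)
    show "c *\<^sub>R v \<in> trace_space" by (intro subspace_scale[OF subspace_trace_space] broken_space_T v)
    fix m assume m: "m \<in> {1..M}"
    show "\<exists>g. has_weak_dt D (grid P (m - 1)) (grid P m) (c *\<^sub>R v) g"
      using has_weak_dt_scale[OF broken_space_dt[OF v m]] by (intro exI)
  qed
qed

lemma X_space_W: "X_space P \<subseteq> broken_space"
proof
  fix v assume "v \<in> X_space P"
  then have bo: "v \<in> L2_H10" and ci: "continuous_into {0..Tend} (L2_space D) (L2_norm D) v"
    and dt: "\<exists>g. has_weak_dt D 0 Tend v g"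
    unfolding X_space_def L2_H10_def by auto
  have lims: "c \<in> {0..<Tend} \<Longrightarrow> has_L2_lim D (at_right c) v (v c)"
    "c \<in> {0<..Tend} \<Longrightarrow> has_L2_lim D (at_left c) v (v c)" for c
    by (rule continuous_into_imp_has_L2_lim[OF ci Tend_pos subset_refl];
      simp add: seminorm_onD(6)[OF seminorm_on_L2])+
  have "traceable v"
    unfolding traceable_def
  proof (intro ballI conjI)
    fix m assume m: "m \<in> {1..M}"
    have "grid P (m - 1) \<in> {0..<Tend}"
      using m grid_bounds(1)[of "m - 1"] grid_less_Tend[of "m - 1"] by auto
    from lims(1)[OF this] show "\<exists>w. has_L2_lim D (at_right (grid P (m - 1))) v w" by (intro exI)
    have "m - 1 \<le> M" "m \<le> M" using m by auto
    then have "grid P m \<in> {0<..Tend}"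
      using grid_bounds(1)[of "m - 1"] grid_less[OF m] grid_bounds(2)[of m] by auto
    from lims(2)[OF this] show "\<exists>w. has_L2_lim D (at_left (grid P m)) v w" by (intro exI)
  qed
  then have "v \<in> trace_space" using bo by (simp add: trace_space_def)
  moreover obtain g where g: "has_weak_dt D 0 Tend v g" using dt by blast
  have "has_weak_dt D (grid P (m - 1)) (grid P m) v g" if m: "m \<in> {1..M}" for m
    by (rule has_weak_dt_restrict[OF g]) (use m grid_bounds(1)[of "m - 1"] grid_bounds(2)[of m] in auto)
  then show "v \<in> broken_space" unfolding broken_space_def using \<open>v \<in> trace_space\<close> by blast
qed

lemma Y_space_T: "Y_space P \<subseteq> trace_space"
proof
  fix v assume "v \<in> Y_space P"
  then have bo: "v \<in> L2_H10" and ex: "\<And>m. m \<in> {1..M} \<Longrightarrow> \<exists>w. (\<forall>t\<in>subint P m. w t = v t) \<and>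
      continuous_into {grid P (m - 1)..grid P m} V nV w"
    unfolding Y_space_def L2_H10_def by auto
  have "traceable v"
    unfolding traceable_def
  proof (intro ballI)
    fix m assume m: "m \<in> {1..M}"
    obtain w where eq: "\<And>t. t \<in> subint P m \<Longrightarrow> w t = v t"
      and ci: "continuous_into {grid P (m - 1)..grid P m} V nV w"
      using ex[OF m] by blast
    have VL: "V \<subseteq> L2_space D" using H10_spaceD(2) by blast
    note lims = continuous_into_imp_has_L2_lim[OF ci grid_less[OF m] VL L2_norm_le_H1_norm(1) seminorm_onD(6)[OF H10]]
    have "eventually (\<lambda>s. w s = v s) (at_right (grid P (m - 1)))"
      using grid_less[OF m] eq unfolding eventually_at_right_field subint_def
      by (intro exI[of _ "grid P m"]) auto
    from has_L2_lim_cong[OF lims(1) this]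
    have "\<exists>w. has_L2_lim D (at_right (grid P (m - 1))) v w" using grid_less[OF m] by auto
    moreover have "eventually (\<lambda>s. w s = v s) (at_left (grid P m))"
      using grid_less[OF m] eq unfolding eventually_at_left_field subint_def
      by (intro exI[of _ "grid P (m - 1)"]) auto
    from has_L2_lim_cong[OF lims(2) this]
    have "\<exists>w. has_L2_lim D (at_left (grid P m)) v w" using grid_less[OF m] by auto
    ultimately show "(\<exists>w. has_L2_lim D (at_right (grid P (m - 1))) v w) \<and> (\<exists>w. has_L2_lim D (at_left (grid P m)) v w)"
      by blast
  qed
  then show "v \<in> trace_space" using bo by (simp add: trace_space_def)
qed

lemma subspace_X_space: "subspace (X_space P)"
  unfolding subspace_def
proof (intro conjI ballI allI)
  have bo: "bochner_L2 (time_int P) V nV = L2_H10" by (simp add: L2_H10_def)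
  note N = seminorm_on_L2[of D]
  have sub: "v \<in> bochner_L2 {0<..Tend} V nV" if "v \<in> L2_H10" for v using that by (simp add: L2_H10_def time_int_def)
  have z: "has_weak_dt D 0 Tend 0 0"
    using has_weak_dt_sum_scalar[OF less_imp_le[OF Tend_pos], of "{}"] by (simp add: zero_fun_def)
  have "continuous_into {0..Tend} (L2_space D) (L2_norm D) 0"
    using continuous_into_scalar[OF N seminorm_onD(8)[OF N] continuous_on_const[of _ 0]] by (simp add: zero_fun_def)
  then show "0 \<in> X_space P" unfolding X_space_def bo using z subspace_0[OF L2_H10_subspace] by blast
  show "v + w \<in> X_space P" if v: "v \<in> X_space P" and w: "w \<in> X_space P" for v w
  proof -
    obtain g h where g: "has_weak_dt D 0 Tend v g" "has_weak_dt D 0 Tend w h"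
      using v w unfolding X_space_def by blast
    have b: "v \<in> L2_H10" "w \<in> L2_H10" using v w unfolding X_space_def bo by blast+
    have "continuous_into {0..Tend} (L2_space D) (L2_norm D) (v + w)"
      by (rule continuous_into_add[OF N]) (use v w in \<open>simp_all add: X_space_def\<close>)
    then show ?thesis unfolding X_space_def bo
      using has_weak_dt_add[OF g sub sub] b subspace_add[OF L2_H10_subspace b] by blast
  qed
  show "c *\<^sub>R v \<in> X_space P" if v: "v \<in> X_space P" for v c
  proof -
    obtain g where g: "has_weak_dt D 0 Tend v g" using v unfolding X_space_def by blast
    have b: "v \<in> L2_H10" using v unfolding X_space_def bo by blast
    have "continuous_into {0..Tend} (L2_space D) (L2_norm D) (c *\<^sub>R v)"
      by (rule continuous_into_scale[OF N]) (use v in \<open>simp add: X_space_def\<close>)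
    then show ?thesis unfolding X_space_def bo
      using has_weak_dt_scale[OF g] subspace_scale[OF L2_H10_subspace b] by blast
  qed
qed

lemma subspace_Y_space: "subspace (Y_space P)"
  unfolding subspace_def
proof (intro conjI ballI allI)
  have bo: "bochner_L2 (time_int P) V nV = L2_H10" by (simp add: L2_H10_def)
  have c0: "continuous_into I V nV 0" for I
    using continuous_into_scalar[OF H10 seminorm_onD(8)[OF H10] continuous_on_const[of _ 0]] by (simp add: zero_fun_def)
  show "0 \<in> Y_space P"
    unfolding Y_space_def bo
    by (intro CollectI conjI ballI exI[of _ 0] subspace_0[OF L2_H10_subspace] c0 refl)
  show "v + w \<in> Y_space P" if v: "v \<in> Y_space P" and w: "w \<in> Y_space P" for v w
    unfolding Y_space_def bo
  proof (intro CollectI conjI ballI)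
    show "v + w \<in> L2_H10" using v w unfolding Y_space_def bo by (intro subspace_add[OF L2_H10_subspace]) blast+
    fix m assume m: "m \<in> {1..M}"
    obtain v' where v': "\<And>t. t \<in> subint P m \<Longrightarrow> v' t = v t" "continuous_into {grid P (m - 1)..grid P m} V nV v'"
      using v m unfolding Y_space_def by blast
    obtain w' where w': "\<And>t. t \<in> subint P m \<Longrightarrow> w' t = w t" "continuous_into {grid P (m - 1)..grid P m} V nV w'"
      using w m unfolding Y_space_def by blast
    show "\<exists>x. (\<forall>t\<in>subint P m. x t = (v + w) t) \<and> continuous_into {grid P (m - 1)..grid P m} V nV x"
      using continuous_into_add[OF H10 v'(2) w'(2)] v'(1) w'(1)
      by (intro exI[of _ "v' + w'"]) simp
  qed
  show "c *\<^sub>R v \<in> Y_space P" if v: "v \<in> Y_space P" for v c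
    unfolding Y_space_def bo
  proof (intro CollectI conjI ballI)
    show "c *\<^sub>R v \<in> L2_H10" using v unfolding Y_space_def bo by (intro subspace_scale[OF L2_H10_subspace]) blast
    fix m assume m: "m \<in> {1..M}"
    obtain v' where v': "\<And>t. t \<in> subint P m \<Longrightarrow> v' t = v t" "continuous_into {grid P (m - 1)..grid P m} V nV v'"
      using v m unfolding Y_space_def by blast
    show "\<exists>x. (\<forall>t\<in>subint P m. x t = (c *\<^sub>R v) t) \<and> continuous_into {grid P (m - 1)..grid P m} V nV x"
      using continuous_into_scale[OF H10 v'(2)] v'(1)
      by (intro exI[of _ "c *\<^sub>R v'"]) simp
  qed
qed

lemma subspace_XY_space: "subspace (XY_space P)"
  unfolding subspace_def XY_space_def
proof (intro conjI ballI allI)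
  note X = subspace_X_space and Y = subspace_Y_space
  show "0 \<in> {v + w |v w. v \<in> X_space P \<and> w \<in> Y_space P}"
    using subspace_0[OF X] subspace_0[OF Y] by (intro CollectI exI[of _ 0]) simp
  fix x assume "x \<in> {v + w |v w. v \<in> X_space P \<and> w \<in> Y_space P}"
  then obtain v w where x: "x = v + w" "v \<in> X_space P" "w \<in> Y_space P" by blast
  show "x + y \<in> {v + w |v w. v \<in> X_space P \<and> w \<in> Y_space P}"
    if yXY: "y \<in> {v + w |v w. v \<in> X_space P \<and> w \<in> Y_space P}" for y
  proof -
    obtain v' w' where y: "y = v' + w'" "v' \<in> X_space P" "w' \<in> Y_space P" using yXY by blast
    show ?thesis
      using x y subspace_add[OF X x(2) y(2)] subspace_add[OF Y x(3) y(3)]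
      by (intro CollectI exI[of _ "v + v'"] exI[of _ "w + w'"]) simp
  qed
  show "c *\<^sub>R x \<in> {v + w |v w. v \<in> X_space P \<and> w \<in> Y_space P}" for c
    using x subspace_scale[OF X x(2)] subspace_scale[OF Y x(3)]
    by (intro CollectI exI[of _ "c *\<^sub>R v"] exI[of _ "c *\<^sub>R w"]) (simp add: scaleR_add_right)
qed

lemma X_space_XY: "v \<in> X_space P \<Longrightarrow> v \<in> XY_space P"
  unfolding XY_space_def using subspace_0[OF subspace_Y_space] by (intro CollectI exI[of _ v] exI[of _ 0]) simp

lemma Y_space_XY: "v \<in> Y_space P \<Longrightarrow> v \<in> XY_space P"
  unfolding XY_space_def using subspace_0[OF subspace_X_space] by (intro CollectI exI[of _ 0] exI[of _ v]) simp

lemma X_space_scalar: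
  assumes \<theta>: "smooth \<theta>" and c: "c \<in> V"
  shows "(\<lambda>t. \<theta> t *\<^sub>R c) \<in> X_space P"
  unfolding X_space_def time_int_def
  using bochner_L2_smooth_scalar[OF \<theta> c] has_weak_dt_scalar[OF less_imp_le[OF Tend_pos] \<theta> c]
    continuous_into_scalar[OF seminorm_on_L2 H10_spaceD(2)[OF c] smooth_continuous[OF \<theta>]] by blast

lemma Xkh_spaceE:
  assumes "v \<in> Xkh_space P" "m \<in> {1..M}"
  obtains c where "\<And>j. j \<le> time_deg P \<Longrightarrow> c j \<in> fe_space D (mesh P m) (space_deg P)"
    "\<And>t. t \<in> subint P m \<Longrightarrow> v t = (\<Sum>j\<le>time_deg P. t ^ j *\<^sub>R c j)"
proof -
  obtain c where c: "\<forall>j\<le>time_deg P. c j \<in> fe_space D (mesh P m) (space_deg P)"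
    "\<forall>t\<in>subint P m. v t = (\<Sum>j\<le>time_deg P. t ^ j *\<^sub>R c j)"
    using assms unfolding Xkh_space_def by blast
  then show thesis by (intro that[of c]) simp_all
qed

lemma Xkh_polynomial:
  assumes "v \<in> Xkh_space P" "m \<in> {1..M}"
  obtains c where "\<And>j. j \<le> time_deg P \<Longrightarrow> c j \<in> V"
    "\<And>t. t \<in> subint P m \<Longrightarrow> v t = (\<Sum>j\<le>time_deg P. t ^ j *\<^sub>R c j)"
proof (rule Xkh_spaceE[OF assms])
  fix c assume c: "\<And>j. j \<le> time_deg P \<Longrightarrow> c j \<in> fe_space D (mesh P m) (space_deg P)"
    "\<And>t. t \<in> subint P m \<Longrightarrow> v t = (\<Sum>j\<le>time_deg P. t ^ j *\<^sub>R c j)"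
  show thesis by (rule that[OF _ c(2)]) (use c(1) in \<open>auto simp: fe_space_def\<close>)
qed

lemma subint_cover: "time_int P = (\<Union>m\<in>{1..M}. subint P m)"
proof -
  have "{0<..grid P n} = (\<Union>m\<in>{1..n}. subint P m)" if "n \<le> M" for n
    using that
  proof (induction n)
    case 0
    then show ?case by (simp add: grid_0)
  next
    case (Suc n)
    have "{0<..grid P (Suc n)} = {0<..grid P n} \<union> subint P (Suc n)"
      using grid_bounds(1)[of n] grid_less[of "Suc n"] Suc.prems by (auto simp: subint_def)
    then show ?case using Suc by (simp add: atLeastAtMostSuc_conv Un_commute)
  qed
  then show ?thesis by (simp add: time_int_def final_time_def)
qed

lemma Xkh_space_L2_H10:
  assumes v: "v \<in> Xkh_space P"
  shows "v \<in> L2_H10"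
proof -
  obtain c where c: "\<And>m j. m \<in> {1..M} \<Longrightarrow> j \<le> time_deg P \<Longrightarrow> c m j \<in> V"
    "\<And>m t. m \<in> {1..M} \<Longrightarrow> t \<in> subint P m \<Longrightarrow> v t = (\<Sum>j\<le>time_deg P. t ^ j *\<^sub>R c m j)"
  proof -
    have "\<exists>c. (\<forall>j\<le>time_deg P. c j \<in> V) \<and> (\<forall>t\<in>subint P m. v t = (\<Sum>j\<le>time_deg P. t ^ j *\<^sub>R c j))"
      if "m \<in> {1..M}" for m
      by (rule Xkh_polynomial[OF v that]) blast
    then obtain c where "\<And>m. m \<in> {1..M} \<Longrightarrow> (\<forall>j\<le>time_deg P. c m j \<in> V) \<and>
        (\<forall>t\<in>subint P m. v t = (\<Sum>j\<le>time_deg P. t ^ j *\<^sub>R c m j))" by metis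
    then show thesis by (intro that[of c]) blast+
  qed
  define w where "w = (\<Sum>m\<in>{1..M}. \<Sum>j\<le>time_deg P. (\<lambda>t. (indicator (subint P m) t * t ^ j) *\<^sub>R c m j))"
  have "w \<in> L2_H10"
    unfolding w_def
  proof (intro subspace_sum[OF L2_H10_subspace])
    fix m j assume m: "m \<in> {1..M}" and j: "j \<in> {..time_deg P}"
    have cont: "continuous_on UNIV (\<lambda>t::real. t ^ j)" by (intro continuous_intros)
    obtain B where B: "\<And>t. t \<in> {0<..Tend} \<Longrightarrow> \<bar>t ^ j\<bar> \<le> B" using bounded_on_Ioc[OF cont] by blast
    show "(\<lambda>t. (indicator (subint P m) t * t ^ j) *\<^sub>R c m j) \<in> L2_H10"
      unfolding L2_H10_def
    proof (rule bochner_L2_scalar[OF _ H10])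
      show "time_int P \<in> lmeasurable" unfolding time_int_def by (rule Ioc_lmeasurable)
      show "c m j \<in> V" using c(1)[OF m] j by simp
      show "(\<lambda>t. indicator (subint P m) t * t ^ j) \<in> borel_measurable (lebesgue_on (time_int P))"
        by (intro borel_measurable_times continuous_measurable_lebesgue_on[OF cont]
          measurable_restrict_space1 borel_measurable_indicator subint_sets)
      show "\<bar>indicator (subint P m) t * t ^ j\<bar> \<le> \<bar>B\<bar>" if "t \<in> time_int P" for t
        using B[of t] that by (auto simp: indicator_def time_int_def)
    qed
  qed
  moreover have "w t = v t" if t: "t \<in> time_int P" for t
  proof -
    obtain m where m: "m \<in> {1..M}" "t \<in> subint P m" using t unfolding subint_cover by blast
    have other: "t \<notin> subint P m'" if m': "m' \<in> {1..M}" "m' \<noteq> m" for m'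
    proof (cases "m' < m")
      case True
      then have "grid P m' \<le> grid P (m - 1)" using m by (intro grid_mono) auto
      then show ?thesis using m(2) by (auto simp: subint_def)
    next
      case False
      then have "grid P m \<le> grid P (m' - 1)" using m' by (intro grid_mono) auto
      then show ?thesis using m(2) by (auto simp: subint_def)
    qed
    have "w t = (\<Sum>m'\<in>{1..M}. \<Sum>j\<le>time_deg P. (indicator (subint P m') t * t ^ j) *\<^sub>R c m' j)"
      unfolding w_def by (simp only: sum_fun_apply)
    also have "\<dots> = (\<Sum>m'\<in>{m}. \<Sum>j\<le>time_deg P. (indicator (subint P m') t * t ^ j) *\<^sub>R c m' j)"
      by (rule sum.mono_neutral_right) (use m other in \<open>auto simp: indicator_def zero_fun_def scaleR_fun_def\<close>)
    also have "\<dots> = v t" using m c(2)[OF m] by simp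
    finally show ?thesis .
  qed
  ultimately show ?thesis unfolding L2_H10_def by (rule bochner_L2_cong)
qed

lemma Xkh_space_Y: "Xkh_space P \<subseteq> Y_space P"
proof
  fix v assume v: "v \<in> Xkh_space P"
  have "\<exists>w. (\<forall>t\<in>subint P m. w t = v t) \<and> continuous_into {grid P (m - 1)..grid P m} V nV w"
    if m: "m \<in> {1..M}" for m
  proof -
    obtain c where c: "\<And>j. j \<le> time_deg P \<Longrightarrow> c j \<in> V"
      "\<And>t. t \<in> subint P m \<Longrightarrow> v t = (\<Sum>j\<le>time_deg P. t ^ j *\<^sub>R c j)"
      using Xkh_polynomial[OF v m] by blast
    have "continuous_into I V nV (\<Sum>j\<in>J. (\<lambda>t. t ^ j *\<^sub>R c j))" if "finite J" "J \<subseteq> {..time_deg P}" for I J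
      using that
    proof (induction rule: finite_induct)
      case empty
      show ?case
        using continuous_into_scalar[OF H10 seminorm_onD(8)[OF H10] continuous_on_const[of _ 0]]
        by (simp add: zero_fun_def)
    next
      case (insert j J)
      have "continuous_into I V nV (\<lambda>t. t ^ j *\<^sub>R c j)"
        by (rule continuous_into_scalar[OF H10 c(1)]) (use insert in \<open>auto intro: continuous_intros\<close>)
      then show ?case
        unfolding sum.insert[OF insert(1,2)]
        by (rule continuous_into_add[OF H10 _ insert.IH]) (use insert.prems in auto)
    qed
    from this[of "{..time_deg P}"]
    show ?thesis using c(2) by (intro exI[of _ "\<Sum>j\<le>time_deg P. (\<lambda>t. t ^ j *\<^sub>R c j)"]) (simp add: sum_fun_apply)
  qed
  then show "v \<in> Y_space P" using Xkh_space_L2_H10[OF v] unfolding Y_space_def L2_H10_def by blast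
qed

lemma Xkh_dt:
  assumes "\<And>j. j \<le> time_deg P \<Longrightarrow> c j \<in> V" "m \<in> {1..M}"
    "\<And>t. t \<in> subint P m \<Longrightarrow> v t = (\<Sum>j\<le>time_deg P. t ^ j *\<^sub>R c j)"
  shows "has_weak_dt D (grid P (m - 1)) (grid P m) v
    (\<lambda>t. \<Sum>j\<le>time_deg P. deriv (\<lambda>t. t ^ j) t *\<^sub>R L2_inner D (c j))"
proof (rule has_weak_dt_cong)
  show "has_weak_dt D (grid P (m - 1)) (grid P m) (\<lambda>t. \<Sum>j\<le>time_deg P. t ^ j *\<^sub>R c j)
      (\<lambda>t. \<Sum>j\<le>time_deg P. deriv (\<lambda>t. t ^ j) t *\<^sub>R L2_inner D (c j))"
    by (rule conjunct1[OF has_weak_dt_sum_scalar[where \<theta> = "\<lambda>j t. t ^ j"]])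
      (use grid_less[OF assms(2)] assms(1) in \<open>auto intro: smooth_power\<close>)
qed (use assms(3) in \<open>simp add: subint_def\<close>)

lemma Xkh_lims:
  assumes c: "\<And>j. j \<le> time_deg P \<Longrightarrow> c j \<in> V" and m: "m \<in> {1..M}"
    and v: "\<And>t. t \<in> subint P m \<Longrightarrow> v t = (\<Sum>j\<le>time_deg P. t ^ j *\<^sub>R c j)"
  shows "has_L2_lim D (at_right (grid P (m - 1))) v (\<Sum>j\<le>time_deg P. grid P (m - 1) ^ j *\<^sub>R c j)"
    and "has_L2_lim D (at_left (grid P m)) v (\<Sum>j\<le>time_deg P. grid P m ^ j *\<^sub>R c j)"
proof -
  have *: "has_L2_lim D Fl v (\<Sum>j\<le>time_deg P. a ^ j *\<^sub>R c j)"
    if "eventually (\<lambda>s. s \<in> subint P m) Fl" "Fl \<le> at a" for Fl a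
  proof (rule has_L2_lim_cong)
    show "has_L2_lim D Fl (\<Sum>j\<le>time_deg P. (\<lambda>t. t ^ j *\<^sub>R c j)) (\<Sum>j\<le>time_deg P. a ^ j *\<^sub>R c j)"
    proof (rule has_L2_lim_sum)
      fix j assume "j \<in> {..time_deg P}"
      then have "c j \<in> L2_space D" by (intro H10_spaceD(2) c) simp
      moreover have "((\<lambda>t. t ^ j) \<longlongrightarrow> a ^ j) Fl"
        by (intro tendsto_power tendsto_mono[OF that(2)] tendsto_ident_at)
      ultimately show "has_L2_lim D Fl (\<lambda>t. t ^ j *\<^sub>R c j) (a ^ j *\<^sub>R c j)" by (rule has_L2_lim_scalar)
    qed simp
    show "eventually (\<lambda>s. (\<Sum>j\<le>time_deg P. (\<lambda>t. t ^ j *\<^sub>R c j)) s = v s) Fl"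
      using that(1) by eventually_elim (simp only: v sum_fun_apply)
  qed
  show "has_L2_lim D (at_right (grid P (m - 1))) v (\<Sum>j\<le>time_deg P. grid P (m - 1) ^ j *\<^sub>R c j)"
  proof (rule *)
    show "eventually (\<lambda>s. s \<in> subint P m) (at_right (grid P (m - 1)))"
      using grid_less[OF m] unfolding eventually_at_right_field subint_def
      by (intro exI[of _ "grid P m"]) auto
  qed (rule at_le, simp)
  show "has_L2_lim D (at_left (grid P m)) v (\<Sum>j\<le>time_deg P. grid P m ^ j *\<^sub>R c j)"
  proof (rule *)
    show "eventually (\<lambda>s. s \<in> subint P m) (at_left (grid P m))"
      using grid_less[OF m] unfolding eventually_at_left_field subint_def
      by (intro exI[of _ "grid P (m - 1)"]) auto
  qed (rule at_le, simp)
qed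

lemma Xkh_space_W: "Xkh_space P \<subseteq> broken_space"
proof
  fix v assume v: "v \<in> Xkh_space P"
  have "\<exists>g. has_weak_dt D (grid P (m - 1)) (grid P m) v g" if m: "m \<in> {1..M}" for m
  proof -
    obtain c where "\<And>j. j \<le> time_deg P \<Longrightarrow> c j \<in> V"
      "\<And>t. t \<in> subint P m \<Longrightarrow> v t = (\<Sum>j\<le>time_deg P. t ^ j *\<^sub>R c j)"
      using Xkh_polynomial[OF v m] by blast
    from Xkh_dt[OF this(1) m this(2)] show ?thesis by blast
  qed
  moreover have "v \<in> trace_space" using v Xkh_space_Y Y_space_T by blast
  ultimately show "v \<in> broken_space" unfolding broken_space_def by blast
qed

lemma fe_space_add:
  assumes "v \<in> fe_space D \<T> p" "w \<in> fe_space D \<T> p"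
  shows "v + w \<in> fe_space D \<T> p" and "c *\<^sub>R v \<in> fe_space D \<T> p"
proof -
  have v: "v \<in> V" "continuous_on (closure D) v" "\<And>K. K \<in> \<T> \<Longrightarrow> \<exists>q\<in>polynomials p. \<forall>x\<in>K. v x = q x"
    and w: "w \<in> V" "continuous_on (closure D) w" "\<And>K. K \<in> \<T> \<Longrightarrow> \<exists>q\<in>polynomials p. \<forall>x\<in>K. w x = q x"
    using assms unfolding fe_space_def by auto
  have poly: "q + r \<in> polynomials p" "c *\<^sub>R q \<in> polynomials p" if "q \<in> polynomials p" "r \<in> polynomials p" for q r :: "'a \<Rightarrow> real"
  proof -
    let ?S = "{\<mu> \<in> Basis \<rightarrow>\<^sub>E {..p}. (\<Sum>i\<in>Basis. \<mu> i) \<le> p}"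
    obtain cq where q: "\<And>x. q x = (\<Sum>\<mu>\<in>?S. cq \<mu> * (\<Prod>i\<in>Basis. (x \<bullet> i) ^ \<mu> i))"
      using \<open>q \<in> polynomials p\<close> unfolding polynomials_def by blast
    obtain cr where r: "\<And>x. r x = (\<Sum>\<mu>\<in>?S. cr \<mu> * (\<Prod>i\<in>Basis. (x \<bullet> i) ^ \<mu> i))"
      using \<open>r \<in> polynomials p\<close> unfolding polynomials_def by blast
    show "q + r \<in> polynomials p"
      unfolding polynomials_def
      by (intro CollectI exI[of _ "\<lambda>\<mu>. cq \<mu> + cr \<mu>"] allI) (simp add: q r distrib_right sum.distrib)
    show "c *\<^sub>R q \<in> polynomials p"
      unfolding polynomials_def
      by (intro CollectI exI[of _ "\<lambda>\<mu>. c * cq \<mu>"] allI) (simp add: q sum_distrib_left mult.assoc)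
  qed
  show "v + w \<in> fe_space D \<T> p"
    unfolding fe_space_def
  proof (intro CollectI conjI ballI)
    show "v + w \<in> V" by (rule seminorm_onD(5)[OF H10 v(1) w(1)])
    show "continuous_on (closure D) (v + w)" unfolding plus_fun_def by (rule continuous_on_add[OF v(2) w(2)])
    fix K assume K: "K \<in> \<T>"
    obtain q r where "q \<in> polynomials p" "\<forall>x\<in>K. v x = q x" "r \<in> polynomials p" "\<forall>x\<in>K. w x = r x"
      using v(3)[OF K] w(3)[OF K] by blast
    then show "\<exists>q\<in>polynomials p. \<forall>x\<in>K. (v + w) x = q x" by (intro bexI[of _ "q + r"] poly) simp_all
  qed
  show "c *\<^sub>R v \<in> fe_space D \<T> p"
    unfolding fe_space_def
  proof (intro CollectI conjI ballI)
    show "c *\<^sub>R v \<in> V" by (rule seminorm_onD(7)[OF H10 v(1)])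
    show "continuous_on (closure D) (c *\<^sub>R v)" unfolding scaleR_fun_def
      by (rule continuous_on_scaleR[OF continuous_on_const v(2)])
    fix K assume K: "K \<in> \<T>"
    obtain q where "q \<in> polynomials p" "\<forall>x\<in>K. v x = q x" using v(3)[OF K] by blast
    then show "\<exists>q\<in>polynomials p. \<forall>x\<in>K. (c *\<^sub>R v) x = q x" by (intro bexI[of _ "c *\<^sub>R q"] poly(2)[of q q]) simp_all
  qed
qed

lemma Xkh_space_closed:
  assumes v: "v \<in> Xkh_space P" and w: "w \<in> Xkh_space P"
  shows "v + w \<in> Xkh_space P" and "c *\<^sub>R v \<in> Xkh_space P"
proof -
  have "v 0 \<in> fe_space D (mesh P 0) (space_deg P)" "w 0 \<in> fe_space D (mesh P 0) (space_deg P)"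
    using v w unfolding Xkh_space_def by blast+
  from fe_space_add[OF this] have z: "(v + w) 0 \<in> fe_space D (mesh P 0) (space_deg P)"
    "(c *\<^sub>R v) 0 \<in> fe_space D (mesh P 0) (space_deg P)" by simp_all
  show "v + w \<in> Xkh_space P"
    unfolding Xkh_space_def
  proof (intro CollectI conjI ballI)
    fix m assume m: "m \<in> {1..M}"
    obtain cv where cv: "\<And>j. j \<le> time_deg P \<Longrightarrow> cv j \<in> fe_space D (mesh P m) (space_deg P)"
      "\<And>t. t \<in> subint P m \<Longrightarrow> v t = (\<Sum>j\<le>time_deg P. t ^ j *\<^sub>R cv j)"
      using Xkh_spaceE[OF v m] by blast
    obtain cw where cw: "\<And>j. j \<le> time_deg P \<Longrightarrow> cw j \<in> fe_space D (mesh P m) (space_deg P)"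
      "\<And>t. t \<in> subint P m \<Longrightarrow> w t = (\<Sum>j\<le>time_deg P. t ^ j *\<^sub>R cw j)"
      using Xkh_spaceE[OF w m] by blast
    show "\<exists>d. (\<forall>j\<le>time_deg P. d j \<in> fe_space D (mesh P m) (space_deg P)) \<and>
        (\<forall>t\<in>subint P m. (v + w) t = (\<Sum>j\<le>time_deg P. t ^ j *\<^sub>R d j))"
      by (intro exI[of _ "\<lambda>j. cv j + cw j"] conjI allI impI ballI fe_space_add(1) cv(1) cw(1))
        (simp_all only: plus_fun_apply cv(2) cw(2) scaleR_add_right sum.distrib)
  qed (rule z)
  show "c *\<^sub>R v \<in> Xkh_space P"
    unfolding Xkh_space_def
  proof (intro CollectI conjI ballI)
    fix m assume m: "m \<in> {1..M}"
    obtain cv where cv: "\<And>j. j \<le> time_deg P \<Longrightarrow> cv j \<in> fe_space D (mesh P m) (space_deg P)"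
      "\<And>t. t \<in> subint P m \<Longrightarrow> v t = (\<Sum>j\<le>time_deg P. t ^ j *\<^sub>R cv j)"
      using Xkh_spaceE[OF v m] by blast
    show "\<exists>d. (\<forall>j\<le>time_deg P. d j \<in> fe_space D (mesh P m) (space_deg P)) \<and>
        (\<forall>t\<in>subint P m. (c *\<^sub>R v) t = (\<Sum>j\<le>time_deg P. t ^ j *\<^sub>R d j))"
    proof (intro exI[of _ "\<lambda>j. c *\<^sub>R cv j"] conjI allI impI ballI)
      show "c *\<^sub>R cv j \<in> fe_space D (mesh P m) (space_deg P)" if "j \<le> time_deg P" for j
        by (rule fe_space_add(2)[OF cv(1)[OF that] cv(1)[OF that]])
      show "(c *\<^sub>R v) t = (\<Sum>j\<le>time_deg P. t ^ j *\<^sub>R c *\<^sub>R cv j)" if "t \<in> subint P m" for t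
        by (simp only: scaleR_fun_apply cv(2)[OF that] scaleR_sum_right scaleR_left_commute)
    qed
  qed (rule z)
qed

section \<open>The bilinear form of the problem\<close>

text \<open>The form $a(v)(w)$ of a single time.\<close>

definition spatial_form :: "('a \<Rightarrow> real) \<Rightarrow> ('a \<Rightarrow> real) \<Rightarrow> real"
  where "spatial_form f g = flow.adv f g + diffusion P * L2_inner D (wgrad D f) (wgrad D g) + reaction P * L2_inner D f g"

lemma bounded_bilinear_grad:
  "bounded_bilinear_on V nV V nV (\<lambda>f g. L2_inner D (wgrad D f) (wgrad D g))"
  unfolding bounded_bilinear_on_def
proof (intro conjI ballI allI)
  show "\<exists>C\<ge>0. \<forall>f\<in>V. \<forall>g\<in>V. \<bar>L2_inner D (wgrad D f) (wgrad D g)\<bar> \<le> C * (nV f * nV g)"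
  proof (intro exI[of _ 1] conjI ballI)
    fix f g assume f: "f \<in> V" and g: "g \<in> V"
    have "\<bar>L2_inner D (wgrad D f) (wgrad D g)\<bar> \<le> L2_norm D (wgrad D f) * L2_norm D (wgrad D g)"
      by (rule L2_Cauchy_Schwarz[OF H10_spaceD(3)[OF f] H10_spaceD(3)[OF g]])
    also have "\<dots> \<le> nV f * nV g"
      by (intro mult_mono L2_norm_le_H1_norm seminorm_onD(2)[OF seminorm_on_L2] H10_spaceD(3)[OF g]
        seminorm_onD(2)[OF H10 f])
    finally show "\<bar>L2_inner D (wgrad D f) (wgrad D g)\<bar> \<le> 1 * (nV f * nV g)" by simp
  qed simp
next
  fix f g h assume fgh: "f \<in> V" "g \<in> V" "h \<in> V"
  show "L2_inner D (wgrad D (f + g)) (wgrad D h) = L2_inner D (wgrad D f) (wgrad D h) + L2_inner D (wgrad D g) (wgrad D h)"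
    by (rule L2_inner_wgrad_linear(1)[OF domain H10_spaceD(1)[OF fgh(1)] H10_spaceD(1)[OF fgh(2)] H10_spaceD(3)[OF fgh(3)]])
  show "L2_inner D (wgrad D f) (wgrad D (g + h)) = L2_inner D (wgrad D f) (wgrad D g) + L2_inner D (wgrad D f) (wgrad D h)"
    using L2_inner_wgrad_linear(1)[OF domain H10_spaceD(1)[OF fgh(2)] H10_spaceD(1)[OF fgh(3)] H10_spaceD(3)[OF fgh(1)]]
    by (simp add: L2_inner_commute)
next
  fix f g c assume fg: "f \<in> V" "g \<in> V"
  show "L2_inner D (wgrad D (c *\<^sub>R f)) (wgrad D g) = c * L2_inner D (wgrad D f) (wgrad D g)"
    by (rule L2_inner_wgrad_linear(2)[OF domain H10_spaceD(1)[OF fg(1)] H10_spaceD(1)[OF fg(1)] H10_spaceD(3)[OF fg(2)]])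
  show "L2_inner D (wgrad D f) (wgrad D (c *\<^sub>R g)) = c * L2_inner D (wgrad D f) (wgrad D g)"
    using L2_inner_wgrad_linear(2)[OF domain H10_spaceD(1)[OF fg(2)] H10_spaceD(1)[OF fg(2)] H10_spaceD(3)[OF fg(1)]]
    by (simp add: L2_inner_commute)
qed

lemma bounded_bilinear_spatial_form: "bounded_bilinear_on V nV V nV spatial_form"
proof -
  have "bounded_bilinear_on V nV V nV (\<lambda>f g. flow.adv f g
      + diffusion P * L2_inner D (wgrad D f) (wgrad D g) + reaction P * L2_inner D f g)"
    by (intro bounded_bilinear_on_add bounded_bilinear_on_cmult flow.bounded_bilinear_adv bounded_bilinear_grad L2_pairing)
  then show ?thesis by (simp add: spatial_form_def[abs_def])
qed

lemma integral_spatial_form: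
  assumes v: "v \<in> L2_H10" and w: "w \<in> L2_H10"
  shows "(LINT t|lebesgue_on (time_int P). spatial_form (v t) (w t))
    = (LINT t|lebesgue_on (time_int P). flow.adv (v t) (w t))
    + diffusion P * (LINT t|lebesgue_on (time_int P). L2_inner D (wgrad D (v t)) (wgrad D (w t)))
    + reaction P * (LINT t|lebesgue_on (time_int P). L2_inner D (v t) (w t))"
  using integrable_L2_H10[OF flow.bounded_bilinear_adv v w] integrable_L2_H10[OF bounded_bilinear_grad v w]
    integrable_L2_H10[OF L2_pairing v w]
  by (simp add: spatial_form_def)

lemma st_inner_terms:
  "st_inner P (\<lambda>t x. velocity P x \<bullet> grad P v t x) w = (LINT t|lebesgue_on (time_int P). flow.adv (v t) (w t))"
  "st_inner P (\<lambda>t x. diffusion P *\<^sub>R grad P v t x) (grad P w)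
    = diffusion P * (LINT t|lebesgue_on (time_int P). L2_inner D (wgrad D (v t)) (wgrad D (w t)))"
  "st_inner P (\<lambda>t x. reaction P * v t x) w
    = reaction P * (LINT t|lebesgue_on (time_int P). L2_inner D (v t) (w t))"
proof -
  have s: "L2_inner D (\<lambda>x. c *\<^sub>R f x) g = c * L2_inner D f g" for c and f g :: "'a \<Rightarrow> 'c::euclidean_space"
    unfolding L2_inner_def by simp
  have s': "L2_inner D (\<lambda>x. c * f x) g = c * L2_inner D f g" for c and f g :: "'a \<Rightarrow> real"
    unfolding L2_inner_def by (simp add: mult.assoc)
  show "st_inner P (\<lambda>t x. velocity P x \<bullet> grad P v t x) w = (LINT t|lebesgue_on (time_int P). flow.adv (v t) (w t))"
    unfolding st_inner_def flow.adv_def grad_def by (rule refl)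
  show "st_inner P (\<lambda>t x. diffusion P *\<^sub>R grad P v t x) (grad P w)
    = diffusion P * (LINT t|lebesgue_on (time_int P). L2_inner D (wgrad D (v t)) (wgrad D (w t)))"
    unfolding st_inner_def s grad_def by simp
  show "st_inner P (\<lambda>t x. reaction P * v t x) w
    = reaction P * (LINT t|lebesgue_on (time_int P). L2_inner D (v t) (w t))"
    unfolding st_inner_def s' by simp
qed

lemma a_form_eq: "v \<in> L2_H10 \<Longrightarrow> w \<in> L2_H10 \<Longrightarrow> a_form P v w = (LINT t|lebesgue_on (time_int P). spatial_form (v t) (w t))"
  unfolding a_form_def st_inner_terms integral_spatial_form by simp

lemma a_dual_eq:
  assumes v: "v \<in> L2_H10" and z: "z \<in> L2_H10"
  shows "- st_inner P (\<lambda>t x. velocity P x \<bullet> grad P z t x) v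
    + st_inner P (\<lambda>t x. diffusion P *\<^sub>R grad P z t x) (grad P v)
    + st_inner P (\<lambda>t x. reaction P * z t x) v = (LINT t|lebesgue_on (time_int P). spatial_form (v t) (z t))"
proof -
  let ?M = "lebesgue_on (time_int P)"
  have "(LINT t|?M. flow.adv (v t) (z t)) = (LINT t|?M. - flow.adv (z t) (v t))"
  proof (rule integral_cong_AE)
    show "(\<lambda>t. flow.adv (v t) (z t)) \<in> borel_measurable ?M"
      by (rule borel_measurable_integrable[OF integrable_L2_H10[OF flow.bounded_bilinear_adv v z]])
    show "(\<lambda>t. - flow.adv (z t) (v t)) \<in> borel_measurable ?M"
      by (rule borel_measurable_uminus[OF borel_measurable_integrable[OF integrable_L2_H10[OF flow.bounded_bilinear_adv z v]]])
    show "AE t in ?M. flow.adv (v t) (z t) = - flow.adv (z t) (v t)"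
      using L2_H10_AE[OF v] L2_H10_AE[OF z] by eventually_elim (rule flow.adv_skew)
  qed
  then show ?thesis
    unfolding st_inner_terms integral_spatial_form[OF v z] by (simp add: L2_inner_commute)
qed

lemma dt_form_eq:
  assumes v: "v \<in> broken_space" and w: "w \<in> L2_H10"
    and g: "\<And>m. m \<in> {1..M} \<Longrightarrow> has_weak_dt D (grid P (m - 1)) (grid P m) v (g m)"
  shows "dt_form P v w = (\<Sum>m=1..M. LINT t|lebesgue_on (subint P m). g m t (w t))"
  unfolding dt_form_def subint_def
proof (intro sum.cong refl)
  fix m assume m: "m \<in> {1..M}"
  show "(LINT t|lebesgue_on {grid P (m - 1)<..grid P m}. weak_dt D (grid P (m - 1)) (grid P m) v t (w t))
      = (LINT t|lebesgue_on {grid P (m - 1)<..grid P m}. g m t (w t))"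
    by (rule has_weak_dt_integral_eq[OF broken_space_dt[OF v m] g[OF m] L2_H10_subint[OF w m]])
qed

lemma integrable_weak_dt:
  assumes "v \<in> broken_space" "w \<in> L2_H10" "m \<in> {1..M}"
  shows "integrable (lebesgue_on (subint P m)) (\<lambda>t. weak_dt D (grid P (m - 1)) (grid P m) v t (w t))"
  unfolding subint_def
  by (rule integrable_dt_pairing[OF has_weak_dtD(1)[OF broken_space_dt[OF assms(1,3)]] L2_H10_subint[OF assms(2,3)]])

lemma dt_form_add_left:
  assumes v: "v \<in> broken_space" and v': "v' \<in> broken_space" and w: "w \<in> L2_H10"
  shows "dt_form P (v + v') w = dt_form P v w + dt_form P v' w"
proof -
  let ?dt = "\<lambda>v m. weak_dt D (grid P (m - 1)) (grid P m) v"
  have "dt_form P (v + v') w = (\<Sum>m=1..M. LINT t|lebesgue_on (subint P m). (?dt v m + ?dt v' m) t (w t))"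
    by (rule dt_form_eq[OF subspace_add[OF subspace_broken_space v v'] w])
      (intro has_weak_dt_add broken_space_dt v v' L2_H10_subint trace_space_L2_H10 broken_space_T)
  also have "\<dots> = (\<Sum>m=1..M. (LINT t|lebesgue_on (subint P m). ?dt v m t (w t)) + (LINT t|lebesgue_on (subint P m). ?dt v' m t (w t)))"
    by (intro sum.cong refl)
      (simp only: plus_fun_apply Bochner_Integration.integral_add[OF integrable_weak_dt[OF v w] integrable_weak_dt[OF v' w]])
  finally show ?thesis by (simp add: dt_form_def sum.distrib)
qed

lemma dt_form_scale_left:
  assumes v: "v \<in> broken_space" and w: "w \<in> L2_H10"
  shows "dt_form P (c *\<^sub>R v) w = c * dt_form P v w"
proof -
  let ?dt = "\<lambda>v m. weak_dt D (grid P (m - 1)) (grid P m) v"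
  have "dt_form P (c *\<^sub>R v) w = (\<Sum>m=1..M. LINT t|lebesgue_on (subint P m). (c *\<^sub>R ?dt v m) t (w t))"
    by (rule dt_form_eq[OF subspace_scale[OF subspace_broken_space v] w])
      (intro has_weak_dt_scale broken_space_dt v)
  then show ?thesis by (simp add: dt_form_def sum_distrib_left)
qed

lemma dt_form_linear_right:
  assumes v: "v \<in> broken_space" and w: "w \<in> L2_H10" and w': "w' \<in> L2_H10"
  shows "dt_form P v (w + w') = dt_form P v w + dt_form P v w'" and "dt_form P v (c *\<^sub>R w) = c * dt_form P v w"
proof -
  let ?dt = "\<lambda>m. weak_dt D (grid P (m - 1)) (grid P m) v"
  have ae: "AE t in lebesgue_on (subint P m). ?dt m t \<in> Hminus1_space D \<and> w t \<in> V \<and> w' t \<in> V" if m: "m \<in> {1..M}" for m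
    using bochner_L2_AE[OF has_weak_dtD(1)[OF broken_space_dt[OF v m]]] bochner_L2_AE[OF L2_H10_subint[OF w m]]
      bochner_L2_AE[OF L2_H10_subint[OF w' m]]
    unfolding subint_def by eventually_elim blast
  note meas = borel_measurable_integrable[OF integrable_weak_dt]
  have "(LINT t|lebesgue_on (subint P m). ?dt m t ((w + w') t))
      = (LINT t|lebesgue_on (subint P m). ?dt m t (w t)) + (LINT t|lebesgue_on (subint P m). ?dt m t (w' t))"
    if m: "m \<in> {1..M}" for m
  proof -
    have "(LINT t|lebesgue_on (subint P m). ?dt m t ((w + w') t))
        = (LINT t|lebesgue_on (subint P m). ?dt m t (w t) + ?dt m t (w' t))"
    proof (rule integral_cong_AE[OF meas[OF v subspace_add[OF L2_H10_subspace w w'] m]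
          borel_measurable_add[OF meas[OF v w m] meas[OF v w' m]]])
      show "AE t in lebesgue_on (subint P m). ?dt m t ((w + w') t) = ?dt m t (w t) + ?dt m t (w' t)"
        using ae[OF m] by eventually_elim (simp add: bounded_bilinear_onD(3)[OF Hminus1_pairing])
    qed
    then show ?thesis
      by (simp only: Bochner_Integration.integral_add[OF integrable_weak_dt[OF v w m] integrable_weak_dt[OF v w' m]])
  qed
  then show "dt_form P v (w + w') = dt_form P v w + dt_form P v w'"
    unfolding dt_form_def sum.distrib[symmetric] by (intro sum.cong refl)
  have "(LINT t|lebesgue_on (subint P m). ?dt m t ((c *\<^sub>R w) t)) = c * (LINT t|lebesgue_on (subint P m). ?dt m t (w t))"
    if m: "m \<in> {1..M}" for m
  proof -
    have "(LINT t|lebesgue_on (subint P m). ?dt m t ((c *\<^sub>R w) t))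
        = (LINT t|lebesgue_on (subint P m). c * ?dt m t (w t))"
    proof (rule integral_cong_AE[OF meas[OF v subspace_scale[OF L2_H10_subspace w] m]
          borel_measurable_times[OF borel_measurable_const meas[OF v w m]]])
      show "AE t in lebesgue_on (subint P m). ?dt m t ((c *\<^sub>R w) t) = c * ?dt m t (w t)"
        using ae[OF m] by eventually_elim (simp add: bounded_bilinear_onD(4)[OF Hminus1_pairing])
    qed
    then show ?thesis by simp
  qed
  then show "dt_form P v (c *\<^sub>R w) = c * dt_form P v w"
    unfolding dt_form_def sum_distrib_left by (intro sum.cong refl)
qed

text \<open>\<open>A_form\<close> with the initial term added, which lets the jump at the initial time be treated
  like the others.\<close>

definition full_form :: "'a st_fun \<Rightarrow> 'a st_fun \<Rightarrow> real"
  where "full_form v w = dt_form P v w + (LINT t|lebesgue_on (time_int P). spatial_form (v t) (w t))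
    + (\<Sum>m=2..M. L2_inner D (jump P v (m - 1)) (rlim P w (m - 1))) + L2_inner D (rlim P v 0) (rlim P w 0)"

lemma A_form_eq:
  "v \<in> L2_H10 \<Longrightarrow> w \<in> L2_H10 \<Longrightarrow> A_form P v w + L2_inner D (rlim P v 0) (rlim P w 0) = full_form v w"
  unfolding A_form_def full_form_def by (simp add: a_form_eq)

lemma zero_less_M: "0 < M"
  using M_pos by simp

lemma jump_L2: "v \<in> trace_space \<Longrightarrow> m \<in> {1..<M} \<Longrightarrow> jump P v m \<in> L2_space D"
  unfolding jump_def by (intro seminorm_onD(6)[OF seminorm_on_L2] rlim_L2 llim_L2) auto

lemma full_form_add_left:
  assumes v: "v \<in> broken_space" and v': "v' \<in> broken_space" and w: "w \<in> trace_space"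
  shows "full_form (v + v') w = full_form v w + full_form v' w"
proof -
  note vT = broken_space_T[OF v] and v'T = broken_space_T[OF v']
  have j: "L2_inner D (jump P (v + v') (m - 1)) (rlim P w (m - 1))
      = L2_inner D (jump P v (m - 1)) (rlim P w (m - 1)) + L2_inner D (jump P v' (m - 1)) (rlim P w (m - 1))"
    if m: "m \<in> {2..M}" for m
  proof -
    have m': "m - 1 \<in> {1..<M}" "m - 1 \<in> {1..M}" "m - 1 < M" using m by auto
    note h = rlim_L2[OF w m'(3)]
    show ?thesis
      using jump_inner[OF vT m'(1) h] jump_inner[OF v'T m'(1) h] jump_inner[OF subspace_add[OF subspace_trace_space vT v'T] m'(1) h]
        rlim_linear(1)[OF vT v'T m'(3) h] llim_linear(1)[OF vT v'T m'(2) h] by simp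
  qed
  have "(\<Sum>m=2..M. L2_inner D (jump P (v + v') (m - 1)) (rlim P w (m - 1)))
      = (\<Sum>m=2..M. L2_inner D (jump P v (m - 1)) (rlim P w (m - 1))) + (\<Sum>m=2..M. L2_inner D (jump P v' (m - 1)) (rlim P w (m - 1)))"
    unfolding sum.distrib[symmetric] by (intro sum.cong refl j)
  then show ?thesis
    unfolding full_form_def dt_form_add_left[OF v v' trace_space_L2_H10[OF w]]
      integral_L2_H10_linear(1)[OF bounded_bilinear_spatial_form trace_space_L2_H10[OF vT] trace_space_L2_H10[OF v'T] trace_space_L2_H10[OF w] trace_space_L2_H10[OF w]]
      rlim_linear(1)[OF vT v'T zero_less_M rlim_L2[OF w zero_less_M]]
    by linarith
qed

lemma full_form_scale_left:
  assumes v: "v \<in> broken_space" and w: "w \<in> trace_space"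
  shows "full_form (c *\<^sub>R v) w = c * full_form v w"
proof -
  note vT = broken_space_T[OF v]
  have j: "L2_inner D (jump P (c *\<^sub>R v) (m - 1)) (rlim P w (m - 1))
      = c * L2_inner D (jump P v (m - 1)) (rlim P w (m - 1))"
    if m: "m \<in> {2..M}" for m
  proof -
    have m': "m - 1 \<in> {1..<M}" "m - 1 \<in> {1..M}" "m - 1 < M" using m by auto
    note h = rlim_L2[OF w m'(3)]
    show ?thesis
      using jump_inner[OF vT m'(1) h] jump_inner[OF subspace_scale[OF subspace_trace_space vT] m'(1) h]
        rlim_linear(2)[OF vT vT m'(3) h] llim_linear(2)[OF vT vT m'(2) h] by (simp add: right_diff_distrib)
  qed
  have "(\<Sum>m=2..M. L2_inner D (jump P (c *\<^sub>R v) (m - 1)) (rlim P w (m - 1)))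
      = c * (\<Sum>m=2..M. L2_inner D (jump P v (m - 1)) (rlim P w (m - 1)))"
    unfolding sum_distrib_left by (intro sum.cong refl j)
  then show ?thesis
    unfolding full_form_def dt_form_scale_left[OF v trace_space_L2_H10[OF w]]
      integral_L2_H10_linear(2)[OF bounded_bilinear_spatial_form trace_space_L2_H10[OF vT] trace_space_L2_H10[OF vT] trace_space_L2_H10[OF w] trace_space_L2_H10[OF w]]
      rlim_linear(2)[OF vT vT zero_less_M rlim_L2[OF w zero_less_M]]
    by (simp only: distrib_left)
qed

lemma full_form_linear_right:
  assumes v: "v \<in> broken_space" and w: "w \<in> trace_space" and w': "w' \<in> trace_space"
  shows "full_form v (w + w') = full_form v w + full_form v w'" and "full_form v (c *\<^sub>R w) = c * full_form v w"
proof -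
  note vT = broken_space_T[OF v]
  note r0 = rlim_L2[OF vT zero_less_M]
  have j: "L2_inner D (jump P v (m - 1)) (rlim P (w + w') (m - 1))
        = L2_inner D (jump P v (m - 1)) (rlim P w (m - 1)) + L2_inner D (jump P v (m - 1)) (rlim P w' (m - 1))"
      "L2_inner D (jump P v (m - 1)) (rlim P (c *\<^sub>R w) (m - 1)) = c * L2_inner D (jump P v (m - 1)) (rlim P w (m - 1))"
    if m: "m \<in> {2..M}" for m
  proof -
    have m': "m - 1 \<in> {1..<M}" "m - 1 < M" using m by auto
    show "L2_inner D (jump P v (m - 1)) (rlim P (w + w') (m - 1))
        = L2_inner D (jump P v (m - 1)) (rlim P w (m - 1)) + L2_inner D (jump P v (m - 1)) (rlim P w' (m - 1))"
      using rlim_linear(1)[OF w w' m'(2) jump_L2[OF vT m'(1)]] by (simp only: L2_inner_commute)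
    show "L2_inner D (jump P v (m - 1)) (rlim P (c *\<^sub>R w) (m - 1)) = c * L2_inner D (jump P v (m - 1)) (rlim P w (m - 1))"
      using rlim_linear(2)[OF w w m'(2) jump_L2[OF vT m'(1)]] by (simp only: L2_inner_commute)
  qed
  have "(\<Sum>m=2..M. L2_inner D (jump P v (m - 1)) (rlim P (w + w') (m - 1)))
      = (\<Sum>m=2..M. L2_inner D (jump P v (m - 1)) (rlim P w (m - 1))) + (\<Sum>m=2..M. L2_inner D (jump P v (m - 1)) (rlim P w' (m - 1)))"
    unfolding sum.distrib[symmetric] by (intro sum.cong refl j)
  then show "full_form v (w + w') = full_form v w + full_form v w'"
    unfolding full_form_def dt_form_linear_right(1)[OF v trace_space_L2_H10[OF w] trace_space_L2_H10[OF w']]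
      integral_L2_H10_linear(3)[OF bounded_bilinear_spatial_form trace_space_L2_H10[OF vT] trace_space_L2_H10[OF vT] trace_space_L2_H10[OF w] trace_space_L2_H10[OF w']]
      L2_inner_commute[of D "rlim P v 0"] rlim_linear(1)[OF w w' zero_less_M r0]
    by linarith
  have "(\<Sum>m=2..M. L2_inner D (jump P v (m - 1)) (rlim P (c *\<^sub>R w) (m - 1)))
      = c * (\<Sum>m=2..M. L2_inner D (jump P v (m - 1)) (rlim P w (m - 1)))"
    unfolding sum_distrib_left by (intro sum.cong refl j)
  then show "full_form v (c *\<^sub>R w) = c * full_form v w"
    unfolding full_form_def dt_form_linear_right(2)[OF v trace_space_L2_H10[OF w] trace_space_L2_H10[OF w]]
      integral_L2_H10_linear(4)[OF bounded_bilinear_spatial_form trace_space_L2_H10[OF vT] trace_space_L2_H10[OF vT] trace_space_L2_H10[OF w] trace_space_L2_H10[OF w]]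
      L2_inner_commute[of D "rlim P v 0"] rlim_linear(2)[OF w w zero_less_M r0]
    by (simp only: distrib_left)
qed

lemma full_form_diff_left:
  assumes "v \<in> broken_space" "v' \<in> broken_space" "w \<in> trace_space"
  shows "full_form (v - v') w = full_form v w - full_form v' w"
  using full_form_add_left[OF subspace_diff[OF subspace_broken_space assms(1,2)] assms(2,3)] by simp

lemma full_form_diff_right:
  assumes "v \<in> broken_space" "w \<in> trace_space" "w' \<in> trace_space"
  shows "full_form v (w - w') = full_form v w - full_form v w'"
  using full_form_linear_right(1)[OF assms(1) subspace_diff[OF subspace_trace_space assms(2,3)] assms(3)] by simp


section \<open>Integration by parts in time and the discrete dual form\<close>

lemma L2_inner_sum_left:
  assumes "finite J" "\<And>j. j \<in> J \<Longrightarrow> c j \<in> L2_space D" "h \<in> L2_space D"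
  shows "L2_inner D (\<Sum>j\<in>J. s j *\<^sub>R c j) h = (\<Sum>j\<in>J. s j * L2_inner D (c j) h)"
  by (rule bounded_bilinear_on_sum_left[OF bounded_bilinear_on_L2_inner[OF subset_refl subset_refl order_refl order_refl]
    subspace_L2_space assms])

text \<open>As \<open>z\<close> is a polynomial in time, this reduces to integration by parts for the
  scalar functions $t \mapsto \langle v(t), c\rangle$ against the powers of $t$.\<close>

lemma time_integration_by_parts:
  assumes v: "v \<in> broken_space" and z: "z \<in> Xkh_space P" and m: "m \<in> {1..M}"
  shows "(LINT t|lebesgue_on (subint P m). weak_dt D (grid P (m - 1)) (grid P m) v t (z t))
      + (LINT t|lebesgue_on (subint P m). weak_dt D (grid P (m - 1)) (grid P m) z t (v t))
    = L2_inner D (llim P v m) (llim P z m) - L2_inner D (rlim P v (m - 1)) (rlim P z (m - 1))"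
proof -
  let ?a = "grid P (m - 1)" and ?b = "grid P m"
  let ?I = "\<lambda>f. LINT t|lebesgue_on {?a<..?b}. f t"
  note vT = broken_space_T[OF v]
  have m': "m - 1 < M" using m by auto
  obtain c where c: "\<And>j. j \<le> time_deg P \<Longrightarrow> c j \<in> V"
    and zc: "\<And>t. t \<in> subint P m \<Longrightarrow> z t = (\<Sum>j\<le>time_deg P. t ^ j *\<^sub>R c j)"
    using Xkh_polynomial[OF z m] by blast
  have cL: "c j \<in> L2_space D" if "j \<in> {..time_deg P}" for j using c H10_spaceD(2) that by blast
  let ?dv = "weak_dt D ?a ?b v"
  have dv: "has_weak_dt D ?a ?b v ?dv" by (rule broken_space_dt[OF v m])
  note vb = L2_H10_subint[OF trace_space_L2_H10[OF vT] m]
  have sm: "smooth (\<lambda>t::real. t ^ j)" for j by (intro smooth_power smooth_ident)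
  have scal: "?I (\<lambda>t. t ^ j * ?dv t (c j)) + ?I (\<lambda>t. deriv (\<lambda>t. t ^ j) t * L2_inner D (v t) (c j))
      = ?b ^ j * L2_inner D (llim P v m) (c j) - ?a ^ j * L2_inner D (rlim P v (m - 1)) (c j)"
    if j: "j \<in> {..time_deg P}" for j
  proof (rule weak_derivative_integration_by_parts)
    have cj: "c j \<in> V" using c j by simp
    show "?a < ?b" by (rule grid_less[OF m])
    show "integrable (lebesgue_on {?a<..?b}) (\<lambda>t. L2_inner D (v t) (c j))"
      by (rule integrable_L2_pairing[OF vb bochner_const[OF cj]])
    show "integrable (lebesgue_on {?a<..?b}) (\<lambda>t. ?dv t (c j))"
      by (rule integrable_dt_pairing[OF has_weak_dtD(1)[OF dv] bochner_const[OF cj]])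
    show "?I (\<lambda>t. deriv \<eta> t * L2_inner D (v t) (c j)) = - ?I (\<lambda>t. \<eta> t * ?dv t (c j))"
      if "\<eta> \<in> test_functions {?a<..<?b}" for \<eta>
      by (rule has_weak_dtD(2)[OF dv cj that])
    show "((\<lambda>t. L2_inner D (v t) (c j)) \<longlongrightarrow> L2_inner D (rlim P v (m - 1)) (c j)) (at_right ?a)"
      by (rule has_L2_lim_inner_tendsto[OF rlim_lim[OF vT m'] cL[OF j]])
    show "((\<lambda>t. L2_inner D (v t) (c j)) \<longlongrightarrow> L2_inner D (llim P v m) (c j)) (at_left ?b)"
      by (rule has_L2_lim_inner_tendsto[OF llim_lim[OF vT m] cL[OF j]])
  qed (rule sm)
  have 1: "?I (\<lambda>t. ?dv t (z t)) = (\<Sum>j\<le>time_deg P. ?I (\<lambda>t. t ^ j * ?dv t (c j)))"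
  proof -
    have i: "integrable (lebesgue_on {?a<..?b}) (\<lambda>t. t ^ j * ?dv t (c j))" if "j \<in> {..time_deg P}" for j
      using that c
      by (intro integrable_continuous_mult_Ioc[OF smooth_continuous[OF sm]]
        integrable_dt_pairing[OF has_weak_dtD(1)[OF dv] bochner_const]) simp
    have zB: "z \<in> bochner_L2 {?a<..?b} V nV" by (rule L2_H10_subint[OF Xkh_space_L2_H10[OF z] m])
    have "?I (\<lambda>t. ?dv t (z t)) = ?I (\<lambda>t. \<Sum>j\<le>time_deg P. t ^ j * ?dv t (c j))"
    proof (rule integral_cong_AE)
      show "(\<lambda>t. ?dv t (z t)) \<in> borel_measurable (lebesgue_on {?a<..?b})"
        by (rule borel_measurable_integrable[OF integrable_dt_pairing[OF has_weak_dtD(1)[OF dv] zB]])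
      show "(\<lambda>t. \<Sum>j\<le>time_deg P. t ^ j * ?dv t (c j)) \<in> borel_measurable (lebesgue_on {?a<..?b})"
        by (intro borel_measurable_integrable Bochner_Integration.integrable_sum i)
      have "AE t in lebesgue_on {?a<..?b}. t \<in> {?a<..?b}" using AE_space[of "lebesgue_on {?a<..?b}"] by simp
      then show "AE t in lebesgue_on {?a<..?b}. ?dv t (z t) = (\<Sum>j\<le>time_deg P. t ^ j * ?dv t (c j))"
        using bochner_L2_AE[OF has_weak_dtD(1)[OF dv]]
      proof eventually_elim
        case (elim t)
        have lin: "bounded_bilinear_on V nV (Hminus1_space D) (Hminus1_norm D) (\<lambda>h l. l h)"
          by (rule bounded_bilinear_on_swap[OF Hminus1_pairing])
        have zt: "z t = (\<Sum>j\<le>time_deg P. t ^ j *\<^sub>R c j)" using elim zc by (simp add: subint_def)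
        show ?case
          unfolding zt using elim c
          by (intro bounded_bilinear_on_sum_left[OF lin seminorm_onD(1)[OF H10]]) auto
      qed
    qed
    also have "\<dots> = (\<Sum>j\<le>time_deg P. ?I (\<lambda>t. t ^ j * ?dv t (c j)))"
      by (rule Bochner_Integration.integral_sum[OF i])
    finally show ?thesis .
  qed
  have 2: "?I (\<lambda>t. weak_dt D ?a ?b z t (v t)) = (\<Sum>j\<le>time_deg P. ?I (\<lambda>t. deriv (\<lambda>t. t ^ j) t * L2_inner D (v t) (c j)))"
  proof -
    note dz = Xkh_dt[OF c m zc]
    have "z \<in> broken_space" using z Xkh_space_W by blast
    have "?I (\<lambda>t. weak_dt D ?a ?b z t (v t))
        = ?I (\<lambda>t. (\<Sum>j\<le>time_deg P. deriv (\<lambda>t. t ^ j) t *\<^sub>R L2_inner D (c j)) (v t))"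
      by (rule has_weak_dt_integral_eq[OF has_weak_dt_weak_dt[OF dz] dz vb])
    also have "\<dots> = ?I (\<lambda>t. \<Sum>j\<le>time_deg P. deriv (\<lambda>t. t ^ j) t * L2_inner D (v t) (c j))"
      by (simp only: sum_fun_apply scaleR_fun_apply real_scaleR_def L2_inner_commute[of D "c _"])
    also have "\<dots> = (\<Sum>j\<le>time_deg P. ?I (\<lambda>t. deriv (\<lambda>t. t ^ j) t * L2_inner D (v t) (c j)))"
    proof (rule Bochner_Integration.integral_sum)
      show "integrable (lebesgue_on {?a<..?b}) (\<lambda>t. deriv (\<lambda>t. t ^ j) t * L2_inner D (v t) (c j))"
        if "j \<in> {..time_deg P}" for j
        using that c
        by (intro integrable_continuous_mult_Ioc[OF smooth_continuous[OF smooth_deriv[OF sm]]]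
          integrable_L2_pairing[OF vb bochner_const]) simp
    qed
    finally show ?thesis .
  qed
  note zl = Xkh_lims[OF c m zc]
  have 3: "L2_inner D (llim P v m) (llim P z m) = (\<Sum>j\<le>time_deg P. ?b ^ j * L2_inner D (llim P v m) (c j))"
    using llim_inner[OF zl(2) llim_L2[OF vT m]] L2_inner_sum_left[OF finite_atMost cL llim_L2[OF vT m], where s = "\<lambda>j. ?b ^ j"]
    by (simp add: L2_inner_commute[of D "llim P v m"])
  have 4: "L2_inner D (rlim P v (m - 1)) (rlim P z (m - 1)) = (\<Sum>j\<le>time_deg P. ?a ^ j * L2_inner D (rlim P v (m - 1)) (c j))"
    unfolding L2_inner_commute[of D "rlim P v (m - 1)"]
    by (rule trans[OF rlim_inner[OF zl(1) rlim_L2[OF vT m']] L2_inner_sum_left[OF finite_atMost cL rlim_L2[OF vT m']]])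
  have "(\<Sum>j\<le>time_deg P. ?I (\<lambda>t. t ^ j * ?dv t (c j))) + (\<Sum>j\<le>time_deg P. ?I (\<lambda>t. deriv (\<lambda>t. t ^ j) t * L2_inner D (v t) (c j)))
      = (\<Sum>j\<le>time_deg P. ?b ^ j * L2_inner D (llim P v m) (c j) - ?a ^ j * L2_inner D (rlim P v (m - 1)) (c j))"
    unfolding sum.distrib[symmetric] by (intro sum.cong refl scal)
  then show ?thesis
    unfolding subint_def 1 2 3 4 sum_subtractf .
qed

text \<open>The boundary terms of the subintervals recombine: at an inner node they turn jumps of \<open>z\<close> tested
  with left limits of \<open>v\<close> into jumps of \<open>v\<close> tested with right limits of \<open>z\<close>.\<close>

lemma dual_form_eq:
  assumes v: "v \<in> broken_space" and z: "z \<in> Xkh_space P"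
  shows "A_dual_form P z v + L2_inner D (llim P z M) (llim P v M) = full_form v z"
proof -
  have zW: "z \<in> broken_space" using z Xkh_space_W by blast
  note vT = broken_space_T[OF v] and zT = broken_space_T[OF zW]
  define A where "A m = L2_inner D (rlim P v (m - 1)) (rlim P z (m - 1))" for m
  define B where "B m = L2_inner D (llim P v m) (llim P z m)" for m
  define C where "C m = L2_inner D (llim P v (m - 1)) (rlim P z (m - 1))" for m
  have dt: "dt_form P v z + dt_form P z v = (\<Sum>m=1..M. B m) - (\<Sum>m=1..M. A m)"
    unfolding dt_form_def sum.distrib[symmetric] sum_subtractf[symmetric] A_def B_def
    by (intro sum.cong refl time_integration_by_parts v z)
  have jv: "L2_inner D (jump P v (m - 1)) (rlim P z (m - 1)) = A m - C m"
    and jz: "L2_inner D (jump P z (m - 1)) (llim P v (m - 1)) = C m - B (m - 1)" if m: "m \<in> {2..M}" for m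
  proof -
    have m': "m - 1 \<in> {1..<M}" "m - 1 \<in> {1..M}" "m - 1 < M" using m by auto
    show "L2_inner D (jump P v (m - 1)) (rlim P z (m - 1)) = A m - C m"
      unfolding A_def C_def by (rule jump_inner[OF vT m'(1) rlim_L2[OF zT m'(3)]])
    show "L2_inner D (jump P z (m - 1)) (llim P v (m - 1)) = C m - B (m - 1)"
      unfolding B_def C_def jump_inner[OF zT m'(1) llim_L2[OF vT m'(2)]] by (simp add: L2_inner_commute)
  qed
  have "(\<Sum>m=2..M. L2_inner D (jump P z (m - 1)) (llim P v (m - 1))) = (\<Sum>m=2..M. C m - B (m - 1))"
    by (intro sum.cong refl jz)
  moreover have "L2_inner D (llim P z M) (llim P v M) = B M" by (simp add: B_def L2_inner_commute)
  ultimately have "A_dual_form P z v + L2_inner D (llim P z M) (llim P v M)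
      = - dt_form P z v + (LINT t|lebesgue_on (time_int P). spatial_form (v t) (z t)) - (\<Sum>m=2..M. C m - B (m - 1)) + B M"
    using a_dual_eq[OF trace_space_L2_H10[OF vT] trace_space_L2_H10[OF zT]]
    unfolding A_dual_form_def by linarith
  moreover have "full_form v z = dt_form P v z + (LINT t|lebesgue_on (time_int P). spatial_form (v t) (z t))
      + (\<Sum>m=2..M. A m - C m) + A 1"
  proof -
    have "(\<Sum>m=2..M. L2_inner D (jump P v (m - 1)) (rlim P z (m - 1))) = (\<Sum>m=2..M. A m - C m)"
      by (intro sum.cong refl jv)
    moreover have "L2_inner D (rlim P v 0) (rlim P z 0) = A 1" by (simp add: A_def)
    ultimately show ?thesis unfolding full_form_def by linarith
  qed
  ultimately show ?thesis
    using dt sum_shift_pred[OF M_pos, of B] sum_split_first[OF M_pos, of A]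
    unfolding sum_subtractf by linarith
qed

section \<open>Stationary points\<close>

lemma initial_L2: "initial P \<in> L2_space D"
  using problem_data unfolding problem_data_def by blast

lemma source_bochner: "source P \<in> bochner_L2 (time_int P) (Hminus1_space D) (Hminus1_norm D)"
  using problem_data unfolding problem_data_def by blast

text \<open>The right-hand side of the primal problem.\<close>

definition rhs :: "'a st_fun \<Rightarrow> real"
  where "rhs w = F_form P w + L2_inner D (initial P) (rlim P w 0)"

lemma rhs_linear:
  assumes w: "w \<in> trace_space" and w': "w' \<in> trace_space"
  shows "rhs (w + c *\<^sub>R w') = rhs w + c * rhs w'"
proof -
  let ?M = "lebesgue_on (time_int P)"
  note cw' = subspace_scale[OF subspace_trace_space w', of c]
  have int: "integrable ?M (\<lambda>t. source P t (v t))" if "v \<in> trace_space" for v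
    using integrable_bounded_bilinear_bochner[OF time_int_sets Hminus1 H10 Hminus1_pairing source_bochner]
      trace_space_L2_H10[OF that] unfolding L2_H10_def by blast
  have "F_form P (w + c *\<^sub>R w') = (LINT t|?M. source P t (w t) + c * source P t (w' t))"
    unfolding F_form_def
  proof (rule integral_cong_AE)
    show "(\<lambda>t. source P t ((w + c *\<^sub>R w') t)) \<in> borel_measurable ?M"
      by (rule borel_measurable_integrable[OF int[OF subspace_add[OF subspace_trace_space w cw']]])
    show "(\<lambda>t. source P t (w t) + c * source P t (w' t)) \<in> borel_measurable ?M"
      by (rule borel_measurable_integrable[OF Bochner_Integration.integrable_add[OF int[OF w] integrable_mult_right[OF int[OF w']]]])
    show "AE t in ?M. source P t ((w + c *\<^sub>R w') t) = source P t (w t) + c * source P t (w' t)"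
      using bochner_L2_AE[OF source_bochner] L2_H10_AE[OF trace_space_L2_H10[OF w]] L2_H10_AE[OF trace_space_L2_H10[OF w']]
      by eventually_elim
        (simp add: bounded_bilinear_onD(3,4)[OF Hminus1_pairing] seminorm_onD(7)[OF H10])
  qed
  also have "\<dots> = F_form P w + c * F_form P w'"
    unfolding F_form_def using int[OF w] int[OF w'] by simp
  finally have F: "F_form P (w + c *\<^sub>R w') = F_form P w + c * F_form P w'" .
  show ?thesis
    unfolding rhs_def F L2_inner_commute[of D "initial P"] rlim_linear(1)[OF w cw' zero_less_M initial_L2]
      rlim_linear(2)[OF w' w' zero_less_M initial_L2]
    by (simp add: algebra_simps)
qed

lemma initial_term:
  assumes "v \<in> trace_space" "w \<in> trace_space"
  shows "L2_inner D (rlim P v 0 - initial P) (rlim P w 0)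
    = L2_inner D (rlim P v 0) (rlim P w 0) - L2_inner D (initial P) (rlim P w 0)"
  by (rule L2_inner_diff_left[OF rlim_L2[OF assms(1) zero_less_M] initial_L2 rlim_L2[OF assms(2) zero_less_M]])

lemma rho_eq:
  assumes "v \<in> trace_space" "w \<in> trace_space"
  shows "rho P v w = rhs w - full_form v w"
  unfolding rho_def initial_term[OF assms] rhs_def A_form_eq[OF trace_space_L2_H10[OF assms(1)] trace_space_L2_H10[OF assms(2)], symmetric]
  by simp

lemma Lagrangian_eq:
  assumes "v \<in> trace_space" "w \<in> trace_space"
  shows "Lagrangian P J v w = J v + rhs w - full_form v w"
  unfolding Lagrangian_def initial_term[OF assms] rhs_def
    A_form_eq[OF trace_space_L2_H10[OF assms(1)] trace_space_L2_H10[OF assms(2)], symmetric] A_form_def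
  by simp

lemma Lagrangian_z_eq:
  assumes u: "u \<in> broken_space" and z: "z \<in> trace_space" and w: "w \<in> trace_space"
  shows "Lagrangian_z P J u z w = rhs w - full_form u w"
proof -
  note uT = broken_space_T[OF u]
  have "Lagrangian P J u (z + s *\<^sub>R w) = (J u + rhs z - full_form u z) + s * (rhs w - full_form u w)" for s
  proof -
    note sw = subspace_scale[OF subspace_trace_space w, of s]
    show ?thesis
      unfolding Lagrangian_eq[OF uT subspace_add[OF subspace_trace_space z sw]] rhs_linear[OF z w]
        full_form_linear_right(1)[OF u z sw] full_form_linear_right(2)[OF u w w]
      by (simp add: algebra_simps)
  qed
  then have "Lagrangian_z P J u z w = deriv (\<lambda>s. (J u + rhs z - full_form u z) + s * (rhs w - full_form u w)) 0"
    unfolding Lagrangian_z_def by simp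
  also have "\<dots> = rhs w - full_form u w"
    by (rule DERIV_imp_deriv) (auto intro!: derivative_eq_intros)
  finally show ?thesis .
qed

lemma Lagrangian_u_eq:
  assumes u: "u \<in> broken_space" and \<psi>: "\<psi> \<in> broken_space" and z: "z \<in> trace_space"
    and J: "((\<lambda>s. J (u + s *\<^sub>R \<psi>)) has_real_derivative d) (at 0)"
  shows "Lagrangian_u P J u z \<psi> = d - full_form \<psi> z"
proof -
  have "Lagrangian P J (u + s *\<^sub>R \<psi>) z = J (u + s *\<^sub>R \<psi>) + (rhs z - full_form u z) - s * full_form \<psi> z" for s
  proof -
    note s\<psi> = subspace_scale[OF subspace_broken_space \<psi>, of s]
    show ?thesis
      unfolding Lagrangian_eq[OF broken_space_T[OF subspace_add[OF subspace_broken_space u s\<psi>]] z]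
        full_form_add_left[OF u s\<psi> z] full_form_scale_left[OF \<psi> z]
      by simp
  qed
  then have "Lagrangian_u P J u z \<psi> = deriv (\<lambda>s. J (u + s *\<^sub>R \<psi>) + (rhs z - full_form u z) - s * full_form \<psi> z) 0"
    unfolding Lagrangian_u_def by simp
  also have "\<dots> = d - full_form \<psi> z"
    by (rule DERIV_imp_deriv) (auto intro!: derivative_eq_intros J)
  finally show ?thesis .
qed


section \<open>Discontinuous test functions in the dual problem\<close>

lemma sum_integral_subint:
  fixes f :: "real \<Rightarrow> real"
  assumes "integrable (lebesgue_on (time_int P)) f"
  shows "(\<Sum>m=1..M. LINT t|lebesgue_on (subint P m). f t) = (LINT t|lebesgue_on (time_int P). f t)"
proof -
  have "(\<Sum>m=1..n. LINT t|lebesgue_on (subint P m). f t) = (LINT t|lebesgue_on {0<..grid P n}. f t)" if "n \<le> M" for n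
    using that
  proof (induction n)
    case 0
    then show ?case by (simp add: grid_0)
  next
    case (Suc n)
    have "integrable (lebesgue_on {0<..grid P (Suc n)}) f"
      by (rule integrable_lebesgue_on_subset[OF assms time_int_sets])
        (use grid_bounds(2)[OF Suc.prems] in \<open>auto simp: time_int_def\<close>)
    moreover have "0 \<le> grid P n" "grid P n \<le> grid P (Suc n)"
      using grid_bounds(1)[of n] grid_mono[of n "Suc n"] Suc.prems by auto
    ultimately show ?case
      using Suc integral_Ioc_combine[of 0 "grid P n" "grid P (Suc n)" f] by (simp add: subint_def)
  qed
  from this[of M] show ?thesis by (simp add: time_int_def final_time_def)
qed

lemma scalar_lims:
  assumes "smooth \<theta>" "c \<in> V"
  shows "has_L2_lim D (at_right a) (\<lambda>t. \<theta> t *\<^sub>R c) (\<theta> a *\<^sub>R c)"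
    and "has_L2_lim D (at_left a) (\<lambda>t. \<theta> t *\<^sub>R c) (\<theta> a *\<^sub>R c)"
proof -
  have "isCont \<theta> a" using smooth_continuous[OF assms(1), of UNIV] by (simp add: continuous_on_eq_continuous_at)
  then have *: "(\<theta> \<longlongrightarrow> \<theta> a) (at a)" by (simp add: isCont_def)
  show "has_L2_lim D (at_right a) (\<lambda>t. \<theta> t *\<^sub>R c) (\<theta> a *\<^sub>R c)"
    by (intro has_L2_lim_scalar H10_spaceD(2)[OF assms(2)] tendsto_mono[OF at_le *]) simp
  show "has_L2_lim D (at_left a) (\<lambda>t. \<theta> t *\<^sub>R c) (\<theta> a *\<^sub>R c)"
    by (intro has_L2_lim_scalar H10_spaceD(2)[OF assms(2)] tendsto_mono[OF at_le *]) simp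
qed

text \<open>A smooth function of time has no jumps.\<close>

lemma full_form_scalar:
  assumes \<theta>: "smooth \<theta>" and c: "c \<in> V" and z: "z \<in> trace_space"
  shows "full_form (\<lambda>t. \<theta> t *\<^sub>R c) z
    = (LINT t|lebesgue_on (time_int P). deriv \<theta> t * L2_inner D c (z t))
    + (LINT t|lebesgue_on (time_int P). \<theta> t * spatial_form c (z t)) + \<theta> 0 * L2_inner D c (rlim P z 0)"
proof -
  let ?v = "\<lambda>t. \<theta> t *\<^sub>R c"
  have vX: "?v \<in> X_space P" by (rule X_space_scalar[OF \<theta> c])
  then have v: "?v \<in> broken_space" using X_space_W by blast
  note vT = broken_space_T[OF v] and zB = trace_space_L2_H10[OF z]
  have cB: "(\<lambda>t. c) \<in> L2_H10" unfolding L2_H10_def time_int_def by (rule bochner_const[OF c])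
  have "integrable (lebesgue_on (time_int P)) (\<lambda>t. deriv \<theta> t * L2_inner D c (z t))"
    using integrable_L2_H10[OF L2_pairing cB zB] unfolding time_int_def
    by (intro integrable_continuous_mult_Ioc smooth_continuous smooth_deriv \<theta>)
  note split = sum_integral_subint[OF this]
  have "dt_form P ?v z = (\<Sum>m=1..M. LINT t|lebesgue_on (subint P m). (deriv \<theta> t *\<^sub>R L2_inner D c) (z t))"
    by (rule dt_form_eq[OF v zB]) (intro has_weak_dt_scalar[OF less_imp_le[OF grid_less] \<theta> c])
  then have dt: "dt_form P ?v z = (LINT t|lebesgue_on (time_int P). deriv \<theta> t * L2_inner D c (z t))"
    using split by simp
  have a: "(LINT t|lebesgue_on (time_int P). spatial_form (?v t) (z t)) = (LINT t|lebesgue_on (time_int P). \<theta> t * spatial_form c (z t))"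
  proof (rule integral_cong_AE)
    show "(\<lambda>t. spatial_form (?v t) (z t)) \<in> borel_measurable (lebesgue_on (time_int P))"
      by (rule borel_measurable_integrable[OF integrable_L2_H10[OF bounded_bilinear_spatial_form trace_space_L2_H10[OF vT] zB]])
    show "(\<lambda>t. \<theta> t * spatial_form c (z t)) \<in> borel_measurable (lebesgue_on (time_int P))"
      by (rule borel_measurable_times[OF smooth_measurable_lebesgue_on[OF \<theta>]
        borel_measurable_integrable[OF integrable_L2_H10[OF bounded_bilinear_spatial_form cB zB]]])
    show "AE t in lebesgue_on (time_int P). spatial_form (?v t) (z t) = \<theta> t * spatial_form c (z t)"
      using L2_H10_AE[OF zB] by eventually_elim (rule bounded_bilinear_onD(2)[OF bounded_bilinear_spatial_form c])
  qed
  have "L2_inner D (jump P ?v (m - 1)) (rlim P z (m - 1)) = 0" if m: "m \<in> {2..M}" for m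
  proof -
    have m': "m - 1 \<in> {1..<M}" "m - 1 < M" using m by auto
    note h = rlim_L2[OF z m'(2)]
    show ?thesis
      unfolding jump_inner[OF vT m'(1) h] rlim_inner[OF scalar_lims(1)[OF \<theta> c] h] llim_inner[OF scalar_lims(2)[OF \<theta> c] h]
      by simp
  qed
  then have jumps: "(\<Sum>m=2..M. L2_inner D (jump P ?v (m - 1)) (rlim P z (m - 1))) = 0"
    by (intro sum.neutral ballI)
  have r0: "L2_inner D (rlim P ?v 0) (rlim P z 0) = \<theta> 0 * L2_inner D c (rlim P z 0)"
    using rlim_inner[OF scalar_lims(1)[OF \<theta> c] rlim_L2[OF z zero_less_M]]
    by (simp add: L2_inner_scale_left grid_0)
  show ?thesis unfolding full_form_def dt a jumps r0 by simp
qed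

context
  fixes q z :: "'a st_fun"
  assumes q: "q \<in> bochner_L2 (time_int P) (L2_space D) (L2_norm D)"
    and z: "z \<in> trace_space"
    and dual: "\<And>\<psi>. \<psi> \<in> X_space P \<Longrightarrow> st_inner P q \<psi> = full_form \<psi> z"
begin

lemma q_pairing: "bounded_bilinear_on (L2_space D) (L2_norm D) V nV (L2_inner D)"
  by (rule bounded_bilinear_on_L2_inner) (auto intro: H10_spaceD L2_norm_le_H1_norm)

lemma integrable_q: "w \<in> L2_H10 \<Longrightarrow> integrable (lebesgue_on (time_int P)) (\<lambda>t. L2_inner D (q t) (w t))"
  using integrable_bounded_bilinear_bochner[OF time_int_sets seminorm_on_L2 H10 q_pairing q] unfolding L2_H10_def by blast

lemma const_L2_H10: "c \<in> V \<Longrightarrow> (\<lambda>t. c) \<in> L2_H10"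
  unfolding L2_H10_def time_int_def by (rule bochner_const)

lemma integrable_dual_data:
  assumes c: "c \<in> V"
  shows "integrable (lebesgue_on (time_int P)) (\<lambda>t. L2_inner D (q t) c - spatial_form c (z t))"
    and "integrable (lebesgue_on (time_int P)) (\<lambda>t. L2_inner D c (z t))"
  by (intro Bochner_Integration.integrable_diff integrable_q[OF const_L2_H10[OF c]]
      integrable_L2_H10[OF bounded_bilinear_spatial_form const_L2_H10[OF c] trace_space_L2_H10[OF z]])
    (rule integrable_L2_H10[OF L2_pairing const_L2_H10[OF c] trace_space_L2_H10[OF z]])

text \<open>Tested with \<open>\<theta> t *\<^sub>R c\<close>, the dual problem says that the scalar function
  $\langle c, z\rangle$ has the weak time derivative $a(c, z) - \langle q, c\rangle$ and vanishes at the final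
  time in the weak sense.\<close>

lemma dual_scalar:
  assumes \<theta>: "smooth \<theta>" and c: "c \<in> V"
  shows "(LINT t|lebesgue_on (time_int P). \<theta> t * (L2_inner D (q t) c - spatial_form c (z t)))
    = (LINT t|lebesgue_on (time_int P). deriv \<theta> t * L2_inner D c (z t)) + \<theta> 0 * L2_inner D c (rlim P z 0)"
proof -
  let ?M = "lebesgue_on (time_int P)"
  note zB = trace_space_L2_H10[OF z]
  have i: "integrable ?M (\<lambda>t. \<theta> t * L2_inner D (q t) c)" "integrable ?M (\<lambda>t. \<theta> t * spatial_form c (z t))"
    unfolding time_int_def
    by (rule integrable_continuous_mult_Ioc[OF smooth_continuous[OF \<theta>] integrable_q[OF const_L2_H10[OF c], unfolded time_int_def]],
      rule integrable_continuous_mult_Ioc[OF smooth_continuous[OF \<theta>]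
        integrable_L2_H10[OF bounded_bilinear_spatial_form const_L2_H10[OF c] zB, unfolded time_int_def]])
  have "(LINT t|?M. \<theta> t * (L2_inner D (q t) c - spatial_form c (z t)))
      = (LINT t|?M. \<theta> t * L2_inner D (q t) c) - (LINT t|?M. \<theta> t * spatial_form c (z t))"
    using i by (simp add: right_diff_distrib)
  moreover have "st_inner P q (\<lambda>t. \<theta> t *\<^sub>R c) = (LINT t|?M. \<theta> t * L2_inner D (q t) c)"
    unfolding st_inner_def L2_inner_scale_right by simp
  ultimately show ?thesis
    using dual[OF X_space_scalar[OF \<theta> c]] full_form_scalar[OF \<theta> c z] by simp
qed

text \<open>Test with \<open>p * c\<close> times a cut-off at the node \<open>k\<close>.  The cut-off vanishes up to the node, so
  no term at the initial time appears, and in the limit it leaves the right limit of \<open>z\<close>.\<close>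

lemma dual_step:
  assumes p: "smooth p" and c: "c \<in> V" and k: "k < M"
  shows "(LINT t|lebesgue_on {grid P k<..Tend}. p t * (L2_inner D (q t) c - spatial_form c (z t)))
    = (LINT t|lebesgue_on {grid P k<..Tend}. deriv p t * L2_inner D c (z t)) + p (grid P k) * L2_inner D c (rlim P z k)"
proof -
  let ?a = "grid P k"
  let ?I = "\<lambda>f. LINT t|lebesgue_on {?a<..Tend}. f t"
  define G where "G t = L2_inner D (q t) c - spatial_form c (z t)" for t
  define U where "U t = L2_inner D c (z t)" for t
  define \<theta> where "\<theta> n t = p t * ramp 1 ?a n t" for n t
  have \<theta>: "smooth (\<theta> n)" for n unfolding \<theta>_def[abs_def] by (intro smooth_mult p smooth_ramp)
  have a_bounds: "0 \<le> ?a" "?a < Tend" using k grid_bounds(1)[of k] grid_less_Tend by auto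
  have sub: "{?a<..Tend} \<subseteq> time_int P" "{?a<..Tend} \<in> sets lebesgue" using a_bounds by (auto simp: time_int_def)
  have iG: "integrable (lebesgue_on {?a<..Tend}) G" and iU: "integrable (lebesgue_on {?a<..Tend}) U"
    unfolding G_def[abs_def] U_def[abs_def]
    by (rule integrable_lebesgue_on_subset[OF integrable_dual_data(1)[OF c] time_int_sets sub(2,1)],
      rule integrable_lebesgue_on_subset[OF integrable_dual_data(2)[OF c] time_int_sets sub(2,1)])
  have zero: "\<theta> n t = 0" "deriv (\<theta> n) t = 0" if "t \<le> ?a" for n t
  proof -
    have r: "ramp 1 ?a n t = 0" using that by (intro ramp_eq_0) simp
    then show "\<theta> n t = 0" by (simp add: \<theta>_def)
    have "real n * (1 * (t - ?a)) \<le> 0" using that by (intro mult_nonneg_nonpos) auto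
    then have "deriv step (real n * (1 * (t - ?a))) = 0" by (intro deriv_step_eq_0) simp
    then have "(ramp 1 ?a n has_real_derivative 0) (at t)" using ramp_derivative[of 1 ?a n t] by simp
    from DERIV_mult[OF smooth_real_derivative[OF p] this]
    have "(\<theta> n has_real_derivative 0) (at t)" unfolding \<theta>_def[abs_def] using r by simp
    then show "deriv (\<theta> n) t = 0" by (rule DERIV_imp_deriv)
  qed
  have "?I (\<lambda>t. \<theta> n t * G t) = ?I (\<lambda>t. deriv (\<theta> n) t * U t)" for n
  proof -
    have "(LINT t|lebesgue_on (time_int P). \<theta> n t * G t) = ?I (\<lambda>t. \<theta> n t * G t)"
      by (rule integral_lebesgue_on_subset[OF time_int_sets sub(2,1)]) (use zero in \<open>auto simp: time_int_def\<close>)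
    moreover have "(LINT t|lebesgue_on (time_int P). deriv (\<theta> n) t * U t) = ?I (\<lambda>t. deriv (\<theta> n) t * U t)"
      by (rule integral_lebesgue_on_subset[OF time_int_sets sub(2,1)]) (use zero in \<open>auto simp: time_int_def\<close>)
    moreover have "\<theta> n 0 = 0" by (rule zero(1)[OF a_bounds(1)])
    ultimately show ?thesis using dual_scalar[OF \<theta> c, of n] unfolding G_def U_def by simp
  qed
  moreover have "(\<lambda>n. ?I (\<lambda>t. \<theta> n t * G t)) \<longlonglongrightarrow> ?I (\<lambda>t. p t * G t)"
    unfolding \<theta>_def by (rule ramp_integral_tendsto[OF a_bounds(2) iG smooth_continuous[OF p]]) simp
  moreover have "(\<lambda>n. ?I (\<lambda>t. deriv (\<theta> n) t * U t)) \<longlonglongrightarrow> ?I (\<lambda>t. deriv p t * U t) + 1 * (p ?a * L2_inner D c (rlim P z k))"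
    unfolding \<theta>_def[abs_def]
  proof (rule ramp_deriv_tendsto[OF a_bounds(2) iU p])
    show "(U \<longlongrightarrow> L2_inner D c (rlim P z k)) (at_right ?a)"
      using has_L2_lim_inner_tendsto[OF rlim_lim[OF z k] H10_spaceD(2)[OF c]]
      unfolding U_def[abs_def] by (simp add: L2_inner_commute)
  qed simp
  ultimately have "?I (\<lambda>t. p t * G t) = ?I (\<lambda>t. deriv p t * U t) + 1 * (p ?a * L2_inner D c (rlim P z k))"
    by (simp only: LIMSEQ_unique)
  then show ?thesis unfolding G_def U_def by simp
qed

text \<open>The difference of two consecutive instances of \<open>dual_step\<close>; behind the last node there is
  nothing to subtract.\<close>

lemma dual_subint:
  assumes p: "smooth p" and c: "c \<in> V" and m: "m \<in> {1..M}"
  shows "(LINT t|lebesgue_on (subint P m). p t * (L2_inner D (q t) c - spatial_form c (z t)))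
      - (LINT t|lebesgue_on (subint P m). deriv p t * L2_inner D c (z t))
    = p (grid P (m - 1)) * L2_inner D c (rlim P z (m - 1))
      - (if m < M then p (grid P m) * L2_inner D c (rlim P z m) else 0)"
proof -
  define G where "G t = p t * (L2_inner D (q t) c - spatial_form c (z t))" for t
  define U where "U t = deriv p t * L2_inner D c (z t)" for t
  have m1: "m - 1 < M" using m by auto
  have ab: "grid P (m - 1) \<le> grid P m" "grid P m \<le> Tend" "0 \<le> grid P (m - 1)"
    using m grid_less[OF m] grid_bounds(2)[of m] grid_bounds(1)[of "m - 1"] by auto
  have iG: "integrable (lebesgue_on (time_int P)) G" and iU: "integrable (lebesgue_on (time_int P)) U"
    unfolding G_def[abs_def] U_def[abs_def] time_int_def
    by (rule integrable_continuous_mult_Ioc[OF smooth_continuous[OF p] integrable_dual_data(1)[OF c, unfolded time_int_def]],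
      rule integrable_continuous_mult_Ioc[OF smooth_continuous[OF smooth_deriv[OF p]]
        integrable_dual_data(2)[OF c, unfolded time_int_def]])
  have sub: "{grid P (m - 1)<..Tend} \<subseteq> time_int P" "{grid P (m - 1)<..Tend} \<in> sets lebesgue"
    using ab by (auto simp: time_int_def)
  note cG = integral_Ioc_combine[OF ab(1,2) integrable_lebesgue_on_subset[OF iG time_int_sets sub(2,1)]]
  note cU = integral_Ioc_combine[OF ab(1,2) integrable_lebesgue_on_subset[OF iU time_int_sets sub(2,1)]]
  note left = dual_step[OF p c m1, folded G_def U_def]
  show ?thesis
  proof (cases "m < M")
    case True
    note right = dual_step[OF p c True, folded G_def U_def]
    show ?thesis
      unfolding G_def[symmetric] U_def[symmetric] subint_def using True cG cU left right by simp
  next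
    case False
    then have "grid P m = Tend" using m by (simp add: final_time_def)
    then show ?thesis
      unfolding G_def[symmetric] U_def[symmetric] subint_def using False left by simp
  qed
qed

text \<open>Summing over the powers of $t$ and the subintervals: at an inner node the left limit of \<open>\<psi>\<close>
  comes from the subinterval before and the right limit from the one behind it, which together
  form the jump.\<close>

lemma dual_problem_Xkh:
  assumes \<psi>: "\<psi> \<in> Xkh_space P"
  shows "st_inner P q \<psi> = full_form \<psi> z"
proof -
  have \<psi>W: "\<psi> \<in> broken_space" using \<psi> Xkh_space_W by blast
  note \<psi>T = broken_space_T[OF \<psi>W]
  note \<psi>B = trace_space_L2_H10[OF \<psi>T] and zB = trace_space_L2_H10[OF z]
  let ?M = "lebesgue_on (time_int P)"
  let ?dt = "\<lambda>m. weak_dt D (grid P (m - 1)) (grid P m) \<psi>"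
  define f where "f t = L2_inner D (q t) (\<psi> t) - spatial_form (\<psi> t) (z t)" for t
  define A where "A m = L2_inner D (rlim P \<psi> (m - 1)) (rlim P z (m - 1))" for m
  define B where "B m = (if m < M then L2_inner D (llim P \<psi> m) (rlim P z m) else 0)" for m
  have f: "integrable ?M f"
    unfolding f_def[abs_def]
    by (intro Bochner_Integration.integrable_diff integrable_q[OF \<psi>B] integrable_L2_H10[OF bounded_bilinear_spatial_form \<psi>B zB])
  have "(LINT t|lebesgue_on (subint P m). f t) - (LINT t|lebesgue_on (subint P m). ?dt m t (z t)) = A m - B m"
    if m: "m \<in> {1..M}" for m
  proof -
    have m1: "m - 1 < M" using m by auto
    let ?S = "lebesgue_on (subint P m)"
    let ?J = "{..time_deg P}"
    obtain c where c: "\<And>j. j \<le> time_deg P \<Longrightarrow> c j \<in> V"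
      and \<psi>c: "\<And>t. t \<in> subint P m \<Longrightarrow> \<psi> t = (\<Sum>j\<le>time_deg P. t ^ j *\<^sub>R c j)"
      using Xkh_polynomial[OF \<psi> m] by blast
    have cV: "c j \<in> V" if "j \<in> ?J" for j using c that by simp
    have cL: "c j \<in> L2_space D" if "j \<in> ?J" for j by (rule H10_spaceD(2)[OF cV[OF that]])
    have sm: "smooth (\<lambda>t::real. t ^ j)" for j by (intro smooth_power smooth_ident)
    define G where "G j t = L2_inner D (q t) (c j) - spatial_form (c j) (z t)" for j t
    have iG: "integrable ?S (\<lambda>t. t ^ j * G j t)" and iU: "integrable ?S (\<lambda>t. deriv (\<lambda>t. t ^ j) t * L2_inner D (c j) (z t))"
      if j: "j \<in> ?J" for j
    proof -
      note r = integrable_lebesgue_on_subset[OF _ time_int_sets subint_sets subint_subset[OF m]]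
      show "integrable ?S (\<lambda>t. t ^ j * G j t)"
        using r[OF integrable_dual_data(1)[OF cV[OF j]]] unfolding G_def subint_def
        by (intro integrable_continuous_mult_Ioc smooth_continuous sm)
      show "integrable ?S (\<lambda>t. deriv (\<lambda>t. t ^ j) t * L2_inner D (c j) (z t))"
        using r[OF integrable_dual_data(2)[OF cV[OF j]]] unfolding subint_def
        by (intro integrable_continuous_mult_Ioc smooth_continuous smooth_deriv sm)
    qed
    have inS: "AE t in ?S. t \<in> subint P m" using AE_space[of ?S] by simp
    have aeS: "AE t in ?S. Q t" if "AE t in ?M. Q t" for Q
    proof -
      have "AE t in lebesgue. t \<in> time_int P \<longrightarrow> Q t" using that time_int_sets by (simp add: AE_restrict_space_iff)
      then have "AE t in lebesgue. t \<in> subint P m \<longrightarrow> Q t"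
        by eventually_elim (use subint_subset[OF m] in blast)
      then show ?thesis using subint_sets by (simp add: AE_restrict_space_iff)
    qed
    have 1: "(LINT t|?S. f t) = (\<Sum>j\<in>?J. (LINT t|?S. t ^ j * G j t))"
    proof -
      have "(LINT t|?S. f t) = (LINT t|?S. (\<Sum>j\<in>?J. t ^ j * G j t))"
      proof (rule integral_cong_AE)
        show "f \<in> borel_measurable ?S"
          by (rule borel_measurable_integrable[OF integrable_lebesgue_on_subset[OF f time_int_sets subint_sets subint_subset[OF m]]])
        show "(\<lambda>t. \<Sum>j\<in>?J. t ^ j * G j t) \<in> borel_measurable ?S"
          by (intro borel_measurable_integrable Bochner_Integration.integrable_sum iG)
        show "AE t in ?S. f t = (\<Sum>j\<in>?J. t ^ j * G j t)"
          using inS aeS[OF L2_H10_AE[OF zB]] aeS[OF bochner_L2_AE[OF q]]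
        proof eventually_elim
          case (elim t)
          have "L2_inner D (q t) (\<Sum>j\<in>?J. t ^ j *\<^sub>R c j) = (\<Sum>j\<in>?J. t ^ j * L2_inner D (q t) (c j))"
            using L2_inner_sum_left[OF finite_atMost cL elim(3), where s = "\<lambda>j. t ^ j"]
            by (simp add: L2_inner_commute[of D "q t"])
          moreover have "spatial_form (\<Sum>j\<in>?J. t ^ j *\<^sub>R c j) (z t) = (\<Sum>j\<in>?J. t ^ j * spatial_form (c j) (z t))"
            by (rule bounded_bilinear_on_sum_left[OF bounded_bilinear_spatial_form seminorm_onD(1)[OF H10] finite_atMost cV elim(2)])
          ultimately show ?case
            unfolding f_def G_def \<psi>c[OF elim(1)] by (simp add: right_diff_distrib sum_subtractf)
        qed
      qed
      also have "\<dots> = (\<Sum>j\<in>?J. (LINT t|?S. t ^ j * G j t))" by (rule Bochner_Integration.integral_sum[OF iG])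
      finally show ?thesis .
    qed
    have 2: "(LINT t|?S. ?dt m t (z t)) = (\<Sum>j\<in>?J. (LINT t|?S. deriv (\<lambda>t. t ^ j) t * L2_inner D (c j) (z t)))"
    proof -
      note d\<psi> = Xkh_dt[OF c m \<psi>c]
      have "(LINT t|?S. ?dt m t (z t)) = (LINT t|?S. (\<Sum>j\<le>time_deg P. deriv (\<lambda>t. t ^ j) t *\<^sub>R L2_inner D (c j)) (z t))"
        unfolding subint_def
        by (rule has_weak_dt_integral_eq[OF has_weak_dt_weak_dt[OF d\<psi>] d\<psi> L2_H10_subint[OF zB m]])
      also have "\<dots> = (LINT t|?S. (\<Sum>j\<in>?J. deriv (\<lambda>t. t ^ j) t * L2_inner D (c j) (z t)))"
        by (simp only: sum_fun_apply scaleR_fun_apply real_scaleR_def)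
      also have "\<dots> = (\<Sum>j\<in>?J. (LINT t|?S. deriv (\<lambda>t. t ^ j) t * L2_inner D (c j) (z t)))"
        by (rule Bochner_Integration.integral_sum[OF iU])
      finally show ?thesis .
    qed
    note lims = Xkh_lims[OF c m \<psi>c]
    have 3: "A m = (\<Sum>j\<in>?J. grid P (m - 1) ^ j * L2_inner D (c j) (rlim P z (m - 1)))"
      unfolding A_def
      by (rule trans[OF rlim_inner[OF lims(1) rlim_L2[OF z m1]] L2_inner_sum_left[OF finite_atMost cL rlim_L2[OF z m1]]])
    have 4: "B m = (\<Sum>j\<in>?J. if m < M then grid P m ^ j * L2_inner D (c j) (rlim P z m) else 0)"
    proof (cases "m < M")
      case True
      have "L2_inner D (llim P \<psi> m) (rlim P z m) = (\<Sum>j\<in>?J. grid P m ^ j * L2_inner D (c j) (rlim P z m))"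
        by (rule trans[OF llim_inner[OF lims(2) rlim_L2[OF z True]] L2_inner_sum_left[OF finite_atMost cL rlim_L2[OF z True]]])
      then show ?thesis using True by (simp add: B_def)
    qed (simp add: B_def)
    show ?thesis
      unfolding 1 2 3 4 sum_subtractf[symmetric] G_def
      by (intro sum.cong refl dual_subint sm cV m)
  qed
  then have "(\<Sum>m=1..M. (LINT t|lebesgue_on (subint P m). f t) - (LINT t|lebesgue_on (subint P m). ?dt m t (z t)))
      = (\<Sum>m=1..M. A m - B m)"
    by (intro sum.cong refl)
  then have "(LINT t|?M. f t) - dt_form P \<psi> z = (\<Sum>m=1..M. A m) - (\<Sum>m=1..M. B m)"
    unfolding sum_subtractf sum_integral_subint[OF f] dt_form_def .
  moreover have "(LINT t|?M. f t) = st_inner P q \<psi> - (LINT t|?M. spatial_form (\<psi> t) (z t))"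
    unfolding f_def st_inner_def
    by (rule Bochner_Integration.integral_diff[OF integrable_q[OF \<psi>B] integrable_L2_H10[OF bounded_bilinear_spatial_form \<psi>B zB]])
  moreover have "(\<Sum>m=2..M. L2_inner D (jump P \<psi> (m - 1)) (rlim P z (m - 1))) = (\<Sum>m=2..M. A m - B (m - 1))"
  proof (intro sum.cong refl)
    fix m assume m: "m \<in> {2..M}"
    then have m': "m - 1 \<in> {1..<M}" "m - 1 < M" by auto
    show "L2_inner D (jump P \<psi> (m - 1)) (rlim P z (m - 1)) = A m - B (m - 1)"
      unfolding jump_inner[OF \<psi>T m'(1) rlim_L2[OF z m'(2)]] A_def B_def using m'(2) by simp
  qed
  moreover have "B M = 0" by (simp add: B_def)
  moreover have "L2_inner D (rlim P \<psi> 0) (rlim P z 0) = A 1" by (simp add: A_def)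
  ultimately show ?thesis
    using sum_shift_pred[OF M_pos, of B] sum_split_first[OF M_pos, of A]
    unfolding full_form_def sum_subtractf by linarith
qed

end

lemma seminorm_on_XY: "norm_on_XY P nrm \<Longrightarrow> seminorm_on (XY_space P) nrm"
  unfolding seminorm_on_def norm_on_XY_def using subspace_XY_space by blast

end

section \<open>The error representation\<close>

theorem theorem3p3:
  fixes P :: "'a::euclidean_space problem"
    and J nrm :: "'a st_fun \<Rightarrow> real"
    and J1 :: "'a st_fun \<Rightarrow> 'a st_fun \<Rightarrow> real"
    and J2 :: "'a st_fun \<Rightarrow> 'a st_fun \<Rightarrow> 'a st_fun \<Rightarrow> real"
    and J3 :: "'a st_fun \<Rightarrow> 'a st_fun \<Rightarrow> 'a st_fun \<Rightarrow> 'a st_fun \<Rightarrow> real"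
    and j :: "'a st_fun \<Rightarrow> 'a st_fun"
    and u z ukh zkh \<phi>kh \<psi>kh :: "'a st_fun"
  assumes "problem_data P"
    and "target_functional P nrm J J1 J2 J3 j"
    and "stationary_point P J u z"
    and "discrete_primal_solution P ukh"
    and "discrete_dual_solution P J1 j ukh zkh"
    and "\<phi>kh \<in> Xkh_space P" and "\<psi>kh \<in> Xkh_space P"
  shows "J u - J ukh =
      1/2 * rho P ukh (z - \<phi>kh) + 1/2 * rho_dual P J1 ukh zkh (u - \<psi>kh)
      + (1/2 * S_form P ukh (\<phi>kh + zkh) + 1/2 * S_dual_form P (j ukh) zkh (\<psi>kh - ukh))
      + 1/2 * integral {0..1} (\<lambda>s.
          J3 (ukh + s *\<^sub>R (u - ukh)) (u - ukh) (u - ukh) (u - ukh) * s * (s - 1))"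
proof -
  interpret convection_diffusion_problem P by unfold_locales (rule assms(1))
  let ?W = "XY_space P"
  have nrm: "norm_on_XY P nrm"
    and dJ: "has_frechet_derivative_on J J1 ?W nrm UNIV abs"
    and dJ1: "has_frechet_derivative_on J1 J2 ?W nrm (dual_space ?W nrm) (dual_norm ?W nrm)"
    and dJ2: "has_frechet_derivative_on J2 J3 ?W nrm (bounded_linear_maps ?W nrm (dual_space ?W nrm) (dual_norm ?W nrm))
      (operator_norm ?W nrm (dual_norm ?W nrm))"
    and jrep: "\<And>v. v \<in> ?W \<Longrightarrow> j v \<in> bochner_L2 (time_int P) (L2_space (dom P)) (L2_norm (dom P))"
      "\<And>v \<phi>. v \<in> ?W \<Longrightarrow> \<phi> \<in> ?W \<Longrightarrow> J1 v \<phi> = st_inner P (j v) \<phi>"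
    using assms(2) unfolding target_functional_def Let_def by blast+
  note N = seminorm_on_XY[OF nrm]
  have uX: "u \<in> X_space P" and zY: "z \<in> Y_space P"
    and stat: "\<And>\<psi> \<phi>. \<psi> \<in> X_space P \<Longrightarrow> \<phi> \<in> Y_space P \<Longrightarrow> Lagrangian_u P J u z \<psi> + Lagrangian_z P J u z \<phi> = 0"
    using assms(3) unfolding stationary_point_def by blast+
  have ukh: "ukh \<in> Xkh_space P" and zkh: "zkh \<in> Xkh_space P"
    using assms(4,5) unfolding discrete_primal_solution_def discrete_dual_solution_def by blast+
  have Xkh_W: "v \<in> broken_space" and Xkh_Y: "v \<in> Y_space P" and Xkh_XY: "v \<in> ?W" and Xkh_T: "v \<in> trace_space"
    if "v \<in> Xkh_space P" for v
    using that Xkh_space_W Xkh_space_Y Y_space_XY broken_space_T by blast+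
  have Y_T: "v \<in> trace_space" if "v \<in> Y_space P" for v using that Y_space_T by blast
  have uW: "u \<in> broken_space" using uX X_space_W by blast
  have zT: "z \<in> trace_space" by (rule Y_T[OF zY])
  have uXY: "u \<in> ?W" by (rule X_space_XY[OF uX])
  define e where "e = u - ukh"
  have eW: "e \<in> broken_space" unfolding e_def by (rule subspace_diff[OF subspace_broken_space uW Xkh_W[OF ukh]])
  have eXY: "e \<in> ?W" unfolding e_def by (rule subspace_diff[OF subspace_XY_space uXY Xkh_XY[OF ukh]])

  have Lu: "Lagrangian_u P J u z \<psi> = J1 u \<psi> - full_form \<psi> z" if \<psi>: "\<psi> \<in> X_space P" for \<psi>
  proof (rule Lagrangian_u_eq[OF uW _ zT])
    show "\<psi> \<in> broken_space" using \<psi> X_space_W by blast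
    have "((\<lambda>s. J (u + s *\<^sub>R \<psi>)) has_real_derivative J1 (u + 0 *\<^sub>R \<psi>) \<psi>) (at 0)"
      by (rule frechet_derivative_along_line[OF N seminorm_on_abs dJ uXY X_space_XY[OF \<psi>], where \<Lambda> = "\<lambda>x. x" and K = 1]) auto
    then show "((\<lambda>s. J (u + s *\<^sub>R \<psi>)) has_real_derivative J1 u \<psi>) (at 0)" by simp
  qed
  have J1_lin: "J1 v (x + y) = J1 v x + J1 v y" if "v \<in> ?W" "x \<in> ?W" "y \<in> ?W" for v x y
  proof -
    have "J1 v \<in> dual_space ?W nrm"
      using dJ that(1) unfolding has_frechet_derivative_on_def dual_space_def by blast
    then show ?thesis by (rule dual_spaceD(1)[OF _ that(2,3)])
  qed
  (* The pair of test functions in the stationarity condition is decoupled by taking one of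
     them to be zero. *)
  have zero: "full_form 0 z = 0" "J1 u 0 = 0"
  proof -
    show "full_form 0 z = 0"
      using full_form_scale_left[OF uW zT, of 0] by simp
    show "J1 u 0 = 0"
      using J1_lin[OF uXY subspace_0[OF subspace_XY_space] subspace_0[OF subspace_XY_space]] by simp
  qed
  have zero': "rhs 0 - full_form u 0 = 0"
    using rhs_linear[OF zT zT, of "- 1"] rhs_linear[OF subspace_0[OF subspace_trace_space] subspace_0[OF subspace_trace_space], of 1]
      full_form_linear_right(2)[OF uW zT zT, of 0] by simp
  have primal: "full_form u \<phi> = rhs \<phi>" if \<phi>: "\<phi> \<in> Y_space P" for \<phi>
    using stat[OF subspace_0[OF subspace_X_space] \<phi>] zero
    by (simp add: Lu[OF subspace_0[OF subspace_X_space]] Lagrangian_z_eq[OF uW zT Y_T[OF \<phi>]])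
  have "J1 u \<psi> = full_form \<psi> z" if \<psi>: "\<psi> \<in> X_space P" for \<psi>
    using stat[OF \<psi> subspace_0[OF subspace_Y_space]] zero'
    by (simp add: Lu[OF \<psi>] Lagrangian_z_eq[OF uW zT subspace_0[OF subspace_trace_space]])
  then have dualX: "st_inner P (j u) \<psi> = full_form \<psi> z" if "\<psi> \<in> X_space P" for \<psi>
    using that jrep(2)[OF uXY X_space_XY[OF that]] by simp
  (* u itself is admissible in the dual problem, and ukh is so by approximation. *)
  have dual: "J1 u e = full_form e z"
  proof -
    have "J1 u ukh = full_form ukh z"
      using dual_problem_Xkh[OF jrep(1)[OF uXY] zT dualX ukh] jrep(2)[OF uXY Xkh_XY[OF ukh]] by simp
    moreover have "J1 u u = full_form u z"
      using dualX[OF uX] jrep(2)[OF uXY uXY] by simp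
    moreover have "J1 u u = J1 u e + J1 u ukh"
      using J1_lin[OF uXY eXY Xkh_XY[OF ukh]] by (simp add: e_def)
    ultimately show ?thesis
      unfolding e_def using full_form_diff_left[OF uW Xkh_W[OF ukh] zT] by simp
  qed

  have rho: "rho P ukh \<phi> = full_form e \<phi>" if \<phi>: "\<phi> \<in> Y_space P" for \<phi>
    unfolding e_def rho_eq[OF Xkh_T[OF ukh] Y_T[OF \<phi>]] full_form_diff_left[OF uW Xkh_W[OF ukh] Y_T[OF \<phi>]]
    using primal[OF \<phi>] by simp
  have S: "S_form P ukh \<phi> = full_form e \<phi>" if \<phi>: "\<phi> \<in> Xkh_space P" for \<phi>
  proof -
    have "A_form P ukh \<phi> + S_form P ukh \<phi> + L2_inner (dom P) (rlim P ukh 0) (rlim P \<phi> 0) = rhs \<phi>"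
      using assms(4) \<phi> unfolding discrete_primal_solution_def rhs_def by blast
    then show ?thesis
      using A_form_eq[OF trace_space_L2_H10[OF Xkh_T[OF ukh]] trace_space_L2_H10[OF Xkh_T[OF \<phi>]]] primal[OF Xkh_Y[OF \<phi>]]
        full_form_diff_left[OF uW Xkh_W[OF ukh] Xkh_T[OF \<phi>]]
      unfolding e_def by linarith
  qed
  have rho_dual: "rho_dual P J1 ukh zkh \<psi> = J1 ukh \<psi> - full_form \<psi> zkh" if "\<psi> \<in> broken_space" for \<psi>
    unfolding rho_dual_def using dual_form_eq[OF that zkh] by simp
  have S_dual: "S_dual_form P (j ukh) zkh \<psi> = J1 ukh \<psi> - full_form \<psi> zkh" if \<psi>: "\<psi> \<in> Xkh_space P" for \<psi>
  proof -
    have "A_dual_form P zkh \<psi> + S_dual_form P (j ukh) zkh \<psi>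
        + L2_inner (dom P) (llim P zkh (nsteps P)) (llim P \<psi> (nsteps P)) = J1 ukh \<psi>"
      using assms(5) \<psi> unfolding discrete_dual_solution_def by blast
    then show ?thesis using dual_form_eq[OF Xkh_W[OF \<psi>] zkh] by linarith
  qed

  have Xkh_diff: "v - w \<in> Xkh_space P" if "v \<in> Xkh_space P" "w \<in> Xkh_space P" for v w
    using Xkh_space_closed(1)[OF that(1) Xkh_space_closed(2)[OF that(2) that(2), of "- 1"]] by simp
  have sum1: "rho P ukh (z - \<phi>kh) + S_form P ukh (\<phi>kh + zkh) = J1 u e + full_form e zkh"
    unfolding rho[OF subspace_diff[OF subspace_Y_space zY Xkh_Y[OF assms(6)]]] S[OF Xkh_space_closed(1)[OF assms(6) zkh]]
      full_form_diff_right[OF eW zT Xkh_T[OF assms(6)]] full_form_linear_right(1)[OF eW Xkh_T[OF assms(6)] Xkh_T[OF zkh]]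
    using dual by simp
  have sum2: "rho_dual P J1 ukh zkh (u - \<psi>kh) + S_dual_form P (j ukh) zkh (\<psi>kh - ukh) = J1 ukh e - full_form e zkh"
  proof -
    note d = subspace_diff[OF subspace_broken_space uW Xkh_W[OF assms(7)]] Xkh_diff[OF assms(7) ukh]
    have "e = (u - \<psi>kh) + (\<psi>kh - ukh)" by (simp add: e_def)
    then have "full_form e zkh = full_form (u - \<psi>kh) zkh + full_form (\<psi>kh - ukh) zkh"
      and "J1 ukh e = J1 ukh (u - \<psi>kh) + J1 ukh (\<psi>kh - ukh)"
      using full_form_add_left[OF d(1) Xkh_W[OF d(2)] Xkh_T[OF zkh]]
        J1_lin[OF Xkh_XY[OF ukh] subspace_diff[OF subspace_XY_space uXY Xkh_XY[OF assms(7)]] Xkh_XY[OF d(2)]]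
      by simp_all
    then show ?thesis unfolding rho_dual[OF d(1)] S_dual[OF d(2)] by simp
  qed
  have "J u - J ukh = 1/2 * (J1 ukh e + J1 u e) + 1/2 * integral {0..1} (\<lambda>s. J3 (ukh + s *\<^sub>R e) e e e * s * (s - 1))"
    using trapezoidal_rule_functional[OF N Xkh_XY[OF ukh] eXY dJ dJ1 dJ2] by (simp add: e_def)
  then show ?thesis using sum1 sum2 unfolding e_def by simp
qed

end
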